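(* Let $d \ge p \ge 1$ be integers, let $A$ be a real symmetric $p\times p$ matrix with eigenvalues $a_1,\ldots,a_p$, let $A_+ = \mathrm{diag}(|a_1|,\ldots,|a_p|)$, and let $\Sigma$ be a real symmetric $d\times d$ matrix. Suppose that $\|\Sigma\| \le \gamma_0 d^{r/2}$, where $\gamma_0>0$ and $0 \le r < 1$. Put $\alpha_p = (2\pi)^{-(p-1)/(4p)} p^{1/(4p)}$, $\gamma_1 = (\sqrt{3}+1)/2$ and $c_m = (1+m^{-1})^{-m}\,\mathrm{e}$. Then for all integers $m \ge 2$, $$|\Phi_{d,p;m}(A,\Sigma)| \le \alpha_p \sum_{k=m}^\infty \frac{\bigl[\gamma_0\gamma_1 p^{1/2} (\mathrm{tr}\, A_+)\, d^{-(1-r)/2}\bigr]^k}{(k!)^{1/2}}$$ $$\le \alpha_p \left(\frac{4\mathrm{e}}{\pi}\right)^{1/4} \left(\frac{\mathrm{e}}{m}\right)^{(m/2)-(1/4)} \bigl[\gamma_0\gamma_1 p^{1/2} (\mathrm{tr}\, A_+)\, d^{-(1-r)/2}\bigr]^m \exp\Bigl(\tfrac12 c_m \bigl[\gamma_0\gamma_1 p^{1/2} (\mathrm{tr}\, A_+)\, d^{-(1-r)/2}\bigr]^2\Bigr).$$ In particular (with $p$, $A$, $m$, $\gamma_0$, $r$ fixed and $\Sigma=\Sigma_d$ satisfying $\|\Sigma_d\|\le\gamma_0 d^{r/2}$), $\Phi_{d,p;m}(A,\Sigma) = O\bigl(d^{-(1-r)m/2}\bigr)$ as $d\to\infty$.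
   Context: Norm: for a real symmetric matrix $\Sigma$, $\|\Sigma\| = [\mathrm{tr}(\Sigma^2)]^{1/2}$ (Frobenius norm). Partitions: a partition $\kappa=(\kappa_1,\kappa_2,\ldots)$ is a weakly decreasing sequence of nonnegative integers with finitely many non-zero entries (trailing zeros are immaterial); its length $\ell(\kappa)$ is the number of non-zero $\kappa_j$ and its weight is $|\kappa|=\sum_j\kappa_j$. Shifted factorials: $(a)_k = a(a+1)\cdots(a+k-1)$, $(a)_0=1$; and $(a)_\kappa = \prod_{i\ge1} \bigl(a-\tfrac12(i-1)\bigr)_{\kappa_i}$ for a partition $\kappa$. Zonal polynomials: for an $n\times n$ real symmetric matrix $S$ and a partition $\kappa$ with $\ell(\kappa)\le n$, $$C_\kappa(S) = C_\kappa(I_n)\int_{\mathrm{O}(n)} \prod_{j=1}^{\ell(\kappa)} \bigl[\det{}_j(H'SH)\bigr]^{\kappa_j-\kappa_{j+1}}\,dH,$$ where $\det_j$ is the leading $j\times j$ principal minor, $dH$ is normalized Haar measure on the orthogonal group $\mathrm{O}(n)$, zeroth powers equal $1$, and $$C_\kappa(I_n) = 2^{2|\kappa|}\,|\kappa|!\,(n/2)_\kappa\, \frac{\prod_{1\le i<j\le \ell(\kappa)} (2\kappa_i-2\kappa_j-i+j)}{\prod_{i=1}^{\ell(\kappa)} (2\kappa_i+\ell(\kappa)-i)!}.$$ (With this normalization $(\mathrm{tr}\,S)^k=\sum_{|\kappa|=k}C_\kappa(S)$, the sum being over $\ell(\kappa)\le n$.) Remainder: the normalizing constant of the matrix Bingham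 distribution on the Stiefel manifold $V_{d,p}=\{x\in\mathbb{R}^{d\times p}: x'x=I_p\}$ with density proportional to $\exp(\mathrm{tr}\,Ax'\Sigma x)$ with respect to the invariant probability measure is $$\Phi_{d,p}(A,\Sigma)=\sum_{k=0}^\infty \frac1{k!}\sum_{|\kappa|=k}\frac{C_\kappa(A)C_\kappa(\Sigma)}{C_\kappa(I_d)},$$ the inner sum being over partitions with $\ell(\kappa)\le p$; the remainder after truncation is $$\Phi_{d,p;m}(A,\Sigma)=\sum_{k=m}^\infty \frac1{k!}\sum_{|\kappa|=k}\frac{C_\kappa(A)C_\kappa(\Sigma)}{C_\kappa(I_d)},$$ again with $\ell(\kappa)\le p$ (the series converges absolutely). *)

theory Defs
  imports
    "HOL-Probability.Probability_Measure"
    "HOL-Library.Landau_Symbols"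
    "Jordan_Normal_Form.Char_Poly"
begin

section \<open>Real matrices\<close>

definition mat_trace :: "real mat \<Rightarrow> real" where
  "mat_trace M = (\<Sum>i<dim_row M. M $$ (i, i))"

definition real_symmetric :: "nat \<Rightarrow> real mat \<Rightarrow> bool" where
  "real_symmetric n M \<longleftrightarrow> M \<in> carrier_mat n n \<and> transpose_mat M = M"

text \<open>This is the Frobenius norm for symmetric matrices only.\<close>

definition frob_norm :: "real mat \<Rightarrow> real" where
  "frob_norm M = sqrt (mat_trace (M * M))"

definition leading_minor :: "nat \<Rightarrow> real mat \<Rightarrow> real" where
  "leading_minor j M = Determinant.det (Matrix.mat j j (\<lambda>ik. M $$ ik))"

text \<open>\<open>evs\<close> lists the eigenvalues of \<open>M\<close>, repeated according to multiplicity.\<close>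

definition eigenvalue_list :: "real mat \<Rightarrow> real list \<Rightarrow> bool" where
  "eigenvalue_list M evs \<longleftrightarrow> char_poly M = (\<Prod>a\<leftarrow>evs. [:- a, 1:])"

definition abs_diag :: "real list \<Rightarrow> real mat" where
  "abs_diag evs = mat_diag (length evs) (\<lambda>i. \<bar>evs ! i\<bar>)"


section \<open>Haar measure on the orthogonal group\<close>

definition orthogonal_group :: "nat \<Rightarrow> real mat set" where
  "orthogonal_group n = {H \<in> carrier_mat n n. transpose_mat H * H = 1\<^sub>m n}"

text \<open>The type \<open>real mat\<close> carries no topology. The Borel sigma-algebra of the orthogonal group is
  the one induced from Euclidean space of dimension \<open>n * n\<close> by the matrix entries.\<close>

definition borel_orthogonal :: "nat \<Rightarrow> real mat measure" where
  "borel_orthogonal n =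
     vimage_algebra (orthogonal_group n)
       (\<lambda>H. \<lambda>ij\<in>{..<n} \<times> {..<n}. H $$ ij)
       (\<Pi>\<^sub>M ij\<in>{..<n} \<times> {..<n}. borel)"

definition is_normalized_haar :: "nat \<Rightarrow> real mat measure \<Rightarrow> bool" where
  "is_normalized_haar n \<mu> \<longleftrightarrow>
     sets \<mu> = sets (borel_orthogonal n) \<and> prob_space \<mu> \<and>
     (\<forall>Q\<in>orthogonal_group n. distr \<mu> \<mu> (\<lambda>H. Q * H) = \<mu>)"

text \<open>By Haar's theorem there is exactly one such measure.\<close>

definition haar_orthogonal :: "nat \<Rightarrow> real mat measure" where
  "haar_orthogonal n = (SOME \<mu>. is_normalized_haar n \<mu>)"


section \<open>Partitions\<close>

text \<open>The parts are indexed from \<open>0\<close>: the value \<open>\<kappa> i\<close> is the part usually written with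
  subscript \<open>i + 1\<close>. All index-dependent formulas below are shifted accordingly.\<close>

definition is_partition :: "(nat \<Rightarrow> nat) \<Rightarrow> bool" where
  "is_partition \<kappa> \<longleftrightarrow> antimono \<kappa> \<and> finite {i. \<kappa> i \<noteq> 0}"

definition part_length :: "(nat \<Rightarrow> nat) \<Rightarrow> nat" where
  "part_length \<kappa> = card {i. \<kappa> i \<noteq> 0}"

definition part_weight :: "(nat \<Rightarrow> nat) \<Rightarrow> nat" where
  "part_weight \<kappa> = (\<Sum>i | \<kappa> i \<noteq> 0. \<kappa> i)"

definition partitions :: "nat \<Rightarrow> nat \<Rightarrow> (nat \<Rightarrow> nat) set" where
  "partitions k p = {\<kappa>. is_partition \<kappa> \<and> part_weight \<kappa> = k \<and> part_length \<kappa> \<le> p}"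

lemma finite_partitions: "finite (partitions k p)"
proof -
  have "partitions k p \<subseteq> {\<kappa>. \<forall>i. (i \<in> {..<k} \<longrightarrow> \<kappa> i \<in> {..k}) \<and> (i \<notin> {..<k} \<longrightarrow> \<kappa> i = 0)}"
  proof
    fix \<kappa> assume "\<kappa> \<in> partitions k p"
    then have anti: "antimono \<kappa>" and fin: "finite {i. \<kappa> i \<noteq> 0}"
      and w: "(\<Sum>i | \<kappa> i \<noteq> 0. \<kappa> i) = k"
      by (auto simp: partitions_def is_partition_def part_weight_def)
    have bound: "\<kappa> i \<le> k" for i
    proof (cases "\<kappa> i = 0")
      case False
      then show ?thesis
        using member_le_sum[of i "{i. \<kappa> i \<noteq> 0}" \<kappa>] fin w by simp
    qed simp
    have vanish: "\<kappa> i = 0" if "i \<notin> {..<k}" for i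
    proof (rule ccontr)
      assume "\<kappa> i \<noteq> 0"
      have pos: "\<kappa> j \<noteq> 0" if "j \<le> i" for j
        using antimonoD[OF anti \<open>j \<le> i\<close>] \<open>\<kappa> i \<noteq> 0\<close> by simp
      have "Suc i = (\<Sum>j\<le>i. 1)" by simp
      also have "\<dots> \<le> (\<Sum>j\<le>i. \<kappa> j)"
        using pos by (intro sum_mono) (simp add: Suc_leI)
      also have "\<dots> \<le> k"
        unfolding w[symmetric] using pos fin by (intro sum_mono2) auto
      finally show False using \<open>i \<notin> {..<k}\<close> by simp
    qed
    show "\<kappa> \<in> {\<kappa>. \<forall>i. (i \<in> {..<k} \<longrightarrow> \<kappa> i \<in> {..k}) \<and> (i \<notin> {..<k} \<longrightarrow> \<kappa> i = 0)}"
      using bound vanish by auto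
  qed
  then show ?thesis
    by (rule finite_subset) (intro finite_set_of_finite_funs; simp)
qed

text \<open>The infinite product over all parts reduces to the nonzero ones, because
  \<open>pochhammer b 0 = 1\<close>.\<close>

definition shifted_factorial :: "real \<Rightarrow> (nat \<Rightarrow> nat) \<Rightarrow> real" where
  "shifted_factorial a \<kappa> = (\<Prod>i<part_length \<kappa>. pochhammer (a - real i / 2) (\<kappa> i))"


section \<open>Zonal polynomials\<close>

definition zonal_at_identity :: "nat \<Rightarrow> (nat \<Rightarrow> nat) \<Rightarrow> real" where
  "zonal_at_identity n \<kappa> =
     2 ^ (2 * part_weight \<kappa>) * fact (part_weight \<kappa>) * shifted_factorial (real n / 2) \<kappa> *
     (\<Prod>(i, j) \<in> {(i, j). i < j \<and> j < part_length \<kappa>}.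
        2 * real (\<kappa> i) - 2 * real (\<kappa> j) - real i + real j) /
     (\<Prod>i<part_length \<kappa>. fact (2 * \<kappa> i + part_length \<kappa> - Suc i))"

definition zonal :: "(nat \<Rightarrow> nat) \<Rightarrow> real mat \<Rightarrow> real" where
  "zonal \<kappa> S =
     zonal_at_identity (dim_row S) \<kappa> *
     (\<integral>H. (\<Prod>j<part_length \<kappa>.
            leading_minor (Suc j) (transpose_mat H * S * H) ^ (\<kappa> j - \<kappa> (Suc j)))
        \<partial>haar_orthogonal (dim_row S))"


section \<open>The matrix Bingham remainder\<close>

definition bingham_term :: "nat \<Rightarrow> nat \<Rightarrow> real mat \<Rightarrow> real mat \<Rightarrow> nat \<Rightarrow> real" where
  "bingham_term d p A S k =
     1 / fact k * (\<Sum>\<kappa>\<in>partitions k p. zonal \<kappa> A * zonal \<kappa> S / zonal \<kappa> (1\<^sub>m d))"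

text \<open>The case \<open>m = 0\<close> is the full normalizing constant.\<close>

definition bingham_remainder :: "nat \<Rightarrow> nat \<Rightarrow> nat \<Rightarrow> real mat \<Rightarrow> real mat \<Rightarrow> real" where
  "bingham_remainder d p m A S = (\<Sum>k. bingham_term d p A S (k + m))"


section \<open>Constants of the bound\<close>

definition alpha_const :: "nat \<Rightarrow> real" where
  "alpha_const p =
     (2 * pi) powr (- ((real p - 1) / (4 * real p))) * real p powr (1 / (4 * real p))"

definition gamma1 :: real where
  "gamma1 = (sqrt 3 + 1) / 2"

definition c_const :: "nat \<Rightarrow> real" where
  "c_const m = (1 + 1 / real m) powr (- real m) * exp 1"

definition bound_base :: "nat \<Rightarrow> nat \<Rightarrow> real \<Rightarrow> real \<Rightarrow> real list \<Rightarrow> real" where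
  "bound_base d p \<gamma>\<^sub>0 r evs =
     \<gamma>\<^sub>0 * gamma1 * real p powr (1 / 2) * mat_trace (abs_diag evs) *
     real d powr (- (1 - r) / 2)"

end

theory Submission
  imports Defs "HOL-Probability.Probability" "Jordan_Normal_Form.Schur_Decomposition"
begin

text \<open>Averaging a highest weight polynomial \<open>\<Delta>\<^sub>\<kappa>\<close> (a product of powers of leading minors) over the orthogonal group
  gives the spherical function \<open>\<phi>\<^sub>\<kappa> = C\<^sub>\<kappa> / C\<^sub>\<kappa>(I)\<close>, and on symmetric matrices \<open>\<phi>\<^sub>\<kappa>(A)\<close> is the inner product of the
  tensor power \<open>A \<otimes> \<dots> \<otimes> A\<close> with a fixed tensor \<open>u\<^sub>\<kappa>\<close>. For \<open>|\<kappa>| = k\<close> these tensors are pairwise orthogonal, and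
  \<open>C\<^sub>\<kappa>(I) |u\<^sub>\<kappa>|\<^sup>2 = 1\<close>: the norm comes from the apolar norm of \<open>\<Delta>\<^sub>\<kappa>\<^sup>2\<close>, computed with a Cayley type identity, and
  from a comparison of Gaussian and Haar averages. Bessel's inequality then reads
  \<open>\<Sum> C\<^sub>\<kappa>(I) \<phi>\<^sub>\<kappa>(A)\<^sup>2 \<le> \<parallel>A\<parallel>\<^sup>2\<^sup>k\<close>.

  For a Haar distributed \<open>H\<close> in \<open>O(d)\<close> let \<open>X\<close> be the leading \<open>p \<times> p\<close> block of \<open>H' \<Sigma> H\<close>. Invariance shows that
  \<open>C\<^sub>\<kappa>(\<Sigma>) / C\<^sub>\<kappa>(I\<^sub>d)\<close> is the mean of \<open>\<phi>\<^sub>\<kappa>(X)\<close>, so by the Cauchy--Schwarz inequality the term of degree \<open>k\<close> is at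
  most \<open>\<parallel>A\<parallel>\<^sup>k E \<parallel>X\<parallel>\<^sup>k / k!\<close>. The moments of a column of \<open>H\<close> yield
  \<open>E \<parallel>X\<parallel>\<^sup>k \<le> (p \<parallel>\<Sigma>\<parallel>\<^sup>2 / d)\<^sup>k\<^sup>/\<^sup>2 (k!)\<^sup>1\<^sup>/\<^sup>2\<close>. With \<open>\<parallel>A\<parallel> \<le> tr A\<^sub>+\<close> and \<open>\<alpha>\<^sub>p \<gamma>\<^sub>1\<^sup>k \<ge> 1\<close> for \<open>k \<ge> 2\<close> this is the
  asserted bound term by term.\<close>

section \<open>Polynomial functions\<close>

text \<open>The reason for doubled parts: let X be a Gaussian matrix and write the square of
  \<open>Del n l\<close> as a sum of powers <., Y>^(2k). A Gaussian moment turns <BX, Y>^(2k) into a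
  multiple of <BB', YY'>^k, while for lower triangular B the same average is \<open>Del n l\<close>
  at BB' times a constant. Comparing the two shows that, on symmetric matrices,
  \<open>Del n l\<close> pairs the k-th tensor power of A with tensor powers of the matrices YY'.
  Inner products of the Haar averages of these tensors become apolar pairings of squared highest
  weight polynomials. Different partitions are separated by a diagonal scaling. The diagonal value
  has to be exact, because \<open>zonal_at_identity\<close> is an explicit product; this is what the
  Cayley constant and the Wishart moment supply. The large dimension d stays out of the algebra:
  C_kappa(I_d) cancels, Bessel's inequality is used in size p only, and d enters through moments of
  single columns of H.\<close>

inductive palg :: "('a \<Rightarrow> real) set \<Rightarrow> ('a \<Rightarrow> real) \<Rightarrow> bool" for S where
  palg_const: "palg S (\<lambda>_. c)"
| palg_base: "f \<in> S \<Longrightarrow> palg S f"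
| palg_add: "palg S f \<Longrightarrow> palg S g \<Longrightarrow> palg S (\<lambda>x. f x + g x)"
| palg_mult: "palg S f \<Longrightarrow> palg S g \<Longrightarrow> palg S (\<lambda>x. f x * g x)"

lemma palg_sum:
  assumes "\<And>i. i \<in> I \<Longrightarrow> palg S (f i)"
  shows "palg S (\<lambda>x. \<Sum>i\<in>I. f i x)"
  using assms by (induction I rule: infinite_finite_induct) (auto intro: palg_const palg_add)

lemma palg_prod:
  assumes "\<And>i. i \<in> I \<Longrightarrow> palg S (f i)"
  shows "palg S (\<lambda>x. \<Prod>i\<in>I. f i x)"
  using assms by (induction I rule: infinite_finite_induct) (auto intro: palg_const palg_mult)

lemma palg_power: "palg S f \<Longrightarrow> palg S (\<lambda>x. f x ^ n)"
  by (induction n) (auto intro: palg_const palg_mult)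

lemma palg_det:
  assumes "\<And>i j. i < n \<Longrightarrow> j < n \<Longrightarrow> palg S (\<lambda>x. F x (i, j))"
  shows "palg S (\<lambda>x. Determinant.det (Matrix.mat n n (F x)))"
proof -
  have eq: "Determinant.det (Matrix.mat n n (F x)) =
     (\<Sum>p | p permutes {0..<n}. signof p * (\<Prod>i = 0..<n. F x (i, p i)))" for x
    by (subst det_def'[of _ n]) (auto intro!: sum.cong prod.cong simp: permutes_in_image)
  show ?thesis unfolding eq
    by (intro palg_sum palg_mult palg_const palg_prod assms) (auto simp: permutes_in_image)
qed

lemma palg_id_poly:
  assumes "palg {\<lambda>t. t} f"
  shows "\<exists>q. \<forall>t. f t = poly q t"
  using assms
proof induction
  case (palg_const c)
  have "\<forall>t. c = poly [:c:] t" by simp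
  then show ?case by blast
next
  case (palg_base f)
  then have "\<forall>t. f t = poly [:0, 1:] t" by auto
  then show ?case by blast
next
  case (palg_add f g)
  then obtain p q where "\<forall>t. f t = poly p t" "\<forall>t. g t = poly q t" by blast
  then have "\<forall>t. f t + g t = poly (p + q) t" by simp
  then show ?case by blast
next
  case (palg_mult f g)
  then obtain p q where "\<forall>t. f t = poly p t" "\<forall>t. g t = poly q t" by blast
  then have "\<forall>t. f t * g t = poly (p * q) t" by simp
  then show ?case by blast
qed

text \<open>A nonzero polynomial has finitely many roots. Matrix identities are proved for X + t I
  with t large, where all leading minors are positive, and this carries them back to t = 0.\<close>

lemma palg_eqI:
  assumes "palg {\<lambda>t. t} f" "palg {\<lambda>t. t} g" and eq: "\<And>t. t > T \<Longrightarrow> f t = g t"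
  shows "f x = g x"
proof -
  obtain p q where p: "\<forall>t. f t = poly p t" and q: "\<forall>t. g t = poly q t"
    using palg_id_poly assms by metis
  have "p = q"
  proof (rule ccontr)
    assume "p \<noteq> q"
    then have "finite {t. poly (p - q) t = 0}" using poly_roots_finite[of "p - q"] by simp
    moreover have "{T<..} \<subseteq> {t. poly (p - q) t = 0}" using eq p q by auto
    ultimately show False using infinite_Ioi[of T] finite_subset by blast
  qed
  then show ?thesis using p q by simp
qed

lemma palg_id_continuous: "palg {\<lambda>t. t} f \<Longrightarrow> isCont f x"
  using palg_id_poly[of f] by (metis (no_types, lifting) ext poly_isCont)

lemma palg_measurable_bounded:
  assumes "palg S f"
    and "\<And>s. s \<in> S \<Longrightarrow> s \<in> borel_measurable M"
    and "\<And>s. s \<in> S \<Longrightarrow> \<exists>B. \<forall>x\<in>space M. \<bar>s x\<bar> \<le> B"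
  shows "f \<in> borel_measurable M \<and> (\<exists>B. \<forall>x\<in>space M. \<bar>f x\<bar> \<le> B)"
  using assms(1)
proof induction
  case (palg_add f g)
  then obtain B C where BC: "\<forall>x\<in>space M. \<bar>f x\<bar> \<le> B" "\<forall>x\<in>space M. \<bar>g x\<bar> \<le> C" by blast
  have "\<forall>x\<in>space M. \<bar>f x + g x\<bar> \<le> B + C"
  proof
    fix x assume "x \<in> space M"
    then have "\<bar>f x\<bar> \<le> B" "\<bar>g x\<bar> \<le> C" using BC by auto
    then show "\<bar>f x + g x\<bar> \<le> B + C" by linarith
  qed
  then show ?case using palg_add by auto
next
  case (palg_mult f g)
  then obtain B C where BC: "\<forall>x\<in>space M. \<bar>f x\<bar> \<le> B" "\<forall>x\<in>space M. \<bar>g x\<bar> \<le> C" by blast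
  have "\<forall>x\<in>space M. \<bar>f x * g x\<bar> \<le> B * C"
  proof
    fix x assume "x \<in> space M"
    then have "\<bar>f x\<bar> \<le> B" "\<bar>g x\<bar> \<le> C" using BC by auto
    then show "\<bar>f x * g x\<bar> \<le> B * C" unfolding abs_mult by (intro mult_mono) auto
  qed
  then show ?case using palg_mult by auto
qed (use assms in auto)

text \<open>Meant for the entries of an orthogonal matrix: they are bounded, so every polynomial in
  them is integrable under Haar measure.\<close>

lemma palg_integrable:
  assumes "palg S f" and "finite_measure M"
    and "\<And>s. s \<in> S \<Longrightarrow> s \<in> borel_measurable M"
    and "\<And>s. s \<in> S \<Longrightarrow> \<exists>B. \<forall>x\<in>space M. \<bar>s x\<bar> \<le> B"
  shows "integrable M f"
proof -
  interpret finite_measure M by fact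
  obtain B where "f \<in> borel_measurable M" "\<forall>x\<in>space M. \<bar>f x\<bar> \<le> B"
    using palg_measurable_bounded[OF assms(1,3,4)] by blast
  then show ?thesis by (intro integrable_const_bound[of _ B]) auto
qed

section \<open>Homogeneous polynomials as sums of powers of linear forms\<close>

definition dotp :: "'j set \<Rightarrow> ('j \<Rightarrow> real) \<Rightarrow> ('j \<Rightarrow> real) \<Rightarrow> real" where
  "dotp J x y = (\<Sum>j\<in>J. x j * y j)"

text \<open>A list \<open>ys\<close> of weighted vectors encodes the homogeneous polynomial \<open>P\<close> of degree \<open>n\<close> that is the sum
  of the corresponding powers \<open>a (x \<bullet> y)\<^sup>n\<close>. Then \<open>app ys Q\<close> is the apolar (Fischer) pairing of \<open>P\<close> with a
  homogeneous polynomial \<open>Q\<close> of the same degree.\<close>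

definition app :: "(real \<times> 'a) list \<Rightarrow> ('a \<Rightarrow> real) \<Rightarrow> real" where
  "app ys Q = (\<Sum>(a, y)\<leftarrow>ys. a * Q y)"

definition rep :: "'j set \<Rightarrow> nat \<Rightarrow> (real \<times> ('j \<Rightarrow> real)) list \<Rightarrow> (('j \<Rightarrow> real) \<Rightarrow> real) \<Rightarrow> bool" where
  "rep J n ys P \<longleftrightarrow> (\<forall>x. P x = app ys (\<lambda>y. dotp J x y ^ n))"

text \<open>Taking the span of n-th powers of linear forms as the notion of a homogeneous polynomial
  turns the apolar pairing into evaluation at points. The price is that closure under products
  (\<open>hp_mult\<close>) needs a proof.\<close>

definition hp :: "'j set \<Rightarrow> nat \<Rightarrow> (('j \<Rightarrow> real) \<Rightarrow> real) \<Rightarrow> bool" where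
  "hp J n P \<longleftrightarrow> (\<exists>ys. rep J n ys P)"

lemma dotp_commute: "dotp J x y = dotp J y x"
  by (simp add: dotp_def mult.commute)

lemma app_Nil [simp]: "app [] Q = 0"
  and app_Cons [simp]: "app (ay # ys) Q = fst ay * Q (snd ay) + app ys Q"
  by (simp_all add: app_def split: prod.split)

lemma app_append: "app (ys @ zs) Q = app ys Q + app zs Q"
  by (induction ys) simp_all

lemma app_cmult: "app ys (\<lambda>y. c * Q y) = c * app ys Q"
  by (induction ys) (simp_all add: algebra_simps)

lemma app_add: "app ys (\<lambda>y. P y + Q y) = app ys P + app ys Q"
  by (induction ys) (simp_all add: algebra_simps)

lemma app_diff: "app ys (\<lambda>y. P y - Q y) = app ys P - app ys Q"
  by (induction ys) (simp_all add: algebra_simps)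

lemma app_sum: "app ys (\<lambda>y. \<Sum>i\<in>I. Q i y) = (\<Sum>i\<in>I. app ys (Q i))"
  by (induction ys) (simp_all add: sum.distrib sum_distrib_left)

lemma app_swap: "app ys (\<lambda>y. app zs (\<lambda>z. F y z)) = app zs (\<lambda>z. app ys (\<lambda>y. F y z))"
  by (induction ys) (simp_all add: app_add app_cmult, induction zs, auto)

lemma app_map: "app (map (\<lambda>(a, y). (c * a, T y)) ys) Q = c * app ys (\<lambda>y. Q (T y))"
  by (induction ys) (auto simp: algebra_simps)

lemma app_cong: "(\<And>y. P y = Q y) \<Longrightarrow> app ys P = app ys Q"
  by (induction ys) auto

lemma palg_app: "(\<And>y. palg S (\<lambda>x. F x y)) \<Longrightarrow> palg S (\<lambda>x. app ys (F x))"
  by (induction ys) (auto intro!: palg_const palg_add palg_mult[OF palg_const])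

lemma app_integral:
  assumes "\<And>y. integrable M (\<lambda>x. F x y)"
  shows "integrable M (\<lambda>x. app ys (F x)) \<and>
    (\<integral>x. app ys (F x) \<partial>M) = app ys (\<lambda>y. \<integral>x. F x y \<partial>M)"
  using assms by (induction ys) auto

lemma hpI: "(\<And>x. P x = app ys (\<lambda>y. dotp J x y ^ n)) \<Longrightarrow> hp J n P"
  unfolding hp_def rep_def by blast

lemma hp_dotp: "hp J n (\<lambda>x. dotp J x y ^ n)"
  by (rule hpI[of _ "[(1, y)]"]) simp

lemma hp_zero: "hp J n (\<lambda>x. 0)"
  by (rule hpI[of _ "[]"]) simp

lemma hp_add: "hp J n P \<Longrightarrow> hp J n Q \<Longrightarrow> hp J n (\<lambda>x. P x + Q x)"
  unfolding hp_def rep_def using app_append by metis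

lemma hp_cmult:
  assumes "hp J n P"
  shows "hp J n (\<lambda>x. c * P x)"
proof -
  obtain ys where "\<And>x. P x = app ys (\<lambda>y. dotp J x y ^ n)" using assms by (auto simp: hp_def rep_def)
  then show ?thesis
    by (intro hpI[of _ "map (\<lambda>(a, y). (c * a, y)) ys"])
      (simp add: app_map[of c "\<lambda>y. y", simplified])
qed

lemma hp_sum:
  assumes "\<And>i. i \<in> I \<Longrightarrow> hp J n (P i)"
  shows "hp J n (\<lambda>x. \<Sum>i\<in>I. P i x)"
  using assms by (induction I rule: infinite_finite_induct) (auto intro: hp_zero hp_add)

lemma hp_app: "(\<And>y. hp J n (\<lambda>x. F x y)) \<Longrightarrow> hp J n (\<lambda>x. app ys (F x))"
  by (induction ys) (auto intro!: hp_zero hp_add hp_cmult)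

section \<open>Products of linear forms as sums of powers\<close>

lemma coeff_one_from_values:
  "\<exists>\<gamma>. \<forall>q::real poly. degree q \<le> n \<longrightarrow> Polynomial.coeff q 1 = (\<Sum>i\<le>n. \<gamma> i * poly q (real i))"
proof -
  \<comment> \<open>The Lagrange basis at the nodes 0, ..., n; the weights sought are the linear
    coefficients of these polynomials.\<close>
  define L where "L i = (\<Prod>j\<in>{..n}-{i}. Polynomial.smult (1 / (real i - real j)) [:- real j, 1:])" for i
  have L_eval: "poly (L i) (real k) = (if k = i then 1 else 0)" if "i \<le> n" "k \<le> n" for i k
  proof (cases "k = i")
    case True
    have "poly (Polynomial.smult (1 / (real i - real j)) [:- real j, 1:]) (real i) = 1" if "j \<noteq> i" for j
      using that by (simp add: divide_simps)
    then show ?thesis using True by (auto simp: L_def poly_prod intro!: prod.neutral)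
  next
    case False
    then have "poly (L i) (real k) = 0"
      unfolding L_def poly_prod using that by (intro prod_zero) auto
    with False show ?thesis by simp
  qed
  have L_deg: "degree (L i) \<le> n" if "i \<le> n" for i
  proof -
    have "degree (L i) \<le> (\<Sum>j\<in>{..n}-{i}. 1)"
      unfolding L_def by (rule order_trans[OF degree_prod_sum_le]) (auto intro!: sum_mono)
    also have "\<dots> = n" using that by simp
    finally show ?thesis .
  qed
  have "coeff q 1 = (\<Sum>i\<le>n. coeff (L i) 1 * poly q (real i))" if "degree q \<le> n" for q :: "real poly"
  proof -
    define h where "h = q - (\<Sum>i\<le>n. Polynomial.smult (poly q (real i)) (L i))"
    have "degree h \<le> n" unfolding h_def
      by (intro degree_diff_le degree_sum_le that) (use L_deg in \<open>auto intro: order_trans[OF degree_smult_le]\<close>)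
    have roots: "real ` {..n} \<subseteq> {t. poly h t = 0}"
      by (auto simp: h_def poly_sum L_eval if_distrib sum.delta cong: if_cong)
    have "h = 0"
    proof (rule ccontr)
      assume "h \<noteq> 0"
      then have "card (real ` {..n}) \<le> degree h"
        using roots card_mono[OF poly_roots_finite] card_poly_roots_bound order_trans by metis
      then show False using \<open>degree h \<le> n\<close> by (simp add: card_image)
    qed
    then have "q = (\<Sum>i\<le>n. Polynomial.smult (poly q (real i)) (L i))" by (simp add: h_def)
    from arg_cong[OF this, of "\<lambda>p. coeff p 1"] show ?thesis
      by (simp add: coeff_sum mult.commute)
  qed
  then show ?thesis by (intro exI[of _ "\<lambda>i. Polynomial.coeff (L i) 1"]) simp
qed

text \<open>Up to the factor n + 1, the product is the coefficient of t in (u + t v)^(n+1), and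
  interpolation recovers that coefficient from t = 0, ..., n + 1.\<close>

lemma power_mult_as_powers:
  "\<exists>\<gamma>. \<forall>u v::real. u ^ n * v = (\<Sum>i\<le>Suc n. \<gamma> i * (u + real i * v) ^ Suc n)"
proof -
  define N where "N = Suc n"
  obtain \<gamma> where \<gamma>: "\<And>q::real poly. degree q \<le> N \<Longrightarrow> Polynomial.coeff q 1 = (\<Sum>i\<le>N. \<gamma> i * poly q (real i))"
    using coeff_one_from_values by blast
  have "u ^ n * v = (\<Sum>i\<le>N. \<gamma> i / real N * (u + real i * v) ^ N)" for u v :: real
  proof -
    have "degree ([:u, v:] ^ N) \<le> degree [:u, v:] * N" by (rule degree_power_le)
    also have "\<dots> \<le> 1 * N" by (intro mult_right_mono) auto
    finally have "coeff ([:u, v:] ^ N) 1 = (\<Sum>i\<le>N. \<gamma> i * poly ([:u, v:] ^ N) (real i))"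
      by (intro \<gamma>) simp
    then have 1: "coeff ([:u, v:] ^ N) 1 = (\<Sum>i\<le>N. \<gamma> i * (u + real i * v) ^ N)"
      by (simp add: poly_power)
    have "coeff ([:u, v:] ^ N) 1 = coeff (pderiv ([:u, v:] ^ N)) 0"
      by (simp add: coeff_pderiv)
    also have "\<dots> = poly (pderiv ([:u, v:] ^ N)) 0" by (simp add: poly_0_coeff_0)
    also have "\<dots> = real N * (u ^ n * v)"
      unfolding N_def by (simp only: pderiv_power_Suc) (simp add: pderiv_pCons poly_power)
    finally have 2: "real N * (u ^ n * v) = (\<Sum>i\<le>N. \<gamma> i * (u + real i * v) ^ N)" using 1 by simp
    have "N > 0" by (simp add: N_def)
    then have "u ^ n * v = (real N * (u ^ n * v)) / real N" by simp
    also have "\<dots> = (\<Sum>i\<le>N. \<gamma> i * (u + real i * v) ^ N / real N)"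
      unfolding 2 by (rule sum_divide_distrib)
    finally show ?thesis by simp
  qed
  then show ?thesis unfolding N_def[symmetric] by (intro exI[of _ "\<lambda>i. \<gamma> i / real N"]) blast
qed

lemma dotp_add_right: "dotp J x (\<lambda>j. y j + c * z j) = dotp J x y + c * dotp J x z"
  by (simp add: dotp_def algebra_simps sum.distrib sum_distrib_left)

lemma hp_mult_dotp:
  assumes "hp J n P"
  shows "hp J (Suc n) (\<lambda>x. P x * dotp J x w)"
proof -
  obtain ys where ys: "\<And>x. P x = app ys (\<lambda>y. dotp J x y ^ n)" using assms by (auto simp: hp_def rep_def)
  obtain \<gamma> where \<gamma>: "\<And>u v::real. u ^ n * v = (\<Sum>i\<le>Suc n. \<gamma> i * (u + real i * v) ^ Suc n)"
    using power_mult_as_powers[of n] by blast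
  have "P x * dotp J x w =
      app ys (\<lambda>y. \<Sum>i\<le>Suc n. \<gamma> i * dotp J x (\<lambda>j. y j + real i * w j) ^ Suc n)" for x
    unfolding dotp_add_right \<gamma>[symmetric] ys by (simp add: mult.commute[of _ "dotp J x w"] app_cmult)
  then show ?thesis
    by (simp only:) (intro hp_app hp_sum hp_cmult hp_dotp)
qed

text \<open>Q is a sum of powers of linear forms, and \<open>hp_mult_dotp\<close> absorbs one linear
  factor at a time.\<close>

lemma hp_mult:
  assumes "hp J m P" "hp J n Q"
  shows "hp J (m + n) (\<lambda>x. P x * Q x)"
proof -
  have pow: "hp J (m + k) (\<lambda>x. P x * dotp J x w ^ k)" for w k
  proof (induction k)
    case (Suc k)
    from hp_mult_dotp[OF this, of w] show ?case by (simp add: algebra_simps)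
  qed (use assms in simp)
  obtain ys where ys: "\<And>x. Q x = app ys (\<lambda>y. dotp J x y ^ n)" using assms(2) by (auto simp: hp_def rep_def)
  have "P x * Q x = app ys (\<lambda>y. P x * dotp J x y ^ n)" for x by (simp add: ys app_cmult)
  then show ?thesis by (simp only:) (intro hp_app pow)
qed

lemma hp_const: "hp J 0 (\<lambda>x. c)"
  by (rule hpI[of _ "[(c, \<lambda>_. 0)]"]) simp

lemma hp_coord:
  assumes "finite J" "j \<in> J"
  shows "hp J 1 (\<lambda>x. x j)"
  by (rule hpI[of _ "[(1, \<lambda>i. if i = j then 1 else 0)]"])
    (use assms in \<open>simp add: dotp_def if_distrib sum.delta cong: if_cong\<close>)

lemma hp_power: "hp J m P \<Longrightarrow> hp J (m * n) (\<lambda>x. P x ^ n)"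
  by (induction n) (use hp_const[of J 1] hp_mult in force)+

lemma hp_prod:
  assumes "finite I" "\<And>i. i \<in> I \<Longrightarrow> hp J (d i) (P i)"
  shows "hp J (\<Sum>i\<in>I. d i) (\<lambda>x. \<Prod>i\<in>I. P i x)"
  using assms by (induction I rule: finite_induct) (auto intro: hp_const hp_mult)

lemma hp_det:
  assumes "finite J" "\<And>i j. i < n \<Longrightarrow> j < n \<Longrightarrow> e (i, j) \<in> J"
  shows "hp J n (\<lambda>x. Determinant.det (Matrix.mat n n (\<lambda>ij. x (e ij))))"
proof -
  have eq: "Determinant.det (Matrix.mat n n (\<lambda>ij. x (e ij))) =
     (\<Sum>p | p permutes {0..<n}. signof p * (\<Prod>i = 0..<n. x (e (i, p i))))" for x
    by (subst det_def'[of _ n]) (auto intro!: sum.cong prod.cong simp: permutes_in_image)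
  have "hp J n (\<lambda>x. signof p * (\<Prod>i = 0..<n. x (e (i, p i))))" if "p permutes {0..<n}" for p
  proof -
    have "hp J (\<Sum>i\<in>{0..<n}. 1) (\<lambda>x. \<Prod>i = 0..<n. x (e (i, p i)))"
      using assms that by (intro hp_prod hp_coord) (auto simp: permutes_in_image)
    then show ?thesis using hp_cmult by fastforce
  qed
  then show ?thesis unfolding eq by (intro hp_sum) auto
qed

text \<open>Functionals that agree on powers of linear forms agree on their span. The weights w, v
  and the maps T, U allow extra factors and substitutions on either side.\<close>

lemma app_agree:
  assumes "hp J n Q"
    and "\<And>x. app ys (\<lambda>y. w y * dotp J x (T y) ^ n) = app zs (\<lambda>z. v z * dotp J x (U z) ^ n)"
  shows "app ys (\<lambda>y. w y * Q (T y)) = app zs (\<lambda>z. v z * Q (U z))"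
proof -
  obtain qs where qs: "\<And>x. Q x = app qs (\<lambda>q. dotp J x q ^ n)" using assms(1) by (auto simp: hp_def rep_def)
  have "app ys (\<lambda>y. w y * Q (T y)) = app qs (\<lambda>q. app ys (\<lambda>y. w y * dotp J q (T y) ^ n))"
    by (subst app_swap) (simp add: qs app_cmult dotp_commute)
  also have "\<dots> = app zs (\<lambda>z. v z * Q (U z))"
    unfolding assms(2) by (subst app_swap) (simp add: qs app_cmult dotp_commute)
  finally show ?thesis .
qed

text \<open>Both sides are the same double sum of (y . z)^n.\<close>

lemma rep_sym:
  assumes "rep J n ys P" "rep J n zs Q"
  shows "app ys Q = app zs P"
proof -
  have P: "P = (\<lambda>z. app ys (\<lambda>y. dotp J y z ^ n))" and Q: "Q = (\<lambda>y. app zs (\<lambda>z. dotp J y z ^ n))"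
    using assms by (auto simp: rep_def dotp_commute)
  show ?thesis unfolding P Q by (rule app_swap)
qed

text \<open>By symmetry the value equals a pairing in which \<open>ys\<close> no longer occurs, so
  the functional belongs to P and not to its representation.\<close>

lemma rep_unique:
  assumes "rep J n ys P" "rep J n zs P" "hp J n Q"
  shows "app ys Q = app zs Q"
  using assms rep_sym unfolding hp_def by metis

section \<open>Leading minors and triangular matrices\<close>

text \<open>Minors of functions on index pairs cover matrices, through \<open>($$)\<close>, as well
  as Gaussian coordinate vectors indexed by \<open>sq n\<close>.\<close>

definition lm :: "nat \<Rightarrow> (nat \<times> nat \<Rightarrow> real) \<Rightarrow> real" where
  "lm j f = Determinant.det (Matrix.mat j j f)"

text \<open>The highest weight polynomial of weight l, with parts numbered from 0; it is used with l
  decreasing and \<open>l n = 0\<close>, so the full determinant has exponent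
  \<open>l (n - 1)\<close>.\<close>

definition Del :: "nat \<Rightarrow> (nat \<Rightarrow> nat) \<Rightarrow> (nat \<times> nat \<Rightarrow> real) \<Rightarrow> real" where
  "Del n l f = (\<Prod>j<n. lm (Suc j) f ^ (l j - l (Suc j)))"

definition lower_tri :: "nat \<Rightarrow> real mat \<Rightarrow> bool" where
  "lower_tri n L \<longleftrightarrow> L \<in> carrier_mat n n \<and> (\<forall>i<n. \<forall>j<n. i < j \<longrightarrow> L $$ (i, j) = 0)"

definition upper_tri :: "nat \<Rightarrow> real mat \<Rightarrow> bool" where
  "upper_tri n U \<longleftrightarrow> U \<in> carrier_mat n n \<and> (\<forall>i<n. \<forall>j<n. j < i \<longrightarrow> U $$ (i, j) = 0)"

definition sq :: "nat \<Rightarrow> (nat \<times> nat) set" where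
  "sq n = {..<n} \<times> {..<n}"

definition shift_mat :: "nat \<Rightarrow> real mat \<Rightarrow> real \<Rightarrow> real mat" where
  "shift_mat n X t = Matrix.mat n n (\<lambda>(i, j). X $$ (i, j) + (if i = j then t else 0))"

lemma finite_sq [simp]: "finite (sq n)"
  by (simp add: sq_def)

lemma leading_minor_lm: "leading_minor j M = lm j (($$) M)"
  by (simp add: leading_minor_def lm_def)

lemma lm_cong: "(\<And>i k. i < j \<Longrightarrow> k < j \<Longrightarrow> f (i, k) = g (i, k)) \<Longrightarrow> lm j f = lm j g"
  unfolding lm_def by (rule arg_cong[where f = Determinant.det]) (rule eq_matI, auto)

lemma Del_cong: "(\<And>i k. i < n \<Longrightarrow> k < n \<Longrightarrow> f (i, k) = g (i, k)) \<Longrightarrow> Del n l f = Del n l g"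
  unfolding Del_def by (intro prod.cong refl arg_cong[where f = "\<lambda>x. x ^ _"] lm_cong) auto

lemma Del_mat [simp]: "Del n l (($$) (Matrix.mat n n f)) = Del n l f"
  by (rule Del_cong) simp

lemma palg_Del:
  assumes "\<And>i j. i < n \<Longrightarrow> j < n \<Longrightarrow> palg S (\<lambda>x. F x (i, j))"
  shows "palg S (\<lambda>x. Del n l (F x))"
  unfolding Del_def lm_def by (intro palg_prod palg_power palg_det assms) auto

lemma index_mult_sum:
  assumes "A \<in> carrier_mat n m" "B \<in> carrier_mat m k" "i < n" "j < k"
  shows "(A * B) $$ (i, j) = (\<Sum>l<m. A $$ (i, l) * B $$ (l, j))"
  using assms by (simp add: scalar_prod_def atLeast0LessThan)

text \<open>A lower triangular left factor combines each row with earlier rows only, so leading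
  blocks multiply.\<close>

lemma lm_mult_lower:
  assumes L: "lower_tri n L" and X: "X \<in> carrier_mat n n" and j: "j \<le> n"
  shows "lm j (($$) (L * X)) = lm j (($$) L) * lm j (($$) X)"
proof -
  have L': "L \<in> carrier_mat n n" using L by (simp add: lower_tri_def)
  have "Matrix.mat j j (($$) (L * X)) = Matrix.mat j j (($$) L) * Matrix.mat j j (($$) X)"
  proof (rule eq_matI)
    fix i k assume "i < dim_row (Matrix.mat j j (($$) L) * Matrix.mat j j (($$) X))"
      "k < dim_col (Matrix.mat j j (($$) L) * Matrix.mat j j (($$) X))"
    then have ik: "i < j" "k < j" by auto
    have "(L * X) $$ (i, k) = (\<Sum>l<n. L $$ (i, l) * X $$ (l, k))"
      using ik j by (intro index_mult_sum[OF L' X]) auto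
    also have "\<dots> = (\<Sum>l<j. L $$ (i, l) * X $$ (l, k))"
      using L ik j by (intro sum.mono_neutral_right) (auto simp: lower_tri_def)
    also have "\<dots> = (Matrix.mat j j (($$) L) * Matrix.mat j j (($$) X)) $$ (i, k)"
      using ik by (subst index_mult_sum[of _ j j _ j]) auto
    finally show "Matrix.mat j j (($$) (L * X)) $$ (i, k) =
        (Matrix.mat j j (($$) L) * Matrix.mat j j (($$) X)) $$ (i, k)" using ik by simp
  qed auto
  then show ?thesis by (simp add: lm_def det_mult[of _ j])
qed

lemma lm_mult_upper:
  assumes U: "upper_tri n U" and X: "X \<in> carrier_mat n n" and j: "j \<le> n"
  shows "lm j (($$) (X * U)) = lm j (($$) X) * lm j (($$) U)"
proof -
  have U': "U \<in> carrier_mat n n" using U by (simp add: upper_tri_def)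
  have "Matrix.mat j j (($$) (X * U)) = Matrix.mat j j (($$) X) * Matrix.mat j j (($$) U)"
  proof (rule eq_matI)
    fix i k assume "i < dim_row (Matrix.mat j j (($$) X) * Matrix.mat j j (($$) U))"
      "k < dim_col (Matrix.mat j j (($$) X) * Matrix.mat j j (($$) U))"
    then have ik: "i < j" "k < j" by auto
    have "(X * U) $$ (i, k) = (\<Sum>l<n. X $$ (i, l) * U $$ (l, k))"
      using ik j by (intro index_mult_sum[OF X U']) auto
    also have "\<dots> = (\<Sum>l<j. X $$ (i, l) * U $$ (l, k))"
      using U ik j by (intro sum.mono_neutral_right) (auto simp: upper_tri_def)
    also have "\<dots> = (Matrix.mat j j (($$) X) * Matrix.mat j j (($$) U)) $$ (i, k)"
      using ik by (subst index_mult_sum[of _ j j _ j]) auto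
    finally show "Matrix.mat j j (($$) (X * U)) $$ (i, k) =
        (Matrix.mat j j (($$) X) * Matrix.mat j j (($$) U)) $$ (i, k)" using ik by simp
  qed auto
  then show ?thesis by (simp add: lm_def det_mult[of _ j])
qed

lemma lm_upper:
  assumes "\<And>i k. k < i \<Longrightarrow> i < j \<Longrightarrow> f (i, k) = 0"
  shows "lm j f = (\<Prod>i<j. f (i, i))"
proof -
  have "lm j f = prod_list (diag_mat (Matrix.mat j j f))"
    unfolding lm_def by (rule det_upper_triangular) (auto simp: assms)
  then show ?thesis by (simp add: prod_list_diag_prod atLeast0LessThan)
qed

lemma lm_transpose: "lm j (\<lambda>(i, k). f (k, i)) = lm j f"
proof -
  have "Matrix.mat j j (\<lambda>(i, k). f (k, i)) = transpose_mat (Matrix.mat j j f)"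
    by (rule eq_matI) auto
  then show ?thesis unfolding lm_def by (simp add: det_transpose[of _ j])
qed

lemma lm_lower:
  assumes "\<And>i k. i < k \<Longrightarrow> k < j \<Longrightarrow> f (i, k) = 0"
  shows "lm j f = (\<Prod>i<j. f (i, i))"
proof -
  have "lm j (\<lambda>(i, k). f (k, i)) = (\<Prod>i<j. (\<lambda>(i, k). f (k, i)) (i, i))"
    by (rule lm_upper) (simp add: assms)
  then show ?thesis unfolding lm_transpose prod.case .
qed

lemma Del_transpose:
  assumes "K \<in> carrier_mat n n"
  shows "Del n l (($$) (transpose_mat K)) = Del n l (($$) K)"
proof -
  have "Del n l (($$) (transpose_mat K)) = Del n l (\<lambda>(i, k). K $$ (k, i))"
    using assms by (intro Del_cong) auto
  also have "\<dots> = Del n l (($$) K)" unfolding Del_def lm_transpose ..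
  finally show ?thesis .
qed

text \<open>Multiplicative summation by parts: \<open>t i\<close> occurs in the partial products
  with j \<ge> i, where its exponents telescope to \<open>l i - l n\<close>; the last factor
  restores \<open>l n\<close>.\<close>

lemma prod_partial_products:
  fixes t :: "nat \<Rightarrow> real"
  assumes "antimono l"
  shows "(\<Prod>j<n. (\<Prod>i<Suc j. t i) ^ (l j - l (Suc j))) * (\<Prod>i<n. t i) ^ l n = (\<Prod>i<n. t i ^ l i)"
proof (induction n)
  case (Suc n)
  define A where "A = (\<Prod>j<n. (\<Prod>i<Suc j. t i) ^ (l j - l (Suc j)))"
  define T where "T = (\<Prod>i<n. t i)"
  have "l (Suc n) \<le> l n" using antimonoD[OF assms, of n "Suc n"] by simp
  then have pw: "x ^ (l n - l (Suc n)) * x ^ l (Suc n) = x ^ l n" for x :: real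
    by (metis le_add_diff_inverse2 power_add)
  have "(\<Prod>j<Suc n. (\<Prod>i<Suc j. t i) ^ (l j - l (Suc j))) * (\<Prod>i<Suc n. t i) ^ l (Suc n)
    = A * ((T * t n) ^ (l n - l (Suc n)) * (T * t n) ^ l (Suc n))"
    by (simp add: A_def T_def)
  also have "\<dots> = (A * T ^ l n) * t n ^ l n" unfolding pw by (simp add: power_mult_distrib)
  also have "A * T ^ l n = (\<Prod>i<n. t i ^ l i)" using Suc.IH by (simp add: A_def T_def)
  finally show ?case by simp
qed simp

lemma Del_upper:
  assumes l: "antimono l" "l n = 0" and f: "\<And>i k. k < i \<Longrightarrow> i < n \<Longrightarrow> f (i, k) = 0"
  shows "Del n l f = (\<Prod>i<n. f (i, i) ^ l i)"
proof -
  have lm: "lm (Suc j) f = (\<Prod>i<Suc j. f (i, i))" if "j < n" for j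
    by (rule lm_upper, rule f) (use that in auto)
  have "Del n l f = (\<Prod>j<n. (\<Prod>i<Suc j. f (i, i)) ^ (l j - l (Suc j)))"
    unfolding Del_def by (rule prod.cong) (simp_all only: lessThan_iff lm)
  also have "\<dots> = (\<Prod>j<n. (\<Prod>i<Suc j. f (i, i)) ^ (l j - l (Suc j))) * (\<Prod>i<n. f (i, i)) ^ l n"
    unfolding l(2) power_0 mult_1_right ..
  also have "\<dots> = (\<Prod>i<n. f (i, i) ^ l i)"
    by (rule prod_partial_products[OF l(1)])
  finally show ?thesis .
qed

lemma Del_lower:
  assumes l: "antimono l" "l n = 0" and f: "\<And>i k. i < k \<Longrightarrow> k < n \<Longrightarrow> f (i, k) = 0"
  shows "Del n l f = (\<Prod>i<n. f (i, i) ^ l i)"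
proof -
  have lm: "lm (Suc j) f = (\<Prod>i<Suc j. f (i, i))" if "j < n" for j
    by (rule lm_lower, rule f) (use that in auto)
  have "Del n l f = (\<Prod>j<n. (\<Prod>i<Suc j. f (i, i)) ^ (l j - l (Suc j)))"
    unfolding Del_def by (rule prod.cong) (simp_all only: lessThan_iff lm)
  also have "\<dots> = (\<Prod>j<n. (\<Prod>i<Suc j. f (i, i)) ^ (l j - l (Suc j))) * (\<Prod>i<n. f (i, i)) ^ l n"
    unfolding l(2) power_0 mult_1_right ..
  also have "\<dots> = (\<Prod>i<n. f (i, i) ^ l i)"
    by (rule prod_partial_products[OF l(1)])
  finally show ?thesis .
qed

lemma Del_mult_lower:
  assumes "lower_tri n L" "X \<in> carrier_mat n n"
  shows "Del n l (($$) (L * X)) = Del n l (($$) L) * Del n l (($$) X)"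
proof -
  have "lm (Suc j) (($$) (L * X)) = lm (Suc j) (($$) L) * lm (Suc j) (($$) X)" if "j < n" for j
    using that by (intro lm_mult_lower[OF assms]) simp
  then have "(\<Prod>j<n. lm (Suc j) (($$) (L * X)) ^ (l j - l (Suc j))) =
     (\<Prod>j<n. lm (Suc j) (($$) L) ^ (l j - l (Suc j)) * lm (Suc j) (($$) X) ^ (l j - l (Suc j)))"
    by (intro prod.cong) (auto simp: power_mult_distrib)
  then show ?thesis by (simp add: Del_def prod.distrib)
qed

lemma Del_mult_upper:
  assumes "upper_tri n U" "X \<in> carrier_mat n n"
  shows "Del n l (($$) (X * U)) = Del n l (($$) X) * Del n l (($$) U)"
proof -
  have "lm (Suc j) (($$) (X * U)) = lm (Suc j) (($$) X) * lm (Suc j) (($$) U)" if "j < n" for j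
    using that by (intro lm_mult_upper[OF assms]) simp
  then have "(\<Prod>j<n. lm (Suc j) (($$) (X * U)) ^ (l j - l (Suc j))) =
     (\<Prod>j<n. lm (Suc j) (($$) X) ^ (l j - l (Suc j)) * lm (Suc j) (($$) U) ^ (l j - l (Suc j)))"
    by (intro prod.cong) (auto simp: power_mult_distrib)
  then show ?thesis by (simp add: Del_def prod.distrib)
qed

lemma Del_double: "Del n (\<lambda>i. 2 * l i) f = (Del n l f)\<^sup>2"
proof -
  have "x ^ (2 * a - 2 * b) = (x ^ (a - b))\<^sup>2" for x :: real and a b
    by (simp add: power_mult[symmetric] diff_mult_distrib mult.commute)
  then show ?thesis unfolding Del_def prod_power_distrib by (intro prod.cong refl)
qed

lemma Del_one:
  assumes "antimono l" "l n = 0"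
  shows "Del n l (($$) (1\<^sub>m n)) = 1"
proof -
  have "Del n l (($$) (1\<^sub>m n)) = (\<Prod>i<n. 1\<^sub>m n $$ (i, i) ^ l i)"
    by (rule Del_upper[OF assms]) auto
  then show ?thesis by simp
qed

section \<open>LU factorisation along the line X + t I\<close>

lemma palg_id: "palg {\<lambda>t. t} (\<lambda>t. t)"
  by (rule palg_base) simp

text \<open>det_j(X + t I) = t^j det_j(I + X / t), and the second factor tends to 1.\<close>

lemma lm_shift_pos:
  assumes X: "X \<in> carrier_mat n n"
  shows "\<exists>T. \<forall>t>T. \<forall>j\<le>n. lm j (($$) (shift_mat n X t)) > 0"
proof -
  define h where "h j s = lm j (\<lambda>(i, k). (if i = k then 1 else 0) + s * X $$ (i, k))" for j s
  have ev: "eventually (\<lambda>s. h j s > 0) (at_right 0)" for j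
  proof -
    have "palg {\<lambda>t. t} (h j)" unfolding h_def lm_def
      by (intro palg_det, unfold prod.case) (intro palg_add palg_const palg_mult palg_id)
    then have "isCont (h j) 0" by (rule palg_id_continuous)
    then have "(h j \<longlongrightarrow> h j 0) (at_right 0)"
      unfolding isCont_def by (rule tendsto_within_subset) simp
    moreover have "h j 0 = 1"
    proof -
      have "h j 0 = (\<Prod>i<j. 1)" unfolding h_def by (subst lm_upper) auto
      then show ?thesis by simp
    qed
    ultimately show ?thesis by (simp add: order_tendstoD(1))
  qed
  have "eventually (\<lambda>s. \<forall>j\<in>{..n}. h j s > 0) (at_right 0)"
    by (intro eventually_ball_finite ballI ev) auto
  then have "eventually (\<lambda>t. \<forall>j\<in>{..n}. h j (inverse t) > 0) at_top"
    using eventually_compose_filterlim filterlim_inverse_at_right_top by blast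
  then obtain T where T: "\<And>t. t \<ge> T \<Longrightarrow> \<forall>j\<in>{..n}. h j (inverse t) > 0"
    by (auto simp: eventually_at_top_linorder)
  have "lm j (($$) (shift_mat n X t)) > 0" if "t > max T 0" "j \<le> n" for t j
  proof -
    have "lm j (($$) (shift_mat n X t)) =
      Determinant.det (t \<cdot>\<^sub>m Matrix.mat j j (\<lambda>(i, k). (if i = k then 1 else 0) + inverse t * X $$ (i, k)))"
      unfolding lm_def using that
      by (intro arg_cong[where f = Determinant.det] eq_matI) (auto simp: shift_mat_def field_simps)
    also have "\<dots> = t ^ j * h j (inverse t)" by (simp add: h_def lm_def)
    also have "\<dots> > 0" using that T[of t] by auto
    finally show ?thesis .
  qed
  then show ?thesis by blast
qed

definition unit_lower :: "nat \<Rightarrow> real mat \<Rightarrow> bool" where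
  "unit_lower n L \<longleftrightarrow> lower_tri n L \<and> (\<forall>i<n. L $$ (i, i) = 1)"

lemma unit_lower_mult:
  assumes "unit_lower n L" "unit_lower n M"
  shows "unit_lower n (L * M)"
proof -
  have c: "L \<in> carrier_mat n n" "M \<in> carrier_mat n n"
    and L: "\<And>i j. i < n \<Longrightarrow> j < n \<Longrightarrow> i < j \<Longrightarrow> L $$ (i, j) = 0" "\<And>i. i < n \<Longrightarrow> L $$ (i, i) = 1"
    and M: "\<And>i j. i < n \<Longrightarrow> j < n \<Longrightarrow> i < j \<Longrightarrow> M $$ (i, j) = 0" "\<And>i. i < n \<Longrightarrow> M $$ (i, i) = 1"
    using assms by (auto simp: unit_lower_def lower_tri_def)
  have z: "(L * M) $$ (i, j) = 0" if "i < n" "j < n" "i < j" for i j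
    unfolding index_mult_sum[OF c that(1,2)]
  proof (rule sum.neutral, rule ballI)
    fix k assume "k \<in> {..<n}"
    then show "L $$ (i, k) * M $$ (k, j) = 0" using L(1)[of i k] M(1)[of k j] that by (cases "i < k") auto
  qed
  have o: "(L * M) $$ (i, i) = 1" if "i < n" for i
  proof -
    have "(L * M) $$ (i, i) = (\<Sum>k\<in>{i}. L $$ (i, k) * M $$ (k, i))"
      unfolding index_mult_sum[OF c that that]
    proof (rule sum.mono_neutral_right)
      show "\<forall>k\<in>{..<n} - {i}. L $$ (i, k) * M $$ (k, i) = 0"
      proof
        fix k assume "k \<in> {..<n} - {i}"
        then show "L $$ (i, k) * M $$ (k, i) = 0" using L(1)[of i k] M(1)[of k i] that by (cases "i < k") auto
      qed
    qed (use that in auto)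
    then show ?thesis using L(2) M(2) that by simp
  qed
  show ?thesis unfolding unit_lower_def lower_tri_def using c z o by auto
qed

lemma unit_lower_Del:
  assumes "unit_lower n L" "antimono l" "l n = 0"
  shows "Del n l (($$) L) = 1"
  using assms by (subst Del_lower) (auto simp: unit_lower_def lower_tri_def)

lemma unit_lower_lm: "unit_lower n L \<Longrightarrow> j \<le> n \<Longrightarrow> lm j (($$) L) = 1"
  by (subst lm_lower) (auto simp: unit_lower_def lower_tri_def)

text \<open>Gaussian elimination without row exchanges. Unit lower triangular factors do not change
  leading minors, and once m columns are cleared the minor of order m + 1 is a product of diagonal
  entries; being nonzero, it makes the next pivot nonzero.\<close>

lemma LU_elimination:
  assumes X: "X \<in> carrier_mat n n" and nz: "\<And>j. j \<le> n \<Longrightarrow> lm j (($$) X) \<noteq> 0"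
  shows "\<exists>L. unit_lower n L \<and> upper_tri n (L * X)"
proof -
  have "\<exists>L. unit_lower n L \<and> (\<forall>j<m. \<forall>i<n. j < i \<longrightarrow> (L * X) $$ (i, j) = 0)" if "m \<le> n" for m
    using that
  proof (induction m)
    case 0
    have "unit_lower n (1\<^sub>m n)" by (auto simp: unit_lower_def lower_tri_def)
    then show ?case by blast
  next
    case (Suc m)
    then obtain L where L: "unit_lower n L" and
      z: "\<And>i j. j < m \<Longrightarrow> i < n \<Longrightarrow> j < i \<Longrightarrow> (L * X) $$ (i, j) = 0" by auto
    have Lc: "L \<in> carrier_mat n n" using L by (simp add: unit_lower_def lower_tri_def)
    define Y where "Y = L * X"
    have Yc: "Y \<in> carrier_mat n n" using Lc X by (simp add: Y_def)
    have "lm (Suc m) (($$) Y) = (\<Prod>i<Suc m. Y $$ (i, i))"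
      using z Suc.prems by (intro lm_upper) (auto simp: Y_def)
    moreover have "lm (Suc m) (($$) Y) = lm (Suc m) (($$) X)"
      using L Suc.prems X unfolding Y_def
      by (subst lm_mult_lower[of n]) (auto simp: unit_lower_lm, simp add: unit_lower_def)
    ultimately have piv: "Y $$ (m, m) \<noteq> 0" using nz[of "Suc m"] Suc.prems by auto
    define E where "E = Matrix.mat n n (\<lambda>(i, j). if i = j then 1 else if j = m \<and> m < i
      then - Y $$ (i, m) / Y $$ (m, m) else (0::real))"
    have E: "unit_lower n E" by (auto simp: unit_lower_def lower_tri_def E_def)
    have Ec: "E \<in> carrier_mat n n" by (simp add: E_def)
    have EY: "(E * Y) $$ (i, j) = Y $$ (i, j) - (if m < i then Y $$ (i, m) / Y $$ (m, m) * Y $$ (m, j) else 0)"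
      if "i < n" "j < n" for i j
    proof -
      have "(E * Y) $$ (i, j) = (\<Sum>k<n. (if k = i then Y $$ (i, j) else 0) +
          (if k = m then (if m < i then - Y $$ (i, m) / Y $$ (m, m) * Y $$ (m, j) else 0) else 0))"
        unfolding index_mult_sum[OF Ec Yc that] using that
        by (intro sum.cong) (auto simp: E_def)
      also have "\<dots> = Y $$ (i, j) - (if m < i then Y $$ (i, m) / Y $$ (m, m) * Y $$ (m, j) else 0)"
        using that Suc.prems by (auto simp: sum.distrib)
      finally show ?thesis .
    qed
    have "(E * L) * X = E * Y" using Ec Lc X by (simp add: Y_def assoc_mult_mat[of _ n n _ n _ n])
    moreover have "(E * Y) $$ (i, j) = 0" if "j < Suc m" "i < n" "j < i" for i j
    proof (cases "j = m")
      case True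
      then show ?thesis using that piv Suc.prems by (simp add: EY)
    next
      case False
      then show ?thesis using that Suc.prems z[of j i, folded Y_def] z[of j m, folded Y_def] by (simp add: EY)
    qed
    ultimately show ?case using unit_lower_mult[OF E L] by auto
  qed
  from this[of n] obtain L where L: "unit_lower n L"
    and "\<And>i j. j < n \<Longrightarrow> i < n \<Longrightarrow> j < i \<Longrightarrow> (L * X) $$ (i, j) = 0" by auto
  moreover have "L * X \<in> carrier_mat n n" using L X by (auto simp: unit_lower_def lower_tri_def)
  ultimately show ?thesis by (auto simp: upper_tri_def)
qed

lemma shift_mat_carrier [simp]: "shift_mat n X t \<in> carrier_mat n n"
  by (simp add: shift_mat_def)

lemma shift_mat_0: "X \<in> carrier_mat n n \<Longrightarrow> shift_mat n X 0 = X"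
  by (rule eq_matI) (auto simp: shift_mat_def)

lemma palg_shift_mat: "i < n \<Longrightarrow> j < n \<Longrightarrow> palg {\<lambda>t. t} (\<lambda>t. shift_mat n X t $$ (i, j))"
  using palg_add[OF palg_const[of "{\<lambda>t. t}" "X $$ (i, j)"], of "\<lambda>t. if i = j then t else 0"]
  by (cases "i = j") (auto simp: shift_mat_def intro: palg_const palg_id)

text \<open>Uniqueness of highest weight vectors: generic matrices have an LU factorisation, and the general
  case follows because both sides are polynomial along the line \<open>X + t I\<close>.\<close>

lemma Del_characterization:
  assumes l: "antimono l" "l n = 0"
    and low: "\<And>L X. unit_lower n L \<Longrightarrow> X \<in> carrier_mat n n \<Longrightarrow> f (L * X) = f X"
    and up: "\<And>U. upper_tri n U \<Longrightarrow> (\<And>i. i < n \<Longrightarrow> U $$ (i, i) \<noteq> 0) \<Longrightarrow> f U = Del n l (($$) U) * f (1\<^sub>m n)"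
    and pol: "\<And>X. X \<in> carrier_mat n n \<Longrightarrow> palg {\<lambda>t. t} (\<lambda>t. f (shift_mat n X t))"
    and X: "X \<in> carrier_mat n n"
  shows "f X = Del n l (($$) X) * f (1\<^sub>m n)"
proof -
  obtain T where T: "\<And>t j. t > T \<Longrightarrow> j \<le> n \<Longrightarrow> lm j (($$) (shift_mat n X t)) > 0"
    using lm_shift_pos[OF X] by blast
  have "f (shift_mat n X t) = Del n l (($$) (shift_mat n X t)) * f (1\<^sub>m n)" if t: "t > T" for t
  proof -
    let ?X = "shift_mat n X t"
    obtain L where L: "unit_lower n L" "upper_tri n (L * ?X)"
      using LU_elimination[of ?X n] T[OF t] by force
    have Llow: "lower_tri n L" using L by (simp add: unit_lower_def)
    have diag: "(L * ?X) $$ (i, i) \<noteq> 0" if "i < n" for i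
    proof -
      have "lm n (($$) (L * ?X)) = (\<Prod>i<n. (L * ?X) $$ (i, i))"
        using L(2) by (intro lm_upper) (auto simp: upper_tri_def)
      moreover have "lm n (($$) (L * ?X)) = lm n (($$) ?X)"
        using L(1) by (subst lm_mult_lower[OF Llow]) (auto simp: unit_lower_lm)
      ultimately have "(\<Prod>i<n. (L * ?X) $$ (i, i)) > 0" using T[OF t, of n] by simp
      then have "(\<Prod>i<n. (L * ?X) $$ (i, i)) \<noteq> 0" by linarith
      then show ?thesis using that unfolding prod_zero_iff[OF finite_lessThan] by blast
    qed
    have "f ?X = f (L * ?X)" using low[OF L(1)] by simp
    also have "\<dots> = Del n l (($$) (L * ?X)) * f (1\<^sub>m n)" using up[OF L(2) diag] .
    also have "Del n l (($$) (L * ?X)) = Del n l (($$) ?X)"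
      by (simp add: Del_mult_lower[OF Llow] unit_lower_Del[OF L(1) l])
    finally show ?thesis .
  qed
  then have "f (shift_mat n X 0) = Del n l (($$) (shift_mat n X 0)) * f (1\<^sub>m n)"
    by (rule palg_eqI[where f = "\<lambda>t. f (shift_mat n X t)" and T = T and x = 0, rotated 2])
      (assumption | intro palg_mult palg_const palg_Del palg_shift_mat pol[OF X])+
  then show ?thesis by (simp add: shift_mat_0[OF X])
qed

section \<open>Substitutions X -> A X B under the trace form\<close>

lemma dotp_mult_left:
  assumes A: "A \<in> carrier_mat n n" and X: "X \<in> carrier_mat n n" and Y: "Y \<in> carrier_mat n n"
  shows "dotp (sq n) (($$) X) (($$) (transpose_mat A * Y)) = dotp (sq n) (($$) (A * X)) (($$) Y)"
proof -
  have e1: "(transpose_mat A * Y) $$ (i, j) = (\<Sum>k<n. A $$ (k, i) * Y $$ (k, j))" if "i < n" "j < n" for i j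
    using A Y that by (subst index_mult_sum[of _ n n _ n]) (auto intro!: sum.cong)
  have e2: "(A * X) $$ (k, j) = (\<Sum>i<n. A $$ (k, i) * X $$ (i, j))" if "k < n" "j < n" for k j
    using A X that by (rule index_mult_sum)
  have "dotp (sq n) (($$) X) (($$) (transpose_mat A * Y)) =
      (\<Sum>i<n. \<Sum>j<n. \<Sum>k<n. X $$ (i, j) * (A $$ (k, i) * Y $$ (k, j)))"
    unfolding dotp_def sq_def sum.cartesian_product'
    by (intro sum.cong refl) (simp only: lessThan_iff e1 sum_distrib_left)
  also have "\<dots> = (\<Sum>i<n. \<Sum>k<n. \<Sum>j<n. X $$ (i, j) * (A $$ (k, i) * Y $$ (k, j)))"
    by (intro sum.cong refl sum.swap)
  also have "\<dots> = (\<Sum>k<n. \<Sum>i<n. \<Sum>j<n. X $$ (i, j) * (A $$ (k, i) * Y $$ (k, j)))"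
    by (rule sum.swap)
  also have "\<dots> = (\<Sum>k<n. \<Sum>j<n. \<Sum>i<n. X $$ (i, j) * (A $$ (k, i) * Y $$ (k, j)))"
    by (intro sum.cong refl sum.swap)
  also have "\<dots> = (\<Sum>k<n. \<Sum>j<n. \<Sum>i<n. A $$ (k, i) * X $$ (i, j) * Y $$ (k, j))"
    by (intro sum.cong refl) (simp only: mult_ac)
  also have "\<dots> = dotp (sq n) (($$) (A * X)) (($$) Y)"
    unfolding dotp_def sq_def sum.cartesian_product'
    by (intro sum.cong refl) (simp only: lessThan_iff e2 sum_distrib_right)
  finally show ?thesis .
qed

lemma dotp_mult_right:
  assumes A: "A \<in> carrier_mat n n" and X: "X \<in> carrier_mat n n" and Y: "Y \<in> carrier_mat n n"
  shows "dotp (sq n) (($$) X) (($$) (Y * transpose_mat A)) = dotp (sq n) (($$) (X * A)) (($$) Y)"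
proof -
  have e1: "(Y * transpose_mat A) $$ (i, j) = (\<Sum>k<n. Y $$ (i, k) * A $$ (j, k))" if "i < n" "j < n" for i j
    using A Y that by (subst index_mult_sum[of _ n n _ n]) (auto intro!: sum.cong)
  have e2: "(X * A) $$ (i, k) = (\<Sum>j<n. X $$ (i, j) * A $$ (j, k))" if "i < n" "k < n" for i k
    using X A that by (rule index_mult_sum)
  have "dotp (sq n) (($$) X) (($$) (Y * transpose_mat A)) =
      (\<Sum>i<n. \<Sum>j<n. \<Sum>k<n. X $$ (i, j) * (Y $$ (i, k) * A $$ (j, k)))"
    unfolding dotp_def sq_def sum.cartesian_product'
    by (intro sum.cong refl) (simp only: lessThan_iff e1 sum_distrib_left)
  also have "\<dots> = (\<Sum>i<n. \<Sum>k<n. \<Sum>j<n. X $$ (i, j) * (Y $$ (i, k) * A $$ (j, k)))"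
    by (intro sum.cong refl sum.swap)
  also have "\<dots> = (\<Sum>i<n. \<Sum>k<n. \<Sum>j<n. X $$ (i, j) * A $$ (j, k) * Y $$ (i, k))"
    by (intro sum.cong refl) (simp only: mult_ac)
  also have "\<dots> = dotp (sq n) (($$) (X * A)) (($$) Y)"
    unfolding dotp_def sq_def sum.cartesian_product'
    by (intro sum.cong refl) (simp only: lessThan_iff e2 sum_distrib_right)
  finally show ?thesis .
qed

lemma dotp_cong:
  "(\<And>j. j \<in> J \<Longrightarrow> x j = x' j) \<Longrightarrow> (\<And>j. j \<in> J \<Longrightarrow> y j = y' j) \<Longrightarrow> dotp J x y = dotp J x' y'"
  unfolding dotp_def by (rule sum.cong) auto

lemma dotp_mat [simp]:
  "dotp (sq n) (($$) (Matrix.mat n n x)) y = dotp (sq n) x y"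
  "dotp (sq n) y (($$) (Matrix.mat n n x)) = dotp (sq n) y x"
  by (auto intro!: dotp_cong simp: sq_def)

text \<open>The adjoint substitution carries a power of a linear form to a power of another linear
  form.\<close>

lemma hp_left_mult:
  assumes "hp (sq n) d (\<lambda>y. P (($$) (Matrix.mat n n y)))" "A \<in> carrier_mat n n"
  shows "hp (sq n) d (\<lambda>y. P (($$) (A * Matrix.mat n n y)))"
proof -
  obtain qs where qs: "\<And>x. P (($$) (Matrix.mat n n x)) = app qs (\<lambda>q. dotp (sq n) x q ^ d)"
    using assms(1) by (auto simp: hp_def rep_def)
  have "P (($$) (A * Matrix.mat n n x)) =
     app qs (\<lambda>q. dotp (sq n) x (($$) (transpose_mat A * Matrix.mat n n q)) ^ d)" for x
  proof -
    have "P (($$) (A * Matrix.mat n n x)) = P (($$) (Matrix.mat n n (($$) (A * Matrix.mat n n x))))"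
      by (rule arg_cong[where f = "\<lambda>M. P (($$) M)"]) (use assms in \<open>auto intro!: eq_matI\<close>)
    also have "\<dots> = app qs (\<lambda>q. dotp (sq n) (($$) (A * Matrix.mat n n x)) q ^ d)"
      by (rule qs)
    also have "\<dots> = app qs (\<lambda>q. dotp (sq n) x (($$) (transpose_mat A * Matrix.mat n n q)) ^ d)"
    proof -
      have "dotp (sq n) (($$) (A * Matrix.mat n n x)) q = dotp (sq n) x (($$) (transpose_mat A * Matrix.mat n n q))" for q
        using dotp_mult_left[of A n "Matrix.mat n n x" "Matrix.mat n n q"] assms(2) by simp
      then show ?thesis by simp
    qed
    finally show ?thesis .
  qed
  then show ?thesis by (simp only:) (intro hp_app hp_dotp)
qed

lemma hp_right_mult:
  assumes "hp (sq n) d (\<lambda>y. P (($$) (Matrix.mat n n y)))" "A \<in> carrier_mat n n"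
  shows "hp (sq n) d (\<lambda>y. P (($$) (Matrix.mat n n y * A)))"
proof -
  obtain qs where qs: "\<And>x. P (($$) (Matrix.mat n n x)) = app qs (\<lambda>q. dotp (sq n) x q ^ d)"
    using assms(1) by (auto simp: hp_def rep_def)
  have "P (($$) (Matrix.mat n n x * A)) =
     app qs (\<lambda>q. dotp (sq n) x (($$) (Matrix.mat n n q * transpose_mat A)) ^ d)" for x
  proof -
    have "P (($$) (Matrix.mat n n x * A)) = P (($$) (Matrix.mat n n (($$) (Matrix.mat n n x * A))))"
      by (rule arg_cong[where f = "\<lambda>M. P (($$) M)"]) (use assms in \<open>auto intro!: eq_matI\<close>)
    also have "\<dots> = app qs (\<lambda>q. dotp (sq n) (($$) (Matrix.mat n n x * A)) q ^ d)"
      by (rule qs)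
    also have "\<dots> = app qs (\<lambda>q. dotp (sq n) x (($$) (Matrix.mat n n q * transpose_mat A)) ^ d)"
    proof -
      have "dotp (sq n) (($$) (Matrix.mat n n x * A)) q = dotp (sq n) x (($$) (Matrix.mat n n q * transpose_mat A))" for q
        using dotp_mult_right[of A n "Matrix.mat n n x" "Matrix.mat n n q"] assms(2) by simp
      then show ?thesis by simp
    qed
    finally show ?thesis .
  qed
  then show ?thesis by (simp only:) (intro hp_app hp_dotp)
qed

lemma hp_Del:
  assumes "antimono l" "l n = 0"
  shows "hp (sq n) (\<Sum>i<n. l i) (Del n l)"
proof -
  have "hp (sq n) (Suc j * (l j - l (Suc j))) (\<lambda>x. lm (Suc j) x ^ (l j - l (Suc j)))" if "j < n" for j
    unfolding lm_def
    using hp_power[OF hp_det[of "sq n" "Suc j" "\<lambda>ij. ij"]] that by (auto simp: sq_def)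
  then have "hp (sq n) (\<Sum>j<n. Suc j * (l j - l (Suc j))) (\<lambda>x. \<Prod>j<n. lm (Suc j) x ^ (l j - l (Suc j)))"
    by (intro hp_prod) auto
  \<comment> \<open>Summation by parts for the degree: the factor for j has degree (j + 1)(l j - l
    (j + 1)), and the boundary term disappears at m = n because \<open>l n = 0\<close>.\<close>
  moreover have "(\<Sum>j<m. Suc j * (l j - l (Suc j))) + m * l m = (\<Sum>i<m. l i)" for m
  proof (induction m)
    case (Suc m)
    have "l (Suc m) \<le> l m" using antimonoD[OF assms(1), of m "Suc m"] by simp
    then have e: "(l m - l (Suc m)) + l (Suc m) = l m" by simp
    have "Suc m * l m = Suc m * (l m - l (Suc m)) + Suc m * l (Suc m)"
      unfolding add_mult_distrib2[symmetric] e ..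
    then have "(\<Sum>j<Suc m. Suc j * (l j - l (Suc j))) + Suc m * l (Suc m)
        = (\<Sum>j<m. Suc j * (l j - l (Suc j))) + Suc m * l m"
      by (simp only: sum.lessThan_Suc)
    also have "\<dots> = (\<Sum>i<Suc m. l i)" using Suc by (simp only: sum.lessThan_Suc mult_Suc)
    finally show ?case .
  qed simp
  from this[of n] have "(\<Sum>j<n. Suc j * (l j - l (Suc j))) = (\<Sum>i<n. l i)" by (simp add: assms)
  ultimately show ?thesis by (simp add: Del_def[abs_def])
qed

text \<open>If \<open>P\<close> is an eigenvector of \<open>X \<mapsto> A X B\<close>, then the functional dual to \<open>P\<close> is one of the
  transposed substitution.\<close>

lemma app_equivariant:
  assumes P: "rep (sq n) d ys P"
    and AB: "A \<in> carrier_mat n n" "B \<in> carrier_mat n n"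
    and eq: "\<And>X. X \<in> carrier_mat n n \<Longrightarrow> P (($$) (A * X * B)) = c * P (($$) X)"
    and Q: "hp (sq n) d Q"
  shows "app ys (\<lambda>y. Q (($$) (transpose_mat A * Matrix.mat n n y * transpose_mat B))) = c * app ys Q"
proof -
  have "app ys (\<lambda>y. 1 * dotp (sq n) x (($$) (transpose_mat A * Matrix.mat n n y * transpose_mat B)) ^ d)
     = app ys (\<lambda>y. c * dotp (sq n) x y ^ d)" for x
  proof -
    let ?X = "Matrix.mat n n x"
    have "dotp (sq n) x (($$) (transpose_mat A * Matrix.mat n n y * transpose_mat B)) =
       dotp (sq n) (($$) (A * ?X * B)) y" for y
    proof -
      have "dotp (sq n) x (($$) (transpose_mat A * Matrix.mat n n y * transpose_mat B)) =
        dotp (sq n) (($$) ?X) (($$) (transpose_mat A * Matrix.mat n n y * transpose_mat B))" by simp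
      also have "\<dots> = dotp (sq n) (($$) (?X * B)) (($$) (transpose_mat A * Matrix.mat n n y))"
        using AB by (intro dotp_mult_right) auto
      also have "\<dots> = dotp (sq n) (($$) (A * (?X * B))) (($$) (Matrix.mat n n y))"
        using AB by (intro dotp_mult_left) auto
      also have "A * (?X * B) = A * ?X * B" using AB by (simp add: assoc_mult_mat[of _ n n _ n _ n])
      finally show ?thesis by simp
    qed
    then have "app ys (\<lambda>y. 1 * dotp (sq n) x (($$) (transpose_mat A * Matrix.mat n n y * transpose_mat B)) ^ d)
      = P (($$) (A * ?X * B))" using P by (simp add: rep_def)
    also have "\<dots> = c * P (($$) ?X)" by (simp add: eq)
    also have "\<dots> = app ys (\<lambda>y. c * dotp (sq n) x y ^ d)" using P by (simp add: rep_def app_cmult)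
    finally show ?thesis .
  qed
  from app_agree[OF Q this] show ?thesis by (simp add: app_cmult)
qed

section \<open>The norm of a highest weight polynomial\<close>

text \<open>A unit lower triangular E clears the first column below the pivot; expansion along that
  column leaves the determinant of the Schur complement.\<close>

lemma lm_Suc_schur:
  assumes "X (0, 0) \<noteq> 0"
  shows "lm (Suc j) X = X (0, 0) * lm j (\<lambda>(i, k). X (Suc i, Suc k) - X (Suc i, 0) * X (0, Suc k) / X (0, 0))"
proof -
  define M where "M = Matrix.mat (Suc j) (Suc j) X"
  define E where "E = Matrix.mat (Suc j) (Suc j) (\<lambda>(i, k). if i = k then 1 else
    if k = 0 then - X (i, 0) / X (0, 0) else (0::real))"
  have E: "unit_lower (Suc j) E" by (auto simp: unit_lower_def lower_tri_def E_def)
  have Ec: "E \<in> carrier_mat (Suc j) (Suc j)" and Mc: "M \<in> carrier_mat (Suc j) (Suc j)"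
    by (simp_all add: E_def M_def)
  have EM: "(E * M) $$ (i, k) = X (i, k) - (if i = 0 then 0 else X (i, 0) / X (0, 0) * X (0, k))"
    if ik: "i < Suc j" "k < Suc j" for i k
  proof -
    have "(E * M) $$ (i, k) = (\<Sum>l<Suc j. (if l = i then X (i, k) else 0) +
        (if l = 0 then (if i = 0 then 0 else - X (i, 0) / X (0, 0) * X (0, k)) else 0))"
      unfolding index_mult_sum[OF Ec Mc ik] using ik
      by (intro sum.cong refl) (auto simp: E_def M_def)
    also have "\<dots> = X (i, k) - (if i = 0 then 0 else X (i, 0) / X (0, 0) * X (0, k))"
      unfolding sum.distrib using ik by (simp add: sum.delta del: sum.lessThan_Suc)
    finally show ?thesis .
  qed
  have "Determinant.det E = 1"
  proof -
    have "Matrix.mat (Suc j) (Suc j) (($$) E) = E" using Ec by (intro eq_matI) auto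
    then show ?thesis using unit_lower_lm[OF E, of "Suc j"] by (simp add: lm_def)
  qed
  then have "lm (Suc j) X = Determinant.det (E * M)"
    using det_mult[OF Ec Mc] by (simp add: lm_def M_def)
  also have "\<dots> = (\<Sum>i<Suc j. (E * M) $$ (i, 0) * cofactor (E * M) i 0)"
    using Ec Mc by (intro laplace_expansion_column) auto
  also have "\<dots> = (\<Sum>i\<in>{0}. (E * M) $$ (i, 0) * cofactor (E * M) i 0)"
    by (rule sum.mono_neutral_right) (use assms in \<open>auto simp: EM simp del: index_mult_mat\<close>)
  also have "\<dots> = X (0, 0) * cofactor (E * M) 0 0" by (simp add: EM del: index_mult_mat)
  also have "cofactor (E * M) 0 0 = lm j (\<lambda>(i, k). X (Suc i, Suc k) - X (Suc i, 0) * X (0, Suc k) / X (0, 0))"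
    unfolding cofactor_def lm_def mat_delete_def using Ec Mc
    by (auto intro!: arg_cong[where f = Determinant.det] eq_matI simp: EM simp del: index_mult_mat(1))
  finally show ?thesis .
qed

text \<open>The pivot divides each leading minor exactly once, so its exponents telescope to
  \<open>l 0\<close>; the shifted exponents act on the Schur complement.\<close>

lemma Del_Suc_schur:
  assumes x: "X (0, 0) \<noteq> 0" and l: "antimono l" "l (Suc n) = 0"
  shows "Del (Suc n) l X = X (0, 0) ^ l 0 *
    Del n (\<lambda>i. l (Suc i)) (\<lambda>(i, k). X (Suc i, Suc k) - X (Suc i, 0) * X (0, Suc k) / X (0, 0))"
proof -
  define S where "S = (\<lambda>(i, k). X (Suc i, Suc k) - X (Suc i, 0) * X (0, Suc k) / X (0, 0))"
  have "(\<Prod>j<m. X (0, 0) ^ (l j - l (Suc j))) * X (0, 0) ^ l m = X (0, 0) ^ l 0" for m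
  proof (induction m)
    case (Suc m)
    have "l (Suc m) \<le> l m" using antimonoD[OF l(1), of m "Suc m"] by simp
    then have "X (0, 0) ^ (l m - l (Suc m)) * X (0, 0) ^ l (Suc m) = X (0, 0) ^ l m"
      by (metis le_add_diff_inverse2 power_add)
    then show ?case using Suc by (simp add: mult.assoc)
  qed simp
  from this[of "Suc n"] have e: "(\<Prod>j<Suc n. X (0, 0) ^ (l j - l (Suc j))) = X (0, 0) ^ l 0"
    using l by simp
  have "Del (Suc n) l X = (\<Prod>j<Suc n. X (0, 0) ^ (l j - l (Suc j)) * lm j S ^ (l j - l (Suc j)))"
    unfolding Del_def lm_Suc_schur[of X, OF x] S_def[symmetric] power_mult_distrib ..
  also have "\<dots> = X (0, 0) ^ l 0 * (\<Prod>j<Suc n. lm j S ^ (l j - l (Suc j)))"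
    unfolding prod.distrib e ..
  also have "(\<Prod>j<Suc n. lm j S ^ (l j - l (Suc j))) = Del n (\<lambda>i. l (Suc i)) S"
    unfolding prod.lessThan_Suc_shift Del_def by (simp add: lm_def)
  finally show ?thesis by (simp add: S_def)
qed

section \<open>Bordered determinants and one step of the Cayley recursion\<close>

definition dn :: "(nat \<times> nat \<Rightarrow> real) \<Rightarrow> nat \<times> nat \<Rightarrow> real" where
  "dn y = (\<lambda>(i, k). y (Suc i, Suc k))"

definition cf :: "nat \<Rightarrow> nat \<Rightarrow> nat \<Rightarrow> (nat \<times> nat \<Rightarrow> real) \<Rightarrow> real" where
  "cf n b a z = cofactor (Matrix.mat n n z) b a"

text \<open>For a first row r, a first column c and a remaining block Z this is y00 det Z - r adj(Z)
  c: expand along the first row, then each minor along its first column.\<close>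

lemma lm_bordered:
  "lm (Suc n) y = y (0, 0) * lm n (dn y) -
     (\<Sum>a<n. \<Sum>b<n. y (0, Suc a) * y (Suc b, 0) * cf n b a (dn y))"
proof -
  define M where "M = Matrix.mat (Suc n) (Suc n) y"
  have Mc: "M \<in> carrier_mat (Suc n) (Suc n)" by (simp add: M_def)
  have c00: "cofactor M 0 0 = lm n (dn y)"
    unfolding cofactor_def lm_def mat_delete_def M_def dn_def
    by (auto intro!: arg_cong[where f = Determinant.det] eq_matI)
  have c: "cofactor M 0 (Suc a) = - (\<Sum>b<n. y (Suc b, 0) * cf n b a (dn y))" if a: "a < n" for a
  proof -
    define D where "D = mat_delete M 0 (Suc a)"
    have Dc: "D \<in> carrier_mat n n" by (simp add: D_def mat_delete_def M_def)
    have D0: "D $$ (b, 0) = y (Suc b, 0)" if "b < n" for b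
      using that a by (simp add: D_def mat_delete_def M_def)
    have del: "mat_delete D b 0 = mat_delete (Matrix.mat n n (dn y)) b a" if "b < n" for b
      using that a by (intro eq_matI) (auto simp: D_def mat_delete_def M_def dn_def)
    have "Determinant.det D = (\<Sum>b<n. D $$ (b, 0) * cofactor D b 0)"
      using Dc a by (intro laplace_expansion_column) auto
    also have "\<dots> = (\<Sum>b<n. y (Suc b, 0) * ((-1) ^ b * Determinant.det (mat_delete (Matrix.mat n n (dn y)) b a)))"
      by (intro sum.cong refl) (simp add: D0 del cofactor_def)
    finally have "cofactor M 0 (Suc a) = (-1) ^ Suc a *
      (\<Sum>b<n. y (Suc b, 0) * ((-1) ^ b * Determinant.det (mat_delete (Matrix.mat n n (dn y)) b a)))"
      by (simp add: cofactor_def D_def)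
    also have "\<dots> = - (\<Sum>b<n. y (Suc b, 0) * cf n b a (dn y))"
      unfolding sum_distrib_left sum_negf[symmetric]
      by (intro sum.cong refl) (simp add: cf_def cofactor_def power_add)
    finally show ?thesis .
  qed
  have "lm (Suc n) y = (\<Sum>j<Suc n. M $$ (0, j) * cofactor M 0 j)"
    unfolding lm_def M_def[symmetric] using Mc by (intro laplace_expansion_row) auto
  also have "\<dots> = y (0, 0) * lm n (dn y) + (\<Sum>a<n. y (0, Suc a) * cofactor M 0 (Suc a))"
    unfolding sum.lessThan_Suc_shift c00 by (simp add: M_def)
  also have "(\<Sum>a<n. y (0, Suc a) * cofactor M 0 (Suc a)) =
      - (\<Sum>a<n. \<Sum>b<n. y (0, Suc a) * y (Suc b, 0) * cf n b a (dn y))"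
    unfolding sum_negf[symmetric] by (intro sum.cong refl) (simp add: c sum_distrib_left mult.assoc sum_negf)
  finally show ?thesis by simp
qed

text \<open>The trace of Z adj(Z): every one of the n row expansions returns the
  determinant.\<close>

lemma cf_laplace: "(\<Sum>a<n. \<Sum>b<n. z (b, a) * cf n b a z) = real n * lm n z"
proof -
  have "(\<Sum>a<n. z (b, a) * cf n b a z) = lm n z" if "b < n" for b
  proof -
    have "lm n z = (\<Sum>a<n. Matrix.mat n n z $$ (b, a) * cofactor (Matrix.mat n n z) b a)"
      unfolding lm_def using that by (intro laplace_expansion_row) auto
    then show ?thesis using that by (simp add: cf_def)
  qed
  then have "(\<Sum>b<n. \<Sum>a<n. z (b, a) * cf n b a z) = real n * lm n z" by simp
  then show ?thesis by (subst sum.swap)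
qed

lemma hp_cf:
  assumes "b < n" "a < n"
  shows "hp (sq n) (n - 1) (cf n b a)"
proof -
  have "cf n b a z = (-1) ^ (b + a) * Determinant.det (Matrix.mat (n - 1) (n - 1)
     (\<lambda>ij. z ((\<lambda>(i, j). (if i < b then i else Suc i, if j < a then j else Suc j)) ij)))" for z
    unfolding cf_def cofactor_def mat_delete_def using assms
    by (intro arg_cong2[where f = "(*)"] refl arg_cong[where f = Determinant.det] eq_matI) auto
  then have "cf n b a = (\<lambda>z. (-1) ^ (b + a) * Determinant.det (Matrix.mat (n - 1) (n - 1)
     (\<lambda>ij. z ((\<lambda>(i, j). (if i < b then i else Suc i, if j < a then j else Suc j)) ij))))" by blast
  moreover have "hp (sq n) (n - 1) (\<lambda>z. (-1) ^ (b + a) * Determinant.det (Matrix.mat (n - 1) (n - 1)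
     (\<lambda>ij. z ((\<lambda>(i, j). (if i < b then i else Suc i, if j < a then j else Suc j)) ij))))"
    by (intro hp_cmult hp_det) (auto simp: sq_def)
  ultimately show ?thesis by simp
qed

lemma app_deriv:
  assumes "\<And>y. ((\<lambda>s. f s y) has_real_derivative f' y) (at x)"
  shows "((\<lambda>s. app ys (f s)) has_real_derivative app ys f') (at x)"
  by (induction ys) (auto intro!: derivative_eq_intros assms)

text \<open>Agreement for all x > 0 is an identity of polynomials in x, and the binomial theorem
  isolates the coefficient of x^m.\<close>

lemma app_coeff:
  assumes eq: "\<And>x. x > 0 \<Longrightarrow> app ys (\<lambda>y. w y * (x * u y + v y) ^ N) = K * x ^ m" and m: "m \<le> N"
  shows "real (N choose m) * app ys (\<lambda>y. w y * (u y ^ m * v y ^ (N - m))) = K"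
proof -
  define c where "c k = real (N choose k) * app ys (\<lambda>y. w y * (u y ^ k * v y ^ (N - k)))" for k
  have ex: "app ys (\<lambda>y. w y * (x * u y + v y) ^ N) = (\<Sum>k\<le>N. c k * x ^ k)" for x
  proof -
    have "w y * (x * u y + v y) ^ N = (\<Sum>k\<le>N. (x ^ k * real (N choose k)) * (w y * (u y ^ k * v y ^ (N - k))))" for y
      unfolding binomial_ring sum_distrib_left
      by (intro sum.cong refl) (simp add: power_mult_distrib)
    then have "app ys (\<lambda>y. w y * (x * u y + v y) ^ N) =
        (\<Sum>k\<le>N. (x ^ k * real (N choose k)) * app ys (\<lambda>y. w y * (u y ^ k * v y ^ (N - k))))"
      by (simp only: app_sum app_cmult)
    also have "\<dots> = (\<Sum>k\<le>N. c k * x ^ k)"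
      by (intro sum.cong refl) (simp add: c_def)
    finally show ?thesis .
  qed
  have "(\<Sum>k\<le>N. c k * x ^ k) = K * x ^ m" for x
    by (rule palg_eqI[where T = 0 and f = "\<lambda>x. \<Sum>k\<le>N. c k * x ^ k" and g = "\<lambda>x. K * x ^ m", rotated 2])
      (intro palg_sum palg_mult palg_const palg_power palg_id | simp add: ex[symmetric] eq)+
  also have "K * x ^ m = (\<Sum>k\<le>N. (if k = m then K else 0) * x ^ k)" for x
    using m by (simp add: if_distrib[of "\<lambda>a. a * _"] sum.delta cong: if_cong)
  finally have "c m = K"
    using polyfun_eq_coeffs[of c N "\<lambda>k. if k = m then K else 0"] m by auto
  then show ?thesis by (simp add: c_def)
qed

text \<open>A test matrix with pivot x, one further entry s in the first row, one further entry t in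
  the first column, and block B. Its Schur complement is B with s t / x subtracted at position (b,
  a), so s and t probe a single entry.\<close>

definition emb :: "real \<Rightarrow> real \<Rightarrow> real \<Rightarrow> nat \<Rightarrow> nat \<Rightarrow> (nat \<times> nat \<Rightarrow> real) \<Rightarrow> nat \<times> nat \<Rightarrow> real" where
  "emb x s t a b B = (\<lambda>(i, k). if i = 0 then (if k = 0 then x else if k = Suc a then s else 0)
     else if k = 0 then (if i = Suc b then t else 0) else B (i - 1, k - 1))"

lemma dotp_emb:
  assumes "a < n" "b < n"
  shows "dotp (sq (Suc n)) (emb x s t a b B) y =
     x * y (0, 0) + dotp (sq n) B (dn y) + s * y (0, Suc a) + t * y (Suc b, 0)"
proof -
  have "dotp (sq (Suc n)) (emb x s t a b B) y =
     x * y (0, 0) + (\<Sum>k<n. (if k = a then s * y (0, Suc a) else 0)) +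
     (\<Sum>i<n. (if i = b then t * y (Suc b, 0) else 0) + (\<Sum>k<n. B (i, k) * y (Suc i, Suc k)))"
    unfolding dotp_def sq_def sum.cartesian_product' sum.lessThan_Suc_shift
    by (simp add: emb_def if_distrib[of "\<lambda>a. a * _"] cong: if_cong)
  then show ?thesis using assms
    by (simp add: sum.distrib dotp_def sq_def sum.cartesian_product' dn_def)
qed

lemma dotp_emb_0:
  "dotp (sq (Suc n)) (emb x 0 0 a b B) y = x * y (0, 0) + dotp (sq n) B (dn y)"
proof -
  have "dotp (sq (Suc n)) (emb x 0 0 a b B) y =
     x * y (0, 0) + (\<Sum>i<n. (\<Sum>k<n. B (i, k) * y (Suc i, Suc k)))"
    unfolding dotp_def sq_def sum.cartesian_product' sum.lessThan_Suc_shift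
    by (auto simp: emb_def intro!: arg_cong2[where f = "(+)"] sum.cong)
  then show ?thesis by (simp add: dotp_def sq_def sum.cartesian_product' dn_def)
qed

lemma hp_mult': "hp J m P \<Longrightarrow> hp J k Q \<Longrightarrow> m + k = d \<Longrightarrow> hp J d (\<lambda>x. P x * Q x)"
  using hp_mult by blast

context
  fixes n :: nat and l :: "nat \<Rightarrow> nat" and ys zs :: "(real \<times> (nat \<times> nat \<Rightarrow> real)) list"
  assumes l: "antimono l" "l (Suc n) = 0" and l0: "l 0 \<ge> 1"
    and ys: "rep (sq (Suc n)) (\<Sum>i<Suc n. l i) ys (Del (Suc n) l)"
    and zs: "rep (sq n) (\<Sum>i<n. l (Suc i)) zs (Del n (\<lambda>i. l (Suc i)))"
begin

private definition "d = (\<Sum>i<Suc n. l i)"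
private definition "d' = (\<Sum>i<n. l (Suc i))"

private lemma d: "d = l 0 + d'"
  unfolding d_def d'_def sum.lessThan_Suc_shift ..

private lemma l': "antimono (\<lambda>i. l (Suc i))"
  using l(1) by (auto simp: antimono_def)

text \<open>At diag(x, B) the polynomial is x^(l 0) times the one of size n at B; the coefficient of
  x^(l 0) moves the pairing from size n + 1 to size n.\<close>

private lemma pivot_diag:
  assumes "hp (sq n) d' H"
  shows "real (d choose l 0) * app ys (\<lambda>y. y (0, 0) ^ l 0 * H (dn y)) = app zs H"
proof -
  have "real (d choose l 0) * app ys (\<lambda>y. 1 * (y (0, 0) ^ l 0 * dotp (sq n) B (dn y) ^ (d - l 0))) =
     app zs (\<lambda>z. dotp (sq n) B z ^ d')" for B
  proof (rule app_coeff)
    fix x :: real assume x: "x > 0"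
    have "app ys (\<lambda>y. 1 * (x * y (0, 0) + dotp (sq n) B (dn y)) ^ d) = Del (Suc n) l (emb x 0 0 0 0 B)"
      using ys by (simp add: rep_def dotp_emb_0 d_def)
    also have "\<dots> = x ^ l 0 * Del n (\<lambda>i. l (Suc i)) B"
      using x by (subst Del_Suc_schur[OF _ l]) (auto simp: emb_def intro!: Del_cong)
    also have "Del n (\<lambda>i. l (Suc i)) B = app zs (\<lambda>z. dotp (sq n) B z ^ d')"
      using zs by (simp add: rep_def d'_def)
    finally show "app ys (\<lambda>y. 1 * (x * y (0, 0) + dotp (sq n) B (dn y)) ^ d) =
      app zs (\<lambda>z. dotp (sq n) B z ^ d') * x ^ l 0" by simp
  qed (simp add: d)
  then have "app ys (\<lambda>y. (real (d choose l 0) * y (0, 0) ^ l 0) * dotp (sq n) B (dn y) ^ d') =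
     app zs (\<lambda>z. 1 * dotp (sq n) B z ^ d')" for B
    by (simp add: d app_cmult[symmetric] mult.assoc)
  from app_agree[OF assms this] show ?thesis by (simp add: app_cmult[symmetric] mult.assoc)
qed

text \<open>Differentiate the identity at \<open>emb x s t a b B\<close> once in s and once in t at
  0. The left side releases the two border entries. On the right the Schur complement releases -z(b,
  a) / x, which lowers the power of x by one, and the coefficient of x^(l 0 - 1) is
  compared.\<close>

private lemma pivot_off:
  assumes ab: "a < n" "b < n" and H: "hp (sq n) (d' - 1) H" and d': "d' \<ge> 1"
  shows "real ((d - 2) choose (l 0 - 1)) * real d * real (d - 1) *
      app ys (\<lambda>y. y (0, Suc a) * y (Suc b, 0) * y (0, 0) ^ (l 0 - 1) * H (dn y))
    = - real d' * app zs (\<lambda>z. z (b, a) * H z)"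
proof -
  have d1: "d \<ge> 2" "d - 2 - (l 0 - 1) = d' - 1" "l 0 - 1 \<le> d - 2" using d l0 d' by auto
  have I: "app ys (\<lambda>y. (x * y (0, 0) + dotp (sq n) B (dn y) + s * y (0, Suc a) + t * y (Suc b, 0)) ^ d)
      = x ^ l 0 * app zs (\<lambda>z. (dotp (sq n) B z - s * t / x * z (b, a)) ^ d')"
    if x: "x > 0" for x s t B
  proof -
    have "app ys (\<lambda>y. (x * y (0, 0) + dotp (sq n) B (dn y) + s * y (0, Suc a) + t * y (Suc b, 0)) ^ d)
      = Del (Suc n) l (emb x s t a b B)"
      using ys by (simp add: rep_def dotp_emb[OF ab] d_def)
    also have "\<dots> = x ^ l 0 * Del n (\<lambda>i. l (Suc i)) (\<lambda>ik. B ik + (- (s * t / x)) * (if ik = (b, a) then 1 else 0))"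
      using x by (subst Del_Suc_schur[OF _ l]) (auto simp: emb_def intro!: Del_cong)
    also have "\<dots> = x ^ l 0 * app zs (\<lambda>z. (dotp (sq n) (\<lambda>ik. B ik + (- (s * t / x)) * (if ik = (b, a) then 1 else 0)) z) ^ d')"
      using zs by (simp add: rep_def d'_def)
    finally have 1: "app ys (\<lambda>y. (x * y (0, 0) + dotp (sq n) B (dn y) + s * y (0, Suc a) + t * y (Suc b, 0)) ^ d)
      = x ^ l 0 * app zs (\<lambda>z. (dotp (sq n) (\<lambda>ik. B ik + (- (s * t / x)) * (if ik = (b, a) then 1 else 0)) z) ^ d')" .
    have 2: "dotp (sq n) (\<lambda>ik. B ik + (- (s * t / x)) * (if ik = (b, a) then 1 else 0)) z =
        dotp (sq n) B z - s * t / x * z (b, a)" for z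
      unfolding dotp_commute[of _ _ z] dotp_add_right
      using ab by (simp add: dotp_def sq_def if_distrib sum.delta cong: if_cong)
    show ?thesis using 1 unfolding 2 .
  qed
  have II: "app ys (\<lambda>y. real d * (x * y (0, 0) + dotp (sq n) B (dn y) + t * y (Suc b, 0)) ^ (d - 1) * y (0, Suc a))
      = x ^ l 0 * app zs (\<lambda>z. real d' * (dotp (sq n) B z) ^ (d' - 1) * (- (t / x * z (b, a))))"
    if x: "x > 0" for x t B
  proof -
    have "((\<lambda>s. app ys (\<lambda>y. (x * y (0, 0) + dotp (sq n) B (dn y) + s * y (0, Suc a) + t * y (Suc b, 0)) ^ d))
      has_real_derivative app ys (\<lambda>y. real d * (x * y (0, 0) + dotp (sq n) B (dn y) + t * y (Suc b, 0)) ^ (d - 1) * y (0, Suc a))) (at 0)"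
      by (intro app_deriv) (auto intro!: derivative_eq_intros)
    moreover have "((\<lambda>s. x ^ l 0 * app zs (\<lambda>z. (dotp (sq n) B z - s * t / x * z (b, a)) ^ d')) has_real_derivative
      x ^ l 0 * app zs (\<lambda>z. real d' * (dotp (sq n) B z) ^ (d' - 1) * (- (t / x * z (b, a))))) (at 0)"
      by (intro DERIV_cmult app_deriv) (use x in \<open>auto intro!: derivative_eq_intros\<close>)
    ultimately show ?thesis unfolding I[OF x] by (rule DERIV_unique)
  qed
  have III: "app ys (\<lambda>y. real d * (real (d - 1) * (x * y (0, 0) + dotp (sq n) B (dn y)) ^ (d - 2) * y (Suc b, 0)) * y (0, Suc a))
      = x ^ l 0 * app zs (\<lambda>z. real d' * (dotp (sq n) B z) ^ (d' - 1) * (- (1 / x * z (b, a))))"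
    if x: "x > 0" for x B
  proof -
    have "((\<lambda>t. app ys (\<lambda>y. real d * (x * y (0, 0) + dotp (sq n) B (dn y) + t * y (Suc b, 0)) ^ (d - 1) * y (0, Suc a)))
      has_real_derivative app ys (\<lambda>y. real d * (real (d - 1) * (x * y (0, 0) + dotp (sq n) B (dn y)) ^ (d - 2) * y (Suc b, 0)) * y (0, Suc a))) (at 0)"
      by (intro app_deriv) (auto intro!: derivative_eq_intros simp: numeral_2_eq_2)
    moreover have "((\<lambda>t. x ^ l 0 * app zs (\<lambda>z. real d' * (dotp (sq n) B z) ^ (d' - 1) * (- (t / x * z (b, a))))) has_real_derivative
      x ^ l 0 * app zs (\<lambda>z. real d' * (dotp (sq n) B z) ^ (d' - 1) * (- (1 / x * z (b, a))))) (at 0)"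
      by (intro DERIV_cmult app_deriv) (use x in \<open>auto intro!: derivative_eq_intros\<close>)
    ultimately show ?thesis unfolding II[OF x] by (rule DERIV_unique)
  qed
  define K where "K B = - real d' * app zs (\<lambda>z. z (b, a) * dotp (sq n) B z ^ (d' - 1))" for B
  have IV: "app ys (\<lambda>y. (real d * real (d - 1) * (y (0, Suc a) * y (Suc b, 0))) * (x * y (0, 0) + dotp (sq n) B (dn y)) ^ (d - 2))
     = K B * x ^ (l 0 - 1)" if x: "x > 0" for x B
  proof -
    have xp: "x ^ l 0 = x * x ^ (l 0 - 1)" using l0 by (simp add: power_eq_if)
    have "app ys (\<lambda>y. (real d * real (d - 1) * (y (0, Suc a) * y (Suc b, 0))) * (x * y (0, 0) + dotp (sq n) B (dn y)) ^ (d - 2))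
       = x ^ l 0 * app zs (\<lambda>z. real d' * (dotp (sq n) B z) ^ (d' - 1) * (- (1 / x * z (b, a))))"
      unfolding III[OF x, symmetric] by (intro app_cong) simp
    also have "\<dots> = app zs (\<lambda>z. (- real d' * x ^ (l 0 - 1)) * (z (b, a) * dotp (sq n) B z ^ (d' - 1)))"
      unfolding app_cmult[symmetric] using x by (intro app_cong) (simp add: xp)
    also have "\<dots> = K B * x ^ (l 0 - 1)" by (subst app_cmult) (simp add: K_def)
    finally show ?thesis .
  qed
  have "real ((d - 2) choose (l 0 - 1)) * app ys (\<lambda>y. (real d * real (d - 1) * (y (0, Suc a) * y (Suc b, 0))) *
      (y (0, 0) ^ (l 0 - 1) * dotp (sq n) B (dn y) ^ (d - 2 - (l 0 - 1)))) = K B" for B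
    by (rule app_coeff[OF IV d1(3)])
  then have "app ys (\<lambda>y. (real ((d - 2) choose (l 0 - 1)) * real d * real (d - 1) * (y (0, Suc a) * y (Suc b, 0) * y (0, 0) ^ (l 0 - 1))) *
      dotp (sq n) B (dn y) ^ (d' - 1)) = app zs (\<lambda>z. (- real d' * z (b, a)) * dotp (sq n) B z ^ (d' - 1))" for B
    unfolding d1(2) K_def app_cmult[symmetric] by (simp add: mult_ac)
  from app_agree[OF H this] show ?thesis unfolding app_cmult[symmetric] by (simp add: mult_ac)
qed

text \<open>Expand the determinant by \<open>lm_bordered\<close>. The pivot term is evaluated by
  \<open>pivot_diag\<close>, the border terms by \<open>pivot_off\<close>, and the cofactors then
  recombine to n times the smaller determinant.\<close>

private lemma cayley_step:
  assumes n: "d' \<ge> n"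
    and c: "\<And>x. x > 0 \<Longrightarrow> app ys (\<lambda>y. lm (Suc n) y * (x * y (0, 0) + dotp (sq n) B (dn y)) ^ (d - Suc n)) = c * x ^ (l 0 - 1)"
  shows "fact d / fact (d - Suc n) * c = real (l 0 + n) * (fact d' / fact (d' - n) *
     app zs (\<lambda>z. lm n z * dotp (sq n) B z ^ (d' - n)))"
proof -
  define m where "m = l 0 - 1"
  define e where "e = d' - n"
  define c' where "c' = app zs (\<lambda>z. lm n z * dotp (sq n) B z ^ e)"
  have dm: "d - Suc n - m = e" "m \<le> d - Suc n" "d = Suc m + d'" "l 0 = Suc m" "d - Suc n = m + e"
    using d l0 n by (auto simp: m_def e_def)
  have H1: "hp (sq n) d' (\<lambda>z. lm n z * dotp (sq n) B z ^ e)"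
    unfolding lm_def using hp_det[of "sq n" n "\<lambda>ij. ij"] n hp_dotp[of "sq n" e B]
    by (intro hp_mult') (auto simp: sq_def e_def dotp_commute)
  have solve: "C * u = v * w \<Longrightarrow> C \<noteq> 0 \<Longrightarrow> u = v / C * w" for C u v w :: real
    by (simp add: field_simps)
  have "c = real ((d - Suc n) choose m) * app ys (\<lambda>y. lm (Suc n) y * (y (0, 0) ^ m * dotp (sq n) B (dn y) ^ e))"
    using app_coeff[OF c, folded m_def, OF _ dm(2)] dm(1) by simp
  also have "app ys (\<lambda>y. lm (Suc n) y * (y (0, 0) ^ m * dotp (sq n) B (dn y) ^ e)) =
      app ys (\<lambda>y. y (0, 0) ^ l 0 * (lm n (dn y) * dotp (sq n) B (dn y) ^ e)) -
      (\<Sum>a<n. \<Sum>b<n. app ys (\<lambda>y. y (0, Suc a) * y (Suc b, 0) * y (0, 0) ^ (l 0 - 1) *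
         (cf n b a (dn y) * dotp (sq n) B (dn y) ^ e)))"
    unfolding app_sum[symmetric] app_diff[symmetric] lm_bordered dm(4)
    by (intro app_cong) (simp add: left_diff_distrib sum_distrib_right sum_distrib_left right_diff_distrib mult_ac)
  also have "app ys (\<lambda>y. y (0, 0) ^ l 0 * (lm n (dn y) * dotp (sq n) B (dn y) ^ e)) = c' / real (d choose l 0)"
  proof -
    have "d choose l 0 > 0" by (rule zero_less_binomial) (simp add: d)
    then have nz: "real (d choose l 0) \<noteq> 0" by linarith
    show ?thesis unfolding nonzero_eq_divide_eq[OF nz] c'_def using pivot_diag[OF H1]
      by (simp only: mult.commute)
  qed
  also have "(\<Sum>a<n. \<Sum>b<n. app ys (\<lambda>y. y (0, Suc a) * y (Suc b, 0) * y (0, 0) ^ (l 0 - 1) *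
         (cf n b a (dn y) * dotp (sq n) B (dn y) ^ e))) =
     (\<Sum>a<n. \<Sum>b<n. - real d' / (real ((d - 2) choose m) * real d * real (d - 1)) *
        app zs (\<lambda>z. z (b, a) * cf n b a z * dotp (sq n) B z ^ e))"
  proof (intro sum.cong refl)
    fix a b assume ab: "a \<in> {..<n}" "b \<in> {..<n}"
    then have d1: "d' \<ge> 1" using n by auto
    have H2: "hp (sq n) (d' - 1) (\<lambda>z. cf n b a z * dotp (sq n) B z ^ e)"
      using hp_cf[of b n a] ab n hp_dotp[of "sq n" e B]
      by (intro hp_mult') (auto simp: e_def dotp_commute)
    have nz: "real ((d - 2) choose m) * real d * real (d - 1) \<noteq> 0" using d1 dm by auto
    show "app ys (\<lambda>y. y (0, Suc a) * y (Suc b, 0) * y (0, 0) ^ (l 0 - 1) *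
         (cf n b a (dn y) * dotp (sq n) B (dn y) ^ e)) =
       - real d' / (real ((d - 2) choose m) * real d * real (d - 1)) *
        app zs (\<lambda>z. z (b, a) * cf n b a z * dotp (sq n) B z ^ e)"
    proof -
      have ab': "a < n" "b < n" using ab by auto
      have "(real ((d - 2) choose m) * real d * real (d - 1)) *
          app ys (\<lambda>y. y (0, Suc a) * y (Suc b, 0) * y (0, 0) ^ (l 0 - 1) *
            (cf n b a (dn y) * dotp (sq n) B (dn y) ^ e))
         = - real d' * app zs (\<lambda>z. z (b, a) * cf n b a z * dotp (sq n) B z ^ e)"
        using pivot_off[OF ab' H2 d1] unfolding m_def mult.assoc .
      then show ?thesis
        by (rule solve) (rule nz)
    qed
  qed
  also have "\<dots> = - real d' / (real ((d - 2) choose m) * real d * real (d - 1)) * (real n * c')"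
    unfolding sum_distrib_left[symmetric] app_sum[symmetric] sum_distrib_right[symmetric] cf_laplace
    by (simp add: c'_def app_cmult[symmetric] mult.assoc)
  finally have c_eq: "c = real ((d - Suc n) choose m) * (c' / real (d choose l 0) +
      real d' / (real ((d - 2) choose m) * real d * real (d - 1)) * (real n * c'))" by simp
  have b1: "real ((d - Suc n) choose m) = fact (d - Suc n) / (fact m * fact e)"
    using dm by (subst binomial_fact) auto
  have b2: "real (d choose l 0) = fact d / (fact (l 0) * fact d')"
    using dm by (subst binomial_fact) auto
  have b3: "real d' / (real ((d - 2) choose m) * real d * real (d - 1)) * real n = fact m * fact d' / fact d * real n"
  proof (cases "n = 0")
    case False
    then have d1: "d' \<ge> 1" using n by auto
    then obtain k where k: "d' = Suc k" by (cases d') auto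
    have dk: "d - 2 = m + k" "d = Suc (Suc (m + k))" using dm k by auto
    have "real ((m + k) choose m) = fact (m + k) / (fact m * fact k)" by (subst binomial_fact) auto
    then show ?thesis unfolding dk(1) k unfolding dk(2) by (simp add: divide_simps) (simp add: mult_ac)
  qed simp
  have "c = fact (d - Suc n) / (fact m * fact e) * (c' * (fact (l 0) * fact d' / fact d) +
     (fact m * fact d' / fact d * real n) * c')"
    unfolding c_eq b1 b2 mult.assoc[symmetric] b3 by simp
  \<comment> \<open>After the common factorials are taken out, the pivot term keeps
    \<open>l 0\<close>, from fact (l 0) = l 0 * fact m, and the border terms keep n; their sum is
    the new factor of the Cayley constant.\<close>
  also have "\<dots> = fact (d - Suc n) / (fact m * fact e) * (fact m * fact d' / fact d) * (real (l 0 + n) * c')"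
  proof -
    have "F * (c' * (s * M * D / G) + (M * D / G * r) * c') = F * (M * D / G) * ((s + r) * c')"
      for F M D G s r :: real
      by (simp add: divide_inverse algebra_simps)
    then show ?thesis unfolding dm(4) fact_Suc of_nat_add .
  qed
  also have "\<dots> = fact (d - Suc n) * fact d' / (fact e * fact d) * (real (l 0 + n) * c')"
  proof -
    have "M \<noteq> 0 \<Longrightarrow> F / (M * E) * (M * D / G) = F * D / (E * G)" for M F E D G :: real by simp
    then show ?thesis by simp
  qed
  finally have "c = fact (d - Suc n) * fact d' / (fact e * fact d) * (real (l 0 + n) * c')" .
  then show ?thesis by (simp add: e_def[symmetric] c'_def)
qed

lemmas cayley_pivot = cayley_step[unfolded d_def d'_def]

end

section \<open>The apolar norm by repeated lowering\<close>

lemma lm_full_mult: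
  assumes "A \<in> carrier_mat n n" "B \<in> carrier_mat n n"
  shows "lm n (($$) (A * B)) = lm n (($$) A) * lm n (($$) B)"
proof -
  have m: "Matrix.mat n n (($$) M) = M" if "M \<in> carrier_mat n n" for M :: "real mat"
    using that by (intro eq_matI) auto
  show ?thesis using assms by (simp add: lm_def m det_mult[of _ n])
qed

text \<open>Lowering all n parts by one keeps the differences of consecutive parts; only the
  exponent of the full determinant drops.\<close>

lemma Del_pred:
  assumes "antimono l" "l n = 0" "\<And>i. i < n \<Longrightarrow> l i \<ge> 1"
  shows "Del n l f = lm n f * Del n (\<lambda>i. l i - 1) f"
proof (cases n)
  case 0
  then show ?thesis by (simp add: Del_def lm_def)
next
  case (Suc k)
  have "(\<Prod>j<k. lm (Suc j) f ^ (l j - l (Suc j))) = (\<Prod>j<k. lm (Suc j) f ^ (l j - 1 - (l (Suc j) - 1)))"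
  proof (intro prod.cong refl)
    fix j assume "j \<in> {..<k}"
    then have "l j \<ge> 1" "l (Suc j) \<ge> 1" using assms(3) Suc by auto
    then show "lm (Suc j) f ^ (l j - l (Suc j)) = lm (Suc j) f ^ (l j - 1 - (l (Suc j) - 1))" by simp
  qed
  moreover have "lm n f ^ l k = lm n f * lm n f ^ (l k - 1)"
    using assms(3)[of k] Suc by (simp add: power_eq_if)
  ultimately show ?thesis using assms(2) Suc by (simp add: Del_def)
qed

lemma antimono_pred: "antimono l \<Longrightarrow> antimono (\<lambda>i. l i - (1::nat))"
  by (auto simp: antimono_def intro: diff_le_mono)

lemma sum_pred:
  fixes l :: "nat \<Rightarrow> nat"
  assumes "\<And>i. i < n \<Longrightarrow> l i \<ge> 1"
  shows "(\<Sum>i<n. l i - 1) = (\<Sum>i<n. l i) - n" "n \<le> (\<Sum>i<n. l i)"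
proof -
  have "(\<Sum>i<n. l i) = (\<Sum>i<n. (l i - 1) + 1)" 
    by (intro sum.cong refl) (use assms in force)
  then have "(\<Sum>i<n. l i) = (\<Sum>i<n. l i - 1) + n" by (simp only: sum.distrib) simp
  then show "(\<Sum>i<n. l i - 1) = (\<Sum>i<n. l i) - n" "n \<le> (\<Sum>i<n. l i)" by auto
qed

text \<open>Applying the differential operator \<open>det(\<partial>)\<close> lowers all parts by one.\<close>

lemma cayley_lower:
  assumes l: "antimono l" "l n = 0" "\<And>i. i < n \<Longrightarrow> l i \<ge> 1"
    and ys: "rep (sq n) (\<Sum>i<n. l i) ys (Del n l)"
  shows "app ys (\<lambda>y. lm n y * dotp (sq n) x y ^ ((\<Sum>i<n. l i) - n)) =
    Del n (\<lambda>i. l i - 1) x * app ys (\<lambda>y. lm n y * dotp (sq n) (($$) (1\<^sub>m n)) y ^ ((\<Sum>i<n. l i) - n))"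
proof -
  define e where "e = (\<Sum>i<n. l i) - n"
  define P where "P X = app ys (\<lambda>y. lm n y * dotp (sq n) (($$) X) y ^ e)" for X
  have hpQ: "hp (sq n) (\<Sum>i<n. l i) (\<lambda>y. lm n y * dotp (sq n) (($$) X) y ^ e)" for X
    unfolding lm_def using hp_det[of "sq n" n "\<lambda>ij. ij"] hp_dotp[of "sq n" e "($$) X"] sum_pred(2)[of n l] l(3)
    by (intro hp_mult') (auto simp: sq_def e_def dotp_commute)
  \<comment> \<open>The determinant inside the pairing contributes det A det B under the transposed
    substitution, so P inherits the equivariance of \<open>Del n l\<close> up to this factor. This
    is why its weight is lower by one in each part.\<close>
  have eqv: "lm n (($$) A) * lm n (($$) B) * P (A * X * B) = c * P X"
    if AB: "A \<in> carrier_mat n n" "B \<in> carrier_mat n n" and X: "X \<in> carrier_mat n n"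
      and c: "\<And>X. X \<in> carrier_mat n n \<Longrightarrow> Del n l (($$) (A * X * B)) = c * Del n l (($$) X)" for A B c X
  proof -
    have lmT: "lm n (($$) (transpose_mat M)) = lm n (($$) M)" if "M \<in> carrier_mat n n" for M
    proof -
      have "lm n (($$) (transpose_mat M)) = lm n (\<lambda>(i, k). M $$ (k, i))"
        using that by (intro lm_cong) auto
      then show ?thesis using lm_transpose[of n "($$) M"] by simp
    qed
    have 1: "lm n (($$) (transpose_mat A * Matrix.mat n n y * transpose_mat B)) = lm n (($$) A) * lm n (($$) B) * lm n y" for y
      using AB lm_cong[of n "($$) (Matrix.mat n n y)" y] by (simp add: lm_full_mult[of _ n] lmT)
    have 2: "dotp (sq n) (($$) X) (($$) (transpose_mat A * Matrix.mat n n y * transpose_mat B)) =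
        dotp (sq n) (($$) (A * X * B)) y" for y
    proof -
      have "dotp (sq n) (($$) X) (($$) (transpose_mat A * Matrix.mat n n y * transpose_mat B))
        = dotp (sq n) (($$) (X * B)) (($$) (transpose_mat A * Matrix.mat n n y))"
        using AB X by (intro dotp_mult_right) auto
      also have "\<dots> = dotp (sq n) (($$) (A * (X * B))) (($$) (Matrix.mat n n y))"
        using AB X by (intro dotp_mult_left) auto
      finally show ?thesis using AB X by (simp add: assoc_mult_mat[of _ n n _ n _ n])
    qed
    have "app ys (\<lambda>y. (\<lambda>y. lm n y * dotp (sq n) (($$) X) y ^ e) (($$) (transpose_mat A * Matrix.mat n n y * transpose_mat B)))
      = c * app ys (\<lambda>y. lm n y * dotp (sq n) (($$) X) y ^ e)"
      by (rule app_equivariant[OF ys AB c hpQ])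
    then show ?thesis unfolding 1 2 by (simp add: P_def app_cmult[symmetric] mult.assoc)
  qed
  have lm1: "lm n (($$) (1\<^sub>m n)) = 1" by (subst lm_upper) auto
  have "P X = Del n (\<lambda>i. l i - 1) (($$) X) * P (1\<^sub>m n)" if X: "X \<in> carrier_mat n n" for X
  proof (rule Del_characterization[OF antimono_pred[OF l(1)] _ _ _ _ X])
    show "l n - 1 = 0" using l by simp
    show "P (L * X) = P X" if L: "unit_lower n L" and X: "X \<in> carrier_mat n n" for L X
    proof -
      have Lc: "L \<in> carrier_mat n n" "lower_tri n L" using L by (auto simp: unit_lower_def lower_tri_def)
      have "lm n (($$) L) * lm n (($$) (1\<^sub>m n)) * P (L * X * 1\<^sub>m n) = 1 * P X"
      proof (rule eqv)
        show "Del n l (($$) (L * X * 1\<^sub>m n)) = 1 * Del n l (($$) X)" if "X \<in> carrier_mat n n" for X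
          using that Lc unit_lower_Del[OF L l(1,2)] by (simp add: Del_mult_lower)
      qed (use Lc X in auto)
      then show ?thesis using Lc X by (simp add: lm1 unit_lower_lm[OF L])
    qed
    show "P U = Del n (\<lambda>i. l i - 1) (($$) U) * P (1\<^sub>m n)"
      if U: "upper_tri n U" and nz: "\<And>i. i < n \<Longrightarrow> U $$ (i, i) \<noteq> 0" for U
    proof -
      have Uc: "U \<in> carrier_mat n n" using U by (simp add: upper_tri_def)
      have "lm n (($$) (1\<^sub>m n)) * lm n (($$) U) * P (1\<^sub>m n * 1\<^sub>m n * U) = Del n l (($$) U) * P (1\<^sub>m n)"
      proof (rule eqv)
        show "Del n l (($$) (1\<^sub>m n * X * U)) = Del n l (($$) U) * Del n l (($$) X)"
          if "X \<in> carrier_mat n n" for X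
          using that U by (simp add: Del_mult_upper)
      qed (use Uc in auto)
      moreover have "lm n (($$) U) \<noteq> 0"
        using U nz by (subst lm_upper) (auto simp: upper_tri_def)
      ultimately show ?thesis using Uc by (simp add: lm1 Del_pred[OF l])
    qed
    show "palg {\<lambda>t. t} (\<lambda>t. P (shift_mat n X t))" if "X \<in> carrier_mat n n" for X
      unfolding P_def dotp_def
      by (intro palg_app palg_mult palg_const palg_power palg_sum)
        (auto simp: sq_def intro!: palg_mult palg_const palg_shift_mat)
  qed
  from this[of "Matrix.mat n n x"] show ?thesis by (simp add: P_def e_def)
qed

text \<open>The factor by which det(\<partial>) acts, read off at the identity. On diag(x, I) the
  lemma \<open>cayley_lower\<close> gives a multiple of x^(l 0 - 1), which is what
  \<open>cayley_pivot\<close> asks for; each size contributes the factor of its first part.\<close>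

lemma cayley_constant:
  assumes "antimono l" "l n = 0" "\<And>i. i < n \<Longrightarrow> l i \<ge> 1"
    and "rep (sq n) (\<Sum>i<n. l i) ys (Del n l)"
  shows "fact (\<Sum>i<n. l i) / fact ((\<Sum>i<n. l i) - n) *
     app ys (\<lambda>y. lm n y * dotp (sq n) (($$) (1\<^sub>m n)) y ^ ((\<Sum>i<n. l i) - n)) = (\<Prod>i<n. real (l i + n - Suc i))"
  using assms
proof (induction n arbitrary: l ys)
  case 0
  have "Del 0 l (\<lambda>_. 0) = app ys (\<lambda>y. 1)" using 0 by (simp add: rep_def)
  then show ?case by (simp add: Del_def lm_def)
next
  case (Suc n)
  let ?l = "\<lambda>i. l (Suc i)"
  have l': "antimono ?l" using Suc.prems(1) by (auto simp: antimono_def)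
  obtain zs where zs: "rep (sq n) (\<Sum>i<n. l (Suc i)) zs (Del n ?l)"
    using hp_Del[OF l'] Suc.prems(2) unfolding hp_def by blast
  have IH: "fact (\<Sum>i<n. ?l i) / fact ((\<Sum>i<n. ?l i) - n) *
     app zs (\<lambda>y. lm n y * dotp (sq n) (($$) (1\<^sub>m n)) y ^ ((\<Sum>i<n. ?l i) - n)) = (\<Prod>i<n. real (?l i + n - Suc i))"
    using Suc.IH[OF l' _ _ zs] Suc.prems by simp
  define c where "c = app ys (\<lambda>y. lm (Suc n) y * dotp (sq (Suc n)) (($$) (1\<^sub>m (Suc n))) y ^ ((\<Sum>i<Suc n. l i) - Suc n))"
  have c: "app ys (\<lambda>y. lm (Suc n) y * (x * y (0, 0) + dotp (sq n) (($$) (1\<^sub>m n)) (dn y)) ^ ((\<Sum>i<Suc n. l i) - Suc n))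
     = c * x ^ (l 0 - 1)" if "x > 0" for x
  proof -
    define X where "X = emb x 0 0 0 0 (($$) (1\<^sub>m n))"
    have "Del (Suc n) (\<lambda>i. l i - 1) X = (\<Prod>i<Suc n. X (i, i) ^ (l i - 1))"
      using Suc.prems by (intro Del_upper antimono_pred) (auto simp: X_def emb_def)
    also have "\<dots> = x ^ (l 0 - 1)"
      unfolding prod.lessThan_Suc_shift by (simp add: X_def emb_def)
    finally have D: "Del (Suc n) (\<lambda>i. l i - 1) X = x ^ (l 0 - 1)" .
    show ?thesis
      using cayley_lower[OF Suc.prems, of X] unfolding D by (simp add: c_def X_def dotp_emb_0)
  qed
  have l0: "l 0 \<ge> 1" using Suc.prems(3) by auto
  have "(\<Sum>i<n. ?l i) \<ge> n" using sum_pred(2)[of n ?l] Suc.prems(3) by auto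
  from cayley_pivot[OF Suc.prems(1,2) l0 Suc.prems(4) zs this c]
  have "fact (\<Sum>i<Suc n. l i) / fact ((\<Sum>i<Suc n. l i) - Suc n) * c = real (l 0 + n) * (\<Prod>i<n. real (?l i + n - Suc i))"
    unfolding IH by simp
  also have "\<dots> = (\<Prod>i<Suc n. real (l i + Suc n - Suc i))"
    unfolding prod.lessThan_Suc_shift by simp
  finally show ?case by (simp only: c_def)
qed

text \<open>Split one determinant off the second argument and move it to the first, where it acts as
  the operator det(\<partial>).\<close>

lemma norm_pred:
  assumes l: "antimono l" "l n = 0" "\<And>i. i < n \<Longrightarrow> l i \<ge> 1"
    and ys: "rep (sq n) (\<Sum>i<n. l i) ys (Del n l)"
    and zs: "rep (sq n) (\<Sum>i<n. l i - 1) zs (Del n (\<lambda>i. l i - 1))"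
  shows "fact (\<Sum>i<n. l i) * app ys (Del n l) =
    (\<Prod>i<n. real (l i + n - Suc i)) * (fact (\<Sum>i<n. l i - 1) * app zs (Del n (\<lambda>i. l i - 1)))"
proof -
  let ?d = "\<Sum>i<n. l i"
  define c where "c = app ys (\<lambda>y. lm n y * dotp (sq n) (($$) (1\<^sub>m n)) y ^ (?d - n))"
  have d: "(\<Sum>i<n. l i - 1) = ?d - n" using sum_pred(1) l(3) by blast
  have "app ys (Del n l) = app ys (\<lambda>y. app zs (\<lambda>z. lm n y * dotp (sq n) z y ^ (?d - n)))"
    using zs unfolding rep_def d by (intro app_cong) (simp add: Del_pred[OF l] app_cmult dotp_commute)
  also have "\<dots> = app zs (\<lambda>z. app ys (\<lambda>y. lm n y * dotp (sq n) z y ^ (?d - n)))"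
    by (rule app_swap)
  also have "\<dots> = app zs (\<lambda>z. c * Del n (\<lambda>i. l i - 1) z)"
    by (intro app_cong) (subst cayley_lower[OF l ys], simp_all add: c_def mult.commute)
  also have "\<dots> = c * app zs (Del n (\<lambda>i. l i - 1))" by (rule app_cmult)
  finally have "fact ?d * app ys (Del n l) = (fact ?d / fact (?d - n) * c) * (fact (?d - n) * app zs (Del n (\<lambda>i. l i - 1)))"
    by simp
  also have "fact ?d / fact (?d - n) * c = (\<Prod>i<n. real (l i + n - Suc i))"
    unfolding c_def by (rule cayley_constant[OF l ys])
  finally show ?thesis unfolding d .
qed

text \<open>The Vandermonde product of the numbers l i + n - 1 - i.\<close>

definition vdm :: "nat \<Rightarrow> (nat \<Rightarrow> nat) \<Rightarrow> real" where
  "vdm n l = (\<Prod>(i, j)\<in>{(i, j). i < j \<and> j < n}. real (l i) - real (l j) - real i + real j)"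

lemma vdm_Suc: "vdm (Suc n) l = vdm n l * (\<Prod>i<n. real (l i) - real (l n) - real i + real n)"
proof -
  have s: "{(i, j). i < j \<and> j < Suc n} = {(i, j). i < j \<and> j < n} \<union> (\<lambda>i. (i, n)) ` {..<n}"
    by (auto simp: less_Suc_eq)
  have fin: "finite {(i, j). i < j \<and> j < n}" by (rule finite_subset[of _ "{..<n} \<times> {..<n}"]) auto
  show ?thesis unfolding vdm_def s
    by (subst prod.union_disjoint) (auto simp: fin prod.reindex inj_on_def)
qed

text \<open>Solved for the norm, the formula gives the product of the hook lengths of l. Induction
  on n plus the weight: a vanishing last part reduces n, and otherwise \<open>norm_pred\<close>
  lowers every part while the Vandermonde product stays the same.\<close>

theorem norm_Del:
  assumes "antimono l" "l n = 0" "rep (sq n) (\<Sum>i<n. l i) ys (Del n l)"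
  shows "fact (\<Sum>i<n. l i) * app ys (Del n l) * vdm n l = (\<Prod>i<n. fact (l i + n - Suc i))"
  using assms
proof (induction "n + (\<Sum>i<n. l i)" arbitrary: n l ys rule: less_induct)
  case less
  note l = less.prems(1,2) and ys = less.prems(3)
  show ?case
  proof (cases n)
    case 0
    have "Del 0 l (\<lambda>_. 0) = app ys (\<lambda>y. 1)" using ys 0 by (simp add: rep_def)
    then show ?thesis using 0 by (simp add: Del_def[abs_def] vdm_def)
  next
    case (Suc k)
    show ?thesis
    proof (cases "l k = 0")
      case True
      \<comment> \<open>Padding by zeros turns a representation of size k into one of size n for the
        same polynomial, since the last row and column do not enter.\<close>
      define pad :: "(nat \<times> nat \<Rightarrow> real) \<Rightarrow> nat \<times> nat \<Rightarrow> real"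
        where "pad z = (\<lambda>ij. if ij \<in> sq k then z ij else 0)" for z
      have DelS: "Del n l f = Del k l f" for f using True Suc l by (simp add: Del_def)
      have dS: "(\<Sum>i<n. l i) = (\<Sum>i<k. l i)" using True Suc by simp
      obtain zs where zs: "rep (sq k) (\<Sum>i<k. l i) zs (Del k l)"
        using hp_Del[OF l(1) True] unfolding hp_def by blast
      have dp: "dotp (sq n) x (pad z) = dotp (sq k) x z" for x z
        unfolding dotp_def using Suc by (intro sum.mono_neutral_cong_right) (auto simp: pad_def sq_def)
      have "rep (sq n) (\<Sum>i<n. l i) (map (\<lambda>(a, z). (1 * a, pad z)) zs) (Del n l)"
        using zs unfolding rep_def DelS dS app_map dp by simp
      from rep_unique[OF ys this hp_Del[OF l]]
      have "app ys (Del n l) = app zs (\<lambda>z. Del k l (pad z))" unfolding app_map DelS by simp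
      also have "\<dots> = app zs (Del k l)" by (intro app_cong Del_cong) (auto simp: pad_def sq_def)
      finally have e1: "app ys (Del n l) = app zs (Del k l)" .
      have IH: "fact (\<Sum>i<k. l i) * app zs (Del k l) * vdm k l = (\<Prod>i<k. fact (l i + k - Suc i))"
        by (rule less.hyps[OF _ l(1) True zs]) (use Suc in simp)
      have e2: "vdm n l = vdm k l * (\<Prod>i<k. real (l i + k - i))"
        unfolding Suc vdm_Suc using True by (auto intro!: prod.cong)
      have "fact (\<Sum>i<n. l i) * app ys (Del n l) * vdm n l =
         (\<Prod>i<k. fact (l i + k - Suc i)) * (\<Prod>i<k. real (l i + k - i))"
        unfolding e1 e2 dS IH[symmetric] by simp
      also have "\<dots> = (\<Prod>i<k. fact (l i + k - i))"
        unfolding prod.distrib[symmetric]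
      proof (intro prod.cong refl)
        fix i assume "i \<in> {..<k}"
        then have "l i + k - i = Suc (l i + k - Suc i)" by simp
        then show "fact (l i + k - Suc i) * real (l i + k - i) = fact (l i + k - i)"
          by (simp only: fact_Suc) (simp add: mult.commute)
      qed
      also have "\<dots> = (\<Prod>i<n. fact (l i + n - Suc i))" unfolding Suc using True by simp
      finally show ?thesis .
    next
      case False
      have pos: "l i \<ge> 1" if "i < n" for i
        using antimonoD[OF l(1), of i k] that Suc False by simp
      let ?m = "\<lambda>i. l i - 1"
      have lm: "antimono ?m" "?m n = 0" using antimono_pred[OF l(1)] l(2) by auto
      obtain zs where zs: "rep (sq n) (\<Sum>i<n. ?m i) zs (Del n ?m)"
        using hp_Del[OF lm] unfolding hp_def by blast
      have "(\<Sum>i<n. ?m i) < (\<Sum>i<n. l i)" using sum_pred[of n l] pos Suc by auto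
      then have IH: "fact (\<Sum>i<n. ?m i) * app zs (Del n ?m) * vdm n ?m = (\<Prod>i<n. fact (?m i + n - Suc i))"
        by (intro less.hyps[OF _ lm zs]) simp
      have v: "vdm n ?m = vdm n l"
        unfolding vdm_def
      proof (intro prod.cong refl, clarsimp)
        fix i j assume "i < j" "j < n"
        then have "l i \<ge> 1" "l j \<ge> 1" using pos by auto
        then show "real (l i - Suc 0) - real (l j - Suc 0) = real (l i) - real (l j)" by (simp add: of_nat_diff)
      qed
      have "fact (\<Sum>i<n. l i) * app ys (Del n l) * vdm n l =
         (\<Prod>i<n. real (l i + n - Suc i)) * (\<Prod>i<n. fact (?m i + n - Suc i))"
        unfolding IH[symmetric] v using norm_pred[OF l pos ys zs] by (simp only: mult_ac)
      also have "\<dots> = (\<Prod>i<n. fact (l i + n - Suc i))"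
        unfolding prod.distrib[symmetric]
      proof (intro prod.cong refl)
        fix i assume "i \<in> {..<n}"
        then have "l i + n - Suc i = Suc (?m i + n - Suc i)" using pos[of i] by auto
        then show "real (l i + n - Suc i) * fact (?m i + n - Suc i) = fact (l i + n - Suc i)"
          by (simp only: fact_Suc of_nat_mult)
      qed
      finally show ?thesis .
    qed
  qed
qed

section \<open>Gaussian vectors\<close>

definition nrm :: "real measure" where
  "nrm = density lborel (\<lambda>x. ennreal (std_normal_density x))"

definition gauss :: "'j set \<Rightarrow> ('j \<Rightarrow> real) measure" where
  "gauss J = PiM J (\<lambda>_. nrm)"

text \<open>The double factorial (2k - 1)!!, the moment of order 2k of a standard normal
  variable.\<close>

definition dfact :: "nat \<Rightarrow> real" where
  "dfact k = fact (2 * k) / (2 ^ k * fact k)"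

interpretation nrm: prob_space nrm
  unfolding nrm_def by (rule prob_space_normal_density) simp

interpretation nrm_pair: pair_sigma_finite nrm nrm
  by standard

interpretation nrm_prod: product_prob_space "\<lambda>_. nrm" I for I
  by standard

lemma sets_nrm [measurable_cong, simp]: "sets nrm = sets borel"
  by (simp add: nrm_def)

lemma space_nrm [simp]: "space nrm = UNIV"
  by (simp add: nrm_def)

lemma sets_gauss [measurable_cong]: "sets (gauss J) = sets (PiM J (\<lambda>_. borel))"
  unfolding gauss_def by (rule sets_PiM_cong) auto

lemma space_gauss: "space (gauss J) = extensional J"
  by (simp add: gauss_def space_PiM PiE_def)

lemma measurable_nrm: "measurable M nrm = borel_measurable M"
  by (rule measurable_cong_sets) simp_all

lemma gauss_component: "k \<in> J \<Longrightarrow> (\<lambda>x. x k) \<in> borel_measurable (gauss J)"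
  unfolding gauss_def using measurable_component_singleton[of k J "\<lambda>_. nrm"] by (simp add: measurable_nrm)

lemma prob_space_gauss: "prob_space (gauss J)"
  unfolding gauss_def by (rule prob_space_PiM) (rule nrm.prob_space_axioms)

lemma nn_integral_nrm:
  assumes [measurable]: "f \<in> borel_measurable borel"
  shows "(\<integral>\<^sup>+x. f x \<partial>nrm) = (\<integral>\<^sup>+x. ennreal (std_normal_density x) * f x \<partial>lborel)"
  unfolding nrm_def by (subst nn_integral_density) auto

subsection \<open>Rotation invariance\<close>

lemma lborel_shear1:
  assumes f[measurable]: "f \<in> borel_measurable (borel \<Otimes>\<^sub>M borel)"
  shows "(\<integral>\<^sup>+x. \<integral>\<^sup>+y. f (x, y + b * x) \<partial>lborel \<partial>lborel) = (\<integral>\<^sup>+x. \<integral>\<^sup>+y. f (x, y) \<partial>lborel \<partial>(lborel :: real measure))"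
proof (rule nn_integral_cong)
  fix x :: real
  have "(\<integral>\<^sup>+y. f (x, y) \<partial>lborel) = ennreal \<bar>1\<bar> * (\<integral>\<^sup>+y. f (x, b * x + 1 * y) \<partial>lborel)"
    by (intro nn_integral_real_affine) auto
  then show "(\<integral>\<^sup>+y. f (x, y + b * x) \<partial>lborel) = (\<integral>\<^sup>+y. f (x, y) \<partial>lborel)"
    by (simp add: add.commute)
qed

lemma lborel_swap:
  assumes f[measurable]: "f \<in> borel_measurable (borel \<Otimes>\<^sub>M borel)"
  shows "(\<integral>\<^sup>+x. \<integral>\<^sup>+y. f (x, y) \<partial>lborel \<partial>(lborel :: real measure)) = (\<integral>\<^sup>+y. \<integral>\<^sup>+x. f (x, y) \<partial>lborel \<partial>(lborel :: real measure))"
  by (rule lborel_pair.Fubini'[symmetric]) measurable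

lemma lborel_shear2:
  assumes f[measurable]: "f \<in> borel_measurable (borel \<Otimes>\<^sub>M borel)"
  shows "(\<integral>\<^sup>+x. \<integral>\<^sup>+y. f (x + b * y, y) \<partial>lborel \<partial>lborel) = (\<integral>\<^sup>+x. \<integral>\<^sup>+y. f (x, y) \<partial>lborel \<partial>(lborel :: real measure))"
proof -
  have "(\<integral>\<^sup>+x. \<integral>\<^sup>+y. f (x + b * y, y) \<partial>lborel \<partial>lborel) = (\<integral>\<^sup>+y. \<integral>\<^sup>+x. f (x + b * y, y) \<partial>lborel \<partial>(lborel :: real measure))"
    using lborel_swap[of "\<lambda>(x, y). f (x + b * y, y)"] by simp
  also have "\<dots> = (\<integral>\<^sup>+y. \<integral>\<^sup>+x. f (x, y) \<partial>lborel \<partial>lborel)"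
    using lborel_shear1[of "\<lambda>(x, y). f (y, x)" b] by simp
  also have "\<dots> = (\<integral>\<^sup>+x. \<integral>\<^sup>+y. f (x, y) \<partial>lborel \<partial>lborel)"
    using lborel_swap[of f] by simp
  finally show ?thesis .
qed

text \<open>A plane rotation is a product of three shears.\<close>

lemma lborel_rotation:
  assumes f[measurable]: "f \<in> borel_measurable (borel \<Otimes>\<^sub>M borel)"
    and cs: "c\<^sup>2 + s\<^sup>2 = 1" "s \<noteq> 0"
  shows "(\<integral>\<^sup>+x. \<integral>\<^sup>+y. f (c * x - s * y, s * x + c * y) \<partial>lborel \<partial>lborel) =
    (\<integral>\<^sup>+x. \<integral>\<^sup>+y. f (x, y) \<partial>lborel \<partial>(lborel :: real measure))"
proof -
  \<comment> \<open>With c and s the cosine and sine of an angle, t is the tangent of half that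
    angle; the shears have slopes -t, s, -t. Here s must not vanish.\<close>
  define t where "t = (1 - c) / s"
  have st: "s * t = 1 - c" using cs by (simp add: t_def)
  have tc: "t * (1 + c) = s"
  proof -
    have "s * (t * (1 + c)) = (1 - c) * (1 + c)" by (simp add: st mult.assoc[symmetric])
    also have "\<dots> = s * s" using cs(1) by (simp add: power2_eq_square algebra_simps)
    finally show ?thesis using cs(2) by simp
  qed
  have "(\<integral>\<^sup>+x. \<integral>\<^sup>+y. f (x, y) \<partial>lborel \<partial>lborel) = (\<integral>\<^sup>+x. \<integral>\<^sup>+y. f (x + (-t) * y, y) \<partial>lborel \<partial>(lborel :: real measure))"
    using lborel_shear2[of f "- t"] by simp
  also have "\<dots> = (\<integral>\<^sup>+x. \<integral>\<^sup>+y. f (x + (-t) * (y + s * x), y + s * x) \<partial>lborel \<partial>(lborel :: real measure))"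
    using lborel_shear1[of "\<lambda>(x, y). f (x + (-t) * y, y)" s] by simp
  also have "\<dots> = (\<integral>\<^sup>+x. \<integral>\<^sup>+y. f (x + (-t) * y + (-t) * (y + s * (x + (-t) * y)), y + s * (x + (-t) * y)) \<partial>lborel \<partial>(lborel :: real measure))"
    using lborel_shear2[of "\<lambda>(x, y). f (x + (-t) * (y + s * x), y + s * x)" "- t"] by simp
  also have "\<dots> = (\<integral>\<^sup>+x. \<integral>\<^sup>+y. f (c * x - s * y, s * x + c * y) \<partial>lborel \<partial>(lborel :: real measure))"
  proof (intro nn_integral_cong arg_cong[where f = f])
    fix x y :: real
    have "y + s * (x + (-t) * y) = s * x + (1 - s * t) * y" by (simp add: algebra_simps)
    then have 1: "y + s * (x + (-t) * y) = s * x + c * y" by (simp add: st)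
    have "x + (-t) * y + (-t) * (y + s * (x + (-t) * y)) = x - t * y - t * (s * x + c * y)"
      using 1 by simp
    also have "\<dots> = (1 - s * t) * x - t * (1 + c) * y" by (simp add: algebra_simps)
    also have "\<dots> = c * x - s * y" by (simp only: st tc) simp
    finally show "(x + (-t) * y + (-t) * (y + s * (x + (-t) * y)), y + s * (x + (-t) * y)) = (c * x - s * y, s * x + c * y)"
      using 1 by simp
  qed
  finally show ?thesis by simp
qed

lemma std_normal_density_mult:
  "std_normal_density x * std_normal_density y = exp (- (x\<^sup>2 + y\<^sup>2) / 2) / (2 * pi)"
  by (simp add: std_normal_density_def exp_add[symmetric] diff_divide_distrib)

text \<open>The joint density depends on x^2 + y^2 only, so Lebesgue measure's invariance carries
  over.\<close>

lemma nrm_rotation: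
  assumes f[measurable]: "f \<in> borel_measurable (borel \<Otimes>\<^sub>M borel)"
    and cs: "c\<^sup>2 + s\<^sup>2 = 1" "s \<noteq> 0"
  shows "(\<integral>\<^sup>+x. \<integral>\<^sup>+y. f (c * x - s * y, s * x + c * y) \<partial>nrm \<partial>nrm) = (\<integral>\<^sup>+x. \<integral>\<^sup>+y. f (x, y) \<partial>nrm \<partial>nrm)"
proof -
  define g where "g = (\<lambda>(x, y). ennreal (exp (- (x\<^sup>2 + y\<^sup>2) / 2) / (2 * pi)) * f (x, y))"
  have g[measurable]: "g \<in> borel_measurable (borel \<Otimes>\<^sub>M borel)" unfolding g_def by measurable
  have e: "(\<integral>\<^sup>+x. \<integral>\<^sup>+y. h (x, y) \<partial>nrm \<partial>nrm) =
      (\<integral>\<^sup>+x. \<integral>\<^sup>+y. ennreal (exp (- (x\<^sup>2 + y\<^sup>2) / 2) / (2 * pi)) * h (x, y) \<partial>lborel \<partial>lborel)"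
    if h[measurable]: "h \<in> borel_measurable (borel \<Otimes>\<^sub>M borel)" for h
  proof -
    have "(\<integral>\<^sup>+x. \<integral>\<^sup>+y. h (x, y) \<partial>nrm \<partial>nrm) = (\<integral>\<^sup>+x. ennreal (std_normal_density x) * (\<integral>\<^sup>+y. ennreal (std_normal_density y) * h (x, y) \<partial>lborel) \<partial>lborel)"
      by (subst nn_integral_nrm, measurable) (intro nn_integral_cong arg_cong2[where f = "(*)"] refl nn_integral_nrm, measurable)
    also have "\<dots> = (\<integral>\<^sup>+x. \<integral>\<^sup>+y. ennreal (std_normal_density x) * (ennreal (std_normal_density y) * h (x, y)) \<partial>lborel \<partial>lborel)"
      by (intro nn_integral_cong nn_integral_cmult[symmetric]) measurable
    also have "\<dots> = (\<integral>\<^sup>+x. \<integral>\<^sup>+y. ennreal (exp (- (x\<^sup>2 + y\<^sup>2) / 2) / (2 * pi)) * h (x, y) \<partial>lborel \<partial>lborel)"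
    proof (intro nn_integral_cong)
      fix x y :: real
      have "ennreal (exp (- (x\<^sup>2 + y\<^sup>2) / 2) / (2 * pi)) = ennreal (std_normal_density x) * ennreal (std_normal_density y)"
        by (subst std_normal_density_mult[symmetric]) (simp add: ennreal_mult)
      then show "ennreal (std_normal_density x) * (ennreal (std_normal_density y) * h (x, y)) =
          ennreal (exp (- (x\<^sup>2 + y\<^sup>2) / 2) / (2 * pi)) * h (x, y)"
        by (simp only: mult.assoc)
    qed
    finally show ?thesis .
  qed
  have "(\<integral>\<^sup>+x. \<integral>\<^sup>+y. f (c * x - s * y, s * x + c * y) \<partial>nrm \<partial>nrm) =
      (\<integral>\<^sup>+x. \<integral>\<^sup>+y. g (c * x - s * y, s * x + c * y) \<partial>lborel \<partial>lborel)"
  proof -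
    have q: "(c * x - s * y)\<^sup>2 + (s * x + c * y)\<^sup>2 = x\<^sup>2 + y\<^sup>2" for x y :: real
    proof -
      have "(c * x - s * y)\<^sup>2 + (s * x + c * y)\<^sup>2 = (c\<^sup>2 + s\<^sup>2) * (x\<^sup>2 + y\<^sup>2)"
        by (simp add: power2_eq_square algebra_simps)
      then show ?thesis by (simp only: cs(1)) simp
    qed
    show ?thesis
    proof -
      have "(\<lambda>(x, y). f (c * x - s * y, s * x + c * y)) \<in> borel_measurable (borel \<Otimes>\<^sub>M borel)" by measurable
      from e[OF this] show ?thesis by (simp only: g_def prod.case q)
    qed
  qed
  also have "\<dots> = (\<integral>\<^sup>+x. \<integral>\<^sup>+y. g (x, y) \<partial>lborel \<partial>lborel)" by (rule lborel_rotation[OF g cs])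
  also have "\<dots> = (\<integral>\<^sup>+x. \<integral>\<^sup>+y. f (x, y) \<partial>nrm \<partial>nrm)" using e[OF f] by (simp only: g_def prod.case)
  finally show ?thesis .
qed

lemma nrm_reflect:
  assumes [measurable]: "f \<in> borel_measurable borel"
  shows "(\<integral>\<^sup>+x. f (- x) \<partial>nrm) = (\<integral>\<^sup>+x. f x \<partial>nrm)"
proof -
  have "(\<integral>\<^sup>+x. f x \<partial>nrm) = ennreal \<bar>-1\<bar> * (\<integral>\<^sup>+x. ennreal (std_normal_density (0 + (-1) * x)) * f (0 + (-1) * x) \<partial>lborel)"
    unfolding nn_integral_nrm[OF assms] by (rule nn_integral_real_affine) auto
  then show ?thesis by (subst nn_integral_nrm) (simp_all add: std_normal_density_def)
qed

subsection \<open>Orthogonal kernels\<close>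

text \<open>Kernels over an arbitrary index set serve both for one row of a matrix and for all n * n
  coordinates at once; the restriction keeps the image in the space of the product measure.\<close>

definition lin :: "'j set \<Rightarrow> ('j \<Rightarrow> 'j \<Rightarrow> real) \<Rightarrow> ('j \<Rightarrow> real) \<Rightarrow> 'j \<Rightarrow> real" where
  "lin J A x = (\<lambda>i\<in>J. \<Sum>k\<in>J. A i k * x k)"

definition orthk :: "'j set \<Rightarrow> ('j \<Rightarrow> 'j \<Rightarrow> real) \<Rightarrow> bool" where
  "orthk J A \<longleftrightarrow> (\<forall>i\<in>J. \<forall>k\<in>J. (\<Sum>l\<in>J. A l i * A l k) = of_bool (i = k))"

definition kmul :: "'j set \<Rightarrow> ('j \<Rightarrow> 'j \<Rightarrow> real) \<Rightarrow> ('j \<Rightarrow> 'j \<Rightarrow> real) \<Rightarrow> 'j \<Rightarrow> 'j \<Rightarrow> real" where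
  "kmul J A B i k = (\<Sum>l\<in>J. A i l * B l k)"

text \<open>Stated for nonnegative functions, invariance composes without integrability
  conditions.\<close>

definition preserves :: "'j set \<Rightarrow> (('j \<Rightarrow> real) \<Rightarrow> 'j \<Rightarrow> real) \<Rightarrow> bool" where
  "preserves J T \<longleftrightarrow> T \<in> measurable (gauss J) (gauss J) \<and>
     (\<forall>f\<in>borel_measurable (gauss J). (\<integral>\<^sup>+x. f (T x) \<partial>gauss J) = (\<integral>\<^sup>+x. f x \<partial>gauss J))"

lemma lin_measurable [measurable]: "lin J A \<in> measurable (gauss J) (gauss J)"
  unfolding lin_def gauss_def by (rule measurable_restrict) measurable

lemma lin_extensional: "lin J A x \<in> extensional J"
  by (simp add: lin_def)

lemma lin_kmul: "lin J (kmul J A B) x = lin J A (lin J B x)"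
proof -
  have "(\<Sum>k\<in>J. kmul J A B i k * x k) = (\<Sum>k\<in>J. A i k * lin J B x k)" for i
  proof -
    have "(\<Sum>k\<in>J. kmul J A B i k * x k) = (\<Sum>k\<in>J. \<Sum>l\<in>J. A i l * (B l k * x k))"
      unfolding kmul_def sum_distrib_right by (simp add: mult.assoc)
    also have "\<dots> = (\<Sum>l\<in>J. \<Sum>k\<in>J. A i l * (B l k * x k))" by (rule sum.swap)
    also have "\<dots> = (\<Sum>k\<in>J. A i k * lin J B x k)"
      by (intro sum.cong refl) (simp add: lin_def sum_distrib_left)
    finally show ?thesis .
  qed
  then show ?thesis by (subst (1 2) lin_def) simp
qed

lemma lin_id:
  assumes "finite J" "\<And>i k. i \<in> J \<Longrightarrow> k \<in> J \<Longrightarrow> A i k = of_bool (i = k)" "x \<in> extensional J"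
  shows "lin J A x = x"
proof -
  have "lin J A x = (\<lambda>i\<in>J. \<Sum>k\<in>J. if k = i then x k else 0)"
    unfolding lin_def using assms(2) by (intro restrict_ext sum.cong) auto
  then show ?thesis using assms by (auto simp: extensional_def)
qed

lemma dotp_lin:
  assumes A: "orthk J A" and J: "finite J"
  shows "dotp J (lin J A x) (lin J A y) = dotp J x y"
proof -
  have "dotp J (lin J A x) (lin J A y) = (\<Sum>i\<in>J. \<Sum>k\<in>J. \<Sum>l\<in>J. x k * y l * (A i k * A i l))"
    unfolding dotp_def lin_def by (intro sum.cong refl) (simp add: sum_product mult_ac)
  also have "\<dots> = (\<Sum>k\<in>J. \<Sum>i\<in>J. \<Sum>l\<in>J. x k * y l * (A i k * A i l))" by (rule sum.swap)
  also have "\<dots> = (\<Sum>k\<in>J. \<Sum>l\<in>J. \<Sum>i\<in>J. x k * y l * (A i k * A i l))"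
    by (intro sum.cong refl sum.swap)
  also have "\<dots> = (\<Sum>k\<in>J. \<Sum>l\<in>J. if l = k then x k * y l else 0)"
    unfolding sum_distrib_left[symmetric] using A by (intro sum.cong refl) (auto simp: orthk_def)
  also have "\<dots> = dotp J x y" using J by (simp add: dotp_def)
  finally show ?thesis .
qed

lemma orthk_kmul:
  assumes "orthk J A" "orthk J B" "finite J"
  shows "orthk J (kmul J A B)"
  unfolding orthk_def
proof (intro ballI)
  fix i k assume ik: "i \<in> J" "k \<in> J"
  have "dotp J (lin J A (\<lambda>l. B l i)) (lin J A (\<lambda>l. B l k)) = of_bool (i = k)"
    unfolding dotp_lin[OF assms(1,3)] using assms(2) ik by (simp add: dotp_def orthk_def)
  then show "(\<Sum>l\<in>J. kmul J A B l i * kmul J A B l k) = of_bool (i = k)"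
    by (simp add: dotp_def lin_def kmul_def)
qed

lemma preserves_comp:
  assumes S: "preserves J S" and T: "preserves J T"
  shows "preserves J (\<lambda>x. S (T x))"
proof -
  have [measurable]: "S \<in> measurable (gauss J) (gauss J)" "T \<in> measurable (gauss J) (gauss J)"
    using S T by (auto simp: preserves_def)
  show ?thesis unfolding preserves_def
  proof (intro conjI ballI)
    fix f :: "('a \<Rightarrow> real) \<Rightarrow> ennreal" assume f[measurable]: "f \<in> borel_measurable (gauss J)"
    have fS: "(\<lambda>x. f (S x)) \<in> borel_measurable (gauss J)" by measurable
    show "(\<integral>\<^sup>+x. f (S (T x)) \<partial>gauss J) = (\<integral>\<^sup>+x. f x \<partial>gauss J)"
      using bspec[OF conjunct2[OF T[unfolded preserves_def]] fS]
        bspec[OF conjunct2[OF S[unfolded preserves_def]] f] by simp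
  qed measurable
qed

lemma preserves_cong:
  assumes "preserves J S" "\<And>x. x \<in> extensional J \<Longrightarrow> S x = T x"
  shows "preserves J T"
proof -
  have 1: "T \<in> measurable (gauss J) (gauss J)"
    using assms by (subst measurable_cong[of _ _ S]) (auto simp: preserves_def space_gauss)
  have "(\<integral>\<^sup>+x. f (T x) \<partial>gauss J) = (\<integral>\<^sup>+x. f (S x) \<partial>gauss J)" for f :: "_ \<Rightarrow> ennreal"
    using assms(2) by (intro nn_integral_cong) (simp add: space_gauss)
  then show ?thesis using 1 assms(1) by (simp add: preserves_def)
qed

lemma preserves_id: "preserves J (\<lambda>x. x)"
  by (simp add: preserves_def)

lemma gauss_insert2:
  assumes J: "finite K" "i \<notin> K" "j \<notin> K" "i \<noteq> j" and f: "f \<in> borel_measurable (gauss (insert i (insert j K)))"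
  shows "(\<integral>\<^sup>+x. f x \<partial>gauss (insert i (insert j K))) =
    (\<integral>\<^sup>+x. \<integral>\<^sup>+y. \<integral>\<^sup>+z. f (x(j := y, i := z)) \<partial>nrm \<partial>nrm \<partial>gauss K)"
proof -
  have f'[measurable]: "f \<in> borel_measurable (PiM (insert i (insert j K)) (\<lambda>_. nrm))"
    using f by (simp add: gauss_def)
  have m: "(\<lambda>x. \<integral>\<^sup>+z. f (x(i := z)) \<partial>nrm) \<in> borel_measurable (PiM (insert j K) (\<lambda>_. nrm))"
    by (rule nrm.borel_measurable_nn_integral) (simp add: split_beta', measurable)
  show ?thesis unfolding gauss_def
    using J by (subst nrm_prod.product_nn_integral_insert[OF _ _ f'])
      (auto simp: nrm_prod.product_nn_integral_insert[OF _ _ m])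
qed

lemma preserves_rotation:
  assumes J: "finite J" "i \<in> J" "j \<in> J" "i \<noteq> j" and cs: "c\<^sup>2 + s\<^sup>2 = 1" "s \<noteq> 0"
  shows "preserves J (\<lambda>x. x(j := c * x j - s * x i, i := s * x j + c * x i))"
  unfolding preserves_def
proof (intro conjI ballI)
  define K where "K = J - {i, j}"
  have JK: "J = insert i (insert j K)" and K: "finite K" "i \<notin> K" "j \<notin> K" using J by (auto simp: K_def)
  let ?T = "\<lambda>x. x(j := c * x j - s * x i, i := s * x j + c * x i)"
  have comp: "(\<lambda>x. x k) \<in> borel_measurable (gauss J)" if "k \<in> J" for k
    by (rule gauss_component[OF that])
  note [measurable] = comp[OF J(2)] comp[OF J(3)]
  show T: "?T \<in> measurable (gauss J) (gauss J)"
  proof -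
    have "(\<lambda>x. \<lambda>k\<in>J. ?T x k) \<in> measurable (gauss J) (PiM J (\<lambda>_. nrm))"
    proof (rule measurable_restrict)
      fix k assume k: "k \<in> J"
      note [measurable] = comp[OF k]
      show "(\<lambda>x. ?T x k) \<in> measurable (gauss J) nrm"
        by (cases "k = i"; cases "k = j") (simp_all add: J(4))
    qed
    then have 1: "(\<lambda>x. \<lambda>k\<in>J. ?T x k) \<in> measurable (gauss J) (gauss J)" unfolding gauss_def[of J] .
    have 2: "(\<lambda>k\<in>J. ?T x k) = ?T x" if "x \<in> space (gauss J)" for x
      using J that by (auto simp: space_gauss extensional_def fun_eq_iff restrict_def)
    show ?thesis using 1 measurable_cong[of "gauss J" "\<lambda>x. \<lambda>k\<in>J. ?T x k" ?T, OF 2] by blast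
  qed
  fix f :: "('a \<Rightarrow> real) \<Rightarrow> ennreal" assume f: "f \<in> borel_measurable (gauss J)"
  have fT: "(\<lambda>x. f (?T x)) \<in> borel_measurable (gauss J)" using f T by measurable
  have "(\<integral>\<^sup>+x. f (?T x) \<partial>gauss J) = (\<integral>\<^sup>+x. \<integral>\<^sup>+y. \<integral>\<^sup>+z. f (?T (x(j := y, i := z))) \<partial>nrm \<partial>nrm \<partial>gauss K)"
    unfolding JK using K J(4) fT by (intro gauss_insert2) (auto simp: JK)
  also have "\<dots> = (\<integral>\<^sup>+x. \<integral>\<^sup>+y. \<integral>\<^sup>+z. f (x(j := y, i := z)) \<partial>nrm \<partial>nrm \<partial>gauss K)"
  proof (rule nn_integral_cong)
    fix x assume x: "x \<in> space (gauss K)"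
    have m: "(\<lambda>(y, z). f (x(j := y, i := z))) \<in> borel_measurable (borel \<Otimes>\<^sub>M borel)"
    proof -
      have "(\<lambda>p. \<lambda>k\<in>J. (x(j := fst p, i := snd p)) k) \<in> measurable (borel \<Otimes>\<^sub>M borel) (PiM J (\<lambda>_. nrm))"
      proof (rule measurable_restrict)
        fix k
        show "(\<lambda>p. (x(j := fst p, i := snd p)) k) \<in> measurable (borel \<Otimes>\<^sub>M borel) nrm"
          by (cases "k = i"; cases "k = j") (simp_all add: J(4))
      qed
      moreover have "(\<lambda>k\<in>J. (x(j := fst p, i := snd p)) k) = x(j := fst p, i := snd p)" for p :: "real \<times> real"
        using x by (auto simp: JK space_gauss extensional_def fun_eq_iff restrict_def)
      ultimately have "(\<lambda>p. x(j := fst p, i := snd p)) \<in> measurable (borel \<Otimes>\<^sub>M borel) (gauss J)"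
        by (simp add: gauss_def)
      from measurable_compose[OF this f] show ?thesis by (simp add: split_beta')
    qed
    have u: "?T (x(j := y, i := z)) = x(j := c * y - s * z, i := s * y + c * z)" for y z
      using J(4) by (auto simp: fun_eq_iff)
    show "(\<integral>\<^sup>+y. \<integral>\<^sup>+z. f (?T (x(j := y, i := z))) \<partial>nrm \<partial>nrm) = (\<integral>\<^sup>+y. \<integral>\<^sup>+z. f (x(j := y, i := z)) \<partial>nrm \<partial>nrm)"
      unfolding u using nrm_rotation[OF m cs] by simp
  qed
  also have "\<dots> = (\<integral>\<^sup>+x. f x \<partial>gauss J)"
    unfolding JK using K J(4) f by (intro gauss_insert2[symmetric]) (auto simp: JK)
  finally show "(\<integral>\<^sup>+x. f (?T x) \<partial>gauss J) = (\<integral>\<^sup>+x. f x \<partial>gauss J)" .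
qed

lemma preserves_reflect:
  assumes J: "finite J" "i \<in> J"
  shows "preserves J (\<lambda>x. x(i := - x i))"
  unfolding preserves_def
proof (intro conjI ballI)
  define K where "K = J - {i}"
  have JK: "J = insert i K" and K: "finite K" "i \<notin> K" using J by (auto simp: K_def)
  let ?T = "\<lambda>x::'a \<Rightarrow> real. x(i := - x i)"
  have comp: "(\<lambda>x. x k) \<in> borel_measurable (gauss J)" if "k \<in> J" for k
    by (rule gauss_component[OF that])
  note [measurable] = comp[OF J(2)]
  show T: "?T \<in> measurable (gauss J) (gauss J)"
  proof -
    have "(\<lambda>x. \<lambda>k\<in>J. ?T x k) \<in> measurable (gauss J) (PiM J (\<lambda>_. nrm))"
    proof (rule measurable_restrict)
      fix k assume k: "k \<in> J"
      note [measurable] = comp[OF k]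
      show "(\<lambda>x. ?T x k) \<in> measurable (gauss J) nrm" by (cases "k = i") simp_all
    qed
    then have 1: "(\<lambda>x. \<lambda>k\<in>J. ?T x k) \<in> measurable (gauss J) (gauss J)" unfolding gauss_def[of J] .
    have 2: "(\<lambda>k\<in>J. ?T x k) = ?T x" if "x \<in> space (gauss J)" for x
      using J that by (auto simp: space_gauss extensional_def fun_eq_iff restrict_def)
    show ?thesis using 1 measurable_cong[of "gauss J" "\<lambda>x. \<lambda>k\<in>J. ?T x k" ?T, OF 2] by blast
  qed
  fix f :: "('a \<Rightarrow> real) \<Rightarrow> ennreal" assume f: "f \<in> borel_measurable (gauss J)"
  have fT: "(\<lambda>x. f (?T x)) \<in> borel_measurable (gauss J)" using f T by measurable
  have ins: "(\<integral>\<^sup>+x. h x \<partial>gauss J) = (\<integral>\<^sup>+x. \<integral>\<^sup>+y. h (x(i := y)) \<partial>nrm \<partial>gauss K)"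
    if "h \<in> borel_measurable (gauss J)" for h
    using that K unfolding JK gauss_def by (intro nrm_prod.product_nn_integral_insert) auto
  have "(\<integral>\<^sup>+x. f (?T x) \<partial>gauss J) = (\<integral>\<^sup>+x. \<integral>\<^sup>+y. f (x(i := - y)) \<partial>nrm \<partial>gauss K)"
    using ins[OF fT] by simp
  also have "\<dots> = (\<integral>\<^sup>+x. \<integral>\<^sup>+y. f (x(i := y)) \<partial>nrm \<partial>gauss K)"
  proof (rule nn_integral_cong)
    fix x assume x: "x \<in> space (gauss K)"
    have "(\<lambda>y. \<lambda>k\<in>J. (x(i := y)) k) \<in> measurable borel (PiM J (\<lambda>_. nrm))"
    proof (rule measurable_restrict)
      fix k show "(\<lambda>y. (x(i := y)) k) \<in> measurable borel nrm" by (cases "k = i") simp_all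
    qed
    moreover have "(\<lambda>k\<in>J. (x(i := y)) k) = x(i := y)" for y
      using x by (auto simp: JK space_gauss extensional_def fun_eq_iff restrict_def)
    ultimately have "(\<lambda>y. x(i := y)) \<in> measurable borel (gauss J)" by (simp only: gauss_def)
    from measurable_compose[OF this f]
    show "(\<integral>\<^sup>+y. f (x(i := - y)) \<partial>nrm) = (\<integral>\<^sup>+y. f (x(i := y)) \<partial>nrm)"
      by (rule nrm_reflect)
  qed
  also have "\<dots> = (\<integral>\<^sup>+x. f x \<partial>gauss J)" using ins[OF f] by simp
  finally show "(\<integral>\<^sup>+x. f (?T x) \<partial>gauss J) = (\<integral>\<^sup>+x. f x \<partial>gauss J)" .
qed

text \<open>The Householder reflection that moves the \<open>F\<close>-part of \<open>q\<close> onto the coordinate \<open>f\<close>. If \<open>q\<close> is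
  already there then \<open>w = 0\<close>, and division by zero makes the reflection the identity.\<close>

lemma householder:
  assumes J: "finite J" "F \<subseteq> J" "f \<in> F"
  shows "\<exists>A. orthk J A \<and> (\<forall>i k. A i k = A k i) \<and> (\<forall>i k. k \<notin> F \<longrightarrow> A i k = of_bool (i = k)) \<and>
    (\<forall>i\<in>F-{f}. (\<Sum>l\<in>J. A i l * q l) = 0) \<and> (\<Sum>l\<in>J. A f l * q l) = sqrt (\<Sum>l\<in>F. (q l)\<^sup>2)"
proof -
  define \<rho> where "\<rho> = sqrt (\<Sum>l\<in>F. (q l)\<^sup>2)"
  have fF: "finite F" using J finite_subset by blast
  have rho2: "\<rho>\<^sup>2 = (\<Sum>l\<in>F. (q l)\<^sup>2)" unfolding \<rho>_def by (simp add: sum_nonneg)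
  define v where "v i = (if i \<in> F then q i - (if i = f then \<rho> else 0) else 0)" for i
  define w where "w = (\<Sum>l\<in>J. v l * v l)"
  define A where "A i k = of_bool (i = k) - 2 / w * (v i * v k)" for i k
  have sJF: "(\<Sum>l\<in>J. v l * g l) = (\<Sum>l\<in>F. v l * g l)" for g
    using J by (intro sum.mono_neutral_right) (auto simp: v_def)
  have vg: "(\<Sum>l\<in>F. v l * g l) = (\<Sum>l\<in>F. q l * g l) - \<rho> * g f" for g
  proof -
    have "(\<Sum>l\<in>F. v l * g l) = (\<Sum>l\<in>F. q l * g l - (if l = f then \<rho> * g l else 0))"
      by (intro sum.cong refl) (auto simp: v_def algebra_simps)
    then show ?thesis using J fF by (simp add: sum_subtractf)
  qed
  have w: "w = 2 * (\<rho>\<^sup>2 - \<rho> * q f)"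
  proof -
    have "w = (\<Sum>l\<in>F. v l * q l) - \<rho> * v f"
      unfolding w_def sJF vg[of v] by (simp add: mult.commute)
    also have "(\<Sum>l\<in>F. v l * q l) = \<rho>\<^sup>2 - \<rho> * q f"
      unfolding vg[of q] rho2 by (simp add: power2_eq_square)
    finally show ?thesis using J by (simp add: v_def algebra_simps power2_eq_square)
  qed
  have vq: "(\<Sum>l\<in>J. v l * q l) = w / 2"
    unfolding sJF vg w rho2 by (simp add: power2_eq_square)
  have v0: "v i = 0" if "w = 0" "i \<in> J" for i
    using that J(1) unfolding w_def by (simp add: sum_nonneg_eq_0_iff)
  have Aq: "(\<Sum>l\<in>J. A i l * q l) = q i - v i" if "i \<in> J" for i
  proof -
    have "(\<Sum>l\<in>J. A i l * q l) = (\<Sum>l\<in>J. (if l = i then q l else 0) - 2 / w * v i * (v l * q l))"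
      by (intro sum.cong refl) (auto simp: A_def algebra_simps)
    also have "\<dots> = q i - 2 / w * v i * (w / 2)"
      unfolding sum_subtractf sum_distrib_left[symmetric] vq using that J by simp
    also have "\<dots> = q i - v i" using v0[OF _ that] by (cases "w = 0") auto
    finally show ?thesis .
  qed
  have "orthk J A"
    unfolding orthk_def
  proof (intro ballI)
    fix i k assume ik: "i \<in> J" "k \<in> J"
    have "(\<Sum>l\<in>J. A l i * A l k) = (\<Sum>l\<in>J. (if l = i then of_bool (i = k) else 0)
       - (if l = i then 2 / w * (v i * v k) else 0) - (if l = k then 2 / w * (v i * v k) else 0)
       + (2 / w)\<^sup>2 * (v i * v k) * (v l * v l))"
      by (intro sum.cong refl) (auto simp: A_def algebra_simps power2_eq_square)
    also have "\<dots> = of_bool (i = k) - 2 / w * (v i * v k) - 2 / w * (v i * v k) + (2 / w)\<^sup>2 * (v i * v k) * w"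
      unfolding sum.distrib sum_subtractf sum_distrib_left[symmetric] w_def[symmetric] using ik J by simp
    also have "\<dots> = of_bool (i = k)" by (cases "w = 0") (auto simp: power2_eq_square)
    finally show "(\<Sum>l\<in>J. A l i * A l k) = of_bool (i = k)" .
  qed
  moreover have "\<forall>i k. A i k = A k i" by (auto simp: A_def)
  moreover have "\<forall>i k. k \<notin> F \<longrightarrow> A i k = of_bool (i = k)" by (auto simp: A_def v_def)
  moreover have "\<forall>i\<in>F-{f}. (\<Sum>l\<in>J. A i l * q l) = 0"
  proof
    fix i assume i: "i \<in> F - {f}"
    then have "v i = q i" "i \<in> J" using J by (auto simp: v_def)
    then show "(\<Sum>l\<in>J. A i l * q l) = 0" using Aq by simp
  qed
  moreover have "(\<Sum>l\<in>J. A f l * q l) = \<rho>" using Aq[of f] J by (auto simp: v_def)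
  ultimately show ?thesis unfolding \<rho>_def by blast
qed

text \<open>Induction on the set F of coordinates whose columns may differ from unit vectors. For a
  new index m, a reflection B inside F brings column m into the plane of f and m, and a rotation R
  of that plane makes it the unit vector of m. Both B and the remaining kernel differ from the
  identity only in columns from F, so the induction hypothesis covers them.\<close>

lemma preserves_lin_aux:
  assumes J: "finite J" and F: "finite F" "F \<subseteq> J" and O: "orthk J A"
    and fixes_outside: "\<And>i k. i \<in> J \<Longrightarrow> k \<in> J - F \<Longrightarrow> A i k = of_bool (i = k)"
  shows "preserves J (lin J A)"
  using F O fixes_outside
proof (induction F arbitrary: A rule: finite_induct)
  case empty
  then show ?case using J by (intro preserves_cong[OF preserves_id]) (auto simp: lin_id)
next
  case (insert m F)
  have m: "m \<in> J" and FJ: "F \<subseteq> J" using insert by auto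
  \<comment> \<open>Column m is orthogonal to the unit columns outside
    \<open>insert m F\<close>.\<close>
  have q0: "A k m = 0" if "k \<in> J - insert m F" for k
  proof -
    have "(\<Sum>l\<in>J. A l k * A l m) = 0" using insert.prems(2) that m by (auto simp: orthk_def)
    moreover have "(\<Sum>l\<in>J. A l k * A l m) = (\<Sum>l\<in>J. if l = k then A l m else 0)"
      using insert.prems(3) that by (intro sum.cong) auto
    ultimately show ?thesis using that J by simp
  qed
  have unit: "(\<Sum>l\<in>J. (A l m)\<^sup>2) = 1"
    using insert.prems(2) m by (simp add: orthk_def power2_eq_square)
  show ?case
  proof (cases "F = {}")
    case True
    have z: "A k m = 0" if "k \<in> J - {m}" for k using q0 that True by auto
    have "(\<Sum>l\<in>J. (A l m)\<^sup>2) = (\<Sum>l\<in>{m}. (A l m)\<^sup>2)"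
      using J m z by (intro sum.mono_neutral_right) auto
    then have am: "A m m = 1 \<or> A m m = -1" using unit by (simp add: power2_eq_1_iff)
    have fx: "A i k = of_bool (i = k)" if "i \<in> J" "k \<in> J - {m}" for i k
      using insert.prems(3) that True by auto
    show ?thesis
    proof (cases "A m m = 1")
      case t: True
      have "A i k = of_bool (i = k)" if "i \<in> J" "k \<in> J" for i k
        using fx[of i k] z[of i] t that by (cases "k = m"; cases "i = m") auto
      then show ?thesis using J by (intro preserves_cong[OF preserves_id]) (auto simp: lin_id)
    next
      case False
      then have am: "A m m = -1" using am by simp
      show ?thesis
      proof (rule preserves_cong[OF preserves_reflect[OF J m]])
        fix x :: "'a \<Rightarrow> real" assume x: "x \<in> extensional J"
        have "lin J A x = lin J (\<lambda>i k. of_bool (i = k)) (x(m := - x m))"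
        proof -
          have "A i k * x k = of_bool (i = k) * (x(m := - x m)) k" if "i \<in> J" "k \<in> J" for i k
            using fx[of i k] z[of i] am that by (cases "k = m"; cases "i = m") auto
          then show ?thesis unfolding lin_def by (intro restrict_ext sum.cong) auto
        qed
        also have "\<dots> = x(m := - x m)" using x m J by (intro lin_id) (auto simp: extensional_def)
        finally show "x(m := - x m) = lin J A x" ..
      qed
    qed
  next
    case False
    then obtain f where f: "f \<in> F" by blast
    then have fm: "f \<noteq> m" "f \<in> J" using insert FJ by auto
    obtain B where B: "orthk J B" "\<And>i k. B i k = B k i" "\<And>i k. k \<notin> F \<Longrightarrow> B i k = of_bool (i = k)"
      "\<And>i. i \<in> F - {f} \<Longrightarrow> (\<Sum>l\<in>J. B i l * A l m) = 0"
    proof -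
      obtain B where "orthk J B \<and> (\<forall>i k. B i k = B k i) \<and> (\<forall>i k. k \<notin> F \<longrightarrow> B i k = of_bool (i = k)) \<and>
        (\<forall>i\<in>F-{f}. (\<Sum>l\<in>J. B i l * A l m) = 0) \<and> (\<Sum>l\<in>J. B f l * A l m) = sqrt (\<Sum>l\<in>F. (A l m)\<^sup>2)"
        using householder[OF J FJ f, of "\<lambda>l. A l m"] by blast
      then show ?thesis by (intro that[of B]) auto
    qed
    have pB: "preserves J (lin J B)" by (rule insert.IH[OF FJ B(1)]) (use B(3) in auto)
    have BB: "lin J B (lin J B x) = x" if "x \<in> extensional J" for x
      unfolding lin_kmul[symmetric]
    proof (rule lin_id[OF J _ that])
      fix i k assume "i \<in> J" "k \<in> J"
      then have "(\<Sum>l\<in>J. B l i * B l k) = of_bool (i = k)" using B(1) by (auto simp: orthk_def)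
      then show "kmul J B B i k = of_bool (i = k)" unfolding kmul_def by (simp add: B(2)[of i])
    qed
    define A1 where "A1 = kmul J B A"
    have A1: "orthk J A1" unfolding A1_def by (rule orthk_kmul[OF B(1) insert.prems(2) J])
    have Brow: "(\<Sum>l\<in>J. B i l * g l) = g i" if "i \<in> J - F" for i g
    proof -
      have "(\<Sum>l\<in>J. B i l * g l) = (\<Sum>l\<in>J. if l = i then g l else 0)"
        using B(2)[of i] B(3)[of i] that by (intro sum.cong) auto
      then show ?thesis using that J by simp
    qed
    have A1m: "A1 i m = 0" if "i \<in> J - {f, m}" for i
      using B(4)[of i] Brow[of i "\<lambda>l. A l m"] q0[of i] that by (cases "i \<in> F") (auto simp: A1_def kmul_def)
    have A1fix: "A1 i k = of_bool (i = k)" if "i \<in> J" "k \<in> J - insert m F" for i k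
    proof -
      have "A1 i k = (\<Sum>l\<in>J. if l = k then B i l else 0)"
        unfolding A1_def kmul_def using insert.prems(3) that by (intro sum.cong) auto
      then show ?thesis using that J B(3)[of k i] by simp
    qed
    define s where "s = A1 f m"
    define c where "c = A1 m m"
    have "(\<Sum>l\<in>J. (A1 l m)\<^sup>2) = 1" using A1 m by (simp add: orthk_def power2_eq_square)
    moreover have "(\<Sum>l\<in>J. (A1 l m)\<^sup>2) = (\<Sum>l\<in>{f, m}. (A1 l m)\<^sup>2)"
      using J m fm A1m by (intro sum.mono_neutral_right) auto
    ultimately have cs: "c\<^sup>2 + s\<^sup>2 = 1" using fm by (simp add: c_def s_def)
    have pA1: "preserves J (lin J A1)"
    proof (cases "s = 0")
      \<comment> \<open>Here the rotation degenerates to a sign on coordinate m, outside the scope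
        of the three shears.\<close>
      case s0: True
      then have c1: "c = 1 \<or> c = -1" using cs by (simp add: power2_eq_1_iff)
      define R where "R = (\<lambda>i k. if i = m \<and> k = m then c else of_bool (i = k))"
      define A2 where "A2 = kmul J R A1"
      have cc: "c * c = 1" using c1 by auto
      have Rm: "(\<Sum>l\<in>J. R i l * g l) = (if i = m then c * g m else g i)" if "i \<in> J" for i g
      proof -
        have "(\<Sum>l\<in>J. R i l * g l) = (\<Sum>l\<in>J. if l = i then (if i = m then c * g m else g i) else 0)"
          by (intro sum.cong refl) (auto simp: R_def)
        then show ?thesis using that J by simp
      qed
      have RR0: "kmul J R R i k = of_bool (i = k)" if "i \<in> J" "k \<in> J" for i k
        unfolding kmul_def Rm[OF that(1)] using cc by (auto simp: R_def)
      have R: "orthk J R" unfolding orthk_def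
      proof (intro ballI)
        fix i k assume ik: "i \<in> J" "k \<in> J"
        have "R l i = R i l" for l by (auto simp: R_def)
        then have "(\<Sum>l\<in>J. R l i * R l k) = (if i = m then c * R m k else R i k)" using Rm[OF ik(1), of "\<lambda>l. R l k"] by simp
        then show "(\<Sum>l\<in>J. R l i * R l k) = of_bool (i = k)" using cc by (auto simp: R_def)
      qed
      have "preserves J (lin J A2)"
      proof (rule insert.IH[OF FJ])
        show "orthk J A2" unfolding A2_def by (rule orthk_kmul[OF R A1 J])
        fix i k assume ik: "i \<in> J" "k \<in> J - F"
        show "A2 i k = of_bool (i = k)"
          unfolding A2_def kmul_def Rm[OF ik(1)]
          using A1fix[of i k] A1fix[of m k] A1m[of i] ik m cc s0
          by (cases "k = m"; cases "i = m"; cases "i = f") (auto simp: c_def s_def)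
      qed
      moreover have "preserves J (lin J R)"
      proof (cases "c = 1")
        case True
        then show ?thesis using J by (intro preserves_cong[OF preserves_id]) (auto simp: lin_id R_def)
      next
        case False
        then have c: "c = -1" using c1 by simp
        show ?thesis
        proof (rule preserves_cong[OF preserves_reflect[OF J m]])
          fix x :: "'a \<Rightarrow> real" assume "x \<in> extensional J"
          then show "x(m := - x m) = lin J R x"
            unfolding lin_def using Rm[of _ x] c by (auto simp: fun_eq_iff extensional_def restrict_def m)
        qed
      qed
      ultimately have "preserves J (\<lambda>x. lin J R (lin J A2 x))" by (rule preserves_comp[rotated])
      moreover have "lin J R (lin J A2 x) = lin J A1 x" if "x \<in> extensional J" for x
      proof -
        have "lin J R (lin J R y) = y" if "y \<in> extensional J" for y
          unfolding lin_kmul[symmetric]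
          by (rule lin_id[OF J RR0 that])
        then show ?thesis unfolding A2_def lin_kmul using lin_extensional by blast
      qed
      ultimately show ?thesis by (rule preserves_cong)
    next
      case s0: False
      define R where "R = (\<lambda>t i k. if i = f then (if k = f then c else if k = m then - t else 0)
        else if i = m then (if k = f then t else if k = m then c else 0) else of_bool (i = k))"
      define A2 where "A2 = kmul J (R s) A1"
      have Rm: "(\<Sum>l\<in>J. R t i l * g l) = (if i = f then c * g f - t * g m else if i = m then t * g f + c * g m else g i)"
        if "i \<in> J" for i g t
      proof -
        have "(\<Sum>l\<in>J. R t i l * g l) = (\<Sum>l\<in>J. (if l = f then (if i = f then c * g f else if i = m then t * g f else 0) else 0)
          + (if l = m then (if i = f then - t * g m else if i = m then c * g m else 0) else 0)
          + (if l = i then (if i = f \<or> i = m then 0 else g i) else 0))"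
          using fm by (intro sum.cong refl) (auto simp: R_def)
        then show ?thesis using that J m fm unfolding sum.distrib by (auto simp: sum.delta)
      qed
      have Rt: "R t l i = R (- t) i l" for t l i using fm by (auto simp: R_def)
      have cs': "c * c + s * s = 1" using cs by (simp add: power2_eq_square)
      have RR: "kmul J (R (-s)) (R s) i k = of_bool (i = k)" if ik: "i \<in> J" "k \<in> J" for i k
        unfolding kmul_def Rm[OF ik(1)] using cs' fm by (auto simp: R_def algebra_simps)
      have R: "orthk J (R s)" unfolding orthk_def
        using RR by (auto simp: kmul_def Rt[of s])
      have lR: "lin J (R t) x = x(f := c * x f - t * x m, m := t * x f + c * x m)" if "x \<in> extensional J" for x t
        unfolding lin_def using Rm[of _ t x] that m fm
        by (auto simp: fun_eq_iff extensional_def restrict_def)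
      have "preserves J (lin J A2)"
      proof (rule insert.IH[OF FJ])
        show "orthk J A2" unfolding A2_def by (rule orthk_kmul[OF R A1 J])
        fix i k assume ik: "i \<in> J" "k \<in> J - F"
        have "c * s - s * c = 0" by simp
        then show "A2 i k = of_bool (i = k)"
          unfolding A2_def kmul_def Rm[OF ik(1)]
          using A1fix[of i k] A1fix[of m k] A1fix[of f k] A1m[of i] ik m fm cs' f
          by (cases "k = m"; cases "i = m"; cases "i = f") (auto simp: c_def s_def algebra_simps)
      qed
      moreover have "preserves J (lin J (R (- s)))"
        by (rule preserves_cong[OF preserves_rotation[OF J m fm(2), of c "- s"]])
          (use fm cs s0 lR in \<open>auto\<close>)
      ultimately have "preserves J (\<lambda>x. lin J (R (- s)) (lin J A2 x))" by (rule preserves_comp[rotated])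
      moreover have "lin J (R (- s)) (lin J A2 x) = lin J A1 x" if "x \<in> extensional J" for x
      proof -
        have "lin J (R (- s)) (lin J (R s) y) = y" if "y \<in> extensional J" for y
          unfolding lin_kmul[symmetric] by (rule lin_id[OF J RR that])
        then show ?thesis unfolding A2_def lin_kmul using lin_extensional by blast
      qed
      ultimately show ?thesis by (rule preserves_cong)
    qed
    have "preserves J (\<lambda>x. lin J B (lin J A1 x))" by (rule preserves_comp[OF pB pA1])
    moreover have "lin J B (lin J A1 x) = lin J A x" for x
      unfolding A1_def lin_kmul using BB[OF lin_extensional] .
    ultimately show ?thesis by (simp add: preserves_cong)
  qed
qed

theorem preserves_lin:
  assumes "finite J" "orthk J A"
  shows "preserves J (lin J A)"
  by (rule preserves_lin_aux[OF assms(1,1) subset_refl assms(2)]) simp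

subsection \<open>Moments\<close>

lemma palg_borel:
  assumes "palg S f" and "\<And>s. s \<in> S \<Longrightarrow> s \<in> borel_measurable M"
  shows "f \<in> borel_measurable M"
  using assms(1) by induction (auto intro: assms(2))

lemma preserves_distr:
  assumes "preserves J T"
  shows "distr (gauss J) (gauss J) T = gauss J"
proof (rule measure_eqI)
  have T: "T \<in> measurable (gauss J) (gauss J)"
    and eq: "\<And>f. f \<in> borel_measurable (gauss J) \<Longrightarrow> (\<integral>\<^sup>+x. f (T x) \<partial>gauss J) = (\<integral>\<^sup>+x. f x \<partial>gauss J)"
    using assms by (auto simp: preserves_def)
  fix B assume "B \<in> sets (distr (gauss J) (gauss J) T)"
  then have B: "B \<in> sets (gauss J)" by simp
  have "emeasure (distr (gauss J) (gauss J) T) B = (\<integral>\<^sup>+x. indicator B x \<partial>distr (gauss J) (gauss J) T)"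
    using B by simp
  also have "\<dots> = (\<integral>\<^sup>+x. indicator B (T x) \<partial>gauss J)" using T B by (intro nn_integral_distr) auto
  also have "\<dots> = emeasure (gauss J) B" using eq[of "indicator B"] B by simp
  finally show "emeasure (distr (gauss J) (gauss J) T) B = emeasure (gauss J) B" .
qed simp

lemma preserves_integral:
  fixes g :: "('j \<Rightarrow> real) \<Rightarrow> real"
  assumes T: "preserves J T" and g: "g \<in> borel_measurable (gauss J)"
  shows "(\<integral>x. g (T x) \<partial>gauss J) = (\<integral>x. g x \<partial>gauss J)"
    and "integrable (gauss J) (\<lambda>x. g (T x)) \<longleftrightarrow> integrable (gauss J) g"
proof -
  have m: "T \<in> measurable (gauss J) (gauss J)" using T by (simp add: preserves_def)
  show "(\<integral>x. g (T x) \<partial>gauss J) = (\<integral>x. g x \<partial>gauss J)"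
    using integral_distr[OF m g] preserves_distr[OF T] by simp
  show "integrable (gauss J) (\<lambda>x. g (T x)) \<longleftrightarrow> integrable (gauss J) g"
    using integrable_distr_eq[OF m g] preserves_distr[OF T] by simp
qed

lemma nrm_moment: "has_bochner_integral nrm (\<lambda>x. x ^ (2 * k)) (dfact k)"
  unfolding nrm_def dfact_def
  by (rule has_bochner_integral_density)
    (use std_normal_moment_even[of k] in \<open>auto simp: normal_density_nonneg\<close>)

lemma gauss_coord_moment:
  assumes "i \<in> J"
  shows "has_bochner_integral (gauss J) (\<lambda>x. x i ^ (2 * k)) (dfact k)"
proof -
  have d: "distr (gauss J) nrm (\<lambda>x. x i) = nrm"
    unfolding gauss_def by (rule distr_PiM_component) (use assms nrm.prob_space_axioms in auto)
  have m: "(\<lambda>x. x i) \<in> measurable (gauss J) nrm"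
    using gauss_component[OF assms] by (simp add: measurable_nrm)
  have "has_bochner_integral (distr (gauss J) nrm (\<lambda>x. x i)) (\<lambda>x. x ^ (2 * k)) (dfact k)"
    unfolding d by (rule nrm_moment)
  then show ?thesis
    using integrable_distr_eq[OF m, of "\<lambda>x. x ^ (2 * k)"] integral_distr[OF m, of "\<lambda>x. x ^ (2 * k)"]
    by (simp add: has_bochner_integral_iff)
qed

text \<open>A reflection moves y to a multiple of a coordinate vector; by rotation invariance the
  linear form is distributed like |y| times a single coordinate.\<close>

lemma gauss_dotp_moment:
  assumes J: "finite J"
  shows "has_bochner_integral (gauss J) (\<lambda>x. dotp J y x ^ (2 * k)) (dfact k * dotp J y y ^ k)"
proof (cases "J = {}")
  case True
  interpret prob_space "gauss J" by (rule prob_space_gauss)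
  have "has_bochner_integral (gauss J) (\<lambda>x. 0 ^ (2 * k)) (0 ^ (2 * k) :: real)"
    by (simp add: has_bochner_integral_iff prob_space)
  then show ?thesis using True by (cases k) (auto simp: dotp_def dfact_def)
next
  case False
  then obtain f where f: "f \<in> J" by blast
  obtain A where A: "orthk J A \<and> (\<forall>i k. A i k = A k i) \<and> (\<forall>i k. k \<notin> J \<longrightarrow> A i k = of_bool (i = k)) \<and>
    (\<forall>i\<in>J-{f}. (\<Sum>l\<in>J. A i l * y l) = 0) \<and> (\<Sum>l\<in>J. A f l * y l) = sqrt (\<Sum>l\<in>J. (y l)\<^sup>2)"
    using householder[OF J subset_refl f, of y] by blast
  define \<rho> where "\<rho> = sqrt (\<Sum>l\<in>J. (y l)\<^sup>2)"
  have rho: "\<rho>\<^sup>2 = dotp J y y" by (simp add: \<rho>_def dotp_def power2_eq_square sum_nonneg)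
  have eq: "dotp J y x = \<rho> * lin J A x f" for x
  proof -
    have "dotp J y x = dotp J (lin J A y) (lin J A x)" using A J by (simp add: dotp_lin)
    also have "\<dots> = (\<Sum>i\<in>J. if i = f then \<rho> * lin J A x f else 0)"
      unfolding dotp_def using A by (intro sum.cong refl) (auto simp: lin_def \<rho>_def)
    finally show ?thesis using f J by simp
  qed
  have pr: "preserves J (lin J A)" using preserves_lin[OF J] A by blast
  have hb: "has_bochner_integral (gauss J) (\<lambda>z. (\<rho> * z f) ^ (2 * k)) (dfact k * dotp J y y ^ k)"
    using has_bochner_integral_mult_right[OF gauss_coord_moment[OF f, of k], of "\<rho> ^ (2 * k)"]
    by (simp add: power_mult_distrib rho[symmetric] power_mult[symmetric] mult.commute)
  have m: "(\<lambda>z. (\<rho> * z f) ^ (2 * k)) \<in> borel_measurable (gauss J)"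
    using hb by (auto intro: has_bochner_integral_integrable)
  show ?thesis
    using hb preserves_integral[OF pr m] unfolding has_bochner_integral_iff eq by simp
qed

lemma dfact_pochhammer: "dfact k = 2 ^ k * pochhammer (1 / 2) k"
proof -
  have "fact (2 * k) = 2 ^ (2 * k) * pochhammer (1 / 2) k * (fact k :: real)" by (rule fact_double)
  then show ?thesis by (simp add: dfact_def power_mult power2_eq_square mult_2 power_add)
qed

lemma dfact_pos: "dfact k > 0"
  by (simp add: dfact_def)

lemma pochhammer_nonneg': "(x::real) \<ge> 0 \<Longrightarrow> pochhammer x n \<ge> 0"
  by (simp add: pochhammer_prod prod_nonneg)

text \<open>Adding one coordinate expands the power by the binomial theorem; the Vandermonde
  convolution of rising factorials then raises the parameter by 1/2.\<close>

lemma gauss_chi_square: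
  assumes "finite F" "F \<subseteq> J" "finite J"
  shows "(\<integral>\<^sup>+x. ennreal ((\<Sum>j\<in>F. (x j)\<^sup>2) ^ m) \<partial>gauss J) = ennreal (2 ^ m * pochhammer (real (card F) / 2) m)"
  using assms
proof (induction F arbitrary: J m rule: finite_induct)
  case empty
  interpret prob_space "gauss J" by (rule prob_space_gauss)
  show ?case by (cases m) (auto simp: emeasure_space_1 pochhammer_0_left)
next
  case (insert i F)
  define K where "K = J - {i}"
  have JK: "J = insert i K" and K: "finite K" "i \<notin> K" "F \<subseteq> K" using insert by (auto simp: K_def)
  have comp: "(\<lambda>x. x k) \<in> borel_measurable (gauss J)" if "k \<in> J" for k J
    using that by (rule gauss_component)
  let ?S = "\<lambda>x::'a \<Rightarrow> real. \<Sum>j\<in>F. (x j)\<^sup>2"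
  have mS: "(\<lambda>x. ennreal ((\<Sum>j\<in>F'. (x j)\<^sup>2) ^ m)) \<in> borel_measurable (gauss J')" if "F' \<subseteq> J'" for F' J' m
    by (intro measurable_compose[OF _ measurable_ennreal] borel_measurable_power borel_measurable_sum comp) (use that in auto)
  have hb: "has_bochner_integral nrm (\<lambda>y. (s + y\<^sup>2) ^ m) (\<Sum>k\<le>m. real (m choose k) * s ^ k * dfact (m - k))" for s
  proof -
    have "(s + y\<^sup>2) ^ m = (\<Sum>k\<le>m. real (m choose k) * s ^ k * y ^ (2 * (m - k)))" for y
      by (simp add: binomial_ring power_mult)
    then show ?thesis
      by (simp only:) (intro has_bochner_integral_sum has_bochner_integral_mult_right nrm_moment)
  qed
  have "(\<integral>\<^sup>+x. ennreal ((\<Sum>j\<in>insert i F. (x j)\<^sup>2) ^ m) \<partial>gauss J) =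
      (\<integral>\<^sup>+x. \<integral>\<^sup>+y. ennreal ((\<Sum>j\<in>insert i F. ((x(i := y)) j)\<^sup>2) ^ m) \<partial>nrm \<partial>gauss K)"
    using mS[OF insert.prems(1)] K unfolding JK gauss_def by (intro nrm_prod.product_nn_integral_insert) auto
  also have "\<dots> = (\<integral>\<^sup>+x. \<integral>\<^sup>+y. ennreal ((?S x + y\<^sup>2) ^ m) \<partial>nrm \<partial>gauss K)"
  proof (intro nn_integral_cong arg_cong[where f = ennreal] arg_cong[where f = "\<lambda>z. z ^ m"])
    fix x :: "'a \<Rightarrow> real" and y
    have "(\<Sum>j\<in>F. ((x(i := y)) j)\<^sup>2) = ?S x" using insert.hyps by (intro sum.cong) auto
    then show "(\<Sum>j\<in>insert i F. ((x(i := y)) j)\<^sup>2) = ?S x + y\<^sup>2" using insert.hyps by simp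
  qed
  also have "\<dots> = (\<integral>\<^sup>+x. (\<Sum>k\<le>m. ennreal (real (m choose k) * dfact (m - k)) * ennreal (?S x ^ k)) \<partial>gauss K)"
  proof (rule nn_integral_cong)
    fix x :: "'a \<Rightarrow> real"
    have S: "?S x \<ge> 0" by (rule sum_nonneg) simp
    have "(\<integral>\<^sup>+y. ennreal ((?S x + y\<^sup>2) ^ m) \<partial>nrm) = ennreal (\<Sum>k\<le>m. real (m choose k) * ?S x ^ k * dfact (m - k))"
      using hb[of "?S x"] S unfolding has_bochner_integral_iff
      by (subst nn_integral_eq_integral) auto
    also have "\<dots> = (\<Sum>k\<le>m. ennreal (real (m choose k) * ?S x ^ k * dfact (m - k)))"
      using S by (subst sum_ennreal) (auto intro!: mult_nonneg_nonneg less_imp_le[OF dfact_pos])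
    also have "\<dots> = (\<Sum>k\<le>m. ennreal (real (m choose k) * dfact (m - k)) * ennreal (?S x ^ k))"
      using S by (intro sum.cong refl) (simp add: ennreal_mult''[symmetric] mult_ac)
    finally show "(\<integral>\<^sup>+y. ennreal ((?S x + y\<^sup>2) ^ m) \<partial>nrm) =
        (\<Sum>k\<le>m. ennreal (real (m choose k) * dfact (m - k)) * ennreal (?S x ^ k))" .
  qed
  also have "\<dots> = (\<Sum>k\<le>m. ennreal (real (m choose k) * dfact (m - k)) * (\<integral>\<^sup>+x. ennreal (?S x ^ k) \<partial>gauss K))"
    using mS[OF K(3)] by (simp add: nn_integral_sum nn_integral_cmult)
  also have "\<dots> = (\<Sum>k\<le>m. ennreal (real (m choose k) * dfact (m - k) * (2 ^ k * pochhammer (real (card F) / 2) k)))"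
    unfolding insert.IH[OF K(3,1)]
    by (intro sum.cong refl ennreal_mult'[symmetric] mult_nonneg_nonneg less_imp_le[OF dfact_pos]) simp
  also have "\<dots> = ennreal (\<Sum>k\<le>m. real (m choose k) * dfact (m - k) * (2 ^ k * pochhammer (real (card F) / 2) k))"
    by (intro sum_ennreal mult_nonneg_nonneg less_imp_le[OF dfact_pos] pochhammer_nonneg') auto
  also have "(\<Sum>k\<le>m. real (m choose k) * dfact (m - k) * (2 ^ k * pochhammer (real (card F) / 2) k)) =
     (\<Sum>k\<le>m. 2 ^ m * (real (m choose k) * pochhammer (real (card F) / 2) k * pochhammer (1 / 2) (m - k)))"
  proof (intro sum.cong refl)
    fix k assume "k \<in> {..m}"
    then have "(2::real) ^ m = 2 ^ k * 2 ^ (m - k)" by (simp add: power_add[symmetric])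
    then show "real (m choose k) * dfact (m - k) * (2 ^ k * pochhammer (real (card F) / 2) k) =
       2 ^ m * (real (m choose k) * pochhammer (real (card F) / 2) k * pochhammer (1 / 2) (m - k))"
      by (simp add: dfact_pochhammer)
  qed
  also have "\<dots> = 2 ^ m * pochhammer (real (card F) / 2 + 1 / 2) m"
    unfolding pochhammer_binomial_sum sum_distrib_left ..
  also have "real (card F) / 2 + 1 / 2 = real (card (insert i F)) / 2"
    using insert.hyps by (simp add: field_simps)
  finally show ?case .
qed

subsection \<open>Orthogonal matrices\<close>

lemma orthogonal_groupD:
  assumes "K \<in> orthogonal_group n"
  shows "K \<in> carrier_mat n n" "transpose_mat K * K = 1\<^sub>m n" "K * transpose_mat K = 1\<^sub>m n"
  using assms mat_mult_left_right_inverse[of "transpose_mat K" n K] by (auto simp: orthogonal_group_def)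

lemma orthogonal_group_transpose: "K \<in> orthogonal_group n \<Longrightarrow> transpose_mat K \<in> orthogonal_group n"
  unfolding orthogonal_group_def[of n]
  by (rule CollectI, frule orthogonal_groupD(1)[unfolded orthogonal_group_def], frule orthogonal_groupD(3)[unfolded orthogonal_group_def]) simp

lemma orthogonal_group_mult:
  assumes "K \<in> orthogonal_group n" "L \<in> orthogonal_group n"
  shows "K * L \<in> orthogonal_group n"
proof -
  note K = orthogonal_groupD[OF assms(1)] and L = orthogonal_groupD[OF assms(2)]
  have "transpose_mat (K * L) * (K * L) = transpose_mat L * (transpose_mat K * K) * L"
    using K(1) L(1) by (simp add: transpose_mult[of _ n n _ n] assoc_mult_mat[of _ n n _ n _ n])
  then show ?thesis using K L by (simp add: orthogonal_group_def)
qed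

lemma orthogonal_group_one: "1\<^sub>m n \<in> orthogonal_group n"
  by (simp add: orthogonal_group_def)

lemma orthogonal_cols:
  assumes "K \<in> orthogonal_group n" "i < n" "k < n"
  shows "(\<Sum>l<n. K $$ (l, i) * K $$ (l, k)) = of_bool (i = k)"
proof -
  note K = orthogonal_groupD[OF assms(1)]
  have "(transpose_mat K * K) $$ (i, k) = (\<Sum>l<n. transpose_mat K $$ (i, l) * K $$ (l, k))"
    using K(1) assms by (intro index_mult_sum) auto
  also have "\<dots> = (\<Sum>l<n. K $$ (l, i) * K $$ (l, k))" using K(1) assms by (intro sum.cong) auto
  finally have "1\<^sub>m n $$ (i, k) = (\<Sum>l<n. K $$ (l, i) * K $$ (l, k))" unfolding K(2) .
  then show ?thesis using assms(2,3) by (cases "i = k") auto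
qed

lemma orthogonal_rows:
  assumes "K \<in> orthogonal_group n" "i < n" "k < n"
  shows "(\<Sum>l<n. K $$ (i, l) * K $$ (k, l)) = of_bool (i = k)"
  using orthogonal_cols[OF orthogonal_group_transpose[OF assms(1)] assms(2,3)]
    orthogonal_groupD(1)[OF assms(1)] assms(2,3) by simp

lemma orthogonal_groupI:
  assumes "K \<in> carrier_mat n n"
    "\<And>i k. i < n \<Longrightarrow> k < n \<Longrightarrow> (\<Sum>l<n. K $$ (l, i) * K $$ (l, k)) = of_bool (i = k)"
  shows "K \<in> orthogonal_group n"
proof -
  have "transpose_mat K * K = 1\<^sub>m n"
  proof (rule eq_matI)
    fix i k assume "i < dim_row (1\<^sub>m n :: real mat)" "k < dim_col (1\<^sub>m n :: real mat)"
    then have ik: "i < n" "k < n" by auto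
    have "(transpose_mat K * K) $$ (i, k) = (\<Sum>l<n. transpose_mat K $$ (i, l) * K $$ (l, k))"
      using assms(1) ik by (intro index_mult_sum) auto
    also have "\<dots> = (\<Sum>l<n. K $$ (l, i) * K $$ (l, k))" using assms(1) ik by (intro sum.cong) auto
    finally show "(transpose_mat K * K) $$ (i, k) = 1\<^sub>m n $$ (i, k)" using assms(2)[OF ik] ik by simp
  qed (use assms in auto)
  then show ?thesis using assms(1) by (simp add: orthogonal_group_def)
qed

text \<open>The reflection that clears row m acts on the columns from m on only, where the earlier
  rows already vanish.\<close>

lemma LQ_rows:
  assumes G: "G \<in> carrier_mat n n" and "m \<le> n"
  shows "\<exists>K\<in>orthogonal_group n. \<forall>i<m. \<forall>j<n. i < j \<longrightarrow> (G * K) $$ (i, j) = 0"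
  using assms(2)
proof (induction m)
  case 0
  then show ?case using orthogonal_group_one by blast
next
  case (Suc m)
  then obtain K where K: "K \<in> orthogonal_group n" and
    z: "\<And>i j. i < m \<Longrightarrow> j < n \<Longrightarrow> i < j \<Longrightarrow> (G * K) $$ (i, j) = 0" by auto
  note Kc = orthogonal_groupD(1)[OF K]
  obtain A where A: "orthk {..<n} A" "\<And>i k. A i k = A k i" "\<And>i k. k \<notin> {m..<n} \<Longrightarrow> A i k = of_bool (i = k)"
    "\<And>i. i \<in> {m..<n} - {m} \<Longrightarrow> (\<Sum>l<n. A i l * (G * K) $$ (m, l)) = 0"
  proof -
    have "finite {..<n}" "{m..<n} \<subseteq> {..<n}" "m \<in> {m..<n}" using Suc.prems by auto
    from householder[OF this, of "\<lambda>l. (G * K) $$ (m, l)"] show ?thesis using that by blast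
  qed
  define B where "B = Matrix.mat n n (\<lambda>(i, k). A i k)"
  have B: "B \<in> orthogonal_group n"
    using A(1) by (intro orthogonal_groupI) (auto simp: B_def orthk_def)
  note Bc = orthogonal_groupD(1)[OF B]
  have GKB: "(G * (K * B)) $$ (i, j) = (\<Sum>l<n. (G * K) $$ (i, l) * A l j)" if "i < n" "j < n" for i j
  proof -
    have "G * (K * B) = (G * K) * B" using G Kc Bc by (simp add: assoc_mult_mat[of _ n n _ n _ n])
    moreover have "((G * K) * B) $$ (i, j) = (\<Sum>l<n. (G * K) $$ (i, l) * B $$ (l, j))"
      using G Kc Bc that by (intro index_mult_sum) auto
    ultimately show ?thesis using that by (simp add: B_def)
  qed
  have "(G * (K * B)) $$ (i, j) = 0" if ij: "i < Suc m" "j < n" "i < j" for i j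
  proof (cases "i = m")
    case True
    then have "(G * (K * B)) $$ (i, j) = (\<Sum>l<n. A j l * (G * K) $$ (m, l))"
      using ij GKB[of i j] A(2) by (simp add: mult.commute)
    then show ?thesis using A(4)[of j] ij True by simp
  next
    case False
    then have im: "i < m" using ij by simp
    have "(G * (K * B)) $$ (i, j) = (\<Sum>l<n. (G * K) $$ (i, l) * A l j)" using GKB ij by auto
    also have "\<dots> = 0"
    proof (rule sum.neutral, rule ballI)
      fix l assume l: "l \<in> {..<n}"
      show "(G * K) $$ (i, l) * A l j = 0"
      proof (cases "i < l")
        case True
        then show ?thesis using z[OF im, of l] l by simp
      next
        case False
        then have "A j l = 0" using A(3)[of l j] im ij by auto
        then show ?thesis using A(2) by simp
      qed
    qed
    finally show ?thesis .
  qed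
  then show ?case using orthogonal_group_mult[OF K B] by blast
qed

lemma LQ_decomposition:
  assumes "G \<in> carrier_mat n n"
  shows "\<exists>K\<in>orthogonal_group n. lower_tri n (G * K)"
  using LQ_rows[OF assms le_refl] assms orthogonal_groupD(1)[of _ n]
  by (auto simp: lower_tri_def)

section \<open>Gram matrices and Wishart moments\<close>

lemma lower_tri_transpose: "lower_tri n L \<Longrightarrow> upper_tri n (transpose_mat L)"
  by (auto simp: lower_tri_def upper_tri_def)

lemma Del_gram_lower:
  assumes L: "lower_tri n L"
  shows "Del n l (($$) (L * transpose_mat L)) = (Del n l (($$) L))\<^sup>2"
proof -
  have Lc: "L \<in> carrier_mat n n" using L by (simp add: lower_tri_def)
  have "Del n l (($$) (L * transpose_mat L)) = Del n l (($$) L) * Del n l (($$) (transpose_mat L))"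
    using L Lc by (intro Del_mult_lower) auto
  then show ?thesis by (simp add: Del_transpose[OF Lc] power2_eq_square)
qed

lemma gram_orthogonal:
  assumes "G \<in> carrier_mat n n" "K \<in> orthogonal_group n"
  shows "(G * K) * transpose_mat (G * K) = G * transpose_mat G"
proof -
  note K = orthogonal_groupD[OF assms(2)]
  have "(G * K) * transpose_mat (G * K) = G * (K * transpose_mat K) * transpose_mat G"
    using K(1) assms(1) by (simp add: transpose_mult[of _ n n _ n] assoc_mult_mat[of _ n n _ n _ n])
  then show ?thesis using K assms(1) by simp
qed

definition gram :: "nat \<Rightarrow> (nat \<times> nat \<Rightarrow> real) \<Rightarrow> nat \<times> nat \<Rightarrow> real" where
  "gram n x = (\<lambda>(i, k). \<Sum>j<n. x (i, j) * x (k, j))"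

lemma gram_mat:
  assumes "i < n" "k < n"
  shows "(Matrix.mat n n x * transpose_mat (Matrix.mat n n x)) $$ (i, k) = gram n x (i, k)"
  using assms by (subst index_mult_sum[of _ n n _ n]) (auto simp: gram_def)

lemma Del_gram: "Del n l (($$) (Matrix.mat n n x * transpose_mat (Matrix.mat n n x))) = Del n l (gram n x)"
  by (rule Del_cong) (simp add: gram_mat del: index_mult_mat)

text \<open>By the LQ decomposition a Gram matrix is L L' with L lower triangular, so the value is a
  square.\<close>

lemma Del_gram_nonneg: "Del n l (gram n x) \<ge> 0"
proof -
  obtain K where K: "K \<in> orthogonal_group n" "lower_tri n (Matrix.mat n n x * K)"
    using LQ_decomposition[of "Matrix.mat n n x" n] by auto
  show ?thesis
    using Del_gram_lower[OF K(2), of l] gram_orthogonal[OF _ K(1), of "Matrix.mat n n x"]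
    by (simp add: Del_gram)
qed

lemma Del_trunc:
  assumes "\<And>i. i \<ge> q \<Longrightarrow> l i = 0" "q \<le> n"
  shows "Del n l f = Del q l f"
  unfolding Del_def using assms by (intro prod.mono_neutral_right) auto

lemma Del_measurable:
  assumes "\<And>i j. i < n \<Longrightarrow> j < n \<Longrightarrow> (\<lambda>x. F x (i, j)) \<in> borel_measurable M"
  shows "(\<lambda>x. Del n l (F x)) \<in> borel_measurable M"
proof -
  have "palg {f. f \<in> borel_measurable M} (\<lambda>x. Del n l (F x))"
    by (intro palg_Del palg_base) (use assms in auto)
  then show ?thesis by (rule palg_borel) auto
qed

text \<open>Factor i is the moment of order l i of a chi-square variable with n - i degrees of
  freedom, the squared diagonal entry of the Bartlett factor of a Wishart matrix.\<close>

definition wishart_const :: "nat \<Rightarrow> (nat \<Rightarrow> nat) \<Rightarrow> real" where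
  "wishart_const n l = (\<Prod>i<n. 2 ^ l i * pochhammer (real (n - i) / 2) (l i))"

text \<open>One row is integrated at a time: in
  coordinates adapted to the previous rows it contributes a power of a chi-square variable.\<close>

lemma gauss_wishart:
  assumes l: "antimono l" "l n = 0"
  shows "(\<integral>\<^sup>+x. ennreal (Del n l (gram n x)) \<partial>gauss (sq n)) = ennreal (wishart_const n l)"
proof -
  \<comment> \<open>Keeping only the first q parts makes the integrand depend on the first q rows
    only; at q = n nothing is cut off because \<open>l n = 0\<close>.\<close>
  define t where "t q i = (if i < q then l i else 0)" for q i :: nat
  have t: "antimono (t q)" for q
    using l(1) by (auto simp: t_def antimono_def)
  define W where "W q x = Del n (t q) (gram n x)" for q x
  have meas: "(\<lambda>x. ennreal (W q x)) \<in> borel_measurable (gauss (sq n))" for q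
    unfolding W_def gram_def
    by (intro measurable_compose[OF _ measurable_ennreal] Del_measurable, unfold prod.case)
      (intro borel_measurable_sum borel_measurable_times gauss_component, auto simp: sq_def)
  have "(\<integral>\<^sup>+x. ennreal (W q x) \<partial>gauss (sq n)) = ennreal (\<Prod>i<q. 2 ^ l i * pochhammer (real (n - i) / 2) (l i))"
    if "q \<le> n" for q
    using that
  proof (induction q)
    case 0
    interpret prob_space "gauss (sq n)" by (rule prob_space_gauss)
    have "W 0 x = 1" for x by (simp add: W_def t_def Del_def)
    then show ?case by (simp add: emeasure_space_1)
  next
    case (Suc q)
    define R where "R = {q} \<times> {..<n}"
    define I where "I = sq n - R"
    have IR: "sq n = I \<union> R" "I \<inter> R = {}" "finite I" "finite R" using Suc.prems by (auto simp: I_def R_def sq_def)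
    have fold: "(\<integral>\<^sup>+x. f x \<partial>gauss (sq n)) = (\<integral>\<^sup>+y. \<integral>\<^sup>+g. f (merge I R (y, g)) \<partial>gauss R \<partial>gauss I)"
      if "f \<in> borel_measurable (gauss (sq n))" for f
      using that IR unfolding gauss_def IR(1) by (intro nrm_prod.product_nn_integral_fold) auto
    define c where "c = 2 ^ l q * pochhammer (real (n - q) / 2) (l q)"
    have key: "\<exists>w\<ge>0. (\<forall>g. W q (merge I R (y, g)) = w) \<and>
      (\<integral>\<^sup>+g. ennreal (W (Suc q) (merge I R (y, g))) \<partial>gauss R) = ennreal w * ennreal c" for y
    proof -
      define X where "X g = Matrix.mat n n (merge I R (y, g))" for g :: "nat \<times> nat \<Rightarrow> real"
      have Xc: "X g \<in> carrier_mat n n" for g by (simp add: X_def)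
      \<comment> \<open>K is adapted to the first q rows. Computing it with row q set to 0 makes it
        independent of the Gaussian row g about to be integrated.\<close>
      obtain K where K: "K \<in> orthogonal_group n"
        and z0: "\<And>i j. i < q \<Longrightarrow> j < n \<Longrightarrow> i < j \<Longrightarrow> (X (\<lambda>_. 0) * K) $$ (i, j) = 0"
        using LQ_rows[OF Xc, of q "\<lambda>_. 0"] Suc.prems by auto
      note Kc = orthogonal_groupD(1)[OF K]
      have XK: "(X g * K) $$ (i, j) = (\<Sum>k<n. merge I R (y, g) (i, k) * K $$ (k, j))" if "i < n" "j < n" for g i j
        using that Xc Kc by (subst index_mult_sum[of _ n n _ n]) (auto simp: X_def)
      have row: "(X g * K) $$ (i, j) = (X (\<lambda>_. 0) * K) $$ (i, j)" if "i < n" "i \<noteq> q" "j < n" for g i j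
        unfolding XK[OF that(1,3)] using that by (intro sum.cong refl) (auto simp: merge_def I_def R_def sq_def)
      define M where "M i j = (X (\<lambda>_. 0) * K) $$ (i, j)" for i j
      define h where "h g j = (\<Sum>k<n. g (q, k) * K $$ (k, j))" for g :: "nat \<times> nat \<Rightarrow> real" and j
      have hrow: "(X g * K) $$ (q, j) = h g j" if "j < n" for g j
        unfolding h_def using XK[of q j g] that Suc.prems
        by (auto simp: merge_def I_def R_def sq_def intro!: sum.cong)
      \<comment> \<open>A lower triangular substitute for X K with the same Gram matrix in the
        leading block of order q + 1: the tail of row q from column q on is replaced by its length.
        Earlier rows vanish in these columns, so all inner products survive.\<close>
      define B where "B g = Matrix.mat n n (\<lambda>(i, j). if i < q then M i j else if i = q then
          (if j < q then h g j else if j = q then sqrt (\<Sum>j\<in>{q..<n}. (h g j)\<^sup>2) else 0) else 0)" for g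
      have Bl: "lower_tri n (B g)" for g
        using z0 by (auto simp: lower_tri_def B_def M_def)
      have Bc: "B g \<in> carrier_mat n n" for g by (simp add: B_def)
      have gramB: "gram n (merge I R (y, g)) (i, k) = (B g * transpose_mat (B g)) $$ (i, k)"
        if ik: "i < Suc q" "k < Suc q" for i k g
      proof -
        have ikn: "i < n" "k < n" using ik Suc.prems by auto
        have "gram n (merge I R (y, g)) (i, k) = (X g * transpose_mat (X g)) $$ (i, k)"
          using gram_mat[OF ikn] by (simp add: X_def del: index_mult_mat)
        also have "X g * transpose_mat (X g) = (X g * K) * transpose_mat (X g * K)"
          using gram_orthogonal[OF Xc K] by simp
        also have "\<dots> $$ (i, k) = (\<Sum>j<n. (X g * K) $$ (i, j) * (X g * K) $$ (k, j))"
        proof -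
          define Y where "Y = X g * K"
          have Yc: "Y \<in> carrier_mat n n" using mult_carrier_mat[OF Xc Kc] by (simp add: Y_def)
          show ?thesis unfolding Y_def[symmetric]
            using Yc ikn by (subst index_mult_sum[of _ n n _ n]) auto
        qed
        also have "\<dots> = (\<Sum>j<n. B g $$ (i, j) * B g $$ (k, j))"
        proof (cases "i = q \<and> k = q")
          case True
          have "(\<Sum>j<n. (X g * K) $$ (i, j) * (X g * K) $$ (k, j)) = (\<Sum>j<n. (h g j)\<^sup>2)"
            using True hrow by (simp add: power2_eq_square del: index_mult_mat)
          also have "\<dots> = (\<Sum>j<q. (h g j)\<^sup>2) + (\<Sum>j\<in>{q..<n}. (h g j)\<^sup>2)"
            using Suc.prems by (subst sum.union_disjoint[symmetric]) (auto intro!: sum.cong)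
          also have "\<dots> = (\<Sum>j<n. (if j < q then (h g j)\<^sup>2 else 0) + (if j = q then (\<Sum>j\<in>{q..<n}. (h g j)\<^sup>2) else 0))"
          proof -
            have "(\<Sum>j<n. if j < q then (h g j)\<^sup>2 else 0) = (\<Sum>j<q. (h g j)\<^sup>2)"
              using Suc.prems by (intro sum.mono_neutral_cong_right) auto
            then show ?thesis using Suc.prems by (simp add: sum.distrib)
          qed
          also have "\<dots> = (\<Sum>j<n. B g $$ (i, j) * B g $$ (k, j))"
            using True ikn by (intro sum.cong refl) (auto simp: B_def power2_eq_square sum_nonneg)
          finally show ?thesis .
        next
          case False
          have "(X g * K) $$ (i, j) * (X g * K) $$ (k, j) = B g $$ (i, j) * B g $$ (k, j)" if j: "j < n" for j
          proof -
            have e: "(X g * K) $$ (a, j) = M a j" if "a < q" for a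
              using row[of a j g] that j Suc.prems by (simp add: M_def)
            have "a < q \<Longrightarrow> a < j \<Longrightarrow> M a j = 0" for a using z0 j by (simp add: M_def)
            then show ?thesis
              using False ik ikn j e[of i] e[of k] hrow[OF j, of g]
              by (cases "i = q"; cases "k = q"; cases "j < q"; cases "j = q") (auto simp: B_def simp del: index_mult_mat)
          qed
          then show ?thesis by (intro sum.cong) auto
        qed
        also have "\<dots> = (B g * transpose_mat (B g)) $$ (i, k)"
          using Bc[of g] ikn by (subst index_mult_sum[of _ n n _ n]) auto
        finally show ?thesis .
      qed
      have WB: "W r (merge I R (y, g)) = (\<Prod>i<n. ((B g $$ (i, i))\<^sup>2) ^ t r i)" if "r \<le> Suc q" for r g
      proof -
        have "W r (merge I R (y, g)) = Del (Suc q) (t r) (gram n (merge I R (y, g)))"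
          unfolding W_def using that Suc.prems by (intro Del_trunc) (auto simp: t_def)
        also have "\<dots> = Del (Suc q) (t r) (($$) (B g * transpose_mat (B g)))"
          by (intro Del_cong gramB)
        also have "\<dots> = Del n (t r) (($$) (B g * transpose_mat (B g)))"
          using that Suc.prems by (intro Del_trunc[symmetric]) (auto simp: t_def)
        also have "\<dots> = (\<Prod>i<n. (B g $$ (i, i)) ^ t r i)\<^sup>2"
          unfolding Del_gram_lower[OF Bl]
          using Bl[of g] l(2) by (subst Del_lower[OF t]) (auto simp: t_def lower_tri_def)
        finally show ?thesis by (simp add: prod_power_distrib power_mult[symmetric] mult.commute)
      qed
      define w where "w = (\<Prod>i<q. ((M i i)\<^sup>2) ^ l i)"
      have w0: "w \<ge> 0" unfolding w_def by (intro prod_nonneg) auto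
      have W1: "W q (merge I R (y, g)) = w" for g
      proof -
        have "W q (merge I R (y, g)) = (\<Prod>i<n. ((B g $$ (i, i))\<^sup>2) ^ t q i)" by (rule WB) simp
        also have "\<dots> = w" unfolding w_def using Suc.prems
          by (intro prod.mono_neutral_cong_right) (auto simp: t_def B_def)
        finally show ?thesis .
      qed
      have W2: "W (Suc q) (merge I R (y, g)) = w * (\<Sum>j\<in>{q..<n}. (h g j)\<^sup>2) ^ l q" for g
      proof -
        have "W (Suc q) (merge I R (y, g)) = (\<Prod>i<n. ((B g $$ (i, i))\<^sup>2) ^ t (Suc q) i)" by (rule WB) simp
        also have "\<dots> = (\<Prod>i<Suc q. ((B g $$ (i, i))\<^sup>2) ^ l i)" using Suc.prems
          by (intro prod.mono_neutral_cong_right) (auto simp: t_def)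
        also have "\<dots> = (\<Prod>i<q. ((B g $$ (i, i))\<^sup>2) ^ l i) * ((B g $$ (q, q))\<^sup>2) ^ l q" by simp
        also have "(\<Prod>i<q. ((B g $$ (i, i))\<^sup>2) ^ l i) = w"
          unfolding w_def using Suc.prems by (intro prod.cong) (auto simp: B_def)
        also have "(B g $$ (q, q))\<^sup>2 = (\<Sum>j\<in>{q..<n}. (h g j)\<^sup>2)"
          using Suc.prems by (simp add: B_def sum_nonneg)
        finally show ?thesis .
      qed
      \<comment> \<open>Row q of X K is the image of the row g under K', an orthogonal map; its tail
        consists of n - q independent Gaussian coordinates.\<close>
      define A where "A = (\<lambda>(a :: nat \<times> nat) (b :: nat \<times> nat). K $$ (snd b, snd a))"
      have A: "orthk R A"
        unfolding orthk_def
      proof (intro ballI)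
        fix a b assume ab: "a \<in> R" "b \<in> R"
        have "(\<Sum>c\<in>R. A c a * A c b) = (\<Sum>j<n. K $$ (snd a, j) * K $$ (snd b, j))"
          unfolding R_def sum.cartesian_product' by (simp add: A_def)
        also have "\<dots> = of_bool (snd a = snd b)" using ab by (intro orthogonal_rows[OF K]) (auto simp: R_def)
        also have "\<dots> = of_bool (a = b)" using ab by (auto simp: R_def)
        finally show "(\<Sum>c\<in>R. A c a * A c b) = of_bool (a = b)" .
      qed
      have hA: "h g j = lin R A g (q, j)" if "j < n" for g j
        using that unfolding lin_def h_def R_def sum.cartesian_product' by (simp add: A_def mult.commute)
      define F where "F = {q} \<times> {q..<n}"
      have F: "F \<subseteq> R" "finite F" "card F = n - q" by (auto simp: F_def R_def)
      have sF: "(\<Sum>j\<in>{q..<n}. (h g j)\<^sup>2) = (\<Sum>a\<in>F. (lin R A g a)\<^sup>2)" for g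
        unfolding F_def sum.cartesian_product' using hA by simp
      have mF: "(\<lambda>g. ennreal ((\<Sum>a\<in>F. (g a)\<^sup>2) ^ l q)) \<in> borel_measurable (gauss R)"
        by (intro measurable_compose[OF _ measurable_ennreal] borel_measurable_power borel_measurable_sum
            gauss_component) (use F in auto)
      have pr: "preserves R (lin R A)" by (rule preserves_lin[OF IR(4) A])
      have int: "(\<integral>\<^sup>+g. ennreal ((\<Sum>a\<in>F. (lin R A g a)\<^sup>2) ^ l q) \<partial>gauss R) = ennreal c"
        using bspec[OF conjunct2[OF pr[unfolded preserves_def]] mF]
          gauss_chi_square[OF F(2,1) IR(4), of "l q"] F(3) by (simp add: c_def)
      have "(\<integral>\<^sup>+g. ennreal (W (Suc q) (merge I R (y, g))) \<partial>gauss R) =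
         (\<integral>\<^sup>+g. ennreal w * ennreal ((\<Sum>a\<in>F. (lin R A g a)\<^sup>2) ^ l q) \<partial>gauss R)"
        unfolding W2 sF using w0 by (intro nn_integral_cong ennreal_mult, assumption)
          (rule zero_le_power, rule sum_nonneg, rule zero_le_power2)
      also have "\<dots> = ennreal w * ennreal c"
        unfolding int[symmetric] by (intro nn_integral_cmult measurable_compose[OF lin_measurable mF])
      finally show ?thesis using w0 W1 by blast
    qed
    have row: "(\<integral>\<^sup>+g. ennreal (W (Suc q) (merge I R (y, g))) \<partial>gauss R) =
      ennreal c * (\<integral>\<^sup>+g. ennreal (W q (merge I R (y, g))) \<partial>gauss R)" for y
    proof -
      interpret prob_space "gauss R" by (rule prob_space_gauss)
      obtain w where "w \<ge> 0" "\<forall>g. W q (merge I R (y, g)) = w"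
        "(\<integral>\<^sup>+g. ennreal (W (Suc q) (merge I R (y, g))) \<partial>gauss R) = ennreal w * ennreal c" using key by blast
      then show ?thesis by (simp add: emeasure_space_1 mult.commute)
    qed
    have mm: "(\<lambda>y. \<integral>\<^sup>+g. ennreal (W q (merge I R (y, g))) \<partial>gauss R) \<in> borel_measurable (gauss I)"
    proof -
      interpret prob_space "gauss R" by (rule prob_space_gauss)
      have "(\<lambda>p. ennreal (W q (merge I R p))) \<in> borel_measurable (gauss I \<Otimes>\<^sub>M gauss R)"
        by (rule measurable_compose[OF _ meas]) (simp only: gauss_def IR(1) measurable_merge)
      then show ?thesis by (intro borel_measurable_nn_integral) (simp add: split_beta')
    qed
    have "(\<integral>\<^sup>+x. ennreal (W (Suc q) x) \<partial>gauss (sq n)) =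
        ennreal c * (\<integral>\<^sup>+x. ennreal (W q x) \<partial>gauss (sq n))"
      unfolding fold[OF meas] row by (rule nn_integral_cmult[OF mm])
    also have "\<dots> = ennreal c * ennreal (\<Prod>i<q. 2 ^ l i * pochhammer (real (n - i) / 2) (l i))"
      using Suc by simp
    also have "\<dots> = ennreal (\<Prod>i<Suc q. 2 ^ l i * pochhammer (real (n - i) / 2) (l i))"
      by (subst ennreal_mult'[symmetric])
        (auto simp: c_def mult.commute intro!: mult_nonneg_nonneg prod_nonneg pochhammer_nonneg')
    finally show ?case .
  qed
  from this[of n] have "(\<integral>\<^sup>+x. ennreal (W n x) \<partial>gauss (sq n)) = ennreal (wishart_const n l)"
    by (simp add: wishart_const_def)
  moreover have "t n = l"
  proof
    fix i show "t n i = l i" using antimonoD[OF l(1), of n i] l(2) by (auto simp: t_def)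
  qed
  ultimately show ?thesis by (simp add: W_def)
qed

section \<open>Haar measure\<close>

declare sum.cong [fundef_cong]

text \<open>Column \<open>j\<close> of the Gram--Schmidt orthonormalisation of the columns of \<open>x\<close>.\<close>

function gsv :: "nat \<Rightarrow> (nat \<times> nat \<Rightarrow> real) \<Rightarrow> nat \<Rightarrow> nat \<Rightarrow> real" where
  "gsv n x j = (\<lambda>i. (x (i, j) - (\<Sum>l<j. (\<Sum>k<n. x (k, j) * gsv n x l k) * gsv n x l i)) /
     sqrt (\<Sum>m<n. (x (m, j) - (\<Sum>l<j. (\<Sum>k<n. x (k, j) * gsv n x l k) * gsv n x l m))\<^sup>2))"
  by pat_completeness auto
termination by (relation "Wellfounded.measure (\<lambda>(n, x, j). j)") auto

declare gsv.simps [simp del]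

definition gsb :: "nat \<Rightarrow> (nat \<times> nat \<Rightarrow> real) \<Rightarrow> nat \<Rightarrow> nat \<Rightarrow> real" where
  "gsb n x j i = x (i, j) - (\<Sum>l<j. (\<Sum>k<n. x (k, j) * gsv n x l k) * gsv n x l i)"

definition gs_norm :: "nat \<Rightarrow> (nat \<times> nat \<Rightarrow> real) \<Rightarrow> nat \<Rightarrow> real" where
  "gs_norm n x j = (\<Sum>m<n. (gsb n x j m)\<^sup>2)"

definition gs_good :: "nat \<Rightarrow> (nat \<times> nat \<Rightarrow> real) set" where
  "gs_good n = {x \<in> extensional (sq n). \<forall>j<n. gs_norm n x j \<noteq> 0}"

text \<open>The identity matrix is a filler that keeps the value orthogonal everywhere; the measure
  will be conditioned on \<open>gs_good\<close>.\<close>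

definition gs_mat :: "nat \<Rightarrow> (nat \<times> nat \<Rightarrow> real) \<Rightarrow> real mat" where
  "gs_mat n x = (if x \<in> gs_good n then Matrix.mat n n (\<lambda>(i, j). gsv n x j i) else 1\<^sub>m n)"

lemma gsv_eq: "gsv n x j i = gsb n x j i / sqrt (gs_norm n x j)"
  by (subst gsv.simps) (simp add: gsb_def gs_norm_def)

lemma gs_orthonormal:
  assumes "x \<in> gs_good n" "j < n" "l \<le> j"
  shows "(\<Sum>k<n. gsv n x j k * gsv n x l k) = of_bool (l = j)"
  using assms(2,3)
proof (induction j arbitrary: l rule: less_induct)
  case (less j)
  have nz: "gs_norm n x j \<noteq> 0" using assms(1) less.prems by (auto simp: gs_good_def)
  have nn: "gs_norm n x j \<ge> 0" by (simp add: gs_norm_def sum_nonneg)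
  show ?case
  proof (cases "l = j")
    case True
    have "(\<Sum>k<n. gsv n x j k * gsv n x j k) = (\<Sum>k<n. (gsb n x j k)\<^sup>2 / gs_norm n x j)"
      using nn by (intro sum.cong refl) (simp add: gsv_eq power2_eq_square[symmetric] power_divide)
    also have "\<dots> = gs_norm n x j / gs_norm n x j" by (simp add: sum_divide_distrib[symmetric] gs_norm_def)
    finally show ?thesis using nz True by simp
  next
    case False
    then have lj: "l < j" using less.prems by simp
    define c where "c a = (\<Sum>k<n. x (k, j) * gsv n x a k)" for a
    have orth: "(\<Sum>k<n. gsv n x a k * gsv n x l k) = of_bool (a = l)" if "a < j" for a
    proof (cases "l \<le> a")
      case True
      then show ?thesis using less.IH[of a l] that less.prems by auto
    next
      case False
      then have "(\<Sum>k<n. gsv n x l k * gsv n x a k) = of_bool (a = l)"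
        using less.IH[of l a] lj less.prems by auto
      then show ?thesis by (simp add: mult.commute)
    qed
    have "(\<Sum>k<n. gsb n x j k * gsv n x l k) =
        c l - (\<Sum>k<n. \<Sum>a<j. c a * (gsv n x a k * gsv n x l k))"
      by (simp add: gsb_def c_def left_diff_distrib sum_subtractf sum_distrib_right mult.assoc)
    also have "(\<Sum>k<n. \<Sum>a<j. c a * (gsv n x a k * gsv n x l k)) = (\<Sum>a<j. c a * (\<Sum>k<n. gsv n x a k * gsv n x l k))"
      by (subst sum.swap) (simp add: sum_distrib_left)
    also have "\<dots> = (\<Sum>a<j. if a = l then c l else 0)" by (intro sum.cong refl) (auto simp: orth)
    also have "\<dots> = c l" using lj by simp
    finally have "(\<Sum>k<n. gsb n x j k * gsv n x l k) = 0" by simp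
    then have "(\<Sum>k<n. gsv n x j k * gsv n x l k) = 0"
      by (simp add: gsv_eq[of n x j] sum_divide_distrib[symmetric])
    then show ?thesis using False by simp
  qed
qed

lemma gs_mat_orthogonal: "gs_mat n x \<in> orthogonal_group n"
proof (cases "x \<in> gs_good n")
  case True
  have "(\<Sum>l<n. gsv n x i l * gsv n x k l) = of_bool (i = k)" if "i < n" "k < n" for i k
  proof (cases "k \<le> i")
    case t: True
    then show ?thesis using gs_orthonormal[OF True that(1) t] by auto
  next
    case False
    then have "(\<Sum>l<n. gsv n x k l * gsv n x i l) = of_bool (i = k)"
      using gs_orthonormal[OF True that(2), of i] by auto
    then show ?thesis by (simp add: mult.commute)
  qed
  then show ?thesis using True by (intro orthogonal_groupI) (auto simp: gs_mat_def)
qed (simp add: gs_mat_def orthogonal_group_one)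

text \<open>The factorisation \<open>X = Q R\<close> holds even where the process breaks down, with a zero on the diagonal of \<open>R\<close>.\<close>

lemma gs_det: "lm n x = lm n (\<lambda>(i, j). gsv n x j i) * (\<Prod>j<n. sqrt (gs_norm n x j))"
proof -
  define Q where "Q = Matrix.mat n n (\<lambda>(i, j). gsv n x j i)"
  define R where "R = Matrix.mat n n (\<lambda>(l, j). if l < j then (\<Sum>k<n. x (k, j) * gsv n x l k)
     else if l = j then sqrt (gs_norm n x j) else 0)"
  have R: "upper_tri n R" by (auto simp: upper_tri_def R_def)
  have "(Q * R) $$ (i, j) = x (i, j)" if ij: "i < n" "j < n" for i j
  proof -
    have b: "gsb n x j i = sqrt (gs_norm n x j) * gsv n x j i"
    proof (cases "gs_norm n x j = 0")
      case True
      then have "\<forall>m\<in>{..<n}. (gsb n x j m)\<^sup>2 = 0"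
        unfolding gs_norm_def by (subst (asm) sum_nonneg_eq_0_iff) auto
      then show ?thesis using ij True by simp
    qed (simp add: gsv_eq)
    have "(Q * R) $$ (i, j) = (\<Sum>l<n. Q $$ (i, l) * R $$ (l, j))"
      by (rule index_mult_sum[of _ n n _ n]) (use ij in \<open>auto simp: Q_def R_def\<close>)
    also have "\<dots> = (\<Sum>l<n. (if l < j then (\<Sum>k<n. x (k, j) * gsv n x l k) * gsv n x l i else 0) +
        (if l = j then sqrt (gs_norm n x j) * gsv n x j i else 0))"
      using ij by (intro sum.cong refl) (auto simp: Q_def R_def)
    also have "\<dots> = (\<Sum>l<n. if l < j then (\<Sum>k<n. x (k, j) * gsv n x l k) * gsv n x l i else 0) + gsb n x j i"
      unfolding sum.distrib using ij b by simp
    also have "(\<Sum>l<n. if l < j then (\<Sum>k<n. x (k, j) * gsv n x l k) * gsv n x l i else 0) =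
        (\<Sum>l<j. (\<Sum>k<n. x (k, j) * gsv n x l k) * gsv n x l i)"
      using ij by (intro sum.mono_neutral_cong_right) auto
    finally show ?thesis by (simp add: gsb_def)
  qed
  then have "lm n x = lm n (($$) (Q * R))" by (intro lm_cong) auto
  also have "\<dots> = lm n (($$) Q) * lm n (($$) R)" by (rule lm_full_mult) (auto simp: Q_def R_def)
  also have "lm n (($$) R) = (\<Prod>j<n. sqrt (gs_norm n x j))"
    using R by (subst lm_upper) (auto simp: upper_tri_def R_def)
  also have "lm n (($$) Q) = lm n (\<lambda>(i, j). gsv n x j i)" by (rule lm_cong) (simp add: Q_def)
  finally show ?thesis .
qed

text \<open>A breakdown of the process puts a zero on the diagonal of R in X = Q R.\<close>

lemma det_zero_if_not_good:
  assumes "x \<in> extensional (sq n)" "x \<notin> gs_good n"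
  shows "lm n x = 0"
proof -
  obtain j where "j < n" "gs_norm n x j = 0" using assms by (auto simp: gs_good_def)
  then have "(\<Prod>j<n. sqrt (gs_norm n x j)) = 0" by (intro prod_zero) auto
  then show ?thesis by (subst gs_det) simp
qed

section \<open>Equivariance of Gram--Schmidt and existence of Haar measure\<close>

definition lmulk :: "nat \<Rightarrow> real mat \<Rightarrow> nat \<times> nat \<Rightarrow> nat \<times> nat \<Rightarrow> real" where
  "lmulk n Q a b = of_bool (snd a = snd b) * Q $$ (fst a, fst b)"

lemma orthk_lmulk:
  assumes "Q \<in> orthogonal_group n"
  shows "orthk (sq n) (lmulk n Q)"
  unfolding orthk_def
proof (intro ballI)
  fix a b assume ab: "a \<in> sq n" "b \<in> sq n"
  have "(\<Sum>c\<in>sq n. lmulk n Q c a * lmulk n Q c b) =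
     (\<Sum>i<n. \<Sum>j<n. if j = snd a then of_bool (snd a = snd b) * (Q $$ (i, fst a) * Q $$ (i, fst b)) else 0)"
    unfolding sq_def sum.cartesian_product' by (intro sum.cong refl) (auto simp: lmulk_def)
  also have "\<dots> = (\<Sum>i<n. of_bool (snd a = snd b) * (Q $$ (i, fst a) * Q $$ (i, fst b)))"
    using ab by (intro sum.cong refl) (auto simp: sq_def)
  also have "\<dots> = of_bool (snd a = snd b) * of_bool (fst a = fst b)"
    unfolding sum_distrib_left[symmetric]
    by (subst orthogonal_cols[OF assms]) (use ab in \<open>auto simp: sq_def\<close>)
  also have "\<dots> = of_bool (a = b)" by (auto simp: prod_eq_iff)
  finally show "(\<Sum>c\<in>sq n. lmulk n Q c a * lmulk n Q c b) = of_bool (a = b)" .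
qed

lemma lin_lmulk:
  assumes "i < n" "j < n"
  shows "lin (sq n) (lmulk n Q) x (i, j) = (\<Sum>k<n. Q $$ (i, k) * x (k, j))"
proof -
  have "(\<Sum>l<n. lmulk n Q (i, j) (k, l) * x (k, l)) = (\<Sum>l<n. if l = j then Q $$ (i, k) * x (k, j) else 0)" for k
    by (intro sum.cong) (auto simp: lmulk_def)
  then show ?thesis using assms unfolding lin_def sq_def sum.cartesian_product' by simp
qed

text \<open>Q preserves the inner products of columns, hence all Gram--Schmidt coefficients; column
  by column the residuals are rotated by Q.\<close>

lemma gs_equivariant:
  assumes Q: "Q \<in> orthogonal_group n" and j: "j < n"
  shows "\<And>i. i < n \<Longrightarrow> gsb n (lin (sq n) (lmulk n Q) x) j i = (\<Sum>k<n. Q $$ (i, k) * gsb n x j k)"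
    and "gs_norm n (lin (sq n) (lmulk n Q) x) j = gs_norm n x j"
    and "\<And>i. i < n \<Longrightarrow> gsv n (lin (sq n) (lmulk n Q) x) j i = (\<Sum>k<n. Q $$ (i, k) * gsv n x j k)"
proof -
  let ?y = "lin (sq n) (lmulk n Q) x"
  have iso: "(\<Sum>k<n. (\<Sum>a<n. Q $$ (k, a) * u a) * (\<Sum>b<n. Q $$ (k, b) * v b)) = (\<Sum>a<n. u a * v a)" for u v
  proof -
    have "orthk {..<n} (\<lambda>i k. Q $$ (i, k))" using orthogonal_cols[OF Q] by (auto simp: orthk_def)
    from dotp_lin[OF this, of u v] show ?thesis by (simp add: dotp_def lin_def)
  qed
  have "(\<forall>i<n. gsb n ?y j i = (\<Sum>k<n. Q $$ (i, k) * gsb n x j k)) \<and> gs_norm n ?y j = gs_norm n x j \<and>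
    (\<forall>i<n. gsv n ?y j i = (\<Sum>k<n. Q $$ (i, k) * gsv n x j k))"
    using j
  proof (induction j rule: less_induct)
    case (less j)
    have IH: "gsv n ?y l i = (\<Sum>k<n. Q $$ (i, k) * gsv n x l k)" if "l < j" "i < n" for l i
      using less.IH[of l] that less.prems by auto
    have c: "(\<Sum>k<n. ?y (k, j) * gsv n ?y l k) = (\<Sum>k<n. x (k, j) * gsv n x l k)" if "l < j" for l
    proof -
      have "(\<Sum>k<n. ?y (k, j) * gsv n ?y l k) = (\<Sum>k<n. (\<Sum>a<n. Q $$ (k, a) * x (a, j)) * (\<Sum>b<n. Q $$ (k, b) * gsv n x l b))"
        using that less.prems by (intro sum.cong refl) (simp add: IH lin_lmulk)
      then show ?thesis by (simp add: iso)
    qed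
    have b: "gsb n ?y j i = (\<Sum>k<n. Q $$ (i, k) * gsb n x j k)" if i: "i < n" for i
    proof -
      have "gsb n ?y j i = (\<Sum>k<n. Q $$ (i, k) * x (k, j)) -
         (\<Sum>l<j. (\<Sum>k<n. x (k, j) * gsv n x l k) * (\<Sum>k<n. Q $$ (i, k) * gsv n x l k))"
      proof -
        have "(\<Sum>l<j. (\<Sum>k<n. ?y (k, j) * gsv n ?y l k) * gsv n ?y l i) =
          (\<Sum>l<j. (\<Sum>k<n. x (k, j) * gsv n x l k) * (\<Sum>k<n. Q $$ (i, k) * gsv n x l k))"
          by (intro sum.cong refl) (simp only: lessThan_iff c IH[OF _ i])
        then show ?thesis unfolding gsb_def using i less.prems by (simp only: lin_lmulk)
      qed
      also have "(\<Sum>l<j. (\<Sum>k<n. x (k, j) * gsv n x l k) * (\<Sum>k<n. Q $$ (i, k) * gsv n x l k)) =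
         (\<Sum>l<j. \<Sum>k<n. Q $$ (i, k) * ((\<Sum>k<n. x (k, j) * gsv n x l k) * gsv n x l k))"
        unfolding sum_distrib_left by (intro sum.cong refl) simp
      also have "\<dots> = (\<Sum>k<n. Q $$ (i, k) * (\<Sum>l<j. (\<Sum>k<n. x (k, j) * gsv n x l k) * gsv n x l k))"
        by (subst sum.swap) (simp add: sum_distrib_left)
      finally show ?thesis by (simp add: gsb_def right_diff_distrib sum_subtractf)
    qed
    have nm: "gs_norm n ?y j = gs_norm n x j"
      unfolding gs_norm_def using iso[of "gsb n x j" "gsb n x j"] by (simp add: b power2_eq_square)
    have "gsv n ?y j i = (\<Sum>k<n. Q $$ (i, k) * gsv n x j k)" if "i < n" for i
      using that by (simp add: gsv_eq nm b sum_divide_distrib)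
    then show ?case using b nm by blast
  qed
  then show "\<And>i. i < n \<Longrightarrow> gsb n ?y j i = (\<Sum>k<n. Q $$ (i, k) * gsb n x j k)"
    "gs_norm n ?y j = gs_norm n x j"
    "\<And>i. i < n \<Longrightarrow> gsv n ?y j i = (\<Sum>k<n. Q $$ (i, k) * gsv n x j k)" by auto
qed

lemma gs_good_equivariant:
  assumes "Q \<in> orthogonal_group n" "x \<in> extensional (sq n)"
  shows "lin (sq n) (lmulk n Q) x \<in> gs_good n \<longleftrightarrow> x \<in> gs_good n"
  using gs_equivariant(2)[OF assms(1)] lin_extensional assms(2) by (auto simp: gs_good_def)

lemma gs_mat_equivariant:
  assumes Q: "Q \<in> orthogonal_group n" and x: "x \<in> gs_good n"
  shows "gs_mat n (lin (sq n) (lmulk n Q) x) = Q * gs_mat n x"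
proof (rule eq_matI)
  have xe: "x \<in> extensional (sq n)" using x by (simp add: gs_good_def)
  note Qc = orthogonal_groupD(1)[OF Q]
  have y: "lin (sq n) (lmulk n Q) x \<in> gs_good n" using gs_good_equivariant[OF Q xe] x by simp
  show "dim_row (gs_mat n (lin (sq n) (lmulk n Q) x)) = dim_row (Q * gs_mat n x)"
    "dim_col (gs_mat n (lin (sq n) (lmulk n Q) x)) = dim_col (Q * gs_mat n x)"
    using Qc x by (auto simp: gs_mat_def)
  fix i j assume "i < dim_row (Q * gs_mat n x)" "j < dim_col (Q * gs_mat n x)"
  then have ij: "i < n" "j < n" using Qc x by (auto simp: gs_mat_def)
  have "(Q * gs_mat n x) $$ (i, j) = (\<Sum>k<n. Q $$ (i, k) * gsv n x j k)"
    using Qc x ij by (subst index_mult_sum[of _ n n _ n]) (auto simp: gs_mat_def)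
  then show "gs_mat n (lin (sq n) (lmulk n Q) x) $$ (i, j) = (Q * gs_mat n x) $$ (i, j)"
    using y ij gs_equivariant(3)[OF Q ij(2,1)] by (simp add: gs_mat_def)
qed

lemma space_borel_orthogonal: "space (borel_orthogonal n) = orthogonal_group n"
  by (simp add: borel_orthogonal_def)

lemma entry_measurable:
  assumes "i < n" "j < n"
  shows "(\<lambda>H. H $$ (i, j)) \<in> borel_measurable (borel_orthogonal n)"
proof -
  have "(\<lambda>H. \<lambda>ij\<in>{..<n} \<times> {..<n}. H $$ ij) \<in> measurable (borel_orthogonal n) (\<Pi>\<^sub>M ij\<in>{..<n} \<times> {..<n}. borel)"
    unfolding borel_orthogonal_def by (rule measurable_vimage_algebra1) (auto simp: space_PiM)
  from measurable_compose[OF this measurable_component_singleton[of "(i, j)"]]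
  show ?thesis using assms by simp
qed

lemma measurable_into_orthogonal:
  assumes "\<And>\<omega>. \<omega> \<in> space N \<Longrightarrow> g \<omega> \<in> orthogonal_group n"
    and "\<And>i j. i < n \<Longrightarrow> j < n \<Longrightarrow> (\<lambda>\<omega>. g \<omega> $$ (i, j)) \<in> borel_measurable N"
  shows "g \<in> measurable N (borel_orthogonal n)"
  unfolding borel_orthogonal_def
proof (rule measurable_vimage_algebra2)
  show "g \<in> space N \<rightarrow> orthogonal_group n" using assms(1) by auto
  show "(\<lambda>\<omega>. \<lambda>ij\<in>{..<n} \<times> {..<n}. g \<omega> $$ ij) \<in> measurable N (\<Pi>\<^sub>M ij\<in>{..<n} \<times> {..<n}. borel)"
    by (rule measurable_restrict) (use assms(2) in auto)
qed

lemma gsv_measurable: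
  assumes "j < n"
  shows "\<forall>i<n. (\<lambda>x. gsb n x j i) \<in> borel_measurable (gauss (sq n)) \<and>
     (\<lambda>x. gsv n x j i) \<in> borel_measurable (gauss (sq n))"
  using assms
proof (induction j rule: less_induct)
  case (less j)
  have IH: "(\<lambda>x. gsv n x l i) \<in> borel_measurable (gauss (sq n))" if "l < j" "i < n" for l i
    using less.IH[of l] that less.prems by auto
  have x: "(\<lambda>x. x (i, k)) \<in> borel_measurable (gauss (sq n))" if "i < n" "k < n" for i k
    by (rule gauss_component) (use that in \<open>auto simp: sq_def\<close>)
  have b: "(\<lambda>x. gsb n x j i) \<in> borel_measurable (gauss (sq n))" if "i < n" for i
    unfolding gsb_def using that less.prems
    by (intro borel_measurable_diff borel_measurable_sum borel_measurable_times x IH) auto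
  have nm: "(\<lambda>x. gs_norm n x j) \<in> borel_measurable (gauss (sq n))"
    unfolding gs_norm_def by (intro borel_measurable_sum borel_measurable_power b) auto
  show ?case unfolding gsv_eq
    using b by (auto intro!: borel_measurable_divide measurable_compose[OF nm borel_measurable_sqrt])
qed

lemma gs_good_sets: "gs_good n \<in> sets (gauss (sq n))"
proof -
  have nm: "(\<lambda>x. gs_norm n x j) \<in> borel_measurable (gauss (sq n))" if "j < n" for j
    unfolding gs_norm_def using gsv_measurable[OF that]
    by (intro borel_measurable_sum borel_measurable_power) auto
  have "gs_good n = space (gauss (sq n)) \<inter> (\<Inter>j\<in>{..<n}. {x \<in> space (gauss (sq n)). gs_norm n x j \<noteq> 0})"
    by (auto simp: gs_good_def space_gauss)
  also have "\<dots> \<in> sets (gauss (sq n))"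
  proof (cases "n = 0")
    case False
    have "{x \<in> space (gauss (sq n)). gs_norm n x j \<noteq> 0} \<in> sets (gauss (sq n))" if "j < n" for j
      using nm[OF that] by measurable
    then show ?thesis using False by (intro sets.Int sets.top sets.finite_INT) auto
  qed auto
  finally show ?thesis .
qed

lemma gs_mat_measurable: "gs_mat n \<in> measurable (gauss (sq n)) (borel_orthogonal n)"
proof (rule measurable_into_orthogonal)
  fix i j assume ij: "i < n" "j < n"
  have "(\<lambda>x. if x \<in> gs_good n then gsv n x j i else of_bool (i = j)) \<in> borel_measurable (gauss (sq n))"
    using gsv_measurable[OF ij(2)] ij gs_good_sets
    by (intro measurable_If_set) (auto intro: sets.Int)
  moreover have "gs_mat n x $$ (i, j) = (if x \<in> gs_good n then gsv n x j i else of_bool (i = j))" for x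
    using ij by (simp add: gs_mat_def)
  ultimately show "(\<lambda>x. gs_mat n x $$ (i, j)) \<in> borel_measurable (gauss (sq n))" by simp
qed (rule gs_mat_orthogonal)

lemma lm_gram: "lm n (gram n x) = (lm n x)\<^sup>2"
proof -
  let ?X = "Matrix.mat n n x"
  have "lm n (gram n x) = lm n (($$) (?X * transpose_mat ?X))"
    by (rule lm_cong) (simp add: gram_mat del: index_mult_mat)
  also have "\<dots> = lm n (($$) ?X) * lm n (($$) (transpose_mat ?X))" by (rule lm_full_mult) auto
  also have "lm n (($$) (transpose_mat ?X)) = lm n (\<lambda>(i, k). x (k, i))" by (rule lm_cong) auto
  also have "\<dots> = lm n x" by (rule lm_transpose)
  also have "lm n (($$) ?X) = lm n x" by (rule lm_cong) auto
  finally show ?thesis by (simp add: power2_eq_square)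
qed

text \<open>If the good set were null, the determinant would vanish almost surely; but the mean of
  its square is the Wishart constant with all parts 1, which is positive.\<close>

lemma gs_good_pos: "emeasure (gauss (sq n)) (gs_good n) \<noteq> 0"
proof
  assume z: "emeasure (gauss (sq n)) (gs_good n) = 0"
  define l where "l i = (if i < n then 1 else 0::nat)" for i
  have l: "antimono l" "l n = 0" by (auto simp: l_def antimono_def)
  have D: "Del n l (gram n x) = (lm n x)\<^sup>2" for x
  proof -
    have "Del n l (gram n x) = lm n (gram n x) * Del n (\<lambda>i. l i - 1) (gram n x)"
      using l by (intro Del_pred) (auto simp: l_def)
    moreover have "Del n (\<lambda>i. l i - 1) (gram n x) = 1" by (auto simp: Del_def l_def)
    ultimately show ?thesis by (simp add: lm_gram)
  qed
  have "AE x in gauss (sq n). x \<notin> gs_good n"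
    using gs_good_sets z by (intro AE_I[of _ _ "gs_good n"]) auto
  then have "AE x in gauss (sq n). ennreal (Del n l (gram n x)) = 0"
  proof (rule AE_mp, intro AE_I2 impI)
    fix x assume "x \<in> space (gauss (sq n))" "x \<notin> gs_good n"
    then have "lm n x = 0" by (intro det_zero_if_not_good) (auto simp: space_gauss)
    then show "ennreal (Del n l (gram n x)) = 0" by (simp add: D)
  qed
  then have "(\<integral>\<^sup>+x. ennreal (Del n l (gram n x)) \<partial>gauss (sq n)) = (\<integral>\<^sup>+x. 0 \<partial>gauss (sq n))"
    by (rule nn_integral_cong_AE)
  then have "ennreal (wishart_const n l) = 0" using gauss_wishart[OF l] by simp
  moreover have "wishart_const n l > 0" unfolding wishart_const_def
    by (intro prod_pos ballI mult_pos_pos pochhammer_pos) auto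
  ultimately show False by simp
qed

text \<open>Orthonormalise a Gaussian matrix conditioned on the good set, for which positive
  probability suffices. Left invariance combines rotation invariance of the Gaussian law with
  equivariance of the process.\<close>

theorem haar_exists: "\<exists>\<mu>. is_normalized_haar n \<mu>"
proof -
  let ?G = "gauss (sq n)"
  let ?B = "borel_orthogonal n"
  define M where "M = uniform_measure ?G (gs_good n)"
  interpret G: prob_space ?G by (rule prob_space_gauss)
  have fin: "emeasure ?G (gs_good n) \<noteq> \<infinity>" by simp
  interpret M: prob_space M unfolding M_def by (rule prob_space_uniform_measure[OF gs_good_pos fin])
  have gm: "gs_mat n \<in> measurable M ?B"
    using gs_mat_measurable[of n] by (simp add: M_def)
  define \<mu> where "\<mu> = distr M ?B (gs_mat n)"
  have "prob_space \<mu>" unfolding \<mu>_def by (rule M.prob_space_distr[OF gm])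
  moreover have "sets \<mu> = sets ?B" by (simp add: \<mu>_def)
  moreover have "distr \<mu> \<mu> (\<lambda>H. Q * H) = \<mu>" if Q: "Q \<in> orthogonal_group n" for Q
  proof (rule measure_eqI)
    note Qc = orthogonal_groupD(1)[OF Q]
    have Qm: "(\<lambda>H. Q * H) \<in> measurable ?B ?B"
    proof (rule measurable_into_orthogonal)
      fix H assume "H \<in> space ?B"
      then show "Q * H \<in> orthogonal_group n" using Q by (simp add: space_borel_orthogonal orthogonal_group_mult)
    next
      fix i j assume ij: "i < n" "j < n"
      have "(\<lambda>H. \<Sum>k<n. Q $$ (i, k) * H $$ (k, j)) \<in> borel_measurable ?B"
        using ij by (intro borel_measurable_sum borel_measurable_times entry_measurable) auto
      moreover have eq: "(Q * H) $$ (i, j) = (\<Sum>k<n. Q $$ (i, k) * H $$ (k, j))" if "H \<in> space ?B" for H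
        using that orthogonal_groupD(1)[of H n] Qc ij
        by (intro index_mult_sum) (auto simp: space_borel_orthogonal)
      ultimately show "(\<lambda>H. (Q * H) $$ (i, j)) \<in> borel_measurable ?B"
        by (subst measurable_cong[OF eq])
    qed
    fix A assume "A \<in> sets (distr \<mu> \<mu> (\<lambda>H. Q * H))"
    then have A: "A \<in> sets ?B" by (simp add: \<mu>_def)
    have T: "preserves (sq n) (lin (sq n) (lmulk n Q))"
      by (rule preserves_lin[OF finite_sq orthk_lmulk[OF Q]])
    have Am: "indicator A \<in> borel_measurable ?B" using A by simp
    have emu: "emeasure \<mu> A' = (\<integral>\<^sup>+x. indicator A' (gs_mat n x) * indicator (gs_good n) x \<partial>?G) / emeasure ?G (gs_good n)"
      if "A' \<in> sets ?B" for A'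
    proof -
      have "emeasure \<mu> A' = (\<integral>\<^sup>+H. indicator A' H \<partial>\<mu>)" using that by (simp add: \<mu>_def)
      also have "\<dots> = (\<integral>\<^sup>+x. indicator A' (gs_mat n x) \<partial>M)"
        unfolding \<mu>_def using that gm by (intro nn_integral_distr) auto
      also have "\<dots> = (\<integral>\<^sup>+x. indicator A' (gs_mat n x) * indicator (gs_good n) x \<partial>?G) / emeasure ?G (gs_good n)"
        unfolding M_def
        by (rule nn_integral_uniform_measure[OF _ gs_good_sets]) (use that gs_mat_measurable in measurable)
      finally show ?thesis .
    qed
    define A1 where "A1 = {H \<in> space ?B. Q * H \<in> A}"
    have A1: "A1 \<in> sets ?B" using Qm A unfolding A1_def by measurable
    have "emeasure (distr \<mu> \<mu> (\<lambda>H. Q * H)) A = emeasure \<mu> A1"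
      using A Qm unfolding A1_def
      by (subst emeasure_distr) (auto simp: \<mu>_def vimage_def Int_def conj_commute)
    also have "\<dots> = (\<integral>\<^sup>+x. indicator A1 (gs_mat n x) * indicator (gs_good n) x \<partial>?G) / emeasure ?G (gs_good n)"
      by (rule emu[OF A1])
    also have "(\<integral>\<^sup>+x. indicator A1 (gs_mat n x) * indicator (gs_good n) x \<partial>?G) =
      (\<integral>\<^sup>+x. (indicator A (gs_mat n (lin (sq n) (lmulk n Q) x)) * indicator (gs_good n) (lin (sq n) (lmulk n Q) x) :: ennreal) \<partial>?G)"
    proof (rule nn_integral_cong)
      fix x assume "x \<in> space ?G"
      then have x: "x \<in> extensional (sq n)" by (simp add: space_gauss)
      show "indicator A1 (gs_mat n x) * indicator (gs_good n) x =
        (indicator A (gs_mat n (lin (sq n) (lmulk n Q) x)) * indicator (gs_good n) (lin (sq n) (lmulk n Q) x) :: ennreal)"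
        using gs_good_equivariant[OF Q x] gs_mat_equivariant[OF Q, of x] gs_mat_orthogonal[of n x]
        by (cases "x \<in> gs_good n") (auto simp: A1_def space_borel_orthogonal split: split_indicator)
    qed
    also have "\<dots> = (\<integral>\<^sup>+x. indicator A (gs_mat n x) * indicator (gs_good n) x \<partial>?G)"
    proof -
      have "(\<lambda>x. indicator A (gs_mat n x) * indicator (gs_good n) x :: ennreal) \<in> borel_measurable ?G"
        using A gs_mat_measurable gs_good_sets by measurable
      from bspec[OF conjunct2[OF T[unfolded preserves_def]] this] show ?thesis .
    qed
    also have "\<dots> / emeasure ?G (gs_good n) = emeasure \<mu> A" by (rule emu[OF A, symmetric])
    finally show "emeasure (distr \<mu> \<mu> (\<lambda>H. Q * H)) A = emeasure \<mu> A" .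
  qed simp
  ultimately show ?thesis unfolding is_normalized_haar_def by blast
qed

section \<open>Haar invariance under transposition and right translation\<close>

lemma haar_is_haar: "is_normalized_haar n (haar_orthogonal n)"
  unfolding haar_orthogonal_def by (rule someI_ex[OF haar_exists])

lemma sets_haar [measurable_cong]: "sets (haar_orthogonal n) = sets (borel_orthogonal n)"
  using haar_is_haar by (simp add: is_normalized_haar_def)

lemma space_haar: "space (haar_orthogonal n) = orthogonal_group n"
  using sets_eq_imp_space_eq[OF sets_haar] by (simp add: space_borel_orthogonal)

lemma prob_space_haar: "prob_space (haar_orthogonal n)"
  using haar_is_haar by (simp add: is_normalized_haar_def)

lemma haar_left_invariant: "Q \<in> orthogonal_group n \<Longrightarrow>
    distr (haar_orthogonal n) (haar_orthogonal n) (\<lambda>H. Q * H) = haar_orthogonal n"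
  using haar_is_haar by (simp add: is_normalized_haar_def)

lemma haar_entry: "i < n \<Longrightarrow> j < n \<Longrightarrow> (\<lambda>H. H $$ (i, j)) \<in> borel_measurable (haar_orthogonal n)"
  using entry_measurable measurable_cong_sets[OF sets_haar refl] by blast

lemma measurable_into_haar:
  assumes "\<And>\<omega>. \<omega> \<in> space N \<Longrightarrow> g \<omega> \<in> orthogonal_group n"
    and "\<And>i j. i < n \<Longrightarrow> j < n \<Longrightarrow> (\<lambda>\<omega>. g \<omega> $$ (i, j)) \<in> borel_measurable N"
  shows "g \<in> measurable N (haar_orthogonal n)"
  using measurable_into_orthogonal[of N g n] assms measurable_cong_sets[OF refl sets_haar] by blast

lemma haar_transpose_measurable:
  "transpose_mat \<in> measurable (haar_orthogonal n) (haar_orthogonal n)"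
proof (rule measurable_into_haar)
  fix H :: "real mat" assume H: "H \<in> space (haar_orthogonal n)"
  then show "transpose_mat H \<in> orthogonal_group n" by (simp add: space_haar orthogonal_group_transpose)
next
  fix i j assume ij: "i < n" "j < n"
  have "transpose_mat H $$ (i, j) = H $$ (j, i)" if "H \<in> space (haar_orthogonal n)" for H
    using that orthogonal_groupD(1)[of H n] ij by (auto simp: space_haar)
  then show "(\<lambda>H. transpose_mat H $$ (i, j)) \<in> borel_measurable (haar_orthogonal n)"
    using haar_entry[OF ij(2,1)] measurable_cong[of "haar_orthogonal n" "\<lambda>H. transpose_mat H $$ (i, j)" "\<lambda>H. H $$ (j, i)"]
    by blast
qed

lemma haar_mult_measurable:
  assumes g: "g \<in> measurable N (haar_orthogonal n)" and h: "h \<in> measurable N (haar_orthogonal n)"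
  shows "(\<lambda>\<omega>. g \<omega> * h \<omega>) \<in> measurable N (haar_orthogonal n)"
proof (rule measurable_into_haar)
  have gO: "g \<omega> \<in> orthogonal_group n" "h \<omega> \<in> orthogonal_group n" if "\<omega> \<in> space N" for \<omega>
    using measurable_space[OF g that] measurable_space[OF h that] by (auto simp: space_haar)
  show "g \<omega> * h \<omega> \<in> orthogonal_group n" if "\<omega> \<in> space N" for \<omega>
    using gO[OF that] by (rule orthogonal_group_mult)
  fix i j assume ij: "i < n" "j < n"
  have "(\<lambda>\<omega>. \<Sum>k<n. g \<omega> $$ (i, k) * h \<omega> $$ (k, j)) \<in> borel_measurable N"
    using ij by (intro borel_measurable_sum borel_measurable_times measurable_compose[OF g haar_entry]
        measurable_compose[OF h haar_entry]) auto
  moreover have eq: "(g \<omega> * h \<omega>) $$ (i, j) = (\<Sum>k<n. g \<omega> $$ (i, k) * h \<omega> $$ (k, j))" if "\<omega> \<in> space N" for \<omega>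
    using orthogonal_groupD(1)[OF gO(1)[OF that]] orthogonal_groupD(1)[OF gO(2)[OF that]] ij
    by (rule index_mult_sum)
  ultimately show "(\<lambda>\<omega>. (g \<omega> * h \<omega>) $$ (i, j)) \<in> borel_measurable N"
    by (subst measurable_cong[OF eq])
qed

lemma haar_const_measurable: "Q \<in> orthogonal_group n \<Longrightarrow> (\<lambda>_. Q) \<in> measurable N (haar_orthogonal n)"
  by (rule measurable_const) (simp add: space_haar)

lemma haar_nn_left:
  assumes Q: "Q \<in> orthogonal_group n" and f: "f \<in> borel_measurable (haar_orthogonal n)"
  shows "(\<integral>\<^sup>+H. f (Q * H) \<partial>haar_orthogonal n) = (\<integral>\<^sup>+H. f H \<partial>haar_orthogonal n)"
proof -
  have "(\<integral>\<^sup>+H. f (Q * H) \<partial>haar_orthogonal n) =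
     (\<integral>\<^sup>+H. f H \<partial>distr (haar_orthogonal n) (haar_orthogonal n) (\<lambda>H. Q * H))"
    using f by (intro nn_integral_distr[symmetric] haar_mult_measurable haar_const_measurable Q measurable_ident) auto
  then show ?thesis by (simp add: haar_left_invariant[OF Q])
qed

text \<open>Average f(H' K) over independent H and K in both orders. Left invariance in K removes
  H'; since H' K is the transpose of K' H, left invariance in H removes K.\<close>

lemma haar_nn_transpose:
  assumes f: "f \<in> borel_measurable (haar_orthogonal n)"
  shows "(\<integral>\<^sup>+H. f (transpose_mat H) \<partial>haar_orthogonal n) = (\<integral>\<^sup>+H. f H \<partial>haar_orthogonal n)"
proof -
  let ?H = "haar_orthogonal n"
  interpret prob_space ?H by (rule prob_space_haar)
  interpret P: pair_sigma_finite ?H ?H by standard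
  have m: "(\<lambda>p. transpose_mat (fst p) * snd p) \<in> measurable (?H \<Otimes>\<^sub>M ?H) ?H"
    by (intro haar_mult_measurable measurable_compose[OF measurable_fst haar_transpose_measurable]) measurable
  have mf: "(\<lambda>(H, K). f (transpose_mat H * K)) \<in> borel_measurable (?H \<Otimes>\<^sub>M ?H)"
    using measurable_compose[OF m f] by (simp add: split_beta')
  have fT: "(\<lambda>H. f (transpose_mat H)) \<in> borel_measurable ?H"
    by (rule measurable_compose[OF haar_transpose_measurable f])
  have "(\<integral>\<^sup>+H. f H \<partial>?H) = (\<integral>\<^sup>+H. (\<integral>\<^sup>+K. f (transpose_mat H * K) \<partial>?H) \<partial>?H)"
  proof -
    have "(\<integral>\<^sup>+K. f (transpose_mat H * K) \<partial>?H) = (\<integral>\<^sup>+K. f K \<partial>?H)" if "H \<in> space ?H" for H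
      using that f by (intro haar_nn_left) (auto simp: space_haar orthogonal_group_transpose)
    then have "(\<integral>\<^sup>+H. (\<integral>\<^sup>+K. f (transpose_mat H * K) \<partial>?H) \<partial>?H) = (\<integral>\<^sup>+H. (\<integral>\<^sup>+K. f K \<partial>?H) \<partial>?H)"
      by (rule nn_integral_cong)
    then show ?thesis by (simp add: emeasure_space_1)
  qed
  also have "\<dots> = (\<integral>\<^sup>+K. (\<integral>\<^sup>+H. f (transpose_mat H * K) \<partial>?H) \<partial>?H)"
    using P.Fubini'[OF mf] by simp
  also have "\<dots> = (\<integral>\<^sup>+K. (\<integral>\<^sup>+H. f (transpose_mat H) \<partial>?H) \<partial>?H)"
  proof (rule nn_integral_cong)
    fix K assume "K \<in> space ?H"
    then have K: "K \<in> orthogonal_group n" by (simp add: space_haar)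
    have "(\<integral>\<^sup>+H. f (transpose_mat H * K) \<partial>?H) = (\<integral>\<^sup>+H. f (transpose_mat (transpose_mat K * H)) \<partial>?H)"
    proof (rule nn_integral_cong)
      fix H assume "H \<in> space ?H"
      then have "transpose_mat (transpose_mat K * H) = transpose_mat H * K"
        using orthogonal_groupD(1)[OF K] orthogonal_groupD(1)[of H n]
        by (subst transpose_mult[of _ n n _ n]) (auto simp: space_haar)
      then show "f (transpose_mat H * K) = f (transpose_mat (transpose_mat K * H))" by simp
    qed
    also have "\<dots> = (\<integral>\<^sup>+H. f (transpose_mat H) \<partial>?H)"
      by (rule haar_nn_left[OF orthogonal_group_transpose[OF K] fT])
    finally show "(\<integral>\<^sup>+H. f (transpose_mat H * K) \<partial>?H) = (\<integral>\<^sup>+H. f (transpose_mat H) \<partial>?H)" .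
  qed
  also have "\<dots> = (\<integral>\<^sup>+H. f (transpose_mat H) \<partial>?H)" by (simp add: emeasure_space_1)
  finally show ?thesis ..
qed

text \<open>Right translation is left translation conjugated by transposition.\<close>

lemma haar_nn_right:
  assumes Q: "Q \<in> orthogonal_group n" and f: "f \<in> borel_measurable (haar_orthogonal n)"
  shows "(\<integral>\<^sup>+H. f (H * Q) \<partial>haar_orthogonal n) = (\<integral>\<^sup>+H. f H \<partial>haar_orthogonal n)"
proof -
  let ?H = "haar_orthogonal n"
  have fQ: "(\<lambda>H. f (H * Q)) \<in> borel_measurable ?H"
    by (rule measurable_compose[OF haar_mult_measurable[OF measurable_ident haar_const_measurable[OF Q]] f, unfolded id_def])
  have fT: "(\<lambda>H. f (transpose_mat H)) \<in> borel_measurable ?H"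
    by (rule measurable_compose[OF haar_transpose_measurable f])
  have "(\<integral>\<^sup>+H. f (H * Q) \<partial>?H) = (\<integral>\<^sup>+H. f (transpose_mat H * Q) \<partial>?H)"
    using haar_nn_transpose[OF fQ] by simp
  also have "\<dots> = (\<integral>\<^sup>+H. f (transpose_mat (transpose_mat Q * H)) \<partial>?H)"
  proof (rule nn_integral_cong)
    fix H assume "H \<in> space ?H"
    then have "transpose_mat (transpose_mat Q * H) = transpose_mat H * Q"
      using orthogonal_groupD(1)[OF Q] orthogonal_groupD(1)[of H n]
      by (subst transpose_mult[of _ n n _ n]) (auto simp: space_haar)
    then show "f (transpose_mat H * Q) = f (transpose_mat (transpose_mat Q * H))" by simp
  qed
  also have "\<dots> = (\<integral>\<^sup>+H. f (transpose_mat H) \<partial>?H)"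
    by (rule haar_nn_left[OF orthogonal_group_transpose[OF Q] fT])
  also have "\<dots> = (\<integral>\<^sup>+H. f H \<partial>?H)" by (rule haar_nn_transpose[OF f])
  finally show ?thesis .
qed

lemma haar_integral_eqI:
  fixes f :: "real mat \<Rightarrow> real"
  assumes T: "T \<in> measurable (haar_orthogonal n) (haar_orthogonal n)"
    and eq: "\<And>g. g \<in> borel_measurable (haar_orthogonal n) \<Longrightarrow>
      (\<integral>\<^sup>+H. g (T H) \<partial>haar_orthogonal n) = (\<integral>\<^sup>+H. g H \<partial>haar_orthogonal n)"
    and f: "f \<in> borel_measurable (haar_orthogonal n)"
  shows "(\<integral>H. f (T H) \<partial>haar_orthogonal n) = (\<integral>H. f H \<partial>haar_orthogonal n)"
proof -
  let ?H = "haar_orthogonal n"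
  have "distr ?H ?H T = ?H"
  proof (rule measure_eqI)
    fix B assume "B \<in> sets (distr ?H ?H T)"
    then have B: "B \<in> sets ?H" by simp
    have "emeasure (distr ?H ?H T) B = (\<integral>\<^sup>+x. indicator B x \<partial>distr ?H ?H T)" using B by simp
    also have "\<dots> = (\<integral>\<^sup>+x. indicator B (T x) \<partial>?H)" using T B by (intro nn_integral_distr) auto
    also have "\<dots> = emeasure ?H B" using eq[of "indicator B"] B by simp
    finally show "emeasure (distr ?H ?H T) B = emeasure ?H B" .
  qed simp
  then show ?thesis using integral_distr[OF T f] by simp
qed

lemma haar_left:
  fixes f :: "real mat \<Rightarrow> real"
  assumes Q: "Q \<in> orthogonal_group n" and f: "f \<in> borel_measurable (haar_orthogonal n)"
  shows "(\<integral>H. f (Q * H) \<partial>haar_orthogonal n) = (\<integral>H. f H \<partial>haar_orthogonal n)"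
  by (rule haar_integral_eqI[OF _ haar_nn_left[OF Q] f])
    (rule haar_mult_measurable[OF haar_const_measurable[OF Q] measurable_ident, unfolded id_def])

lemma haar_right:
  fixes f :: "real mat \<Rightarrow> real"
  assumes Q: "Q \<in> orthogonal_group n" and f: "f \<in> borel_measurable (haar_orthogonal n)"
  shows "(\<integral>H. f (H * Q) \<partial>haar_orthogonal n) = (\<integral>H. f H \<partial>haar_orthogonal n)"
  by (rule haar_integral_eqI[OF _ haar_nn_right[OF Q] f])
    (rule haar_mult_measurable[OF measurable_ident haar_const_measurable[OF Q], unfolded id_def])

definition ent :: "nat \<Rightarrow> (real mat \<Rightarrow> real) set" where
  "ent n = (\<lambda>ij H. H $$ ij) ` sq n"

lemma orthogonal_entry_le:
  assumes H: "H \<in> orthogonal_group n" and ij: "i < n" "j < n"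
  shows "\<bar>H $$ (i, j)\<bar> \<le> 1"
proof -
  have "(H $$ (i, j))\<^sup>2 \<le> (\<Sum>l<n. (H $$ (l, j))\<^sup>2)"
    by (rule member_le_sum) (use ij in auto)
  also have "\<dots> = 1" using orthogonal_cols[OF H ij(2,2)] by (simp add: power2_eq_square)
  finally show ?thesis by (simp add: abs_square_le_1)
qed

lemma ent_bounded:
  assumes "s \<in> ent n"
  shows "s \<in> borel_measurable (haar_orthogonal n)" "\<exists>B. \<forall>x\<in>space (haar_orthogonal n). \<bar>s x\<bar> \<le> B"
  using assms haar_entry orthogonal_entry_le by (auto simp: ent_def sq_def space_haar intro!: exI[of _ 1])

lemma haar_palg:
  assumes "palg (ent n) f"
  shows "f \<in> borel_measurable (haar_orthogonal n)" "integrable (haar_orthogonal n) f"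
proof -
  interpret prob_space "haar_orthogonal n" by (rule prob_space_haar)
  show "f \<in> borel_measurable (haar_orthogonal n)"
    by (rule palg_borel[OF assms ent_bounded(1)])
  show "integrable (haar_orthogonal n) f"
    by (rule palg_integrable[OF assms finite_measure_axioms ent_bounded])
qed

lemma palg_ent: "i < n \<Longrightarrow> j < n \<Longrightarrow> palg (ent n) (\<lambda>H. H $$ (i, j))"
  by (rule palg_base) (auto simp: ent_def sq_def)

section \<open>A Bessel inequality for zonal polynomials\<close>

lemma gram_symmetric: "gram n y (i, k) = gram n y (k, i)"
  by (simp add: gram_def mult.commute)

text \<open>The variance of a Gaussian linear form, quadratic in Y, becomes linear in YY'; this is
  how degree 2k in Y turns into degree k in the Gram matrix.\<close>

lemma dotp_gram:
  assumes B: "B \<in> carrier_mat n n"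
  shows "dotp (sq n) (($$) (transpose_mat B * Matrix.mat n n y)) (($$) (transpose_mat B * Matrix.mat n n y)) =
     dotp (sq n) (($$) (B * transpose_mat B)) (gram n y)"
proof -
  let ?Y = "Matrix.mat n n y"
  have "dotp (sq n) (($$) (transpose_mat B * ?Y)) (($$) (transpose_mat B * ?Y)) =
     dotp (sq n) (($$) (B * (transpose_mat B * ?Y))) (($$) ?Y)"
    using B by (intro dotp_mult_left) auto
  also have "B * (transpose_mat B * ?Y) = (B * transpose_mat B) * ?Y"
    using B by (simp add: assoc_mult_mat[of _ n n _ n _ n])
  also have "dotp (sq n) (($$) ((B * transpose_mat B) * ?Y)) (($$) ?Y) =
     dotp (sq n) (($$) (B * transpose_mat B)) (($$) (?Y * transpose_mat ?Y))"
    using B by (intro dotp_mult_right[symmetric]) auto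
  also have "\<dots> = dotp (sq n) (($$) (B * transpose_mat B)) (gram n y)"
    by (intro dotp_cong refl) (auto simp: sq_def gram_mat simp del: index_mult_mat)
  finally show ?thesis .
qed

lemma hp_gram:
  shows "hp (sq n) (2 * k) (\<lambda>y. dotp (sq n) A (gram n y) ^ k)"
proof -
  have "hp (sq n) 2 (\<lambda>y. dotp (sq n) A (gram n y))"
    unfolding dotp_def gram_def
  proof (intro hp_sum)
    fix a assume "a \<in> sq n"
    then obtain i k where a: "a = (i, k)" "i < n" "k < n" by (auto simp: sq_def)
    have "hp (sq n) 2 (\<lambda>y. A a * (\<Sum>j<n. y (i, j) * y (k, j)))"
      using a by (intro hp_cmult hp_sum hp_mult'[OF hp_coord hp_coord]) (auto simp: sq_def)
    then show "hp (sq n) 2 (\<lambda>y. A a * (case a of (i, k) \<Rightarrow> \<Sum>j<n. y (i, j) * y (k, j)))"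
      by (simp add: a)
  qed
  from hp_power[OF this, of k] show ?thesis by simp
qed

section \<open>Leading minors of a Gaussian matrix\<close>

lemma lm_affine:
  assumes "j < n"
  shows "lm (Suc j) (x((j, j) := y)) = lm (Suc j) (x((j, j) := 0)) + y * lm j x"
proof -
  define M where "M y = Matrix.mat (Suc j) (Suc j) (x((j, j) := y))" for y :: real
  have e: "lm (Suc j) (x((j, j) := y)) = (\<Sum>k<Suc j. M y $$ (j, k) * cofactor (M y) j k)" for y
    unfolding lm_def M_def by (intro laplace_expansion_row) auto
  have c: "cofactor (M y) j k = cofactor (M 0) j k" if "k < Suc j" for k
  proof -
    have "mat_delete (M y) j k = mat_delete (M 0) j k"
      by (rule eq_matI) (auto simp: mat_delete_def M_def)
    then show ?thesis by (simp add: cofactor_def)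
  qed
  have cj: "cofactor (M 0) j j = lm j x"
  proof -
    have "mat_delete (M 0) j j = Matrix.mat j j x"
      by (rule eq_matI) (auto simp: mat_delete_def M_def)
    then show ?thesis by (simp add: cofactor_def lm_def)
  qed
  have "(\<Sum>k<j. M y $$ (j, k) * cofactor (M y) j k) = (\<Sum>k<j. M 0 $$ (j, k) * cofactor (M 0) j k)"
    by (intro sum.cong refl) (simp add: c, simp add: M_def)
  then show ?thesis unfolding e sum.lessThan_Suc c[of j, simplified] cj by (simp add: M_def)
qed

lemma nrm_singleton: "emeasure nrm {y} = 0"
proof -
  have "emeasure nrm {y} = (\<integral>\<^sup>+x. ennreal (std_normal_density x) * indicator {y} x \<partial>lborel)"
    unfolding nrm_def by (subst emeasure_density) auto
  also have "\<dots> = 0"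
    by (subst nn_integral_0_iff_AE, simp, rule eventually_mono[OF AE_lborel_singleton[of y]], simp)
  finally show ?thesis .
qed

lemma lm_measurable:
  assumes "j \<le> n"
  shows "lm j \<in> borel_measurable (gauss (sq n))"
proof -
  have "palg {f. f \<in> borel_measurable (gauss (sq n))} (\<lambda>x. lm j x)"
    unfolding lm_def
    by (intro palg_det palg_base) (use assms in \<open>auto simp: sq_def intro!: gauss_component\<close>)
  then show ?thesis by (rule palg_borel) auto
qed

text \<open>The minor of order j + 1 is affine in its corner entry with slope the minor of order j.
  Where the slope is nonzero, the other coordinates leave one bad value of that entry, a null
  set.\<close>

lemma gauss_lm_nonzero:
  assumes "j \<le> n"
  shows "AE x in gauss (sq n). lm j x \<noteq> 0"
  using assms
proof (induction j)
  case 0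
  then show ?case by (simp add: lm_def)
next
  case (Suc j)
  define K where "K = sq n - {(j, j)}"
  have JK: "sq n = insert (j, j) K" and K: "finite K" "(j, j) \<notin> K" using Suc.prems by (auto simp: K_def sq_def)
  define N where "N = {x \<in> space (gauss (sq n)). lm j x \<noteq> 0 \<and> lm (Suc j) x = 0}"
  have N: "N \<in> sets (gauss (sq n))"
  proof -
    have [measurable]: "lm j \<in> borel_measurable (gauss (sq n))" "lm (Suc j) \<in> borel_measurable (gauss (sq n))"
      using Suc.prems by (auto intro: lm_measurable)
    show ?thesis unfolding N_def by measurable
  qed
  have "emeasure (gauss (sq n)) N = (\<integral>\<^sup>+x. indicator N x \<partial>gauss (sq n))" using N by simp
  also have "\<dots> = (\<integral>\<^sup>+x. \<integral>\<^sup>+y. indicator N (x((j, j) := y)) \<partial>nrm \<partial>gauss K)"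
    using N K unfolding JK gauss_def by (intro nrm_prod.product_nn_integral_insert) auto
  also have "\<dots> = (\<integral>\<^sup>+x. 0 \<partial>gauss K)"
  proof (rule nn_integral_cong)
    fix x :: "nat \<times> nat \<Rightarrow> real"
    have lmj: "lm j (x((j, j) := y)) = lm j x" for y by (rule lm_cong) auto
    define y0 where "y0 = - lm (Suc j) (x((j, j) := 0)) / lm j x"
    have y: "y = y0" if "x((j, j) := y) \<in> N" for y
    proof -
      have "lm j x \<noteq> 0" "lm (Suc j) (x((j, j) := 0)) + y * lm j x = 0"
        using that Suc.prems lm_affine[of j n x y] by (auto simp: N_def lmj)
      then have "y * lm j x = - lm (Suc j) (x((j, j) := 0))" by linarith
      with \<open>lm j x \<noteq> 0\<close> show ?thesis by (metis y0_def nonzero_eq_divide_eq)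
    qed
    have "indicator N (x((j, j) := y)) \<le> (indicator {y0} y :: ennreal)" for y
      using y[of y] by (cases "x((j, j) := y) \<in> N") auto
    then have "(\<integral>\<^sup>+y. indicator N (x((j, j) := y)) \<partial>nrm) \<le> (\<integral>\<^sup>+y. indicator {y0} y \<partial>nrm)"
      by (intro nn_integral_mono)
    also have "\<dots> = 0" by (simp add: nrm_singleton)
    finally show "(\<integral>\<^sup>+y. indicator N (x((j, j) := y)) \<partial>nrm) = 0" by simp
  qed
  finally have "AE x in gauss (sq n). x \<notin> N"
    using N by (intro AE_I[of _ _ N]) auto
  moreover have "AE x in gauss (sq n). lm j x \<noteq> 0" using Suc by simp
  ultimately show ?case by (elim AE_mp) (auto simp: N_def intro!: AE_I2)
qed

definition rmulk :: "nat \<Rightarrow> real mat \<Rightarrow> nat \<times> nat \<Rightarrow> nat \<times> nat \<Rightarrow> real" where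
  "rmulk n K a b = of_bool (fst a = fst b) * K $$ (snd b, snd a)"

lemma orthk_rmulk:
  assumes "K \<in> orthogonal_group n"
  shows "orthk (sq n) (rmulk n K)"
  unfolding orthk_def
proof (intro ballI)
  fix a b assume ab: "a \<in> sq n" "b \<in> sq n"
  have "(\<Sum>c\<in>sq n. rmulk n K c a * rmulk n K c b) =
     (\<Sum>i<n. \<Sum>j<n. if i = fst a then of_bool (fst a = fst b) * (K $$ (snd a, j) * K $$ (snd b, j)) else 0)"
    unfolding sq_def sum.cartesian_product' by (intro sum.cong refl) (auto simp: rmulk_def)
  also have "\<dots> = (\<Sum>j<n. of_bool (fst a = fst b) * (K $$ (snd a, j) * K $$ (snd b, j)))"
    by (subst sum.swap) (use ab in \<open>auto simp: sq_def intro!: sum.cong\<close>)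
  also have "\<dots> = of_bool (fst a = fst b) * of_bool (snd a = snd b)"
    unfolding sum_distrib_left[symmetric]
    by (subst orthogonal_rows[OF assms]) (use ab in \<open>auto simp: sq_def\<close>)
  also have "\<dots> = of_bool (a = b)" by (auto simp: prod_eq_iff)
  finally show "(\<Sum>c\<in>sq n. rmulk n K c a * rmulk n K c b) = of_bool (a = b)" .
qed

lemma lin_rmulk:
  assumes "i < n" "j < n"
  shows "lin (sq n) (rmulk n K) x (i, j) = (\<Sum>k<n. x (i, k) * K $$ (k, j))"
proof -
  have "(\<Sum>k<n. rmulk n K (i, j) (l, k) * x (l, k)) = (if l = i then (\<Sum>k<n. x (i, k) * K $$ (k, j)) else 0)" for l
    by (auto simp: rmulk_def intro!: sum.cong)
  then show ?thesis using assms unfolding lin_def sq_def sum.cartesian_product' by simp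
qed

section \<open>Apolar pairings of translated highest weight polynomials\<close>

lemma palg_conj:
  assumes "A \<in> carrier_mat n n" "i < n" "j < n"
    and "\<And>i j. i < n \<Longrightarrow> j < n \<Longrightarrow> palg S (\<lambda>x. P x $$ (i, j))"
    and "\<And>i j. i < n \<Longrightarrow> j < n \<Longrightarrow> palg S (\<lambda>x. Q x $$ (i, j))"
    and "\<And>x. P x \<in> carrier_mat n n" "\<And>x. Q x \<in> carrier_mat n n"
  shows "palg S (\<lambda>x. (P x * A * Q x) $$ (i, j))"
proof -
  have "(P x * A * Q x) $$ (i, j) = (\<Sum>k<n. (\<Sum>l<n. P x $$ (i, l) * A $$ (l, k)) * Q x $$ (k, j))" for x
  proof -
    have "(P x * A * Q x) $$ (i, j) = (\<Sum>k<n. (P x * A) $$ (i, k) * Q x $$ (k, j))"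
      using assms(1-3) assms(6,7)[of x] by (intro index_mult_sum) auto
    also have "\<dots> = (\<Sum>k<n. (\<Sum>l<n. P x $$ (i, l) * A $$ (l, k)) * Q x $$ (k, j))"
      using assms(1-3) assms(6,7)[of x] by (intro sum.cong refl arg_cong2[where f = "(*)"] index_mult_sum) auto
    finally show ?thesis .
  qed
  then show ?thesis using assms(2,3) by (simp only:) (intro palg_sum palg_mult palg_const assms(4,5); simp)
qed

text \<open>As a function of g the left side is a highest weight vector of weight l, as a function
  of h one of weight m, so \<open>Del_characterization\<close> applies to each variable. In either
  variable one triangular half of the equivariance comes from \<open>Del n m\<close>, the other from
  the functional dual to \<open>Del n l\<close>.\<close>

lemma app_translate:
  assumes l: "antimono l" "l n = 0" and m: "antimono m" "m n = 0"
    and lm: "(\<Sum>i<n. l i) = (\<Sum>i<n. m i)"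
    and ys: "rep (sq n) (\<Sum>i<n. l i) ys (Del n l)"
    and g: "g \<in> carrier_mat n n" and h: "h \<in> carrier_mat n n"
  shows "app ys (\<lambda>y. Del n m (($$) (g * Matrix.mat n n y * h))) =
    Del n l (($$) g) * Del n m (($$) h) * app ys (Del n m)"
proof -
  define F where "F g h = app ys (\<lambda>y. Del n m (($$) (g * Matrix.mat n n y * h)))" for g h
  have Q: "hp (sq n) (\<Sum>i<n. l i) (\<lambda>y. Del n m (($$) (g * Matrix.mat n n y * h)))"
    if "g \<in> carrier_mat n n" "h \<in> carrier_mat n n" for g h
  proof -
    have "hp (sq n) (\<Sum>i<n. l i) (\<lambda>y. Del n m (($$) (Matrix.mat n n y)))"
      unfolding lm Del_mat by (rule hp_Del[OF m])
    from hp_right_mult[OF this that(2)]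
    have "hp (sq n) (\<Sum>i<n. l i) (\<lambda>y. (\<lambda>f. Del n m (($$) (Matrix.mat n n f * h))) (($$) (Matrix.mat n n y)))"
      by (rule iffD1[OF arg_cong[where f = "hp (sq n) _"], rotated])
        (auto intro!: Del_cong arg_cong[where f = "\<lambda>M. Del n m (($$) (M * h))"] eq_matI)
    from hp_left_mult[OF this that(1)]
    show ?thesis
    proof (rule iffD1[OF arg_cong[where f = "hp (sq n) _"], rotated], intro ext)
      fix y :: "nat \<times> nat \<Rightarrow> real"
      have "Matrix.mat n n (($$) (g * Matrix.mat n n y)) = g * Matrix.mat n n y"
        using that by (intro eq_matI) auto
      then show "Del n m (($$) (Matrix.mat n n (($$) (g * Matrix.mat n n y)) * h)) =
        Del n m (($$) (g * Matrix.mat n n y * h))" by simp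
    qed
  qed
  have eqv: "F (g * transpose_mat A) (transpose_mat B * h) = c * F g h"
    if gh: "g \<in> carrier_mat n n" "h \<in> carrier_mat n n" and AB: "A \<in> carrier_mat n n" "B \<in> carrier_mat n n"
      and c: "\<And>X. X \<in> carrier_mat n n \<Longrightarrow> Del n l (($$) (A * X * B)) = c * Del n l (($$) X)" for g h A B c
  proof -
    have "app ys (\<lambda>y. (\<lambda>y. Del n m (($$) (g * Matrix.mat n n y * h)))
        (($$) (transpose_mat A * Matrix.mat n n y * transpose_mat B))) = c * F g h"
      unfolding F_def by (rule app_equivariant[OF ys AB c Q[OF gh]])
    moreover have "g * Matrix.mat n n (($$) (transpose_mat A * Matrix.mat n n y * transpose_mat B)) * h =
      g * transpose_mat A * Matrix.mat n n y * (transpose_mat B * h)" for y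
    proof -
      have "Matrix.mat n n (($$) (transpose_mat A * Matrix.mat n n y * transpose_mat B)) =
         transpose_mat A * Matrix.mat n n y * transpose_mat B"
        using AB by (intro eq_matI) auto
      moreover have "g * (transpose_mat A * Matrix.mat n n y * transpose_mat B) * h =
          g * transpose_mat A * Matrix.mat n n y * (transpose_mat B * h)"
        using AB gh by (simp add: assoc_mult_mat[of _ n n _ n _ n] mult_carrier_mat[of _ n n _ n])
      ultimately show ?thesis by simp
    qed
    ultimately show ?thesis by (simp add: F_def)
  qed
  have one: "Del n l (($$) (1\<^sub>m n * X * B)) = Del n l (($$) B) * Del n l (($$) X)"
    if "X \<in> carrier_mat n n" "upper_tri n B" for X B
    using that by (simp add: Del_mult_upper)
  have F1: "F g h = Del n l (($$) g) * F (1\<^sub>m n) h" if gh: "g \<in> carrier_mat n n" "h \<in> carrier_mat n n" for g h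
  proof (rule Del_characterization[OF l _ _ _ gh(1), of "\<lambda>g. F g h"])
    fix L X :: "real mat" assume L: "unit_lower n L" and X: "X \<in> carrier_mat n n"
    have Lt: "lower_tri n L" "L \<in> carrier_mat n n" using L by (auto simp: unit_lower_def lower_tri_def)
    have "Del n m (($$) (L * X * Matrix.mat n n y * h)) = Del n m (($$) (X * Matrix.mat n n y * h))" for y
    proof -
      have "L * X * Matrix.mat n n y * h = L * (X * Matrix.mat n n y * h)"
        using Lt X gh by (simp add: assoc_mult_mat[of _ n n _ n _ n])
      moreover have "X * Matrix.mat n n y * h \<in> carrier_mat n n"
        using X gh by (intro mult_carrier_mat[of _ n n _ n]) auto
      ultimately show ?thesis using Del_mult_lower[OF Lt(1), of "X * Matrix.mat n n y * h" m]
        by (simp add: unit_lower_Del[OF L m])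
    qed
    then show "F (L * X) h = F X h" by (simp add: F_def)
  next
    fix U assume U: "upper_tri n U"
    have Uc: "U \<in> carrier_mat n n" using U by (simp add: upper_tri_def)
    have low: "lower_tri n (transpose_mat U)" using U by (auto simp: upper_tri_def lower_tri_def)
    have "F (1\<^sub>m n * transpose_mat (transpose_mat U)) (transpose_mat (1\<^sub>m n) * h) = Del n l (($$) U) * F (1\<^sub>m n) h"
    proof (rule eqv)
      fix X :: "real mat" assume "X \<in> carrier_mat n n"
      then show "Del n l (($$) (transpose_mat U * X * 1\<^sub>m n)) = Del n l (($$) U) * Del n l (($$) X)"
        using low Uc by (simp add: Del_mult_lower Del_transpose)
    qed (use gh Uc in auto)
    then show "F U h = Del n l (($$) U) * F (1\<^sub>m n) h" using Uc gh by simp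
  next
    fix X :: "real mat" assume X: "X \<in> carrier_mat n n"
    show "palg {\<lambda>t. t} (\<lambda>t. F (shift_mat n X t) h)"
      unfolding F_def
      by (intro palg_app palg_Del palg_conj palg_shift_mat palg_const) (use X gh in auto)
  qed
  have F2: "F (1\<^sub>m n) h = Del n m (($$) h) * F (1\<^sub>m n) (1\<^sub>m n)" if hc: "h \<in> carrier_mat n n" for h
  proof (rule Del_characterization[OF m _ _ _ hc, of "\<lambda>h. F (1\<^sub>m n) h"])
    fix L X :: "real mat" assume L: "unit_lower n L" and X: "X \<in> carrier_mat n n"
    have Lt: "lower_tri n L" "L \<in> carrier_mat n n" using L by (auto simp: unit_lower_def lower_tri_def)
    have "F (1\<^sub>m n * transpose_mat (1\<^sub>m n)) (transpose_mat (transpose_mat L) * X) = 1 * F (1\<^sub>m n) X"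
    proof (rule eqv)
      fix X :: "real mat" assume "X \<in> carrier_mat n n"
      then show "Del n l (($$) (1\<^sub>m n * X * transpose_mat L)) = 1 * Del n l (($$) X)"
        using one[OF _ lower_tri_transpose[OF Lt(1)]] unit_lower_Del[OF L l] Del_transpose[OF Lt(2)] by simp
    qed (use X Lt in auto)
    then show "F (1\<^sub>m n) (L * X) = F (1\<^sub>m n) X" using Lt X by simp
  next
    fix U assume U: "upper_tri n U"
    have Uc: "U \<in> carrier_mat n n" using U by (simp add: upper_tri_def)
    show "F (1\<^sub>m n) U = Del n m (($$) U) * F (1\<^sub>m n) (1\<^sub>m n)"
      unfolding F_def app_cmult[symmetric]
      using Uc by (intro app_cong) (simp add: Del_mult_upper[OF U])
  next
    fix X :: "real mat" assume X: "X \<in> carrier_mat n n"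
    show "palg {\<lambda>t. t} (\<lambda>t. F (1\<^sub>m n) (shift_mat n X t))"
      unfolding F_def
      by (intro palg_app palg_Del palg_conj palg_shift_mat palg_const) (use X in auto)
  qed
  have "F (1\<^sub>m n) (1\<^sub>m n) = app ys (Del n m)"
  proof -
    have "Del n m (($$) (1\<^sub>m n * Matrix.mat n n y * 1\<^sub>m n)) = Del n m y" for y by simp
    then show ?thesis by (simp add: F_def)
  qed
  then show ?thesis using F1[OF g h] F2[OF h] by (simp add: F_def)
qed

text \<open>Doubling row i multiplies the pairing by 2^(l i) according to
  \<open>app_translate\<close> and by 2^(m i) according to \<open>Del n m\<close> itself.\<close>

lemma app_orthogonal:
  assumes l: "antimono l" "l n = 0" and m: "antimono m" "m n = 0"
    and lm: "(\<Sum>i<n. l i) = (\<Sum>i<n. m i)"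
    and ys: "rep (sq n) (\<Sum>i<n. l i) ys (Del n l)"
    and ne: "i < n" "l i \<noteq> m i"
  shows "app ys (Del n m) = 0"
proof -
  define D where "D = Matrix.mat n n (\<lambda>(a, b). if a = b then (if a = i then 2 else 1) else (0::real))"
  have Dl: "lower_tri n D" and Dc: "D \<in> carrier_mat n n" by (auto simp: lower_tri_def D_def)
  have DD: "Del n k (($$) D) = 2 ^ k i" if k: "antimono k" "k n = 0" for k
  proof -
    have "Del n k (($$) D) = (\<Prod>a<n. D $$ (a, a) ^ k a)"
      using Dl by (intro Del_lower[OF k]) (auto simp: lower_tri_def)
    also have "\<dots> = (\<Prod>a<n. if a = i then 2 ^ k i else 1)"
      by (intro prod.cong) (auto simp: D_def)
    finally show ?thesis using ne(1) by simp
  qed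
  have "app ys (\<lambda>y. Del n m (($$) (D * Matrix.mat n n y * 1\<^sub>m n))) = 2 ^ l i * app ys (Del n m)"
    using app_translate[OF l m lm ys Dc, of "1\<^sub>m n"] by (simp add: DD[OF l] Del_one[OF m])
  moreover have "Del n m (($$) (D * Matrix.mat n n y * 1\<^sub>m n)) = 2 ^ m i * Del n m y" for y
    using Dc Del_mult_lower[OF Dl, of "Matrix.mat n n y" m] by (simp add: DD[OF m])
  ultimately have "2 ^ m i * app ys (Del n m) = 2 ^ l i * app ys (Del n m)" by (simp add: app_cmult)
  then show ?thesis using ne(2) by (auto simp: power_inject_exp)
qed

section \<open>Spherical functions with their Haar and Gaussian constants\<close>

definition sph :: "nat \<Rightarrow> (nat \<Rightarrow> nat) \<Rightarrow> real mat \<Rightarrow> real" where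
  "sph n l A = (\<integral>H. Del n l (($$) (transpose_mat H * A * H)) \<partial>haar_orthogonal n)"

text \<open>Doubling the parts squares the polynomial (\<open>Del_double\<close>), so this is a mean
  square, and so is \<open>gauss_const\<close>.\<close>

definition haar_const :: "nat \<Rightarrow> (nat \<Rightarrow> nat) \<Rightarrow> real" where
  "haar_const n l = (\<integral>K. Del n (\<lambda>i. 2 * l i) (($$) K) \<partial>haar_orthogonal n)"

definition gauss_const :: "nat \<Rightarrow> (nat \<Rightarrow> nat) \<Rightarrow> real" where
  "gauss_const n l = (\<integral>x. Del n (\<lambda>i. 2 * l i) x \<partial>gauss (sq n))"

lemma haar_mult_left_palg:
  assumes "G \<in> carrier_mat n n"
  shows "palg (ent n) (\<lambda>K. Del n l (\<lambda>(i, j). \<Sum>k<n. G $$ (i, k) * K $$ (k, j)))"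
  by (intro palg_Del, unfold prod.case) (intro palg_sum palg_mult palg_const palg_ent, auto)

lemma Del_mult_expand:
  assumes "G \<in> carrier_mat n n" "K \<in> carrier_mat n n"
  shows "Del n l (($$) (G * K)) = Del n l (\<lambda>(i, j). \<Sum>k<n. G $$ (i, k) * K $$ (k, j))"
  using assms by (intro Del_cong) (simp add: index_mult_sum[of _ n n _ n] del: index_mult_mat(1))

text \<open>Left invariance in K allows G to be replaced by a lower triangular L = G K0. There the
  integrand factors, and the square of \<open>Del n l\<close> at L is its value at LL' =
  GG'.\<close>

lemma haar_average_right:
  assumes G: "G \<in> carrier_mat n n" and l: "antimono l" "l n = 0"
  shows "(\<integral>K. Del n (\<lambda>i. 2 * l i) (($$) (G * K)) \<partial>haar_orthogonal n) =
    haar_const n l * Del n l (($$) (G * transpose_mat G))"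
proof -
  let ?H = "haar_orthogonal n"
  let ?l = "\<lambda>i. 2 * l i"
  obtain K0 where K0: "K0 \<in> orthogonal_group n" "lower_tri n (G * K0)" using LQ_decomposition[OF G] by blast
  define L where "L = G * K0"
  note K0c = orthogonal_groupD[OF K0(1)]
  have Lc: "L \<in> carrier_mat n n" "lower_tri n L" using K0 G K0c by (auto simp: L_def)
  define f where "f K = Del n ?l (\<lambda>(i, j). \<Sum>k<n. L $$ (i, k) * K $$ (k, j))" for K
  have fm: "f \<in> borel_measurable ?H" unfolding f_def by (rule haar_palg(1)[OF haar_mult_left_palg[OF Lc(1)]])
  have "(\<integral>K. Del n ?l (($$) (G * K)) \<partial>?H) = (\<integral>K. f (transpose_mat K0 * K) \<partial>?H)"
  proof (rule Bochner_Integration.integral_cong)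
    fix K assume "K \<in> space ?H"
    then have Kc: "K \<in> carrier_mat n n" using orthogonal_groupD(1) by (auto simp: space_haar)
    have "L * (transpose_mat K0 * K) = G * (K0 * transpose_mat K0) * K"
      using G K0c(1) Kc by (simp add: L_def assoc_mult_mat[of _ n n _ n _ n])
    also have "\<dots> = G * K" using G K0c(3) by simp
    finally show "Del n ?l (($$) (G * K)) = f (transpose_mat K0 * K)"
      unfolding f_def using Del_mult_expand[of L n "transpose_mat K0 * K" ?l] Lc K0c(1) Kc by simp
  qed simp
  also have "\<dots> = (\<integral>K. f K \<partial>?H)" by (rule haar_left[OF orthogonal_group_transpose[OF K0(1)] fm])
  also have "\<dots> = (\<integral>K. Del n ?l (($$) L) * Del n ?l (($$) K) \<partial>?H)"
  proof (rule Bochner_Integration.integral_cong)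
    fix K assume "K \<in> space ?H"
    then have Kc: "K \<in> carrier_mat n n" using orthogonal_groupD(1) by (auto simp: space_haar)
    show "f K = Del n ?l (($$) L) * Del n ?l (($$) K)"
      unfolding f_def Del_mult_expand[OF Lc(1) Kc, symmetric] by (rule Del_mult_lower[OF Lc(2) Kc])
  qed simp
  also have "\<dots> = Del n ?l (($$) L) * haar_const n l" by (simp add: haar_const_def)
  also have "Del n ?l (($$) L) = Del n l (($$) (G * transpose_mat G))"
    unfolding Del_double Del_gram_lower[OF Lc(2), symmetric] unfolding L_def gram_orthogonal[OF G K0(1)] ..
  finally show ?thesis by simp
qed

lemma haar_const_nonneg: "haar_const n l \<ge> 0"
  unfolding haar_const_def Del_double by (intro Bochner_Integration.integral_nonneg) simp

context
  fixes n :: nat and l :: "nat \<Rightarrow> nat" and ys :: "(real \<times> (nat \<times> nat \<Rightarrow> real)) list" and k :: nat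
  assumes l: "antimono l" "l n = 0" and k: "(\<Sum>i<n. l i) = k"
    and ys: "rep (sq n) (\<Sum>i<n. 2 * l i) ys (Del n (\<lambda>i. 2 * l i))"
begin

private lemma k2: "(\<Sum>i<n. 2 * l i) = 2 * k"
  using k by (simp add: sum_distrib_left[symmetric])

private lemma l2: "antimono (\<lambda>i. 2 * l i)" "2 * l n = 0"
  using l by (auto simp: antimono_def)

lemma Del_rep: "Del n (\<lambda>i. 2 * l i) x = app ys (\<lambda>y. dotp (sq n) x y ^ (2 * k))"
  using ys unfolding rep_def k2 by blast

text \<open>Each term <BX, Y> = <X, B'Y> is a Gaussian variable of variance <BB', YY'>; its moment
  of order 2k is taken term by term.\<close>

lemma gauss_Del_left:
  assumes B: "B \<in> carrier_mat n n"
  shows "has_bochner_integral (gauss (sq n)) (\<lambda>x. Del n (\<lambda>i. 2 * l i) (($$) (B * Matrix.mat n n x)))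
     (dfact k * app ys (\<lambda>y. dotp (sq n) (($$) (B * transpose_mat B)) (gram n y) ^ k))"
proof -
  have e: "Del n (\<lambda>i. 2 * l i) (($$) (B * Matrix.mat n n x)) =
     app ys (\<lambda>y. dotp (sq n) (($$) (transpose_mat B * Matrix.mat n n y)) x ^ (2 * k))" for x
  proof -
    have "dotp (sq n) (($$) (B * Matrix.mat n n x)) y =
        dotp (sq n) (($$) (transpose_mat B * Matrix.mat n n y)) x" for y
      using dotp_mult_left[OF B, of "Matrix.mat n n x" "Matrix.mat n n y"]
      by (simp add: dotp_commute)
    then show ?thesis unfolding Del_rep by simp
  qed
  have hb: "has_bochner_integral (gauss (sq n)) (\<lambda>x. dotp (sq n) (($$) (transpose_mat B * Matrix.mat n n y)) x ^ (2 * k))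
     (dfact k * dotp (sq n) (($$) (B * transpose_mat B)) (gram n y) ^ k)" for y
    using gauss_dotp_moment[OF finite_sq, of n "($$) (transpose_mat B * Matrix.mat n n y)" k]
    unfolding dotp_gram[OF B] .
  show ?thesis unfolding e has_bochner_integral_iff
    using app_integral[of "gauss (sq n)" "\<lambda>x y. dotp (sq n) (($$) (transpose_mat B * Matrix.mat n n y)) x ^ (2 * k)" ys]
      hb unfolding has_bochner_integral_iff by (simp add: app_cmult)
qed

lemma gauss_const_integral:
  "has_bochner_integral (gauss (sq n)) (Del n (\<lambda>i. 2 * l i)) (gauss_const n l)"
proof -
  have "has_bochner_integral (gauss (sq n)) (\<lambda>x. Del n (\<lambda>i. 2 * l i) (($$) (1\<^sub>m n * Matrix.mat n n x)))
     (dfact k * app ys (\<lambda>y. dotp (sq n) (($$) (1\<^sub>m n * transpose_mat (1\<^sub>m n))) (gram n y) ^ k))"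
    by (rule gauss_Del_left) simp
  then have "integrable (gauss (sq n)) (Del n (\<lambda>i. 2 * l i))"
    unfolding has_bochner_integral_iff by simp
  then show ?thesis by (simp add: has_bochner_integral_iff gauss_const_def)
qed

text \<open>Average the square of \<open>Del n l\<close> at X K over a Gaussian X and a Haar K. For
  fixed K rotation invariance returns the Gaussian mean; for fixed X
  \<open>haar_average_right\<close> leaves a Wishart integrand.\<close>

lemma gauss_const_haar: "gauss_const n l = haar_const n l * wishart_const n l"
proof -
  let ?H = "haar_orthogonal n" and ?G = "gauss (sq n)"
  let ?D = "Del n (\<lambda>i. 2 * l i)"
  interpret H: prob_space ?H by (rule prob_space_haar)
  interpret G: prob_space ?G by (rule prob_space_gauss)
  interpret P: pair_sigma_finite ?H ?G by standard
  have D0: "?D x \<ge> 0" for x by (simp add: Del_double)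
  have gm: "(\<lambda>x. x (i, j)) \<in> borel_measurable ?G" if "i < n" "j < n" for i j
    by (rule gauss_component) (use that in \<open>simp add: sq_def\<close>)
  have Dm: "(\<lambda>x. ennreal (?D x)) \<in> borel_measurable ?G"
    by (intro measurable_compose[OF _ measurable_ennreal] Del_measurable gm)
  define f where "f x K = ?D (\<lambda>(i, j). \<Sum>k<n. x (i, k) * K $$ (k, j))" for x K
  have "(\<lambda>z. ennreal (f (snd z) (fst z))) \<in> borel_measurable (?H \<Otimes>\<^sub>M ?G)"
    unfolding f_def
    by (intro measurable_compose[OF _ measurable_ennreal] Del_measurable, unfold prod.case)
      (intro borel_measurable_sum borel_measurable_times measurable_compose[OF measurable_snd gm]
        measurable_compose[OF measurable_fst haar_entry], auto)
  then have fm: "(\<lambda>(K, x). ennreal (f x K)) \<in> borel_measurable (?H \<Otimes>\<^sub>M ?G)"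
    by (simp add: case_prod_beta')
  have 1: "(\<integral>\<^sup>+x. ennreal (f x K) \<partial>?G) = (\<integral>\<^sup>+x. ennreal (?D x) \<partial>?G)" if "K \<in> space ?H" for K
  proof -
    have pr: "preserves (sq n) (lin (sq n) (rmulk n K))"
      using that by (intro preserves_lin orthk_rmulk) (auto simp: space_haar)
    have "f x K = ?D (lin (sq n) (rmulk n K) x)" for x
      unfolding f_def by (rule Del_cong) (simp add: lin_rmulk)
    then show ?thesis using bspec[OF conjunct2[OF pr[unfolded preserves_def]] Dm] by simp
  qed
  have 2: "(\<integral>\<^sup>+K. ennreal (f x K) \<partial>?H) = ennreal (haar_const n l) * ennreal (Del n l (gram n x))" for x
  proof -
    let ?X = "Matrix.mat n n x"
    have pal: "palg (ent n) (\<lambda>K. f x K)" unfolding f_def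
      by (intro palg_Del, unfold prod.case) (intro palg_sum palg_mult palg_const palg_ent, auto)
    have fe: "f x K = ?D (($$) (?X * K))" if "K \<in> space ?H" for K
    proof -
      have Kc: "K \<in> carrier_mat n n" using that orthogonal_groupD(1) by (auto simp: space_haar)
      show ?thesis unfolding f_def Del_mult_expand[OF mat_carrier Kc]
        by (rule Del_cong) auto
    qed
    have "(\<integral>\<^sup>+K. ennreal (f x K) \<partial>?H) = ennreal (\<integral>K. f x K \<partial>?H)"
      using haar_palg(2)[OF pal] by (intro nn_integral_eq_integral) (auto simp: f_def D0)
    also have "(\<integral>K. f x K \<partial>?H) = (\<integral>K. ?D (($$) (?X * K)) \<partial>?H)"
      by (intro Bochner_Integration.integral_cong fe refl)
    also have "\<dots> = haar_const n l * Del n l (gram n x)"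
      by (subst haar_average_right[OF _ l]) (auto simp: Del_gram)
    finally show ?thesis by (simp add: ennreal_mult haar_const_nonneg Del_gram_nonneg)
  qed
  have "ennreal (gauss_const n l) = (\<integral>\<^sup>+x. ennreal (?D x) \<partial>?G)"
    using gauss_const_integral by (subst nn_integral_eq_integral) (auto simp: has_bochner_integral_iff D0)
  also have "\<dots> = (\<integral>\<^sup>+K. (\<integral>\<^sup>+x. ennreal (f x K) \<partial>?G) \<partial>?H)"
    using nn_integral_cong[of ?H "\<lambda>K. \<integral>\<^sup>+x. ennreal (f x K) \<partial>?G" "\<lambda>K. \<integral>\<^sup>+x. ennreal (?D x) \<partial>?G", OF 1]
    by (simp add: H.emeasure_space_1)
  also have "\<dots> = (\<integral>\<^sup>+x. (\<integral>\<^sup>+K. ennreal (f x K) \<partial>?H) \<partial>?G)"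
    using P.Fubini'[OF fm] by simp
  also have "\<dots> = ennreal (haar_const n l) * (\<integral>\<^sup>+x. ennreal (Del n l (gram n x)) \<partial>?G)"
    unfolding 2
  proof (rule nn_integral_cmult)
    show "(\<lambda>x. ennreal (Del n l (gram n x))) \<in> borel_measurable ?G"
      unfolding gram_def
      by (intro measurable_compose[OF _ measurable_ennreal] Del_measurable, unfold prod.case)
        (intro borel_measurable_sum borel_measurable_times gm, auto)
  qed
  also have "\<dots> = ennreal (haar_const n l * wishart_const n l)"
    unfolding gauss_wishart[OF l] by (simp add: ennreal_mult' haar_const_nonneg)
  finally show ?thesis
  proof (rule ennreal_inj[THEN iffD1, rotated 2])
    show "gauss_const n l \<ge> 0" unfolding gauss_const_def using D0 by (rule Bochner_Integration.integral_nonneg)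
    show "haar_const n l * wishart_const n l \<ge> 0"
      unfolding wishart_const_def
      by (intro mult_nonneg_nonneg haar_const_nonneg prod_nonneg ballI pochhammer_nonneg') auto
  qed
qed

text \<open>The integrand is a square that is almost surely nonzero.\<close>

lemma gauss_const_pos: "gauss_const n l > 0"
proof -
  have nn: "AE x in gauss (sq n). Del n (\<lambda>i. 2 * l i) x \<ge> 0" by (simp add: Del_double)
  have "AE x in gauss (sq n). \<forall>j\<in>{..<n}. lm (Suc j) x \<noteq> 0"
    by (intro AE_finite_allI gauss_lm_nonzero) auto
  then have pos: "AE x in gauss (sq n). Del n (\<lambda>i. 2 * l i) x \<noteq> 0"
    by (rule AE_mp) (auto intro!: AE_I2 simp: Del_def)
  interpret prob_space "gauss (sq n)" by (rule prob_space_gauss)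
  have int: "integrable (gauss (sq n)) (Del n (\<lambda>i. 2 * l i))"
    using gauss_const_integral by (simp add: has_bochner_integral_iff)
  have "gauss_const n l \<ge> 0" unfolding gauss_const_def
    by (intro Bochner_Integration.integral_nonneg) (simp add: Del_double)
  moreover have "gauss_const n l \<noteq> 0"
  proof
    assume "gauss_const n l = 0"
    then have "AE x in gauss (sq n). Del n (\<lambda>i. 2 * l i) x = 0"
      using integral_nonneg_eq_0_iff_AE[OF int nn] by (simp add: gauss_const_def)
    with pos have "AE x in gauss (sq n). False" by eventually_elim simp
    then show False using AE_False not_empty by (simp add: emeasure_space_1)
  qed
  ultimately show ?thesis by simp
qed

text \<open>The identity is computed for \<open>A = B B'\<close> with \<open>B\<close> lower triangular and extends to all symmetric \<open>A\<close>
  polynomially.\<close>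

lemma Del_symmetric_rep:
  assumes A: "A \<in> carrier_mat n n" "transpose_mat A = A"
  shows "gauss_const n l * Del n l (($$) A) = dfact k * app ys (\<lambda>y. dotp (sq n) (($$) A) (gram n y) ^ k)"
proof -
  define T where "T X = app ys (\<lambda>y. dotp (sq n) (($$) X) (gram n y) ^ k)" for X
  have Tinv: "T (L * X * transpose_mat L) = T X" if L: "unit_lower n L" and X: "X \<in> carrier_mat n n" for L X
  proof -
    have Lt: "lower_tri n L" "L \<in> carrier_mat n n" using L by (auto simp: unit_lower_def lower_tri_def)
    have "app ys (\<lambda>y. (\<lambda>y. dotp (sq n) (($$) X) (gram n y) ^ k)
        (($$) (transpose_mat L * Matrix.mat n n y * transpose_mat (1\<^sub>m n)))) = 1 * T X"
      unfolding T_def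
    proof (rule app_equivariant[OF ys Lt(2)])
      fix X :: "real mat" assume "X \<in> carrier_mat n n"
      then show "Del n (\<lambda>i. 2 * l i) (($$) (L * X * 1\<^sub>m n)) = 1 * Del n (\<lambda>i. 2 * l i) (($$) X)"
        using Lt unit_lower_Del[OF L l2] by (simp add: Del_mult_lower)
    qed (simp_all add: k2 hp_gram)
    moreover have "dotp (sq n) (($$) X) (gram n (($$) (transpose_mat L * Matrix.mat n n y * transpose_mat (1\<^sub>m n)))) =
      dotp (sq n) (($$) (L * X * transpose_mat L)) (gram n y)" for y
    proof -
      let ?Y = "Matrix.mat n n y"
      let ?Z = "transpose_mat L * ?Y"
      have Zc: "?Z \<in> carrier_mat n n" using Lt by simp
      have g: "dotp (sq n) (($$) M) (gram n (($$) W)) = dotp (sq n) (($$) (M * W)) (($$) W)"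
        if "M \<in> carrier_mat n n" "W \<in> carrier_mat n n" for M W
      proof -
        have "dotp (sq n) (($$) M) (gram n (($$) W)) = dotp (sq n) (($$) M) (($$) (W * transpose_mat W))"
        proof (intro dotp_cong refl)
          fix a assume "a \<in> sq n"
          then obtain i j where a: "a = (i, j)" "i < n" "j < n" by (auto simp: sq_def)
          have "(W * transpose_mat W) $$ (i, j) = (\<Sum>c<n. W $$ (i, c) * transpose_mat W $$ (c, j))"
            using that a by (intro index_mult_sum) auto
          then show "gram n (($$) W) a = (W * transpose_mat W) $$ a"
            using that a by (simp add: gram_def)
        qed
        also have "\<dots> = dotp (sq n) (($$) (M * W)) (($$) W)" using that by (intro dotp_mult_right) auto
        finally show ?thesis .
      qed
      have "dotp (sq n) (($$) X) (gram n (($$) ?Z)) = dotp (sq n) (($$) (X * ?Z)) (($$) ?Z)"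
        using g X Zc by blast
      also have "\<dots> = dotp (sq n) (($$) (L * (X * ?Z))) (($$) ?Y)"
        using X Lt by (intro dotp_mult_left) auto
      also have "L * (X * ?Z) = (L * X * transpose_mat L) * ?Y"
        using X Lt by (simp add: assoc_mult_mat[of _ n n _ n _ n])
      also have "dotp (sq n) (($$) ((L * X * transpose_mat L) * ?Y)) (($$) ?Y) =
          dotp (sq n) (($$) (L * X * transpose_mat L)) (gram n (($$) ?Y))"
        using g[of "L * X * transpose_mat L" ?Y] X Lt by simp
      also have "\<dots> = dotp (sq n) (($$) (L * X * transpose_mat L)) (gram n y)"
        by (intro dotp_cong refl) (auto simp: sq_def gram_def)
      finally show ?thesis using Zc Lt by simp
    qed
    ultimately show ?thesis by (simp add: T_def)
  qed
  have Tlow: "gauss_const n l * Del n l (($$) (B * transpose_mat B)) = dfact k * T (B * transpose_mat B)"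
    if B: "lower_tri n B" for B
  proof -
    have Bc: "B \<in> carrier_mat n n" using B by (simp add: lower_tri_def)
    have "dfact k * T (B * transpose_mat B) = (\<integral>x. Del n (\<lambda>i. 2 * l i) (($$) (B * Matrix.mat n n x)) \<partial>gauss (sq n))"
      using gauss_Del_left[OF Bc] by (simp add: has_bochner_integral_iff T_def)
    also have "\<dots> = (\<integral>x. Del n (\<lambda>i. 2 * l i) (($$) B) * Del n (\<lambda>i. 2 * l i) x \<partial>gauss (sq n))"
      by (subst Del_mult_lower[OF B]) auto
    also have "\<dots> = Del n (\<lambda>i. 2 * l i) (($$) B) * gauss_const n l" by (simp add: gauss_const_def)
    also have "Del n (\<lambda>i. 2 * l i) (($$) B) = Del n l (($$) (B * transpose_mat B))"
      unfolding Del_double Del_gram_lower[OF B] ..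
    finally show ?thesis by simp
  qed
  obtain t0 where t0: "\<And>t j. t > t0 \<Longrightarrow> j \<le> n \<Longrightarrow> lm j (($$) (shift_mat n A t)) > 0"
    using lm_shift_pos[OF A(1)] by blast
  have large: "gauss_const n l * Del n l (($$) (shift_mat n A t)) = dfact k * T (shift_mat n A t)" if t: "t > t0" for t
  proof -
    define X where "X = shift_mat n A t"
    have Xc: "X \<in> carrier_mat n n" by (simp add: X_def)
    have Asym: "A $$ (i, j) = A $$ (j, i)" if "i < n" "j < n" for i j
      using A that by (metis carrier_matD index_transpose_mat(1))
    have Xs: "transpose_mat X = X"
      by (rule eq_matI) (auto simp: X_def shift_mat_def Asym)
    obtain L where L: "unit_lower n L" "upper_tri n (L * X)"
      using LU_elimination[OF Xc] t0[OF t] by (force simp: X_def)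
    have Lt: "lower_tri n L" "L \<in> carrier_mat n n" using L by (auto simp: unit_lower_def lower_tri_def)
    \<comment> \<open>Two-sided elimination: L X L' is upper triangular and symmetric, hence
      diagonal. Its leading minors are those of X, so the diagonal is positive and has a square root
      B.\<close>
    define D where "D = L * X * transpose_mat L"
    have Dc: "D \<in> carrier_mat n n" using Lt Xc by (simp add: D_def)
    have Dup: "D $$ (i, j) = 0" if "i < n" "j < n" "j < i" for i j
    proof -
      have "D $$ (i, j) = (\<Sum>c<n. (L * X) $$ (i, c) * transpose_mat L $$ (c, j))"
        unfolding D_def using Lt Xc that by (intro index_mult_sum[of _ n n _ n]) auto
      also have "\<dots> = 0"
      proof (rule sum.neutral, rule ballI)
        fix c assume c: "c \<in> {..<n}"
        show "(L * X) $$ (i, c) * transpose_mat L $$ (c, j) = 0"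
        proof (cases "c < i")
          case True
          then have "(L * X) $$ (i, c) = 0" using L(2) c that by (auto simp: upper_tri_def)
          then show ?thesis by simp
        next
          case False
          then have "L $$ (j, c) = 0" using Lt(1) c that by (auto simp: lower_tri_def)
          then show ?thesis using Lt(2) c that by simp
        qed
      qed
      finally show ?thesis .
    qed
    have Dsym: "D $$ (i, j) = D $$ (j, i)" if "i < n" "j < n" for i j
    proof -
      have "transpose_mat D = D"
        unfolding D_def using Lt Xc Xs by (simp add: transpose_mult[of _ n n _ n] assoc_mult_mat[of _ n n _ n _ n])
      then show ?thesis using Dc that by (metis carrier_matD index_transpose_mat(1))
    qed
    have Ddiag: "D $$ (i, j) = 0" if "i < n" "j < n" "i \<noteq> j" for i j
      using Dup[of i j] Dup[of j i] Dsym[of i j] that by (cases "j < i") auto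
    have lmD: "lm j (($$) D) > 0" if "j \<le> n" for j
    proof -
      have "lm j (($$) D) = lm j (($$) L) * lm j (($$) X) * lm j (($$) (transpose_mat L))"
        unfolding D_def using that Lt Xc
        by (subst lm_mult_upper[OF lower_tri_transpose[OF Lt(1)]]) (auto simp: lm_mult_lower)
      moreover have "lm j (($$) (transpose_mat L)) = 1"
        using that L(1) by (subst lm_upper) (auto simp: unit_lower_def lower_tri_def)
      ultimately show ?thesis using t0[OF t that] that by (simp add: unit_lower_lm[OF L(1)] X_def)
    qed
    have Dpos: "D $$ (i, i) > 0" if "i < n" for i
    proof -
      have p: "lm j (($$) D) = (\<Prod>i<j. D $$ (i, i))" if "j \<le> n" for j
        using that Ddiag by (intro lm_upper) auto
      have "lm (Suc i) (($$) D) = lm i (($$) D) * D $$ (i, i)" using p[of i] p[of "Suc i"] that by simp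
      then show ?thesis using lmD[of i] lmD[of "Suc i"] that by (simp add: zero_less_mult_iff)
    qed
    define B where "B = Matrix.mat n n (\<lambda>(i, j). if i = j then sqrt (D $$ (i, i)) else 0)"
    have Bl: "lower_tri n B" by (auto simp: lower_tri_def B_def)
    have BB: "B * transpose_mat B = D"
    proof (rule eq_matI)
      fix i j assume "i < dim_row D" "j < dim_col D"
      then have ij: "i < n" "j < n" using Dc by auto
      have "(B * transpose_mat B) $$ (i, j) = (\<Sum>c<n. B $$ (i, c) * transpose_mat B $$ (c, j))"
        using ij by (intro index_mult_sum) (auto simp: B_def)
      also have "\<dots> = (\<Sum>c<n. if c = i then (if i = j then D $$ (i, i) else 0) else 0)"
        using ij Dpos[of i] by (intro sum.cong) (auto simp: B_def less_imp_le)
      also have "\<dots> = D $$ (i, j)" using ij Ddiag[of i j] by auto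
      finally show "(B * transpose_mat B) $$ (i, j) = D $$ (i, j)" .
    qed (use Dc in \<open>auto simp: B_def\<close>)
    have "gauss_const n l * Del n l (($$) D) = dfact k * T D" using Tlow[OF Bl] BB by simp
    moreover have "T D = T X" unfolding D_def by (rule Tinv[OF L(1) Xc])
    moreover have "Del n l (($$) D) = Del n l (($$) X)"
      unfolding D_def using Lt Xc unit_lower_Del[OF L(1) l]
      by (subst Del_mult_upper[OF lower_tri_transpose[OF Lt(1)]]) (auto simp: Del_mult_lower Del_transpose)
    ultimately show ?thesis by (simp add: X_def)
  qed
  have "gauss_const n l * Del n l (($$) (shift_mat n A 0)) = dfact k * T (shift_mat n A 0)"
    by (rule palg_eqI[where T = t0 and x = 0 and f = "\<lambda>t. gauss_const n l * Del n l (($$) (shift_mat n A t))"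
          and g = "\<lambda>t. dfact k * T (shift_mat n A t)", OF _ _ large])
      (auto simp: T_def dotp_def sq_def intro!: palg_mult palg_const palg_Del palg_shift_mat palg_app palg_power palg_sum)
  then show ?thesis by (simp add: shift_mat_0[OF A(1)] T_def)
qed

text \<open>Passing through the representation on symmetric matrices frees B from being
  triangular.\<close>

lemma Del_gram_integral:
  assumes B: "B \<in> carrier_mat n n"
  shows "gauss_const n l * Del n l (($$) (B * transpose_mat B)) =
    (\<integral>x. Del n (\<lambda>i. 2 * l i) (($$) (B * Matrix.mat n n x)) \<partial>gauss (sq n))"
proof -
  have "transpose_mat (B * transpose_mat B) = B * transpose_mat B"
    using B by (simp add: transpose_mult[of _ n n _ n])
  then have "gauss_const n l * Del n l (($$) (B * transpose_mat B)) =
      dfact k * app ys (\<lambda>y. dotp (sq n) (($$) (B * transpose_mat B)) (gram n y) ^ k)"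
    using B by (intro Del_symmetric_rep) auto
  then show ?thesis
    using gauss_Del_left[OF B] unfolding has_bochner_integral_iff by metis
qed

end

section \<open>Tensor powers in coordinates and Bessel's inequality\<close>

definition tens :: "nat \<Rightarrow> ('j \<Rightarrow> real) \<Rightarrow> (nat \<Rightarrow> 'j) \<Rightarrow> real" where
  "tens k f t = (\<Prod>i<k. f (t i))"

definition tuples :: "nat \<Rightarrow> nat \<Rightarrow> (nat \<Rightarrow> nat \<times> nat) set" where
  "tuples n k = {..<k} \<rightarrow>\<^sub>E sq n"

lemma finite_tuples [simp]: "finite (tuples n k)"
  by (simp add: tuples_def finite_PiE)

lemma sum_tens: "(\<Sum>t\<in>tuples n k. tens k f t * tens k g t) = dotp (sq n) f g ^ k"
proof -
  have "dotp (sq n) f g ^ k = (\<Prod>i<k. \<Sum>a\<in>sq n. f a * g a)" by (simp add: dotp_def)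
  also have "\<dots> = (\<Sum>t\<in>tuples n k. \<Prod>i<k. f (t i) * g (t i))"
    unfolding tuples_def by (rule prod_sum_PiE) auto
  finally show ?thesis by (simp add: tens_def prod.distrib)
qed

lemma tens_cong:
  assumes "t \<in> tuples n k" "\<And>a. a \<in> sq n \<Longrightarrow> f a = g a"
  shows "tens k f t = tens k g t"
  unfolding tens_def using assms(1) by (intro prod.cong refl assms(2)) (auto simp: tuples_def)

lemma palg_tens:
  assumes "t \<in> tuples n k" "\<And>a. a \<in> sq n \<Longrightarrow> palg S (\<lambda>x. F x a)"
  shows "palg S (\<lambda>x. tens k (F x) t)"
  unfolding tens_def using assms(1) by (intro palg_prod assms(2)) (auto simp: tuples_def)

text \<open>The vector w below is the orthogonal projection of v onto the span of the u i, and the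
  claim expands |v - w|^2 \<ge> 0. The weights Z replace a normalisation of the vectors.\<close>

lemma bessel_inequality:
  fixes u :: "'i \<Rightarrow> 't \<Rightarrow> real"
  assumes fin: "finite I"
    and orth: "\<And>i j. i \<in> I \<Longrightarrow> j \<in> I \<Longrightarrow> (\<Sum>t\<in>T. u i t * u j t) = (if i = j then N i else 0)"
    and Z: "\<And>i. i \<in> I \<Longrightarrow> Z i * N i = 1"
  shows "(\<Sum>i\<in>I. Z i * (\<Sum>t\<in>T. u i t * v t)\<^sup>2) \<le> (\<Sum>t\<in>T. v t * v t)"
proof -
  define s where "s i = (\<Sum>t\<in>T. u i t * v t)" for i
  define w where "w t = (\<Sum>i\<in>I. Z i * s i * u i t)" for t
  have wv: "(\<Sum>t\<in>T. w t * v t) = (\<Sum>i\<in>I. Z i * s i * s i)"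
    unfolding w_def sum_distrib_right
    by (subst sum.swap) (simp add: s_def sum_distrib_left mult_ac)
  have uw: "(\<Sum>t\<in>T. u i t * w t) = s i" if i: "i \<in> I" for i
  proof -
    have "(\<Sum>t\<in>T. u i t * w t) = (\<Sum>j\<in>I. Z j * s j * (\<Sum>t\<in>T. u i t * u j t))"
      unfolding w_def sum_distrib_left by (subst sum.swap) (simp add: mult_ac)
    also have "\<dots> = (\<Sum>j\<in>I. if j = i then Z i * s i * N i else 0)"
      using i by (intro sum.cong refl) (auto simp: orth)
    also have "\<dots> = s i" using fin i Z[OF i] by (simp add: mult_ac)
    finally show ?thesis .
  qed
  have "(\<Sum>t\<in>T. w t * w t) = (\<Sum>t\<in>T. \<Sum>i\<in>I. Z i * s i * (u i t * w t))"
    by (intro sum.cong refl) (simp add: w_def[of t for t] sum_distrib_right mult_ac)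
  also have "\<dots> = (\<Sum>i\<in>I. Z i * s i * (\<Sum>t\<in>T. u i t * w t))"
    unfolding sum_distrib_left by (rule sum.swap)
  finally have ww: "(\<Sum>t\<in>T. w t * w t) = (\<Sum>i\<in>I. Z i * s i * s i)"
    by (simp add: uw)
  have "0 \<le> (\<Sum>t\<in>T. (v t - w t) * (v t - w t))" by (intro sum_nonneg) auto
  also have "\<dots> = (\<Sum>t\<in>T. v t * v t) - 2 * (\<Sum>t\<in>T. w t * v t) + (\<Sum>t\<in>T. w t * w t)"
    by (simp add: algebra_simps sum.distrib sum_subtractf sum_distrib_left)
  finally show ?thesis unfolding wv ww by (simp add: s_def power2_eq_square mult_ac)
qed

section \<open>Conjugation, coefficient tensors and their inner products\<close>

definition conj_ent :: "nat \<Rightarrow> real mat \<Rightarrow> real mat \<Rightarrow> nat \<times> nat \<Rightarrow> real" where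
  "conj_ent n A H = (\<lambda>(i, j). \<Sum>k<n. (\<Sum>l<n. H $$ (l, i) * A $$ (l, k)) * H $$ (k, j))"

text \<open>This is K YY' K', written like \<open>conj_ent\<close> so that it is visibly polynomial
  in the entries of the orthogonal matrix.\<close>

definition conj_gram :: "nat \<Rightarrow> real mat \<Rightarrow> (nat \<times> nat \<Rightarrow> real) \<Rightarrow> nat \<times> nat \<Rightarrow> real" where
  "conj_gram n K y = gram n (\<lambda>(a, c). \<Sum>d<n. K $$ (a, d) * y (d, c))"

lemma conj_ent:
  assumes "A \<in> carrier_mat n n" "H \<in> carrier_mat n n" "i < n" "j < n"
  shows "(transpose_mat H * A * H) $$ (i, j) = conj_ent n A H (i, j)"
proof -
  have "(transpose_mat H * A * H) $$ (i, j) = (\<Sum>k<n. (transpose_mat H * A) $$ (i, k) * H $$ (k, j))"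
    using assms by (intro index_mult_sum[of _ n n _ n]) auto
  also have "\<dots> = (\<Sum>k<n. (\<Sum>l<n. transpose_mat H $$ (i, l) * A $$ (l, k)) * H $$ (k, j))"
    using assms by (intro sum.cong refl arg_cong2[where f = "(*)"] index_mult_sum[of _ n n _ n]) auto
  also have "\<dots> = conj_ent n A H (i, j)"
    using assms by (auto simp: conj_ent_def intro!: sum.cong)
  finally show ?thesis .
qed

lemma palg_conj_ent: "a \<in> sq n \<Longrightarrow> palg (ent n) (\<lambda>H. conj_ent n A H a)"
  unfolding conj_ent_def
  by (auto simp: sq_def intro!: palg_sum palg_mult palg_const palg_ent)

lemma palg_Del_conj: "q \<le> n \<Longrightarrow> palg (ent n) (\<lambda>H. Del q l (conj_ent n A H))"
  by (intro palg_Del palg_conj_ent) (auto simp: sq_def)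

lemma palg_conj_gram: "a \<in> sq n \<Longrightarrow> palg (ent n) (\<lambda>K. conj_gram n K y a)"
  unfolding conj_gram_def gram_def
  by (auto simp: sq_def intro!: palg_sum palg_mult palg_const palg_ent)

lemma conj_gram_mat:
  assumes K: "K \<in> carrier_mat n n"
  shows "Matrix.mat n n (conj_gram n K y) = K * Matrix.mat n n (gram n y) * transpose_mat K"
proof -
  let ?Y = "Matrix.mat n n y"
  have G: "Matrix.mat n n (gram n y) = Matrix.mat n n y * transpose_mat (Matrix.mat n n y)" for y
    by (rule eq_matI) (auto simp: gram_mat simp del: index_mult_mat(1))
  have KY: "Matrix.mat n n (\<lambda>(a, c). \<Sum>d<n. K $$ (a, d) * y (d, c)) = K * ?Y"
    using K by (intro eq_matI) (auto simp: index_mult_sum[of _ n n _ n] simp del: index_mult_mat(1))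
  show ?thesis unfolding conj_gram_def G KY
    using K by (simp add: transpose_mult[of _ n n _ n] assoc_mult_mat[of _ n n _ n _ n] mult_carrier_mat[of _ n n _ n])
qed

lemma dotp_conj_gram:
  assumes A: "A \<in> carrier_mat n n" and K: "K \<in> carrier_mat n n"
  shows "dotp (sq n) (($$) (transpose_mat K * A * K)) (gram n y) = dotp (sq n) (($$) A) (conj_gram n K y)"
proof -
  let ?G = "Matrix.mat n n (gram n y)"
  have "dotp (sq n) (($$) (transpose_mat K * A * K)) (gram n y) =
      dotp (sq n) (($$) (transpose_mat K * (A * K))) (($$) ?G)"
    using A K by (simp add: assoc_mult_mat[of _ n n _ n _ n])
  also have "\<dots> = dotp (sq n) (($$) (A * K)) (($$) (K * ?G))"
    using dotp_mult_left[OF K, of ?G "A * K"] A K by (simp only: dotp_commute mult_carrier_mat[of _ n n _ n] mat_carrier)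
  also have "\<dots> = dotp (sq n) (($$) A) (($$) (K * ?G * transpose_mat K))"
    using A K by (intro dotp_mult_right[symmetric]) auto
  also have "\<dots> = dotp (sq n) (($$) A) (conj_gram n K y)"
    unfolding conj_gram_mat[OF K, symmetric] by simp
  finally show ?thesis .
qed

lemma sph_conj_ent:
  assumes A: "A \<in> carrier_mat n n"
  shows "sph n l A = (\<integral>H. Del n l (conj_ent n A H) \<partial>haar_orthogonal n)"
  unfolding sph_def
  by (intro Bochner_Integration.integral_cong refl Del_cong conj_ent A)
    (auto simp: space_haar dest: orthogonal_groupD)

lemma real_symmetric_conj:
  assumes "real_symmetric n A" "K \<in> carrier_mat n n"
  shows "real_symmetric n (transpose_mat K * A * K)"
  using assms by (auto simp: real_symmetric_def transpose_mult[of _ n n _ n] assoc_mult_mat[of _ n n _ n _ n] mult_carrier_mat[of _ n n _ n])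

lemma sph_invariant:
  assumes A: "A \<in> carrier_mat n n" and K: "K \<in> orthogonal_group n"
  shows "sph n l (transpose_mat K * A * K) = sph n l A"
proof -
  note Kc = orthogonal_groupD[OF K]
  have "sph n l (transpose_mat K * A * K) = (\<integral>H. Del n l (conj_ent n A (K * H)) \<partial>haar_orthogonal n)"
    unfolding sph_def
  proof (intro Bochner_Integration.integral_cong refl Del_cong)
    fix H i k assume "H \<in> space (haar_orthogonal n)" and ik: "i < n" "k < n"
    then have H: "H \<in> carrier_mat n n" using orthogonal_groupD(1) by (auto simp: space_haar)
    have "transpose_mat H * (transpose_mat K * A * K) * H = transpose_mat (K * H) * A * (K * H)"
      using A Kc(1) H by (simp add: transpose_mult[of _ n n _ n] assoc_mult_mat[of _ n n _ n _ n] mult_carrier_mat[of _ n n _ n])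
    moreover have "K * H \<in> carrier_mat n n" using Kc(1) H by simp
    ultimately show "(transpose_mat H * (transpose_mat K * A * K) * H) $$ (i, k) = conj_ent n A (K * H) (i, k)"
      using conj_ent[OF A _ ik] by metis
  qed
  also have "\<dots> = sph n l A"
    unfolding sph_conj_ent[OF A] by (rule haar_left[OF K haar_palg(1)[OF palg_Del_conj]]) simp
  finally show ?thesis .
qed

text \<open>A weight l of size k together with power sums \<open>ys\<close> for the square of its
  polynomial.\<close>

definition hw_data :: "nat \<Rightarrow> nat \<Rightarrow> (nat \<Rightarrow> nat) \<Rightarrow> (real \<times> (nat \<times> nat \<Rightarrow> real)) list \<Rightarrow> bool" where
  "hw_data n k l ys \<longleftrightarrow> antimono l \<and> l n = 0 \<and> (\<Sum>i<n. l i) = k \<and>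
     rep (sq n) (\<Sum>i<n. 2 * l i) ys (Del n (\<lambda>i. 2 * l i))"

lemma hw_dataD:
  assumes "hw_data n k l ys"
  shows "antimono l" "l n = 0" "(\<Sum>i<n. l i) = k" "rep (sq n) (\<Sum>i<n. 2 * l i) ys (Del n (\<lambda>i. 2 * l i))"
    "antimono (\<lambda>i. 2 * l i)" "2 * l n = 0" "(\<Sum>i<n. 2 * l i) = 2 * k"
  using assms by (auto simp: hw_data_def antimono_def sum_distrib_left[symmetric])

lemma hw_data_exists:
  assumes "antimono l" "l n = 0" "(\<Sum>i<n. l i) = k"
  shows "\<exists>ys. hw_data n k l ys"
proof -
  have "hp (sq n) (\<Sum>i<n. 2 * l i) (Del n (\<lambda>i. 2 * l i))"
    using assms by (intro hp_Del) (auto simp: antimono_def)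
  then show ?thesis using assms by (auto simp: hp_def hw_data_def)
qed

text \<open>The coefficient tensor by which A -> \<open>Del n l\<close> at K' A K pairs with the
  k-th tensor power of A; its Haar mean \<open>mean_tensor\<close> is the u_kappa of the
  overview.\<close>

definition sphere_tensor :: "nat \<Rightarrow> nat \<Rightarrow> (nat \<Rightarrow> nat) \<Rightarrow> (real \<times> (nat \<times> nat \<Rightarrow> real)) list \<Rightarrow>
    real mat \<Rightarrow> (nat \<Rightarrow> nat \<times> nat) \<Rightarrow> real" where
  "sphere_tensor n k l ys K t = dfact k / gauss_const n l * app ys (\<lambda>y. tens k (conj_gram n K y) t)"

definition mean_tensor :: "nat \<Rightarrow> nat \<Rightarrow> (nat \<Rightarrow> nat) \<Rightarrow> (real \<times> (nat \<times> nat \<Rightarrow> real)) list \<Rightarrow>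
    (nat \<Rightarrow> nat \<times> nat) \<Rightarrow> real" where
  "mean_tensor n k l ys t = (\<integral>K. sphere_tensor n k l ys K t \<partial>haar_orthogonal n)"

lemma palg_sphere_tensor: "t \<in> tuples n k \<Longrightarrow> palg (ent n) (\<lambda>K. sphere_tensor n k l ys K t)"
  unfolding sphere_tensor_def
  by (intro palg_mult palg_const palg_app palg_tens palg_conj_gram)

lemma Del_sphere_tensor:
  assumes d: "hw_data n k l ys" and A: "real_symmetric n A" and K: "K \<in> carrier_mat n n"
  shows "Del n l (($$) (transpose_mat K * A * K)) =
    (\<Sum>t\<in>tuples n k. sphere_tensor n k l ys K t * tens k (($$) A) t)"
proof -
  note d = hw_dataD[OF d]
  have Ac: "A \<in> carrier_mat n n" using A by (simp add: real_symmetric_def)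
  have "gauss_const n l * Del n l (($$) (transpose_mat K * A * K)) =
      dfact k * app ys (\<lambda>y. dotp (sq n) (($$) A) (conj_gram n K y) ^ k)"
    using Del_symmetric_rep[OF d(1-4), of "transpose_mat K * A * K"] real_symmetric_conj[OF A K]
    unfolding dotp_conj_gram[OF Ac K] by (simp add: real_symmetric_def)
  also have "\<dots> = dfact k * (\<Sum>t\<in>tuples n k. app ys (\<lambda>y. tens k (conj_gram n K y) t) * tens k (($$) A) t)"
    unfolding sum_tens[symmetric] by (simp add: app_sum app_cmult mult.commute)
  finally have "Del n l (($$) (transpose_mat K * A * K)) =
     dfact k / gauss_const n l * (\<Sum>t\<in>tuples n k. app ys (\<lambda>y. tens k (conj_gram n K y) t) * tens k (($$) A) t)"
    using gauss_const_pos[OF d(1-4)] by (simp add: field_simps)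
  then show ?thesis by (simp add: sphere_tensor_def sum_distrib_left mult_ac)
qed

lemma sph_mean_tensor:
  assumes d: "hw_data n k l ys" and A: "real_symmetric n A"
  shows "sph n l A = (\<Sum>t\<in>tuples n k. mean_tensor n k l ys t * tens k (($$) A) t)"
proof -
  have "sph n l A = (\<integral>K. (\<Sum>t\<in>tuples n k. sphere_tensor n k l ys K t * tens k (($$) A) t) \<partial>haar_orthogonal n)"
    unfolding sph_def
    by (intro Bochner_Integration.integral_cong refl Del_sphere_tensor[OF d A])
      (auto simp: space_haar dest: orthogonal_groupD)
  also have "\<dots> = (\<Sum>t\<in>tuples n k. mean_tensor n k l ys t * tens k (($$) A) t)"
    unfolding mean_tensor_def
    by (subst Bochner_Integration.integral_sum)
      (auto intro!: integrable_mult_left haar_palg(2) palg_sphere_tensor)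
  finally show ?thesis .
qed

lemma real_symmetric_gram: "real_symmetric n (Matrix.mat n n (gram n y))"
  by (auto simp: real_symmetric_def gram_symmetric intro!: eq_matI)

text \<open>At YY' the spherical function is a Haar mean over H of a Gaussian mean over X of the
  squared polynomial at H' Y X. Applying the functional in Y first, \<open>app_translate\<close>
  separates H from X, and each integral becomes a constant.\<close>

lemma app_sph:
  assumes d: "hw_data n k l ys" and e: "hw_data n k m zs"
  shows "app zs (\<lambda>y. sph n l (Matrix.mat n n (gram n y))) =
    haar_const n m * app zs (Del n (\<lambda>i. 2 * l i))"
proof -
  note d = hw_dataD[OF d] and e = hw_dataD[OF e]
  let ?H = "haar_orthogonal n" and ?G = "gauss (sq n)" and ?l = "\<lambda>i. 2 * l i" and ?m = "\<lambda>i. 2 * m i"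
  let ?F = "\<lambda>H y x. Del n ?l (($$) (transpose_mat H * Matrix.mat n n y * Matrix.mat n n x))"
  have mean: "gauss_const n l * Del n l (conj_ent n (Matrix.mat n n (gram n y)) H) = (\<integral>x. ?F H y x \<partial>?G)"
    and int: "integrable ?G (?F H y)" if "H \<in> space ?H" for H y
  proof -
    let ?Y = "Matrix.mat n n y"
    have H: "H \<in> carrier_mat n n" using that orthogonal_groupD(1) by (auto simp: space_haar)
    let ?B = "transpose_mat H * ?Y"
    have B: "?B \<in> carrier_mat n n" using H by simp
    have "Matrix.mat n n (gram n y) = ?Y * transpose_mat ?Y"
      by (rule eq_matI) (auto simp: gram_mat simp del: index_mult_mat(1))
    then have BB: "?B * transpose_mat ?B = transpose_mat H * Matrix.mat n n (gram n y) * H"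
      using H by (simp add: transpose_mult[of _ n n _ n] assoc_mult_mat[of _ n n _ n _ n] mult_carrier_mat[of _ n n _ n])
    have "Del n l (conj_ent n (Matrix.mat n n (gram n y)) H) = Del n l (($$) (?B * transpose_mat ?B))"
      unfolding BB by (intro Del_cong conj_ent[symmetric] H) auto
    then show "gauss_const n l * Del n l (conj_ent n (Matrix.mat n n (gram n y)) H) = (\<integral>x. ?F H y x \<partial>?G)"
      using Del_gram_integral[OF d(1-4) B] by simp
    show "integrable ?G (?F H y)"
      using gauss_Del_left[OF d(1-4) B] by (simp add: has_bochner_integral_iff)
  qed
  have inti: "integrable ?H (\<lambda>H. gauss_const n l * Del n l (conj_ent n (Matrix.mat n n (gram n y)) H))" for y
    by (intro integrable_mult_right haar_palg(2) palg_Del_conj) simp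
  have "gauss_const n l * app zs (\<lambda>y. sph n l (Matrix.mat n n (gram n y))) =
      app zs (\<lambda>y. \<integral>H. gauss_const n l * Del n l (conj_ent n (Matrix.mat n n (gram n y)) H) \<partial>?H)"
    by (simp add: app_cmult sph_conj_ent)
  also have "\<dots> = (\<integral>H. app zs (\<lambda>y. gauss_const n l * Del n l (conj_ent n (Matrix.mat n n (gram n y)) H)) \<partial>?H)"
    using app_integral[of ?H "\<lambda>H y. gauss_const n l * Del n l (conj_ent n (Matrix.mat n n (gram n y)) H)" zs] inti
    by simp
  also have "\<dots> = (\<integral>H. Del n ?m (($$) H) * (gauss_const n l * app zs (Del n ?l)) \<partial>?H)"
  proof (intro Bochner_Integration.integral_cong refl)
    fix H assume HH: "H \<in> space ?H"
    then have H: "H \<in> carrier_mat n n" using orthogonal_groupD(1) by (auto simp: space_haar)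
    have "app zs (\<lambda>y. gauss_const n l * Del n l (conj_ent n (Matrix.mat n n (gram n y)) H)) =
        app zs (\<lambda>y. \<integral>x. ?F H y x \<partial>?G)"
      by (simp only: mean[OF HH])
    also have "\<dots> = (\<integral>x. app zs (\<lambda>y. ?F H y x) \<partial>?G)"
      using app_integral[of ?G "\<lambda>x y. ?F H y x" zs] int[OF HH] by simp
    also have "\<dots> = (\<integral>x. (Del n ?m (($$) H) * app zs (Del n ?l)) * Del n ?l x \<partial>?G)"
    proof (intro Bochner_Integration.integral_cong refl)
      fix x
      have "app zs (\<lambda>y. ?F H y x) = Del n ?m (($$) (transpose_mat H)) * Del n ?l (($$) (Matrix.mat n n x)) * app zs (Del n ?l)"
        using H d(7) e(7) by (intro app_translate[OF e(5,6) d(5,6) _ e(4)]) auto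
      then show "app zs (\<lambda>y. ?F H y x) = (Del n ?m (($$) H) * app zs (Del n ?l)) * Del n ?l x"
        by (simp add: Del_transpose[OF H] mult_ac)
    qed
    also have "\<dots> = (Del n ?m (($$) H) * app zs (Del n ?l)) * gauss_const n l"
      by (simp add: gauss_const_def)
    finally show "app zs (\<lambda>y. gauss_const n l * Del n l (conj_ent n (Matrix.mat n n (gram n y)) H)) =
        Del n ?m (($$) H) * (gauss_const n l * app zs (Del n ?l))" by (simp add: mult_ac)
  qed
  also have "\<dots> = gauss_const n l * (haar_const n m * app zs (Del n ?l))"
    by (simp add: haar_const_def)
  finally show ?thesis using gauss_const_pos[OF d(1-4)] by simp
qed

text \<open>Expand only the second tensor as an average over K. Pairing the first with a tensor
  power of K YY' K' gives \<open>sph\<close> at that matrix, which equals \<open>sph\<close> at YY',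
  so the integrand is constant in K.\<close>

lemma mean_tensor_inner:
  assumes d: "hw_data n k l ys" and e: "hw_data n k m zs"
  shows "(\<Sum>t\<in>tuples n k. mean_tensor n k l ys t * mean_tensor n k m zs t) =
    dfact k / gauss_const n m * (haar_const n m * app zs (Del n (\<lambda>i. 2 * l i)))"
proof -
  let ?H = "haar_orthogonal n"
  let ?G = "\<lambda>y. Matrix.mat n n (gram n y)"
  have "(\<Sum>t\<in>tuples n k. mean_tensor n k l ys t * mean_tensor n k m zs t) =
     (\<integral>K. (\<Sum>t\<in>tuples n k. mean_tensor n k l ys t * sphere_tensor n k m zs K t) \<partial>?H)"
    unfolding mean_tensor_def[of n k m]
    by (subst Bochner_Integration.integral_sum)
      (auto intro!: integrable_mult_right haar_palg(2) palg_sphere_tensor)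
  also have "\<dots> = (\<integral>K. dfact k / gauss_const n m * app zs (\<lambda>y. sph n l (?G y)) \<partial>?H)"
  proof (intro Bochner_Integration.integral_cong refl)
    fix K assume "K \<in> space ?H"
    then have K: "transpose_mat K \<in> orthogonal_group n" and Kc: "K \<in> carrier_mat n n"
      using orthogonal_groupD(1) orthogonal_group_transpose by (auto simp: space_haar)
    have eq: "(\<Sum>t\<in>tuples n k. mean_tensor n k l ys t * tens k (conj_gram n K y) t) = sph n l (?G y)" for y
    proof -
      have "(\<Sum>t\<in>tuples n k. mean_tensor n k l ys t * tens k (conj_gram n K y) t) =
         (\<Sum>t\<in>tuples n k. mean_tensor n k l ys t * tens k (($$) (Matrix.mat n n (conj_gram n K y))) t)"
        by (intro sum.cong refl arg_cong2[where f = "(*)"] tens_cong) (auto simp: sq_def)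
      also have "\<dots> = sph n l (Matrix.mat n n (conj_gram n K y))"
        using real_symmetric_conj[OF real_symmetric_gram, of "transpose_mat K" n y] Kc
        by (intro sph_mean_tensor[OF d, symmetric]) (simp add: conj_gram_mat[OF Kc])
      also have "\<dots> = sph n l (?G y)"
        using sph_invariant[OF _ K, of "?G y" l] by (simp add: conj_gram_mat[OF Kc])
      finally show ?thesis .
    qed
    have "app zs (\<lambda>y. sph n l (?G y)) =
        (\<Sum>t\<in>tuples n k. mean_tensor n k l ys t * app zs (\<lambda>y. tens k (conj_gram n K y) t))"
      by (simp only: eq[symmetric] app_sum app_cmult)
    then show "(\<Sum>t\<in>tuples n k. mean_tensor n k l ys t * sphere_tensor n k m zs K t) =
        dfact k / gauss_const n m * app zs (\<lambda>y. sph n l (?G y))"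
      by (simp add: sphere_tensor_def sum_distrib_left mult_ac)
  qed
  also have "\<dots> = dfact k / gauss_const n m * app zs (\<lambda>y. sph n l (?G y))"
  proof -
    interpret prob_space ?H by (rule prob_space_haar)
    show ?thesis by (simp add: prob_space)
  qed
  finally show ?thesis by (simp add: app_sph[OF d e])
qed

lemma mean_tensor_orthogonal:
  assumes d: "hw_data n k l ys" and e: "hw_data n k m zs" and ne: "i < n" "l i \<noteq> m i"
  shows "(\<Sum>t\<in>tuples n k. mean_tensor n k l ys t * mean_tensor n k m zs t) = 0"
proof -
  have "app zs (Del n (\<lambda>i. 2 * l i)) = 0"
    using hw_dataD[OF d] hw_dataD[OF e] ne
    by (intro app_orthogonal[of "\<lambda>i. 2 * m i" n "\<lambda>i. 2 * l i" zs i]) auto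
  then show ?thesis by (simp add: mean_tensor_inner[OF d e])
qed

text \<open>The Haar to Gaussian ratio is the reciprocal Wishart constant, and
  \<open>dfact k\<close> completes to the factorial (2k)! that \<open>norm_Del\<close> requires for
  doubled parts.\<close>

lemma mean_tensor_norm:
  assumes d: "hw_data n k l ys"
  shows "(\<Sum>t\<in>tuples n k. mean_tensor n k l ys t * mean_tensor n k l ys t) * wishart_const n l * vdm n (\<lambda>i. 2 * l i) * 2 ^ k * fact k =
    (\<Prod>i<n. fact (2 * l i + n - Suc i))"
proof -
  note d' = hw_dataD[OF d]
  have "gauss_const n l \<noteq> 0" using gauss_const_pos[OF d'(1-4)] by simp
  then have c: "haar_const n l / gauss_const n l * wishart_const n l = 1"
    using gauss_const_haar[OF d'(1-4)] by simp
  have "(\<Sum>t\<in>tuples n k. mean_tensor n k l ys t * mean_tensor n k l ys t) * wishart_const n l * vdm n (\<lambda>i. 2 * l i) * 2 ^ k * fact k =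
     (haar_const n l / gauss_const n l * wishart_const n l) * ((dfact k * (2 ^ k * fact k)) * app ys (Del n (\<lambda>i. 2 * l i)) * vdm n (\<lambda>i. 2 * l i))"
    unfolding mean_tensor_inner[OF d d] by (simp add: mult_ac)
  also have "dfact k * (2 ^ k * fact k) = fact (2 * k)" by (simp add: dfact_def)
  finally show ?thesis using norm_Del[OF d'(5,6,4)] unfolding d'(7) c by simp
qed

section \<open>Matching the norm with the zonal normalisation\<close>

lemma partition_facts:
  assumes "\<kappa> \<in> partitions k p"
  shows "antimono \<kappa>" "part_length \<kappa> \<le> p" "part_weight \<kappa> = k"
    "\<And>i. \<kappa> i = 0 \<longleftrightarrow> part_length \<kappa> \<le> i" "(\<Sum>i<p. \<kappa> i) = k"
proof -
  have anti: "antimono \<kappa>" and fin: "finite {i. \<kappa> i \<noteq> 0}"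
    and len: "part_length \<kappa> \<le> p" and w: "part_weight \<kappa> = k"
    using assms by (auto simp: partitions_def is_partition_def)
  \<comment> \<open>A decreasing sequence with finite support is nonzero exactly on an initial
    segment, so counting the nonzero parts finds the first zero.\<close>
  obtain q where q: "\<And>i. \<kappa> i = 0 \<longleftrightarrow> q \<le> i"
  proof -
    define q where "q = (LEAST i. \<kappa> i = 0)"
    have "\<exists>i. \<kappa> i = 0" using fin ex_new_if_finite[of "{i. \<kappa> i \<noteq> 0}"] by auto
    then have "\<kappa> q = 0" unfolding q_def by (auto intro: LeastI_ex)
    then have "\<kappa> i = 0" if "q \<le> i" for i using antimonoD[OF anti that] by simp
    moreover have "\<kappa> i \<noteq> 0" if "i < q" for i using not_less_Least[of i "\<lambda>i. \<kappa> i = 0"] that by (simp add: q_def)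
    ultimately have "\<kappa> i = 0 \<longleftrightarrow> q \<le> i" for i by (meson not_le)
    then show thesis by (rule that)
  qed
  have "{i. \<kappa> i \<noteq> 0} = {..<q}" by (auto simp: q)
  then have ql: "part_length \<kappa> = q" by (simp add: part_length_def)
  show z: "\<kappa> i = 0 \<longleftrightarrow> part_length \<kappa> \<le> i" for i unfolding q ql ..
  show "antimono \<kappa>" "part_length \<kappa> \<le> p" "part_weight \<kappa> = k" by fact+
  have "(\<Sum>i<p. \<kappa> i) = (\<Sum>i | \<kappa> i \<noteq> 0. \<kappa> i)"
    using len z by (intro sum.mono_neutral_right) (auto simp: not_le)
  then show "(\<Sum>i<p. \<kappa> i) = k" using w by (simp add: part_weight_def)
qed

lemma partition_top: "\<kappa> \<in> partitions k p \<Longrightarrow> \<kappa> p = 0"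
  using partition_facts(2,4) by blast

lemma partitions_mono: "p \<le> d \<Longrightarrow> partitions k p \<subseteq> partitions k d"
  by (auto simp: partitions_def)

text \<open>Appending zero parts leaves the quotient of the Vandermonde and factorial products
  unchanged. The norm is computed in size n, whereas \<open>zonal_at_identity\<close> uses the
  length of the partition.\<close>

lemma vdm_reduce:
  assumes "\<And>i. q \<le> i \<Longrightarrow> l i = 0" "q \<le> n"
  shows "vdm n l * (\<Prod>i<q. fact (l i + q - Suc i)) = vdm q l * (\<Prod>i<n. fact (l i + n - Suc i))"
  using assms(2)
proof (induction rule: dec_induct)
  case base
  show ?case by simp
next
  case (step n)
  have "(\<Prod>i<n. fact (l i + Suc n - Suc i)) =
     (\<Prod>i<n. (real (l i) - real i + real n) * fact (l i + n - Suc i))"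
  proof (intro prod.cong refl)
    fix i assume i: "i \<in> {..<n}"
    then have "l i + Suc n - Suc i = Suc (l i + n - Suc i)" by auto
    then have "(fact (l i + Suc n - Suc i) :: real) = real (Suc (l i + n - Suc i)) * fact (l i + n - Suc i)"
      by (simp only: fact_Suc of_nat_mult)
    moreover have "real (Suc (l i + n - Suc i)) = real (l i) - real i + real n" using i by (auto simp: of_nat_diff)
    ultimately show "fact (l i + Suc n - Suc i) = (real (l i) - real i + real n) * fact (l i + n - Suc i)" by simp
  qed
  then have "(\<Prod>i<Suc n. fact (l i + Suc n - Suc i)) =
     (\<Prod>i<n. real (l i) - real i + real n) * (\<Prod>i<n. fact (l i + n - Suc i))"
    using assms(1)[of n] step by (simp add: prod.distrib)
  moreover have "vdm (Suc n) l = vdm n l * (\<Prod>i<n. real (l i) - real i + real n)"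
    using assms(1)[of n] step by (simp add: vdm_Suc)
  ultimately show ?case using step.IH by simp
qed

lemma wishart_shifted_factorial:
  assumes "\<kappa> \<in> partitions k p"
  shows "wishart_const p \<kappa> = 2 ^ k * shifted_factorial (real p / 2) \<kappa>"
proof -
  note \<kappa> = partition_facts[OF assms]
  have "wishart_const p \<kappa> = 2 ^ k * (\<Prod>i<p. pochhammer (real (p - i) / 2) (\<kappa> i))"
    unfolding wishart_const_def prod.distrib \<kappa>(5)[symmetric] by (simp add: power_sum)
  also have "(\<Prod>i<p. pochhammer (real (p - i) / 2) (\<kappa> i)) = (\<Prod>i<part_length \<kappa>. pochhammer (real (p - i) / 2) (\<kappa> i))"
    using \<kappa>(2) by (intro prod.mono_neutral_right) (auto simp: not_less \<kappa>(4)[symmetric])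
  also have "\<dots> = shifted_factorial (real p / 2) \<kappa>"
    unfolding shifted_factorial_def using \<kappa>(2)
    by (intro prod.cong refl arg_cong2[where f = pochhammer]) (auto simp: of_nat_diff diff_divide_distrib)
  finally show ?thesis .
qed

text \<open>The normalisation of the zonal polynomials is exactly the one that makes the averaged tensors
  \<open>sqrt (C(I)) u\<close> orthonormal.\<close>

lemma zonal_at_identity_norm:
  assumes \<kappa>: "\<kappa> \<in> partitions k p" and d: "hw_data p k \<kappa> ys"
  shows "zonal_at_identity p \<kappa> * (\<Sum>t\<in>tuples p k. mean_tensor p k \<kappa> ys t * mean_tensor p k \<kappa> ys t) = 1"
proof -
  note \<kappa>' = partition_facts[OF \<kappa>]
  let ?l = "\<lambda>i. 2 * \<kappa> i" and ?q = "part_length \<kappa>"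
  define N where "N = (\<Sum>t\<in>tuples p k. mean_tensor p k \<kappa> ys t * mean_tensor p k \<kappa> ys t)"
  define F where "F n = (\<Prod>i<n. fact (2 * \<kappa> i + n - Suc i) :: real)" for n
  have F: "F n > 0" for n unfolding F_def by (intro prod_pos) auto
  have Z: "zonal_at_identity p \<kappa> = 2 ^ (2 * k) * fact k * shifted_factorial (real p / 2) \<kappa> * vdm ?q ?l / F ?q"
    unfolding zonal_at_identity_def vdm_def F_def \<kappa>'(3) by simp
  have N: "N * (2 ^ k * shifted_factorial (real p / 2) \<kappa>) * vdm p ?l * 2 ^ k * fact k = F p"
    using mean_tensor_norm[OF d] unfolding wishart_shifted_factorial[OF \<kappa>] N_def F_def .
  have red: "vdm p ?l * F ?q = vdm ?q ?l * F p"
    unfolding F_def using \<kappa>'(2,4) by (intro vdm_reduce) auto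
  have "vdm p ?l \<noteq> 0" using N F[of p] by auto
  moreover have e: "zonal_at_identity p \<kappa> * N * vdm p ?l =
      (N * (2 ^ k * shifted_factorial (real p / 2) \<kappa>) * vdm p ?l * 2 ^ k * fact k) * vdm ?q ?l / F ?q"
    unfolding Z mult_2 power_add by (simp add: mult_ac)
  have "zonal_at_identity p \<kappa> * N * vdm p ?l = vdm p ?l"
    unfolding e N using red F[of ?q] by (simp add: field_simps)
  ultimately show ?thesis unfolding N_def by simp
qed

lemma hw_data_partition:
  assumes "\<kappa> \<in> partitions k p"
  shows "\<exists>ys. hw_data p k \<kappa> ys"
  using partition_facts[OF assms] partition_top[OF assms] by (intro hw_data_exists)

text \<open>Its product with a sum of squares is 1.\<close>

lemma zonal_at_identity_pos:
  assumes \<kappa>: "\<kappa> \<in> partitions k p"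
  shows "zonal_at_identity p \<kappa> > 0"
proof -
  obtain ys where "hw_data p k \<kappa> ys" using hw_data_partition[OF \<kappa>] by blast
  from zonal_at_identity_norm[OF \<kappa> this]
  have "0 < zonal_at_identity p \<kappa> * (\<Sum>t\<in>tuples p k. mean_tensor p k \<kappa> ys t * mean_tensor p k \<kappa> ys t)" by simp
  moreover have "(\<Sum>t\<in>tuples p k. mean_tensor p k \<kappa> ys t * mean_tensor p k \<kappa> ys t) \<ge> 0"
    by (intro sum_nonneg) simp
  ultimately show ?thesis unfolding zero_less_mult_iff by linarith
qed

lemma zonal_bessel:
  assumes A: "real_symmetric p A"
  shows "(\<Sum>\<kappa>\<in>partitions k p. zonal_at_identity p \<kappa> * (sph p \<kappa> A)\<^sup>2) \<le> dotp (sq p) (($$) A) (($$) A) ^ k"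
proof -
  have "\<forall>\<kappa>\<in>partitions k p. \<exists>ys. hw_data p k \<kappa> ys" using hw_data_partition by blast
  then obtain Y where Y: "\<And>\<kappa>. \<kappa> \<in> partitions k p \<Longrightarrow> hw_data p k \<kappa> (Y \<kappa>)" by metis
  define u where "u \<kappa> = mean_tensor p k \<kappa> (Y \<kappa>)" for \<kappa>
  have "(\<Sum>\<kappa>\<in>partitions k p. zonal_at_identity p \<kappa> * (\<Sum>t\<in>tuples p k. u \<kappa> t * tens k (($$) A) t)\<^sup>2) \<le>
      (\<Sum>t\<in>tuples p k. tens k (($$) A) t * tens k (($$) A) t)"
  proof (rule bessel_inequality[OF finite_partitions])
    fix \<kappa> \<mu> assume \<kappa>: "\<kappa> \<in> partitions k p" and \<mu>: "\<mu> \<in> partitions k p"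
    show "(\<Sum>t\<in>tuples p k. u \<kappa> t * u \<mu> t) = (if \<kappa> = \<mu> then \<Sum>t\<in>tuples p k. u \<kappa> t * u \<kappa> t else 0)"
    proof (cases "\<kappa> = \<mu>")
      case False
      then obtain i where i: "\<kappa> i \<noteq> \<mu> i" by blast
      have "i < p"
        using partition_facts(2)[OF \<kappa>] partition_facts(2)[OF \<mu>] partition_facts(4)[OF \<kappa>, of i] partition_facts(4)[OF \<mu>, of i] i
        by linarith
      then show ?thesis using mean_tensor_orthogonal[OF Y[OF \<kappa>] Y[OF \<mu>] _ i] False by (simp add: u_def)
    qed simp
  next
    fix \<kappa> assume \<kappa>: "\<kappa> \<in> partitions k p"
    show "zonal_at_identity p \<kappa> * (\<Sum>t\<in>tuples p k. u \<kappa> t * u \<kappa> t) = 1"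
      unfolding u_def by (rule zonal_at_identity_norm[OF \<kappa> Y[OF \<kappa>]])
  qed
  then show ?thesis by (simp add: sum_tens u_def sph_mean_tensor[OF Y A])
qed

lemma weighted_Cauchy_Schwarz:
  fixes a b z :: "'i \<Rightarrow> real"
  assumes "finite I" "\<And>i. i \<in> I \<Longrightarrow> z i \<ge> 0"
  shows "\<bar>\<Sum>i\<in>I. z i * a i * b i\<bar> \<le> sqrt (\<Sum>i\<in>I. z i * (a i)\<^sup>2) * sqrt (\<Sum>i\<in>I. z i * (b i)\<^sup>2)"
proof -
  have "(\<Sum>i\<in>I. z i * a i * b i) = (\<Sum>i\<in>I. (sqrt (z i) * a i) * (sqrt (z i) * b i))"
    using assms(2) by (intro sum.cong refl) (simp add: real_sqrt_mult[symmetric] mult_ac flip: power2_eq_square)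
  also have "\<bar>\<dots>\<bar> \<le> L2_set (\<lambda>i. sqrt (z i) * a i) I * L2_set (\<lambda>i. sqrt (z i) * b i) I"
    by (rule order_trans[OF sum_abs order_trans[OF _ L2_set_mult_ineq]]) (simp add: abs_mult)
  also have "\<dots> = sqrt (\<Sum>i\<in>I. z i * (a i)\<^sup>2) * sqrt (\<Sum>i\<in>I. z i * (b i)\<^sup>2)"
    using assms(2) unfolding L2_set_def by (simp add: power_mult_distrib)
  finally show ?thesis .
qed

lemma zonal_pairing_bound:
  assumes A: "real_symmetric p A" and X: "real_symmetric p X"
  shows "\<bar>\<Sum>\<kappa>\<in>partitions k p. zonal_at_identity p \<kappa> * sph p \<kappa> A * sph p \<kappa> X\<bar> \<le>
    sqrt (dotp (sq p) (($$) A) (($$) A)) ^ k * sqrt (dotp (sq p) (($$) X) (($$) X)) ^ k"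
proof -
  have "\<bar>\<Sum>\<kappa>\<in>partitions k p. zonal_at_identity p \<kappa> * sph p \<kappa> A * sph p \<kappa> X\<bar> \<le>
     sqrt (\<Sum>\<kappa>\<in>partitions k p. zonal_at_identity p \<kappa> * (sph p \<kappa> A)\<^sup>2) *
     sqrt (\<Sum>\<kappa>\<in>partitions k p. zonal_at_identity p \<kappa> * (sph p \<kappa> X)\<^sup>2)"
    by (intro weighted_Cauchy_Schwarz finite_partitions less_imp_le zonal_at_identity_pos)
  also have "\<dots> \<le> sqrt (dotp (sq p) (($$) A) (($$) A) ^ k) * sqrt (dotp (sq p) (($$) X) (($$) X) ^ k)"
    by (intro mult_mono real_sqrt_le_mono zonal_bessel A X) 
      (auto simp: dotp_def intro!: sum_nonneg zero_le_power
        mult_nonneg_nonneg[OF less_imp_le[OF zonal_at_identity_pos] zero_le_power2])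
  finally show ?thesis by (simp add: real_sqrt_power)
qed

section \<open>Moments of a Haar distributed orthogonal matrix\<close>

lemma haar_palg_bounded:
  assumes "palg (ent n) f"
  shows "\<exists>B. \<forall>H\<in>space (haar_orthogonal n). \<bar>f H\<bar> \<le> B"
  using palg_measurable_bounded[OF assms ent_bounded] by blast

lemma palg_column: "i < d \<Longrightarrow> palg (ent d) (\<lambda>H. (\<Sum>b<d. c b * H $$ (b, i)) ^ n)"
  by (intro palg_power palg_sum palg_mult palg_const palg_ent) auto

text \<open>A reflection takes c to a multiple of the first coordinate vector, and Haar measure is
  left invariant.\<close>

lemma haar_column_invariance:
  assumes i: "i < d"
  shows "(\<integral>H. (\<Sum>b<d. c b * H $$ (b, i)) ^ (2 * n) \<partial>haar_orthogonal d) =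
    (\<Sum>b<d. (c b)\<^sup>2) ^ n * (\<integral>H. H $$ (0, i) ^ (2 * n) \<partial>haar_orthogonal d)"
proof -
  let ?H = "haar_orthogonal d"
  obtain A where A: "orthk {..<d} A" "\<And>i k. A i k = A k i"
    "\<And>i. i \<in> {..<d} - {0} \<Longrightarrow> (\<Sum>l<d. A i l * c l) = 0" "(\<Sum>l<d. A 0 l * c l) = sqrt (\<Sum>l<d. (c l)\<^sup>2)"
    using householder[of "{..<d}" "{..<d}" 0 c] i by force
  define Q where "Q = Matrix.mat d d (\<lambda>(i, j). A i j)"
  have Q: "Q \<in> orthogonal_group d"
    using A(1) by (intro orthogonal_groupI) (auto simp: Q_def orthk_def)
  note Qc = orthogonal_groupD(1)[OF Q]
  have "(\<integral>H. (\<Sum>b<d. c b * H $$ (b, i)) ^ (2 * n) \<partial>?H) = (\<integral>H. (\<Sum>b<d. c b * (Q * H) $$ (b, i)) ^ (2 * n) \<partial>?H)"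
    by (rule haar_left[OF Q haar_palg(1)[OF palg_column[OF i]], symmetric])
  also have "\<dots> = (\<integral>H. (\<Sum>b<d. (c b)\<^sup>2) ^ n * H $$ (0, i) ^ (2 * n) \<partial>?H)"
  proof (intro Bochner_Integration.integral_cong refl)
    fix H assume "H \<in> space ?H"
    then have H: "H \<in> carrier_mat d d" using orthogonal_groupD(1) by (auto simp: space_haar)
    have "(\<Sum>b<d. c b * (Q * H) $$ (b, i)) = (\<Sum>b<d. c b * (\<Sum>l<d. A l b * H $$ (l, i)))"
    proof (intro sum.cong refl arg_cong2[where f = "(*)"])
      fix b assume b: "b \<in> {..<d}"
      have "(Q * H) $$ (b, i) = (\<Sum>l<d. Q $$ (b, l) * H $$ (l, i))"
        using Qc H b i by (intro index_mult_sum) auto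
      also have "\<dots> = (\<Sum>l<d. A l b * H $$ (l, i))"
        using b by (intro sum.cong refl) (simp add: Q_def A(2)[of b])
      finally show "(Q * H) $$ (b, i) = (\<Sum>l<d. A l b * H $$ (l, i))" .
    qed
    also have "\<dots> = (\<Sum>l<d. (\<Sum>b<d. A l b * c b) * H $$ (l, i))"
      unfolding sum_distrib_left sum_distrib_right by (subst sum.swap) (simp add: mult_ac)
    also have "\<dots> = (\<Sum>l<d. if l = 0 then sqrt (\<Sum>b<d. (c b)\<^sup>2) * H $$ (0, i) else 0)"
      by (intro sum.cong refl) (auto simp: A(3) A(4))
    also have "\<dots> = sqrt (\<Sum>b<d. (c b)\<^sup>2) * H $$ (0, i)" using i by simp
    finally show "(\<Sum>b<d. c b * (Q * H) $$ (b, i)) ^ (2 * n) = (\<Sum>b<d. (c b)\<^sup>2) ^ n * H $$ (0, i) ^ (2 * n)"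
      by (simp add: power_mult_distrib power_mult sum_nonneg)
  qed
  finally show ?thesis by simp
qed

text \<open>Integrating the previous identity over a Gaussian vector \<open>c\<close> bounds the moment of a single entry.\<close>

lemma haar_entry_moment:
  assumes i: "i < d"
  shows "real d ^ n * (\<integral>H. H $$ (0, i) ^ (2 * n) \<partial>haar_orthogonal d) \<le> dfact n"
proof -
  let ?H = "haar_orthogonal d" and ?G = "gauss {..<d}"
  interpret H: prob_space ?H by (rule prob_space_haar)
  interpret G: prob_space ?G by (rule prob_space_gauss)
  interpret P: pair_sigma_finite ?H ?G by standard
  define m where "m = (\<integral>H. H $$ (0, i) ^ (2 * n) \<partial>?H)"
  have m0: "m \<ge> 0" unfolding m_def by (intro Bochner_Integration.integral_nonneg) (simp add: power_mult)
  define f where "f c H = (\<Sum>b<d. c b * H $$ (b, i)) ^ (2 * n)" for c :: "nat \<Rightarrow> real" and H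
  have f0: "f c H \<ge> 0" for c H by (simp add: f_def power_mult)
  have 1: "(\<integral>\<^sup>+H. ennreal (f c H) \<partial>?H) = ennreal ((\<Sum>b<d. (c b)\<^sup>2) ^ n) * ennreal m" for c
  proof -
    have "(\<integral>\<^sup>+H. ennreal (f c H) \<partial>?H) = ennreal (\<integral>H. f c H \<partial>?H)"
      using haar_palg(2)[OF palg_column[OF i]] f0 unfolding f_def by (intro nn_integral_eq_integral) auto
    also have "(\<integral>H. f c H \<partial>?H) = (\<Sum>b<d. (c b)\<^sup>2) ^ n * m"
      unfolding f_def m_def by (rule haar_column_invariance[OF i])
    finally show ?thesis by (simp add: ennreal_mult sum_nonneg m0)
  qed
  have 2: "(\<integral>\<^sup>+c. ennreal (f c H) \<partial>?G) = ennreal (dfact n)" if "H \<in> space ?H" for H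
  proof -
    have H: "H \<in> orthogonal_group d" using that by (simp add: space_haar)
    have fe: "f c H = dotp {..<d} (\<lambda>b. H $$ (b, i)) c ^ (2 * n)" for c by (simp add: f_def dotp_def mult.commute)
    have one: "dotp {..<d} (\<lambda>b. H $$ (b, i)) (\<lambda>b. H $$ (b, i)) = 1"
      using orthogonal_cols[OF H i i] by (simp add: dotp_def)
    have hb: "has_bochner_integral ?G (\<lambda>c. f c H) (dfact n)"
      using gauss_dotp_moment[of "{..<d}" "\<lambda>b. H $$ (b, i)" n] unfolding fe one by simp
    then show ?thesis using f0 by (subst nn_integral_eq_integral) (auto simp: has_bochner_integral_iff)
  qed
  have gm: "(\<lambda>x. x b) \<in> borel_measurable ?G" if "b < d" for b
    by (rule gauss_component) (use that in simp)
  have "(\<lambda>z. ennreal (f (snd z) (fst z))) \<in> borel_measurable (?H \<Otimes>\<^sub>M ?G)"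
    unfolding f_def
    by (intro measurable_compose[OF _ measurable_ennreal] borel_measurable_power borel_measurable_sum
        borel_measurable_times measurable_compose[OF measurable_snd gm]
        measurable_compose[OF measurable_fst haar_entry]) (use i in auto)
  then have fm: "(\<lambda>(H, c). ennreal (f c H)) \<in> borel_measurable (?H \<Otimes>\<^sub>M ?G)"
    by (simp add: case_prod_beta')
  have "ennreal (2 ^ n * pochhammer (real d / 2) n) * ennreal m =
      (\<integral>\<^sup>+c. ennreal ((\<Sum>b<d. (c b)\<^sup>2) ^ n) * ennreal m \<partial>?G)"
    using gauss_chi_square[of "{..<d}" "{..<d}" n] gm by (subst nn_integral_multc) auto
  also have "\<dots> = (\<integral>\<^sup>+c. (\<integral>\<^sup>+H. ennreal (f c H) \<partial>?H) \<partial>?G)" unfolding 1 ..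
  also have "\<dots> = (\<integral>\<^sup>+H. (\<integral>\<^sup>+c. ennreal (f c H) \<partial>?G) \<partial>?H)" by (rule P.Fubini'[OF fm])
  also have "\<dots> = (\<integral>\<^sup>+H. ennreal (dfact n) \<partial>?H)" by (intro nn_integral_cong 2)
  also have "\<dots> = ennreal (dfact n)" by (simp add: H.emeasure_space_1)
  finally have "ennreal (2 ^ n * pochhammer (real d / 2) n * m) = ennreal (dfact n)"
    by (simp add: ennreal_mult pochhammer_nonneg' m0)
  then have e: "2 ^ n * pochhammer (real d / 2) n * m = dfact n"
    by (subst (asm) ennreal_inj) (auto simp: pochhammer_nonneg' m0 less_imp_le[OF dfact_pos])
  \<comment> \<open>The chi-square moment d(d + 2)...(d + 2n - 2) is bounded below by d^n.\<close>
  have "real d ^ n = (\<Prod>j<n. real d)" by simp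
  also have "\<dots> \<le> (\<Prod>j<n. 2 * (real d / 2 + real j))" by (intro prod_mono) auto
  also have "\<dots> = 2 ^ n * pochhammer (real d / 2) n"
    by (simp only: pochhammer_prod prod.distrib atLeast0LessThan prod_constant card_lessThan)
  finally have "real d ^ n * m \<le> 2 ^ n * pochhammer (real d / 2) n * m" using m0 by (rule mult_right_mono)
  then show ?thesis unfolding e unfolding m_def .
qed

lemma haar_column_moment:
  assumes i: "i < d"
  shows "(\<integral>H. (\<Sum>b<d. c b * H $$ (b, i)) ^ (2 * n) \<partial>haar_orthogonal d) \<le> (\<Sum>b<d. (c b)\<^sup>2) ^ n * (dfact n / real d ^ n)"
proof -
  have "(\<integral>H. H $$ (0, i) ^ (2 * n) \<partial>haar_orthogonal d) \<le> dfact n / real d ^ n"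
    using haar_entry_moment[OF i, of n] i by (simp add: field_simps)
  then show ?thesis unfolding haar_column_invariance[OF i]
    by (rule mult_left_mono) (intro zero_le_power sum_nonneg zero_le_power2)
qed

text \<open>Jensen's inequality for powers with unnormalised weights; the induction step is
  Chebyshev's sum inequality for the equally ordered y i and y i^(n+1).\<close>

lemma power_mean:
  fixes w y :: "'i \<Rightarrow> real"
  assumes "finite I" "\<And>i. i \<in> I \<Longrightarrow> w i \<ge> 0" "\<And>i. i \<in> I \<Longrightarrow> y i \<ge> 0"
  shows "(\<Sum>i\<in>I. w i * y i) ^ Suc n \<le> (\<Sum>i\<in>I. w i) ^ n * (\<Sum>i\<in>I. w i * y i ^ Suc n)"
proof (induction n)
  case (Suc n)
  let ?W = "\<Sum>i\<in>I. w i" and ?S = "\<lambda>k. \<Sum>i\<in>I. w i * y i ^ k"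
  have cheb: "?S 1 * ?S (Suc n) \<le> ?W * ?S (Suc (Suc n))"
  proof -
    have "0 \<le> (\<Sum>i\<in>I. \<Sum>j\<in>I. w i * w j * ((y i - y j) * (y i ^ Suc n - y j ^ Suc n)))"
    proof (intro sum_nonneg mult_nonneg_nonneg[of "w _ * w _"])
      fix i j assume ij: "i \<in> I" "j \<in> I"
      show "0 \<le> w i * w j" using assms ij by simp
      show "0 \<le> (y i - y j) * (y i ^ Suc n - y j ^ Suc n)"
        using power_mono[of "y i" "y j" "Suc n"] power_mono[of "y j" "y i" "Suc n"] assms(3) ij
        by (cases "y i \<le> y j") (auto intro!: mult_nonneg_nonneg mult_nonpos_nonpos)
    qed
    also have "\<dots> = (\<Sum>i\<in>I. \<Sum>j\<in>I. (w i * y i ^ Suc (Suc n)) * w j + w i * (w j * y j ^ Suc (Suc n))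
        - (w i * y i) * (w j * y j ^ Suc n) - (w i * y i ^ Suc n) * (w j * y j))"
      by (intro sum.cong refl) (simp add: algebra_simps)
    also have "\<dots> = 2 * (?W * ?S (Suc (Suc n)) - ?S 1 * ?S (Suc n))"
      unfolding sum.distrib sum_subtractf sum_product[symmetric] by (simp add: algebra_simps)
    finally show ?thesis by simp
  qed
  have nn: "?S 1 \<ge> 0" "?W \<ge> 0" using assms by (auto intro!: sum_nonneg)
  have "(\<Sum>i\<in>I. w i * y i) ^ Suc (Suc n) = ?S 1 * (\<Sum>i\<in>I. w i * y i) ^ Suc n" by simp
  also have "\<dots> \<le> ?S 1 * (?W ^ n * ?S (Suc n))" by (rule mult_left_mono[OF Suc.IH nn(1)])
  also have "\<dots> = ?W ^ n * (?S 1 * ?S (Suc n))" by (simp only: mult_ac)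
  also have "\<dots> \<le> ?W ^ n * (?W * ?S (Suc (Suc n)))" using nn(2) by (intro mult_left_mono cheb) auto
  finally show ?case by (simp add: mult_ac)
qed simp

text \<open>Letting the column index run up to d adds squares; orthogonality of H then removes the
  right factor and leaves the lengths of S h_i for the first p columns h_i.\<close>

lemma conj_ent_norm_le:
  assumes S: "real_symmetric d S" and H: "H \<in> orthogonal_group d" and p: "p \<le> d"
  shows "dotp (sq p) (conj_ent d S H) (conj_ent d S H) \<le> (\<Sum>(i, a)\<in>{..<p} \<times> {..<d}. (\<Sum>b<d. S $$ (a, b) * H $$ (b, i))\<^sup>2)"
proof -
  have Ssym: "S $$ (a, b) = S $$ (b, a)" if "a < d" "b < d" for a b
    using S that unfolding real_symmetric_def by (metis carrier_matD index_transpose_mat(1))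
  define v where "v i k = (\<Sum>b<d. S $$ (k, b) * H $$ (b, i))" for i k
  have "(\<Sum>l<d. H $$ (l, i) * S $$ (l, k)) = v i k" if "k < d" for i k
    unfolding v_def by (intro sum.cong refl) (metis Ssym mult.commute lessThan_iff that)
  then have "conj_ent d S H (i, j) = (\<Sum>k<d. v i k * H $$ (k, j))" for i j
    by (simp add: conj_ent_def)
  then have "dotp (sq p) (conj_ent d S H) (conj_ent d S H) = (\<Sum>i<p. \<Sum>j<p. (\<Sum>k<d. v i k * H $$ (k, j))\<^sup>2)"
    unfolding dotp_def sq_def sum.cartesian_product' by (simp add: power2_eq_square)
  also have "\<dots> \<le> (\<Sum>i<p. \<Sum>j<d. (\<Sum>k<d. v i k * H $$ (k, j))\<^sup>2)"
    using p by (intro sum_mono sum_mono2) auto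
  also have "\<dots> = (\<Sum>i<p. \<Sum>k<d. (v i k)\<^sup>2)"
  proof (rule sum.cong[OF refl])
    fix i
    have "(\<Sum>j<d. (\<Sum>k<d. v i k * H $$ (k, j))\<^sup>2) = (\<Sum>j<d. \<Sum>k<d. \<Sum>l<d. v i k * v i l * (H $$ (k, j) * H $$ (l, j)))"
      unfolding power2_eq_square sum_product by (simp add: mult_ac)
    also have "\<dots> = (\<Sum>k<d. \<Sum>l<d. v i k * v i l * (\<Sum>j<d. H $$ (k, j) * H $$ (l, j)))"
      unfolding sum_distrib_left by (subst sum.swap) (intro sum.cong refl sum.swap)
    also have "\<dots> = (\<Sum>k<d. \<Sum>l<d. if l = k then (v i k)\<^sup>2 else 0)"
      by (intro sum.cong refl) (auto simp: orthogonal_rows[OF H] power2_eq_square)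
    finally show "(\<Sum>j<d. (\<Sum>k<d. v i k * H $$ (k, j))\<^sup>2) = (\<Sum>k<d. (v i k)\<^sup>2)" by simp
  qed
  finally show ?thesis by (simp add: v_def sum.cartesian_product')
qed

lemma palg_conj_norm:
  assumes "p \<le> d"
  shows "palg (ent d) (\<lambda>H. dotp (sq p) (conj_ent d S H) (conj_ent d S H))"
  unfolding dotp_def using assms by (intro palg_sum palg_mult palg_conj_ent) (auto simp: sq_def)

text \<open>Weighting by the squared row norms \<rho> a of S gives all quotients (r a i)^2 / \<rho>
  a the same moment bound, and the weights add up to p |S|^2.\<close>

lemma conj_even_moment:
  assumes S: "real_symmetric d S" and p: "p \<le> d" "0 < d"
  shows "(\<integral>H. dotp (sq p) (conj_ent d S H) (conj_ent d S H) ^ n \<partial>haar_orthogonal d) \<le>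
    (real p * dotp (sq d) (($$) S) (($$) S) / real d) ^ n * dfact n"
proof (cases n)
  case 0
  interpret prob_space "haar_orthogonal d" by (rule prob_space_haar)
  show ?thesis using 0 by (simp add: prob_space dfact_def)
next
  case (Suc m)
  let ?H = "haar_orthogonal d" and ?I = "{..<p} \<times> {..<d}"
  define \<rho> where "\<rho> a = (\<Sum>b<d. (S $$ (a, b))\<^sup>2)" for a
  define r where "r a i H = (\<Sum>b<d. S $$ (a, b) * H $$ (b, i))" for a i and H :: "real mat"
  have \<rho>0: "\<rho> a \<ge> 0" for a by (simp add: \<rho>_def sum_nonneg)
  \<comment> \<open>For a zero row of S the quotient is 0 / 0, which is 0, in agreement with the
    term it replaces.\<close>
  have r0: "r a i H = 0" if "\<rho> a = 0" for a i H
    using that by (auto simp: \<rho>_def r_def sum_nonneg_eq_0_iff)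
  have T0: "(\<Sum>(i, a)\<in>?I. \<rho> a) = real p * dotp (sq d) (($$) S) (($$) S)"
    unfolding dotp_def sq_def sum.cartesian_product' \<rho>_def by (simp add: power2_eq_square)
  have pal: "palg (ent d) (\<lambda>H. r a i H ^ (2 * n))" if "i < d" for a i
    unfolding r_def by (rule palg_column[OF that])
  have "(\<integral>H. dotp (sq p) (conj_ent d S H) (conj_ent d S H) ^ n \<partial>?H) \<le>
      (\<integral>H. (\<Sum>(i, a)\<in>?I. \<rho> a) ^ m * (\<Sum>(i, a)\<in>?I. \<rho> a / \<rho> a ^ n * r a i H ^ (2 * n)) \<partial>?H)"
  proof (rule integral_mono)
    show "integrable ?H (\<lambda>H. dotp (sq p) (conj_ent d S H) (conj_ent d S H) ^ n)"
      by (intro haar_palg(2) palg_power palg_conj_norm p)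
    show "integrable ?H (\<lambda>H. (\<Sum>(i, a)\<in>?I. \<rho> a) ^ m * (\<Sum>(i, a)\<in>?I. \<rho> a / \<rho> a ^ n * r a i H ^ (2 * n)))"
      unfolding split_beta' using p by (intro haar_palg(2) palg_mult palg_const palg_sum pal) auto
  next
    fix H assume "H \<in> space ?H"
    then have H: "H \<in> orthogonal_group d" by (simp add: space_haar)
    have "dotp (sq p) (conj_ent d S H) (conj_ent d S H) ^ n \<le> (\<Sum>(i, a)\<in>?I. (r a i H)\<^sup>2) ^ n"
      using conj_ent_norm_le[OF S H p(1)] unfolding r_def
      by (intro power_mono) (auto simp: dotp_def intro!: sum_nonneg)
    also have "(\<Sum>(i, a)\<in>?I. (r a i H)\<^sup>2) = (\<Sum>(i, a)\<in>?I. \<rho> a * ((r a i H)\<^sup>2 / \<rho> a))"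
      using r0 by (intro sum.cong refl) auto
    also have "\<dots> ^ n \<le> (\<Sum>(i, a)\<in>?I. \<rho> a) ^ m * (\<Sum>(i, a)\<in>?I. \<rho> a * ((r a i H)\<^sup>2 / \<rho> a) ^ n)"
      using power_mean[of ?I "\<lambda>(i, a). \<rho> a" "\<lambda>(i, a). (r a i H)\<^sup>2 / \<rho> a" m] \<rho>0
      unfolding Suc by (simp add: split_beta')
    also have "(\<Sum>(i, a)\<in>?I. \<rho> a * ((r a i H)\<^sup>2 / \<rho> a) ^ n) = (\<Sum>(i, a)\<in>?I. \<rho> a / \<rho> a ^ n * r a i H ^ (2 * n))"
      by (intro sum.cong refl) (auto simp: power_divide power_mult)
    finally show "dotp (sq p) (conj_ent d S H) (conj_ent d S H) ^ n \<le>
      (\<Sum>(i, a)\<in>?I. \<rho> a) ^ m * (\<Sum>(i, a)\<in>?I. \<rho> a / \<rho> a ^ n * r a i H ^ (2 * n))" .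
  qed
  also have "\<dots> = (\<Sum>(i, a)\<in>?I. \<rho> a) ^ m * (\<Sum>(i, a)\<in>?I. \<rho> a / \<rho> a ^ n * (\<integral>H. r a i H ^ (2 * n) \<partial>?H))"
  proof -
    have "integrable ?H (\<lambda>H. \<rho> a / \<rho> a ^ n * r a i H ^ (2 * n))" if "i < p" for a i
      by (intro integrable_mult_right haar_palg(2) pal) (use that p in simp)
    then have "(\<integral>H. (\<Sum>(i, a)\<in>?I. \<rho> a / \<rho> a ^ n * r a i H ^ (2 * n)) \<partial>?H) =
        (\<Sum>(i, a)\<in>?I. \<integral>H. \<rho> a / \<rho> a ^ n * r a i H ^ (2 * n) \<partial>?H)"
      unfolding split_beta' by (intro Bochner_Integration.integral_sum) auto
    then show ?thesis by simp
  qed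
  also have "\<dots> \<le> (\<Sum>(i, a)\<in>?I. \<rho> a) ^ m * (\<Sum>(i, a)\<in>?I. \<rho> a * (dfact n / real d ^ n))"
  proof (intro mult_left_mono sum_mono)
    fix z assume "z \<in> ?I"
    then obtain i a where z: "z = (i, a)" "i < p" "a < d" by auto
    have "(\<integral>H. r a i H ^ (2 * n) \<partial>?H) \<le> \<rho> a ^ n * (dfact n / real d ^ n)"
      unfolding r_def \<rho>_def using z p by (intro haar_column_moment) auto
    then have "\<rho> a / \<rho> a ^ n * (\<integral>H. r a i H ^ (2 * n) \<partial>?H) \<le> \<rho> a / \<rho> a ^ n * (\<rho> a ^ n * (dfact n / real d ^ n))"
      by (rule mult_left_mono) (simp add: \<rho>0)
    also have "\<dots> \<le> \<rho> a * (dfact n / real d ^ n)"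
      using \<rho>0[of a] less_imp_le[OF dfact_pos[of n]] by (cases "\<rho> a = 0") auto
    finally show "(case z of (i, a) \<Rightarrow> \<rho> a / \<rho> a ^ n * (\<integral>H. r a i H ^ (2 * n) \<partial>?H)) \<le> (case z of (i, a) \<Rightarrow> \<rho> a * (dfact n / real d ^ n))"
      by (simp add: z)
  qed (auto intro!: sum_nonneg zero_le_power simp: \<rho>0)
  also have "\<dots> = (\<Sum>(i, a)\<in>?I. \<rho> a) ^ m * ((\<Sum>(i, a)\<in>?I. \<rho> a) * (dfact n / real d ^ n))"
    unfolding sum_distrib_right by (simp add: split_beta')
  also have "\<dots> = (real p * dotp (sq d) (($$) S) (($$) S) / real d) ^ n * dfact n"
    unfolding T0 Suc by (simp add: power_divide)
  finally show ?thesis .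
qed

section \<open>From even moments to all moments\<close>

lemma dfact_Suc: "dfact (Suc n) = real (2 * n + 1) * dfact n"
  by (simp add: dfact_pochhammer pochhammer_Suc algebra_simps)

text \<open>(2n)! = (2n - 1)!! (2n)!!, and the first factor is at most the second, which is 2^n
  n!.\<close>

lemma dfact_square_le: "(dfact n)\<^sup>2 \<le> fact (2 * n)" "real (2 * n + 1) * (dfact n)\<^sup>2 \<le> fact (2 * n + 1)"
proof -
  have f: "(fact (2 * n) :: real) = dfact n * (2 ^ n * fact n)" for n by (simp add: dfact_def)
  have le: "dfact n \<le> 2 ^ n * fact n"
  proof (induction n)
    case (Suc n)
    have "dfact (Suc n) = (2 * real n + 1) * dfact n" by (simp add: dfact_Suc)
    also have "\<dots> \<le> (2 * real n + 2) * (2 ^ n * fact n)" using Suc dfact_pos[of n] by (intro mult_mono) auto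
    finally show ?case by (simp add: algebra_simps)
  qed (simp add: dfact_def)
  show 1: "(dfact n)\<^sup>2 \<le> fact (2 * n)"
    unfolding f power2_eq_square using le dfact_pos[of n] by (intro mult_left_mono) auto
  show "real (2 * n + 1) * (dfact n)\<^sup>2 \<le> fact (2 * n + 1)"
    using mult_left_mono[OF 1, of "real (2 * n + 1)"] by simp
qed

text \<open>Odd moments are interpolated between even ones by the inequality of the arithmetic and geometric mean.\<close>

lemma sqrt_moment:
  fixes q :: "'a \<Rightarrow> real"
  assumes q0: "\<And>x. q x \<ge> 0" and T: "T \<ge> 0"
    and int: "\<And>n. integrable M (\<lambda>x. q x ^ n)" and ints: "\<And>k. integrable M (\<lambda>x. sqrt (q x) ^ k)"
    and bound: "\<And>n. (\<integral>x. q x ^ n \<partial>M) \<le> T ^ n * dfact n"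
  shows "(\<integral>x. sqrt (q x) ^ k \<partial>M) \<le> sqrt T ^ k * sqrt (fact k)"
proof -
  have d: "dfact n \<ge> 0" for n using dfact_pos[of n] by simp
  obtain n where "k = 2 * n \<or> k = 2 * n + 1" by (metis oddE evenE)
  then show ?thesis
  proof
    assume k: "k = 2 * n"
    have "(\<integral>x. sqrt (q x) ^ k \<partial>M) \<le> T ^ n * dfact n" using bound[of n] q0 by (simp add: k power_mult)
    also have "\<dots> \<le> T ^ n * sqrt (fact k)"
      using T dfact_square_le(1)[of n] by (intro mult_left_mono real_le_rsqrt) (auto simp: k)
    finally show ?thesis using T by (simp add: k power_mult)
  next
    assume k: "k = 2 * n + 1"
    have amgm: "(\<integral>x. sqrt (q x) ^ k \<partial>M) \<le> (s * (T ^ n * dfact n) + T ^ Suc n * dfact (Suc n) / s) / 2" if s: "s > 0" for s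
    proof -
      have "(\<integral>x. sqrt (q x) ^ k \<partial>M) \<le> (\<integral>x. (s * q x ^ n + q x ^ Suc n / s) / 2 \<partial>M)"
      proof (rule integral_mono)
        fix x
        define y where "y = sqrt (q x)"
        have y: "q x = y\<^sup>2" "y \<ge> 0" using q0[of x] by (simp_all add: y_def)
        have "0 \<le> (y\<^sup>2) ^ n * (s - y)\<^sup>2 / (2 * s)" using s by simp
        also have "\<dots> = (s * (y\<^sup>2) ^ n + (y\<^sup>2 * (y\<^sup>2) ^ n) / s) / 2 - y * (y\<^sup>2) ^ n"
          using s by (simp add: power2_eq_square[of s] power2_diff field_simps)
        finally have "0 \<le> (s * q x ^ n + q x ^ Suc n / s) / 2 - sqrt (q x) ^ k"
          by (simp add: k y_def[symmetric] y power_mult)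
        then show "sqrt (q x) ^ k \<le> (s * q x ^ n + q x ^ Suc n / s) / 2" by simp
      qed (intro ints int integrable_divide Bochner_Integration.integrable_add integrable_mult_right)+
      also have "\<dots> = (s * (\<integral>x. q x ^ n \<partial>M) + (\<integral>x. q x ^ Suc n \<partial>M) / s) / 2"
        using int[of n] int[of "Suc n"] by (simp del: power_Suc)
      also have "\<dots> \<le> (s * (T ^ n * dfact n) + T ^ Suc n * dfact (Suc n) / s) / 2"
        using s by (intro divide_right_mono add_mono mult_left_mono bound) auto
      finally show ?thesis .
    qed
    show ?thesis
    proof (cases "T = 0")
      \<comment> \<open>No balancing s exists when T = 0; letting s tend to 0 shows that the moment
        is at most 0.\<close>
      case True
      have "(\<integral>x. sqrt (q x) ^ k \<partial>M) \<le> 0"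
      proof (rule field_le_epsilon)
        fix e :: real assume e: "e > 0"
        have "(T ^ n * dfact n) \<le> 1" using True by (cases n) (auto simp: dfact_def)
        then have "(e * (T ^ n * dfact n) + T ^ Suc n * dfact (Suc n) / e) / 2 \<le> e" using e True by (simp add: mult_le_cancel_left)
        with amgm[OF e] show "(\<integral>x. sqrt (q x) ^ k \<partial>M) \<le> 0 + e" by simp
      qed
      then show ?thesis by (simp add: True k)
    next
      case False
      \<comment> \<open>This s makes the two terms of the mean equal: the bounds for n + 1 and n
        differ by the factor (2n + 1) T = s^2.\<close>
      define s where "s = sqrt (real (2 * n + 1)) * sqrt T"
      have "s\<^sup>2 = real (2 * n + 1) * T" unfolding s_def power_mult_distrib using T by simp
      then have s: "s > 0" "s * s = real (2 * n + 1) * T" using False T by (simp_all add: s_def power2_eq_square)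
      have e: "(s * (T ^ n * dfact n) + T ^ Suc n * dfact (Suc n) / s) / 2 = T ^ n * dfact n * s"
      proof -
        have "T ^ Suc n * dfact (Suc n) = (s * s) * (T ^ n * dfact n)" unfolding s(2) by (simp add: dfact_Suc)
        then show ?thesis using s(1) by (simp only:) (simp add: field_simps)
      qed
      have "(\<integral>x. sqrt (q x) ^ k \<partial>M) \<le> T ^ n * dfact n * s" using amgm[OF s(1)] unfolding e .
      also have "\<dots> = T ^ n * sqrt T * sqrt (real (2 * n + 1) * (dfact n)\<^sup>2)"
        using d[of n] by (simp add: s_def real_sqrt_mult)
      also have "\<dots> \<le> T ^ n * sqrt T * sqrt (fact k)"
        unfolding k using T dfact_square_le(2)[of n] by (intro mult_left_mono real_sqrt_le_mono) auto
      also have "T ^ n * sqrt T = sqrt T ^ k" unfolding k power_add power_mult using T by simp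
      finally show ?thesis .
    qed
  qed
qed

lemma conj_moment:
  assumes S: "real_symmetric d S" and p: "p \<le> d" "0 < d"
  shows "integrable (haar_orthogonal d) (\<lambda>H. sqrt (dotp (sq p) (conj_ent d S H) (conj_ent d S H)) ^ k)"
    and "(\<integral>H. sqrt (dotp (sq p) (conj_ent d S H) (conj_ent d S H)) ^ k \<partial>haar_orthogonal d) \<le>
      sqrt (real p * dotp (sq d) (($$) S) (($$) S) / real d) ^ k * sqrt (fact k)"
proof -
  let ?q = "\<lambda>H. dotp (sq p) (conj_ent d S H) (conj_ent d S H)"
  interpret prob_space "haar_orthogonal d" by (rule prob_space_haar)
  have q0: "?q H \<ge> 0" for H by (auto simp: dotp_def intro!: sum_nonneg)
  obtain B where B: "\<And>H. H \<in> space (haar_orthogonal d) \<Longrightarrow> \<bar>?q H\<bar> \<le> B"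
    using haar_palg_bounded[OF palg_conj_norm[OF p(1)]] by blast
  show int: "integrable (haar_orthogonal d) (\<lambda>H. sqrt (?q H) ^ k)" for k
  proof (rule integrable_const_bound[of _ "sqrt B ^ k"])
    show "AE H in haar_orthogonal d. norm (sqrt (?q H) ^ k) \<le> sqrt B ^ k"
      using B q0 by (intro AE_I2) (auto intro!: power_mono simp: power_abs[symmetric] norm_power)
    show "(\<lambda>H. sqrt (?q H) ^ k) \<in> borel_measurable (haar_orthogonal d)"
      using haar_palg(1)[OF palg_conj_norm[OF p(1)]] by simp
  qed
  show "(\<integral>H. sqrt (?q H) ^ k \<partial>haar_orthogonal d) \<le>
      sqrt (real p * dotp (sq d) (($$) S) (($$) S) / real d) ^ k * sqrt (fact k)"
    by (rule sqrt_moment[OF q0 _ haar_palg(2)[OF palg_power[OF palg_conj_norm[OF p(1)]]] int conj_even_moment[OF S p]])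
      (auto simp: dotp_def intro!: sum_nonneg divide_nonneg_nonneg mult_nonneg_nonneg[of "real p"])
qed

section \<open>Reduction to the leading block\<close>

definition embed_mat :: "nat \<Rightarrow> nat \<Rightarrow> real mat \<Rightarrow> real mat" where
  "embed_mat d p K = Matrix.mat d d (\<lambda>(i, j). if i < p \<and> j < p then K $$ (i, j) else of_bool (i = j))"

lemma embed_orthogonal:
  assumes K: "K \<in> orthogonal_group p" and p: "p \<le> d"
  shows "embed_mat d p K \<in> orthogonal_group d"
proof (rule orthogonal_groupI)
  fix i k assume ik: "i < d" "k < d"
  have E: "embed_mat d p K $$ (l, j) = (if l < p \<and> j < p then K $$ (l, j) else of_bool (l = j))" if "l < d" "j < d" for l j
    using that by (simp add: embed_mat_def)
  have s: "(\<Sum>l<d. of_bool (l = i) * f l) = f i" "(\<Sum>l<d. f l * of_bool (l = k)) = f k" for f :: "nat \<Rightarrow> real"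
    using ik by (simp_all add: of_bool_def if_distrib[of "\<lambda>x. x * _"] if_distrib[of "\<lambda>x. _ * x"] cong: if_cong)
  show "(\<Sum>l<d. embed_mat d p K $$ (l, i) * embed_mat d p K $$ (l, k)) = of_bool (i = k)"
  proof (cases "i < p \<and> k < p")
    case True
    have "(\<Sum>l<d. embed_mat d p K $$ (l, i) * embed_mat d p K $$ (l, k)) = (\<Sum>l<p. K $$ (l, i) * K $$ (l, k))"
      using p True ik by (intro sum.mono_neutral_cong_right) (auto simp: E)
    then show ?thesis using orthogonal_cols[OF K] True by simp
  next
    case False
    then consider "p \<le> i" | "p \<le> k" by linarith
    then show ?thesis
    proof cases
      case 1
      have "(\<Sum>l<d. embed_mat d p K $$ (l, i) * embed_mat d p K $$ (l, k)) = (\<Sum>l<d. of_bool (l = i) * embed_mat d p K $$ (l, k))"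
        using 1 ik by (intro sum.cong refl) (auto simp: E)
      then show ?thesis using 1 ik by (simp add: s E)
    next
      case 2
      have "(\<Sum>l<d. embed_mat d p K $$ (l, i) * embed_mat d p K $$ (l, k)) = (\<Sum>l<d. embed_mat d p K $$ (l, i) * of_bool (l = k))"
        using 2 ik by (intro sum.cong refl) (auto simp: E)
      then show ?thesis using 2 ik by (auto simp: s E)
    qed
  qed
qed (simp add: embed_mat_def)

lemma conj_ent_embed:
  assumes "i < p" "j < p" "p \<le> d"
  shows "conj_ent d M (embed_mat d p K) (i, j) = conj_ent p M K (i, j)"
proof -
  have E: "embed_mat d p K $$ (l, j) = (if l < p then K $$ (l, j) else 0)" if "l < d" "j < p" for l j
    using that assms(3) by (auto simp: embed_mat_def)
  have "(\<Sum>l<d. embed_mat d p K $$ (l, i) * M $$ (l, k)) = (\<Sum>l<p. K $$ (l, i) * M $$ (l, k))" for k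
    using assms by (intro sum.mono_neutral_cong_right) (auto simp: E)
  then show ?thesis
    unfolding conj_ent_def prod.case
    using assms by (intro sum.mono_neutral_cong_right) (auto simp: E)
qed

lemma conj_ent_mult:
  assumes S: "S \<in> carrier_mat d d" and H: "H \<in> carrier_mat d d" and E: "E \<in> carrier_mat d d"
    and ij: "i < d" "j < d"
  shows "conj_ent d S (H * E) (i, j) = conj_ent d (Matrix.mat d d (conj_ent d S H)) E (i, j)"
proof -
  have M: "Matrix.mat d d (conj_ent d S H) = transpose_mat H * S * H"
  proof (rule eq_matI)
    fix i j assume "i < dim_row (transpose_mat H * S * H)" "j < dim_col (transpose_mat H * S * H)"
    then have ij: "i < d" "j < d" using H by auto
    show "Matrix.mat d d (conj_ent d S H) $$ (i, j) = (transpose_mat H * S * H) $$ (i, j)"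
      unfolding conj_ent[OF S H ij] using ij by simp
  qed (use S H in auto)
  have "transpose_mat (H * E) * S * (H * E) = transpose_mat E * (transpose_mat H * S * H) * E"
    using S H E by (simp add: transpose_mult[of _ d d _ d] assoc_mult_mat[of _ d d _ d _ d] mult_carrier_mat[of _ d d _ d])
  moreover have "(transpose_mat (H * E) * S * (H * E)) $$ (i, j) = conj_ent d S (H * E) (i, j)"
    using S H E ij by (intro conj_ent) auto
  moreover have "(transpose_mat E * (transpose_mat H * S * H) * E) $$ (i, j) = conj_ent d (transpose_mat H * S * H) E (i, j)"
    using S H E ij by (intro conj_ent) auto
  ultimately show ?thesis unfolding M by simp
qed

lemma real_symmetric_block:
  assumes S: "real_symmetric d S" and H: "H \<in> carrier_mat d d" and p: "p \<le> d"
  shows "real_symmetric p (Matrix.mat p p (conj_ent d S H))"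
proof -
  have Sc: "S \<in> carrier_mat d d" using S by (simp add: real_symmetric_def)
  have "conj_ent d S H (i, j) = conj_ent d S H (j, i)" if "i < d" "j < d" for i j
    using real_symmetric_conj[OF S H] conj_ent[OF Sc H that] conj_ent[OF Sc H that(2,1)] that
    unfolding real_symmetric_def by (metis carrier_matD index_transpose_mat(1))
  then show ?thesis using p by (auto simp: real_symmetric_def intro!: eq_matI)
qed

text \<open>By right invariance under \<open>diag(K, I)\<close> the leading block of \<open>H' S H\<close> may be conjugated by an arbitrary
  orthogonal \<open>K\<close>; averaging over \<open>K\<close> replaces its leading minors by a spherical function.\<close>

lemma block_average:
  assumes S: "real_symmetric d S" and p: "p \<le> d" and hw: "hw_data p k l ys"
  shows "integrable (haar_orthogonal d) (\<lambda>H. sph p l (Matrix.mat p p (conj_ent d S H)))"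
    and "(\<integral>H. Del p l (conj_ent d S H) \<partial>haar_orthogonal d) =
    (\<integral>H. sph p l (Matrix.mat p p (conj_ent d S H)) \<partial>haar_orthogonal d)"
proof -
  let ?H = "haar_orthogonal d" and ?X = "\<lambda>H. Matrix.mat p p (conj_ent d S H)" and ?T = "tuples p k"
  define W where "W t = (\<integral>H. tens k (conj_ent d S H) t \<partial>?H)" for t
  have Sc: "S \<in> carrier_mat d d" using S by (simp add: real_symmetric_def)
  have Hc: "H \<in> carrier_mat d d" if "H \<in> space ?H" for H using that orthogonal_groupD(1) by (auto simp: space_haar)
  have pal: "palg (ent d) (\<lambda>H. tens k (conj_ent d S H) t)" if "t \<in> ?T" for t
    using p by (intro palg_tens[OF that] palg_conj_ent) (auto simp: sq_def)
  have tX: "tens k (($$) (?X H)) t = tens k (conj_ent d S H) t" if "t \<in> ?T" for t H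
    by (rule tens_cong[OF that]) (auto simp: sq_def)
  have comb: "integrable ?H (\<lambda>H. \<Sum>t\<in>?T. c t * tens k (conj_ent d S H) t)"
    "(\<integral>H. (\<Sum>t\<in>?T. c t * tens k (conj_ent d S H) t) \<partial>?H) = (\<Sum>t\<in>?T. c t * W t)" for c
  proof -
    have i: "integrable ?H (\<lambda>H. c t * tens k (conj_ent d S H) t)" if "t \<in> ?T" for t
      by (intro integrable_mult_right haar_palg(2) pal that)
    show "integrable ?H (\<lambda>H. \<Sum>t\<in>?T. c t * tens k (conj_ent d S H) t)"
      by (intro Bochner_Integration.integrable_sum i)
    show "(\<integral>H. (\<Sum>t\<in>?T. c t * tens k (conj_ent d S H) t) \<partial>?H) = (\<Sum>t\<in>?T. c t * W t)"
      by (subst Bochner_Integration.integral_sum[OF i]) (simp_all add: W_def)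
  qed
  have sphX: "sph p l (?X H) = (\<Sum>t\<in>?T. mean_tensor p k l ys t * tens k (conj_ent d S H) t)" if "H \<in> space ?H" for H
    unfolding sph_mean_tensor[OF hw real_symmetric_block[OF S Hc[OF that] p]]
    by (intro sum.cong refl) (simp add: tX)
  show "integrable ?H (\<lambda>H. sph p l (?X H))"
    by (subst Bochner_Integration.integrable_cong[OF refl sphX]) (simp_all add: comb)
  \<comment> \<open>The tensor expansion separates K from H, so averaging over K becomes a finite
    sum over tuples.\<close>
  have K: "(\<integral>H. Del p l (conj_ent d S H) \<partial>?H) = (\<Sum>t\<in>?T. sphere_tensor p k l ys K t * W t)"
    if K: "K \<in> orthogonal_group p" for K
  proof -
    let ?E = "embed_mat d p K"
    have EO: "?E \<in> orthogonal_group d" by (rule embed_orthogonal[OF K p])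
    note Ec = orthogonal_groupD(1)[OF EO]
    note Kc = orthogonal_groupD(1)[OF K]
    have "(\<integral>H. Del p l (conj_ent d S H) \<partial>?H) = (\<integral>H. Del p l (conj_ent d S (H * ?E)) \<partial>?H)"
      by (rule haar_right[OF EO haar_palg(1)[OF palg_Del_conj[OF p]], symmetric])
    also have "\<dots> = (\<integral>H. (\<Sum>t\<in>?T. sphere_tensor p k l ys K t * tens k (conj_ent d S H) t) \<partial>?H)"
    proof (intro Bochner_Integration.integral_cong refl)
      fix H assume H: "H \<in> space ?H"
      have "Del p l (conj_ent d S (H * ?E)) = Del p l (($$) (transpose_mat K * ?X H * K))"
      proof (rule Del_cong)
        fix i j assume ij: "i < p" "j < p"
        have "conj_ent d S (H * ?E) (i, j) = conj_ent d (Matrix.mat d d (conj_ent d S H)) ?E (i, j)"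
          using ij p by (intro conj_ent_mult Sc Hc H Ec) auto
        also have "\<dots> = conj_ent p (Matrix.mat d d (conj_ent d S H)) K (i, j)"
          by (rule conj_ent_embed[OF ij p])
        also have "\<dots> = conj_ent p (?X H) K (i, j)"
          unfolding conj_ent_def[of p] prod.case using p by (intro sum.cong refl arg_cong2[where f = "(*)"]) auto
        also have "\<dots> = (transpose_mat K * ?X H * K) $$ (i, j)"
          by (rule conj_ent[OF _ Kc ij, symmetric]) simp
        finally show "conj_ent d S (H * ?E) (i, j) = (transpose_mat K * ?X H * K) $$ (i, j)" .
      qed
      also have "\<dots> = (\<Sum>t\<in>?T. sphere_tensor p k l ys K t * tens k (conj_ent d S H) t)"
        unfolding Del_sphere_tensor[OF hw real_symmetric_block[OF S Hc[OF H] p] Kc]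
        by (intro sum.cong refl) (simp add: tX)
      finally show "Del p l (conj_ent d S (H * ?E)) = (\<Sum>t\<in>?T. sphere_tensor p k l ys K t * tens k (conj_ent d S H) t)" .
    qed
    also have "\<dots> = (\<Sum>t\<in>?T. sphere_tensor p k l ys K t * W t)" by (rule comb)
    finally show ?thesis .
  qed
  interpret P: prob_space "haar_orthogonal p" by (rule prob_space_haar)
  have "(\<integral>H. Del p l (conj_ent d S H) \<partial>?H) =
      (\<integral>K. (\<integral>H. Del p l (conj_ent d S H) \<partial>?H) \<partial>haar_orthogonal p)" by (simp add: P.prob_space)
  also have "\<dots> = (\<integral>K. (\<Sum>t\<in>?T. sphere_tensor p k l ys K t * W t) \<partial>haar_orthogonal p)"
    by (intro Bochner_Integration.integral_cong refl K) (simp add: space_haar)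
  also have "\<dots> = (\<Sum>t\<in>?T. mean_tensor p k l ys t * W t)"
    unfolding mean_tensor_def
    by (subst Bochner_Integration.integral_sum) (auto intro!: integrable_mult_left haar_palg(2) palg_sphere_tensor)
  also have "\<dots> = (\<integral>H. sph p l (?X H) \<partial>?H)"
    unfolding comb(2)[symmetric] by (intro Bochner_Integration.integral_cong refl sphX[symmetric])
  finally show "(\<integral>H. Del p l (conj_ent d S H) \<partial>?H) = (\<integral>H. sph p l (?X H) \<partial>?H)" .
qed

text \<open>A partition of length at most p gives exponent 0 to every minor of order above p, so
  only the leading p by p block matters.\<close>

lemma zonal_Del:
  assumes \<kappa>: "\<kappa> \<in> partitions k p" and S: "S \<in> carrier_mat d d" and p: "p \<le> d"
  shows "zonal \<kappa> S = zonal_at_identity d \<kappa> * (\<integral>H. Del p \<kappa> (conj_ent d S H) \<partial>haar_orthogonal d)"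
proof -
  have "(\<Prod>j<part_length \<kappa>. leading_minor (Suc j) (transpose_mat H * S * H) ^ (\<kappa> j - \<kappa> (Suc j))) =
      Del p \<kappa> (conj_ent d S H)" if "H \<in> space (haar_orthogonal d)" for H
  proof -
    have H: "H \<in> carrier_mat d d" using that orthogonal_groupD(1) by (auto simp: space_haar)
    have "(\<Prod>j<part_length \<kappa>. leading_minor (Suc j) (transpose_mat H * S * H) ^ (\<kappa> j - \<kappa> (Suc j))) =
        Del (part_length \<kappa>) \<kappa> (($$) (transpose_mat H * S * H))"
      by (simp add: Del_def leading_minor_lm)
    also have "\<dots> = Del p \<kappa> (($$) (transpose_mat H * S * H))"
      using partition_facts(2,4)[OF \<kappa>] by (intro Del_trunc[symmetric]) auto
    also have "\<dots> = Del p \<kappa> (conj_ent d S H)"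
      using p by (intro Del_cong conj_ent S H) auto
    finally show ?thesis .
  qed
  then show ?thesis using S unfolding zonal_def
    by (simp cong: Bochner_Integration.integral_cong)
qed

lemma zonal_one:
  assumes \<kappa>: "\<kappa> \<in> partitions k p" and p: "p \<le> d"
  shows "zonal \<kappa> (1\<^sub>m d) = zonal_at_identity d \<kappa>"
proof -
  interpret prob_space "haar_orthogonal d" by (rule prob_space_haar)
  have \<kappa>d: "\<kappa> \<in> partitions k d" using \<kappa> partitions_mono[OF p] by blast
  have "(\<integral>H. Del d \<kappa> (conj_ent d (1\<^sub>m d) H) \<partial>haar_orthogonal d) = (\<integral>H. 1 \<partial>haar_orthogonal d)"
  proof (intro Bochner_Integration.integral_cong refl)
    fix H assume "H \<in> space (haar_orthogonal d)"
    then have H: "H \<in> orthogonal_group d" by (simp add: space_haar)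
    note Hc = orthogonal_groupD[OF H]
    have "Del d \<kappa> (conj_ent d (1\<^sub>m d) H) = Del d \<kappa> (($$) (transpose_mat H * 1\<^sub>m d * H))"
      by (intro Del_cong conj_ent[symmetric] Hc) auto
    also have "\<dots> = 1" using Hc Del_one[OF partition_facts(1)[OF \<kappa>d] partition_top[OF \<kappa>d]] by simp
    finally show "Del d \<kappa> (conj_ent d (1\<^sub>m d) H) = 1" .
  qed
  then show ?thesis using zonal_Del[OF \<kappa>d, of "1\<^sub>m d" d] by (simp add: prob_space)
qed

lemma bingham_term_bound:
  assumes A: "real_symmetric p A" and S: "real_symmetric d S" and p: "p \<le> d" "0 < d"
  shows "\<bar>bingham_term d p A S k\<bar> \<le>
    (sqrt (dotp (sq p) (($$) A) (($$) A)) * sqrt (real p * dotp (sq d) (($$) S) (($$) S) / real d)) ^ k / sqrt (fact k)"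
proof -
  let ?H = "haar_orthogonal d" and ?X = "\<lambda>H. Matrix.mat p p (conj_ent d S H)" and ?P = "partitions k p"
  let ?a = "sqrt (dotp (sq p) (($$) A) (($$) A))" and ?s = "sqrt (real p * dotp (sq d) (($$) S) (($$) S) / real d)"
  have Ac: "A \<in> carrier_mat p p" and Sc: "S \<in> carrier_mat d d" using A S by (auto simp: real_symmetric_def)
  define F where "F H = (\<Sum>\<kappa>\<in>?P. zonal_at_identity p \<kappa> * sph p \<kappa> A * sph p \<kappa> (?X H))" for H
  have avg: "integrable ?H (\<lambda>H. sph p \<kappa> (?X H))"
    "(\<integral>H. Del p \<kappa> (conj_ent d S H) \<partial>?H) = (\<integral>H. sph p \<kappa> (?X H) \<partial>?H)" if "\<kappa> \<in> ?P" for \<kappa>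
    using hw_data_partition[OF that] block_average[OF S p(1)] by blast+
  have "(\<Sum>\<kappa>\<in>?P. zonal \<kappa> A * zonal \<kappa> S / zonal \<kappa> (1\<^sub>m d)) =
      (\<Sum>\<kappa>\<in>?P. zonal_at_identity p \<kappa> * sph p \<kappa> A * (\<integral>H. sph p \<kappa> (?X H) \<partial>?H))"
  proof (intro sum.cong refl)
    fix \<kappa> assume \<kappa>: "\<kappa> \<in> ?P"
    have "zonal_at_identity d \<kappa> > 0" using partitions_mono[OF p(1)] \<kappa> by (blast intro: zonal_at_identity_pos)
    moreover have "zonal \<kappa> A = zonal_at_identity p \<kappa> * sph p \<kappa> A"
      unfolding sph_conj_ent[OF Ac] by (rule zonal_Del[OF \<kappa> Ac order_refl])
    ultimately show "zonal \<kappa> A * zonal \<kappa> S / zonal \<kappa> (1\<^sub>m d) =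
        zonal_at_identity p \<kappa> * sph p \<kappa> A * (\<integral>H. sph p \<kappa> (?X H) \<partial>?H)"
      by (simp add: zonal_Del[OF \<kappa> Sc p(1)] zonal_one[OF \<kappa> p(1)] avg[OF \<kappa>])
  qed
  also have "\<dots> = (\<integral>H. F H \<partial>?H)"
    unfolding F_def using avg(1) by (subst Bochner_Integration.integral_sum) auto
  finally have term_eq: "bingham_term d p A S k = (\<integral>H. F H \<partial>?H) / fact k" by (simp add: bingham_term_def)
  have Fi: "integrable ?H F"
    unfolding F_def using avg(1) by (intro Bochner_Integration.integrable_sum integrable_mult_right) auto
  have "\<bar>\<integral>H. F H \<partial>?H\<bar> \<le> (\<integral>H. \<bar>F H\<bar> \<partial>?H)" by (rule integral_abs_bound)
  also have "\<dots> \<le> (\<integral>H. ?a ^ k * sqrt (dotp (sq p) (conj_ent d S H) (conj_ent d S H)) ^ k \<partial>?H)"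
  proof (rule integral_mono)
    show "integrable ?H (\<lambda>H. \<bar>F H\<bar>)" using Fi by simp
    show "integrable ?H (\<lambda>H. ?a ^ k * sqrt (dotp (sq p) (conj_ent d S H) (conj_ent d S H)) ^ k)"
      by (intro integrable_mult_right conj_moment(1)[OF S p])
    fix H assume "H \<in> space ?H"
    then have H: "H \<in> carrier_mat d d" using orthogonal_groupD(1) by (auto simp: space_haar)
    show "\<bar>F H\<bar> \<le> ?a ^ k * sqrt (dotp (sq p) (conj_ent d S H) (conj_ent d S H)) ^ k"
      unfolding F_def using zonal_pairing_bound[OF A real_symmetric_block[OF S H p(1)], of k] by simp
  qed
  also have "\<dots> \<le> ?a ^ k * (?s ^ k * sqrt (fact k))"
    using conj_moment(2)[OF S p, of k] by (simp add: mult_left_mono dotp_def sum_nonneg)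
  finally have "\<bar>\<integral>H. F H \<partial>?H\<bar> / fact k \<le> ?a ^ k * (?s ^ k * sqrt (fact k)) / fact k"
    by (intro divide_right_mono) auto
  also have "\<dots> = (?a * ?s) ^ k / (fact k / sqrt (fact k))" by (simp add: power_mult_distrib)
  also have "fact k / sqrt (fact k) = sqrt (fact k)" by (simp add: real_div_sqrt)
  finally show ?thesis unfolding term_eq by (simp add: abs_divide)
qed

section \<open>Frobenius norm and eigenvalues\<close>

lemma trace_mult_commute:
  assumes "A \<in> carrier_mat n m" "B \<in> carrier_mat m n"
  shows "mat_trace (A * B) = mat_trace (B * A)"
proof -
  have "mat_trace (A * B) = (\<Sum>i<n. \<Sum>j<m. A $$ (i, j) * B $$ (j, i))"
    using assms unfolding mat_trace_def by (auto simp: index_mult_sum[of _ n m _ n] simp del: index_mult_mat(1) intro!: sum.cong)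
  also have "\<dots> = (\<Sum>j<m. \<Sum>i<n. B $$ (j, i) * A $$ (i, j))" by (subst sum.swap) (simp add: mult.commute)
  also have "\<dots> = mat_trace (B * A)"
    using assms unfolding mat_trace_def by (auto simp: index_mult_sum[of _ m n _ m] simp del: index_mult_mat(1) intro!: sum.cong)
  finally show ?thesis .
qed

lemma dotp_symmetric_trace:
  assumes "real_symmetric n A"
  shows "dotp (sq n) (($$) A) (($$) A) = mat_trace (A * A)"
proof -
  have Ac: "A \<in> carrier_mat n n" and At: "transpose_mat A = A" using assms by (auto simp: real_symmetric_def)
  have "A $$ (i, j) = A $$ (j, i)" if "i < n" "j < n" for i j
    using Ac At that by (metis carrier_matD index_transpose_mat(1))
  then have "mat_trace (A * A) = (\<Sum>i<n. \<Sum>j<n. A $$ (i, j) * A $$ (i, j))"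
    using Ac unfolding mat_trace_def
    by (auto simp: index_mult_sum[of _ n n _ n] simp del: index_mult_mat(1) intro!: sum.cong)
  then show ?thesis unfolding dotp_def sq_def sum.cartesian_product' by simp
qed

text \<open>Schur decomposition makes A similar to a triangular B with the given diagonal; the trace
  is a similarity invariant, and for triangular B only squares of diagonal entries survive.\<close>

lemma trace_square_eigenvalues:
  assumes A: "A \<in> carrier_mat n n" and ev: "eigenvalue_list A evs"
  shows "mat_trace (A * A) = (\<Sum>a\<leftarrow>evs. a\<^sup>2)"
proof -
  obtain B P Q where BPQ: "schur_decomposition A evs = (B, P, Q)" by (cases "schur_decomposition A evs")
  have B: "similar_mat_wit A B P Q" "upper_triangular B" "diag_mat B = evs"
    using schur_decomposition[OF A _ BPQ] ev by (auto simp: eigenvalue_list_def)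
  have c: "B \<in> carrier_mat n n" "P \<in> carrier_mat n n" "Q \<in> carrier_mat n n"
    and PQ: "Q * P = 1\<^sub>m n" and AB: "A = P * B * Q"
    using B(1) A by (auto simp: similar_mat_wit_def Let_def)
  have "A * A = P * (B * (Q * P) * B) * Q"
    unfolding AB using c by (simp add: assoc_mult_mat[of _ n n _ n _ n] mult_carrier_mat[of _ n n _ n])
  then have AA: "A * A = P * (B * (B * Q))"
    unfolding PQ using c by (simp add: assoc_mult_mat[of _ n n _ n _ n] mult_carrier_mat[of _ n n _ n])
  have "B * (B * Q) \<in> carrier_mat n n" using c by simp
  from trace_mult_commute[OF c(2) this] have "mat_trace (A * A) = mat_trace (B * (B * Q) * P)" unfolding AA .
  also have "B * (B * Q) * P = B * (B * (Q * P))"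
    using c by (simp add: assoc_mult_mat[of _ n n _ n _ n] mult_carrier_mat[of _ n n _ n])
  also have "\<dots> = B * B" using c by (simp add: PQ)
  also have "mat_trace (B * B) = (\<Sum>i<n. \<Sum>j<n. B $$ (i, j) * B $$ (j, i))"
    using c unfolding mat_trace_def
    by (auto simp: index_mult_sum[of _ n n _ n] simp del: index_mult_mat(1) intro!: sum.cong)
  also have "\<dots> = (\<Sum>i<n. \<Sum>j<n. if j = i then (B $$ (i, i))\<^sup>2 else 0)"
  proof (intro sum.cong refl)
    fix i j assume ij: "i \<in> {..<n}" "j \<in> {..<n}"
    have z: "B $$ (i, j) = 0" if "j < i" "i < n" for i j using upper_triangularD[OF B(2), of j i] that c by auto
    show "B $$ (i, j) * B $$ (j, i) = (if j = i then (B $$ (i, i))\<^sup>2 else 0)"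
      using z[of i j] z[of j i] ij by (cases i j rule: linorder_cases) (auto simp: power2_eq_square)
  qed
  also have "\<dots> = (\<Sum>a\<leftarrow>diag_mat B. a\<^sup>2)"
    using c by (simp add: diag_mat_def sum_list_sum_nth comp_def atLeast0LessThan)
  finally show ?thesis unfolding B(3) .
qed

text \<open>The Euclidean norm of the eigenvalues is at most the sum of their absolute
  values.\<close>

lemma frobenius_le_trace:
  assumes A: "real_symmetric n A" and ev: "eigenvalue_list A evs"
  shows "sqrt (dotp (sq n) (($$) A) (($$) A)) \<le> mat_trace (abs_diag evs)"
proof -
  have "mat_trace (abs_diag evs) = (\<Sum>i<length evs. \<bar>evs ! i\<bar>)"
    by (simp add: mat_trace_def abs_diag_def mat_diag_def)
  moreover have "(\<Sum>a\<leftarrow>evs. a\<^sup>2) = (\<Sum>i<length evs. \<bar>evs ! i\<bar>\<^sup>2)"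
    by (simp add: sum_list_sum_nth atLeast0LessThan)
  moreover have "sqrt (\<Sum>i<length evs. \<bar>evs ! i\<bar>\<^sup>2) \<le> (\<Sum>i<length evs. \<bar>evs ! i\<bar>)"
    using L2_set_le_sum[of "{..<length evs}" "\<lambda>i. \<bar>evs ! i\<bar>"] by (simp add: L2_set_def)
  moreover have "dotp (sq n) (($$) A) (($$) A) = (\<Sum>a\<leftarrow>evs. a\<^sup>2)"
    using A trace_square_eigenvalues[OF _ ev] unfolding dotp_symmetric_trace[OF A] real_symmetric_def by blast
  ultimately show ?thesis by simp
qed

section \<open>Estimates for the majorising series\<close>

text \<open>Both factors of \<open>alpha_const\<close> together are at least (2 pi)^(-1/4), and the
  square of \<open>gamma1\<close> is 1 + sqrt 3 / 2 \<ge> 7/4, where (7/4)^4 > 8 > 2 pi.\<close>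

lemma alpha_gamma_ge_1:
  assumes p: "p \<ge> 1" and k: "k \<ge> 2"
  shows "1 \<le> alpha_const p * gamma1 ^ k"
proof -
  have s3: "sqrt 3 \<ge> 3 / 2" by (rule real_le_rsqrt) (simp add: power2_eq_square)
  have g2: "gamma1\<^sup>2 \<ge> 7 / 4"
  proof -
    have "gamma1\<^sup>2 = 1 + sqrt 3 / 2" by (simp add: gamma1_def power2_eq_square field_simps)
    then show ?thesis using s3 by simp
  qed
  have g1: "gamma1 \<ge> 1" using s3 by (simp add: gamma1_def)
  have "2 * pi \<le> (gamma1\<^sup>2) ^ 4"
  proof -
    have "2 * pi \<le> (7 / 4) ^ 4" using pi_less_4 by (simp add: eval_nat_numeral)
    also have "\<dots> \<le> (gamma1\<^sup>2) ^ 4" using g2 by (intro power_mono) auto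
    finally show ?thesis .
  qed
  then have "(2 * pi) powr (1 / 4) \<le> ((gamma1\<^sup>2) ^ 4) powr (1 / 4)"
    by (intro powr_mono2) auto
  also have "\<dots> = gamma1\<^sup>2"
  proof -
    have "(x ^ 4) powr (1 / 4) = x" if "x > 0" for x :: real
      using that powr_realpow[of x 4] powr_powr[of x 4 "1 / 4"] by simp
    then show ?thesis using g1 by (smt (verit) zero_less_power)
  qed
  also have "\<dots> \<le> gamma1 ^ k" using g1 k by (rule power_increasing[rotated])
  finally have le: "(2 * pi) powr (1 / 4) \<le> gamma1 ^ k" .
  have pp: "(2 * pi) powr (1 / 4) > 0" by simp
  have "1 = (2 * pi) powr (- (1 / 4)) * (2 * pi) powr (1 / 4)" by (simp add: powr_minus)
  also have "\<dots> \<le> (2 * pi) powr (- ((real p - 1) / (4 * real p))) * gamma1 ^ k"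
    using p pi_gt3 le by (intro mult_mono powr_mono) (auto simp: field_simps)
  also have "\<dots> \<le> ((2 * pi) powr (- ((real p - 1) / (4 * real p))) * real p powr (1 / (4 * real p))) * gamma1 ^ k"
  proof -
    have "1 \<le> real p powr (1 / (4 * real p))" using p by (intro ge_one_powr_ge_zero) auto
    then show ?thesis using g1 by (intro mult_right_mono) auto
  qed
  finally show ?thesis by (simp add: alpha_const_def)
qed

lemma alpha_const_nonneg: "alpha_const p \<ge> 0"
  by (simp add: alpha_const_def)

text \<open>The term is the geometric mean of (2 b^2)^k / k! and 2^(-k), both summable.\<close>

lemma summable_power_sqrt_fact:
  fixes b :: real
  assumes b: "b \<ge> 0"
  shows "summable (\<lambda>k. b ^ k / sqrt (fact k))"
proof (rule summable_comparison_test')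
  show "summable (\<lambda>k. ((2 * b\<^sup>2) ^ k / fact k + (1 / 2) ^ k) / 2)"
    using summable_exp[of "2 * b\<^sup>2"]
    by (intro summable_divide summable_add summable_geometric) (simp_all add: field_simps)
  fix k :: nat
  have e: "((2 * b\<^sup>2) ^ k / fact k) * (1 / 2) ^ k = (b ^ k / sqrt (fact k))\<^sup>2"
    by (simp add: power_divide power_mult_distrib[of 2] power_mult[symmetric] mult.commute)
  have "b ^ k / sqrt (fact k) = sqrt (((2 * b\<^sup>2) ^ k / fact k) * (1 / 2) ^ k)"
    unfolding e using b by simp
  also have "\<dots> \<le> ((2 * b\<^sup>2) ^ k / fact k + (1 / 2) ^ k) / 2"
    by (rule arith_geo_mean_sqrt) auto
  finally show "norm (b ^ k / sqrt (fact k)) \<le> ((2 * b\<^sup>2) ^ k / fact k + (1 / 2) ^ k) / 2"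
    using b by simp
qed

text \<open>The additional factors pair up as (m + 2i + 1)(m + 2i + 2) \<ge> (2i + 2)^2 when m \<ge>
  1.\<close>

lemma fact_even_shift: "m \<ge> 1 \<Longrightarrow> fact m * (2 ^ j * fact j)\<^sup>2 \<le> (fact (m + 2 * j) :: real)"
proof (induction j)
  case (Suc j)
  have "fact m * (2 ^ Suc j * fact (Suc j))\<^sup>2 = (2 * (real j + 1) * (2 * (real j + 1))) * (fact m * (2 ^ j * fact j)\<^sup>2)"
    by (simp add: power2_eq_square algebra_simps)
  also have "\<dots> \<le> (real (m + 2 * j + 2) * real (m + 2 * j + 1)) * fact (m + 2 * j)"
    using Suc by (intro mult_mono) auto
  also have "\<dots> = fact (m + 2 * Suc j)" by (simp add: algebra_simps)
  finally show ?case .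
qed simp

text \<open>The odd terms are compared with their even neighbours, and the even ones with the series of
  \<open>exp (b\<^sup>2 / 2)\<close>.\<close>

lemma odd_term_le:
  fixes b :: real
  assumes b: "b \<ge> 0" and n: "n \<ge> 2"
  shows "b ^ Suc k / sqrt (fact (Suc n)) \<le> 11 / 20 * (b ^ k / sqrt (fact n) + b ^ Suc (Suc k) / sqrt (fact (Suc (Suc n))))"
proof -
  define x where "x = b ^ k / sqrt (fact n)"
  define y where "y = b ^ Suc (Suc k) / sqrt (fact (Suc (Suc n)))"
  define z where "z = b ^ Suc k / sqrt (fact (Suc n))"
  have nn: "x \<ge> 0" "y \<ge> 0" "z \<ge> 0" using b by (auto simp: x_def y_def z_def)
  have f: "(fact (Suc n) :: real) = (real n + 1) * fact n" "(fact (Suc (Suc n)) :: real) = (real n + 2) * ((real n + 1) * fact n)"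
    by (simp_all add: algebra_simps)
  have x2: "x\<^sup>2 = (b\<^sup>2) ^ k / fact n" and y2: "y\<^sup>2 = (b\<^sup>2) ^ Suc (Suc k) / fact (Suc (Suc n))"
    and z2: "z\<^sup>2 = (b\<^sup>2) ^ Suc k / fact (Suc n)"
    unfolding x_def y_def z_def power_divide power_mult[symmetric] mult.commute[of _ 2] by simp_all
  \<comment> \<open>The odd term exceeds the geometric mean of its neighbours by the factor ((n +
    2)/(n + 1))^(1/4), at most (4/3)^(1/4) < 11/10; halving for the arithmetic mean gives
    11/20.\<close>
  have "(z\<^sup>2)\<^sup>2 = (real n + 2) / (real n + 1) * (x\<^sup>2 * y\<^sup>2)"
    unfolding x2 y2 z2 f by (simp add: power2_eq_square divide_simps)
  also have "\<dots> \<le> (11 / 10) ^ 4 * (x\<^sup>2 * y\<^sup>2)"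
  proof (rule mult_right_mono)
    show "(real n + 2) / (real n + 1) \<le> (11 / 10) ^ 4" using n by (simp add: field_simps eval_nat_numeral)
  qed simp
  also have "\<dots> = ((11 / 10)\<^sup>2 * (x * y))\<^sup>2" by (simp add: power_mult_distrib eval_nat_numeral)
  finally have "z\<^sup>2 \<le> (11 / 10)\<^sup>2 * (x * y)" by (rule power2_le_imp_le) (use nn in auto)
  also have "\<dots> \<le> (11 / 20 * (x + y))\<^sup>2"
    using zero_le_power2[of "x - y"] by (simp add: power2_eq_square algebra_simps)
  finally have "z \<le> 11 / 20 * (x + y)" by (rule power2_le_imp_le) (use nn in auto)
  then show ?thesis by (simp only: x_def y_def z_def)
qed

text \<open>The even terms sum to at most exp(b^2/2) / sqrt(m!). Each even term is charged by at
  most two odd ones, so the total factor is 1 + 2 * 11/20 = 21/10.\<close>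

lemma sqrt_fact_series_bound:
  fixes b :: real
  assumes b: "b \<ge> 0" and m: "m \<ge> 2"
  shows "summable (\<lambda>k. b ^ k / sqrt (fact (k + m)))"
    and "(\<Sum>k. b ^ k / sqrt (fact (k + m))) \<le> 21 / 10 / sqrt (fact m) * exp (b\<^sup>2 / 2)"
proof -
  define a where "a k = b ^ k / sqrt (fact (k + m))" for k
  have a0: "a k \<ge> 0" for k using b by (simp add: a_def)
  show s: "summable (\<lambda>k. b ^ k / sqrt (fact (k + m)))"
  proof (rule summable_comparison_test'[OF summable_power_sqrt_fact[OF b]])
    fix k :: nat
    show "norm (b ^ k / sqrt (fact (k + m))) \<le> b ^ k / sqrt (fact k)"
      using b by (auto intro!: divide_left_mono fact_mono)
  qed
  define E where "E = exp (b\<^sup>2 / 2) / sqrt (fact m)"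
  have even: "(\<Sum>j<N. a (2 * j)) \<le> E" for N
  proof -
    have "(\<Sum>j<N. a (2 * j)) \<le> (\<Sum>j<N. (b\<^sup>2 / 2) ^ j /\<^sub>R fact j / sqrt (fact m))"
    proof (rule sum_mono)
      fix j
      have "sqrt (fact m) * (2 ^ j * fact j) = sqrt (fact m * (2 ^ j * fact j)\<^sup>2)" by (simp add: real_sqrt_mult)
      also have "\<dots> \<le> sqrt (fact (2 * j + m))"
        using fact_even_shift[of m j] m by (intro real_sqrt_le_mono) (simp add: add.commute)
      finally have "a (2 * j) \<le> (b\<^sup>2) ^ j / (sqrt (fact m) * (2 ^ j * fact j))"
        unfolding a_def power_mult using b by (intro divide_left_mono) auto
      also have "\<dots> = (b\<^sup>2 / 2) ^ j /\<^sub>R fact j / sqrt (fact m)"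
        by (simp add: power_divide scaleR_conv_of_real divide_simps)
      finally show "a (2 * j) \<le> (b\<^sup>2 / 2) ^ j /\<^sub>R fact j / sqrt (fact m)" .
    qed
    also have "\<dots> = (\<Sum>j<N. (b\<^sup>2 / 2) ^ j /\<^sub>R fact j) / sqrt (fact m)" by (rule sum_divide_distrib[symmetric])
    also have "\<dots> \<le> E"
      unfolding E_def
    proof (rule divide_right_mono)
      have "(\<Sum>j<N. (b\<^sup>2 / 2) ^ j /\<^sub>R fact j) \<le> (\<Sum>j. (b\<^sup>2 / 2) ^ j /\<^sub>R fact j)"
        by (rule sum_le_suminf[OF sums_summable[OF exp_converges]]) auto
      also have "\<dots> = exp (b\<^sup>2 / 2)" by (rule sums_unique[OF exp_converges, symmetric])
      finally show "(\<Sum>j<N. (b\<^sup>2 / 2) ^ j /\<^sub>R fact j) \<le> exp (b\<^sup>2 / 2)" .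
    qed simp
    finally show ?thesis .
  qed
  have part: "(\<Sum>k<n. a k) \<le> 21 / 10 * E" for n
  proof -
    have odd: "a (Suc (2 * j)) \<le> 11 / 20 * (a (2 * j) + a (2 * Suc j))" for j
      using odd_term_le[OF b, of "2 * j + m" "2 * j"] m by (simp add: a_def)
    have "(\<Sum>k<n. a k) \<le> (\<Sum>k<2 * n. a k)" by (rule sum_mono2) (auto simp: a0)
    also have "\<dots> = (\<Sum>j<n. a (2 * j) + a (Suc (2 * j)))" by (induction n) auto
    also have "\<dots> \<le> (\<Sum>j<n. a (2 * j) + 11 / 20 * (a (2 * j) + a (2 * Suc j)))"
      by (intro sum_mono add_left_mono odd)
    also have "\<dots> = (\<Sum>j<n. 31 / 20 * a (2 * j) + 11 / 20 * a (2 * Suc j))"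
      by (intro sum.cong refl) (simp add: algebra_simps)
    also have "\<dots> = 31 / 20 * (\<Sum>j<n. a (2 * j)) + 11 / 20 * (\<Sum>j<n. a (2 * Suc j))"
      by (simp only: sum.distrib sum_distrib_left)
    also have "(\<Sum>j<n. a (2 * Suc j)) \<le> (\<Sum>j<Suc n. a (2 * j))"
      unfolding sum.lessThan_Suc_shift using a0[of 0] by simp
    finally show ?thesis using even[of n] even[of "Suc n"] by linarith
  qed
  have "suminf a \<le> 21 / 10 * E"
    using s by (intro suminf_le_const part) (simp add: a_def[abs_def])
  then show "(\<Sum>k. b ^ k / sqrt (fact (k + m))) \<le> 21 / 10 / sqrt (fact m) * exp (b\<^sup>2 / 2)"
    by (simp add: a_def[abs_def] E_def)
qed

lemma one_plus_inverse_power_le_exp: "(1 + 1 / real m) ^ m \<le> exp 1"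
proof (cases "m = 0")
  case False
  have "(1 + 1 / real m) ^ m \<le> exp (1 / real m) ^ m" by (intro power_mono exp_ge_add_one_self) auto
  also have "\<dots> = exp 1" using False by (simp add: exp_of_nat_mult[symmetric])
  finally show ?thesis .
qed simp

text \<open>The series is bounded with exponent b^2 / 2; this permits the weaker exponent that
  contains \<open>c_const m\<close>.\<close>

lemma c_const_ge_1:
  assumes "m \<ge> 1"
  shows "1 \<le> c_const m"
proof -
  have p: "(1 + 1 / real m) ^ m > 0" by (intro zero_less_power) (simp add: add_pos_nonneg)
  have "c_const m = exp 1 / (1 + 1 / real m) ^ m"
    using assms by (simp add: c_const_def powr_minus powr_realpow add_pos_nonneg divide_inverse mult.commute)
  then show ?thesis using one_plus_inverse_power_le_exp[of m] p by simp
qed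

text \<open>The right side increases with m, its successive ratios being e / (1 + 1/m)^m \<ge> 1; at
  m = 2 it is e^2 / 2, and e \<ge> 5/2.\<close>

lemma fact_exp_ge:
  assumes "m \<ge> 2"
  shows "25 / 8 \<le> fact m * (exp 1 / real m) ^ m"
  using assms
proof (induction m rule: dec_induct)
  case base
  have "5 / 2 \<le> exp (1::real)" using exp_lower_Taylor_quadratic[of 1] by simp
  then have "(5 / 2)\<^sup>2 \<le> (exp (1::real))\<^sup>2" by (intro power_mono) auto
  then show ?case by (simp add: power_divide power2_eq_square)
next
  case (step m)
  have m: "real m > 0" using step by simp
  have e: "real (Suc m) * (exp 1 / real (Suc m)) ^ Suc m * (1 + 1 / real m) ^ m = (exp 1 / real m) ^ m * exp 1"
  proof -
    have "1 + 1 / real m = real (Suc m) / real m" using m by (simp add: field_simps)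
    then have "(exp 1 / real (Suc m)) * (1 + 1 / real m) = exp 1 / real m" by (simp only:) simp
    then have "(exp 1 / real (Suc m)) ^ m * (1 + 1 / real m) ^ m = (exp 1 / real m) ^ m"
      by (simp only: power_mult_distrib[symmetric])
    moreover have "real (Suc m) * (exp 1 / real (Suc m)) = exp 1" by (simp add: field_simps)
    moreover have "real (Suc m) * (exp 1 / real (Suc m)) ^ Suc m * (1 + 1 / real m) ^ m =
        (real (Suc m) * (exp 1 / real (Suc m))) * ((exp 1 / real (Suc m)) ^ m * (1 + 1 / real m) ^ m)"
      by (simp only: power_Suc mult.assoc)
    ultimately show ?thesis by (simp only: mult.commute)
  qed
  have "(exp 1 / real m) ^ m * (1 + 1 / real m) ^ m \<le>
      real (Suc m) * (exp 1 / real (Suc m)) ^ Suc m * (1 + 1 / real m) ^ m"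
    unfolding e by (intro mult_left_mono one_plus_inverse_power_le_exp) auto
  then have "(exp 1 / real m) ^ m \<le> real (Suc m) * (exp 1 / real (Suc m)) ^ Suc m"
    by (rule mult_right_le_imp_le) (intro zero_less_power, simp add: add_pos_nonneg)
  then have "fact m * (exp 1 / real m) ^ m \<le> fact m * (real (Suc m) * (exp 1 / real (Suc m)) ^ Suc m)"
    by (intro mult_left_mono) auto
  also have "\<dots> = fact (Suc m) * (exp 1 / real (Suc m)) ^ Suc m"
    by (simp only: fact_Suc of_nat_mult mult_ac)
  finally show ?case using step.IH by linarith
qed

text \<open>In fourth powers the claim is (21/10)^4 \<le> (4m / pi) (m! (e/m)^m)^2. Since 4m / pi
  \<ge> 2 and \<open>fact_exp_ge\<close> bounds the bracket by 25/8, it reduces to 19.4481 \<le>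
  19.53125.\<close>

lemma stirling_constant:
  assumes m: "m \<ge> 2"
  shows "21 / 10 / sqrt (fact m) \<le> (4 * exp 1 / pi) powr (1 / 4) * (exp 1 / real m) powr (real m / 2 - 1 / 4)"
proof -
  let ?X = "(4 * exp 1 / pi) powr (1 / 4) * (exp 1 / real m) powr (real m / 2 - 1 / 4)"
  have em: "exp 1 / real m > 0" using m by simp
  have X4: "?X ^ 4 = (4 * exp 1 / pi) * (exp 1 / real m) ^ (2 * m - 1)"
  proof -
    have "(x powr a) ^ 4 = x powr (4 * a)" if "x > 0" for x a :: real
      using that powr_realpow[of "x powr a" 4] by (simp add: powr_powr mult.commute)
    moreover have "(exp 1 / real m) powr (4 * (real m / 2 - 1 / 4)) = (exp 1 / real m) ^ (2 * m - 1)"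
      using em m powr_realpow[OF em, of "2 * m - 1"] by (simp add: of_nat_diff algebra_simps)
    ultimately show ?thesis using em by (simp add: power_mult_distrib)
  qed
  have "(25 / 8)\<^sup>2 \<le> (fact m * (exp 1 / real m) ^ m)\<^sup>2" by (intro power_mono fact_exp_ge m) auto
  also have "\<dots> = (fact m)\<^sup>2 * ((exp 1 / real m) * (exp 1 / real m) ^ (2 * m - 1))"
  proof -
    have "Suc (2 * m - 1) = m * 2" using m by simp
    then show ?thesis by (metis power_Suc power_mult power_mult_distrib)
  qed
  finally have 1: "(25 / 8)\<^sup>2 \<le> (fact m)\<^sup>2 * ((exp 1 / real m) * (exp 1 / real m) ^ (2 * m - 1))" .
  have "(21 / 10) ^ 4 \<le> 2 * (25 / 8 :: real)\<^sup>2" by (simp add: eval_nat_numeral)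
  also have "\<dots> \<le> (4 * real m / pi) * ((fact m)\<^sup>2 * ((exp 1 / real m) * (exp 1 / real m) ^ (2 * m - 1)))"
    using m pi_less_4 by (intro mult_mono 1) (auto simp: field_simps)
  also have "\<dots> = (fact m)\<^sup>2 * ?X ^ 4" unfolding X4 using m by (simp add: field_simps)
  finally have "(21 / 10) ^ 4 / (fact m)\<^sup>2 \<le> ?X ^ 4" by (simp add: divide_le_eq mult.commute)
  moreover have "(21 / 10 / sqrt (fact m)) ^ 4 = (21 / 10) ^ 4 / (fact m)\<^sup>2"
    using power_mult[of "sqrt (fact m)" 2 2] by (simp add: power_divide)
  ultimately have "(21 / 10 / sqrt (fact m)) ^ 4 \<le> ?X ^ 4" by simp
  then show ?thesis by (rule power_le_imp_le_base[of _ 3, simplified]) simp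
qed

lemma majorant_series_bound:
  fixes b :: real
  assumes b: "b \<ge> 0" and m: "m \<ge> 2"
  shows "(\<Sum>k. b ^ (k + m) / fact (k + m) powr (1 / 2)) \<le>
    (4 * exp 1 / pi) powr (1 / 4) * (exp 1 / real m) powr (real m / 2 - 1 / 4) * b ^ m * exp (1 / 2 * c_const m * b\<^sup>2)"
    and "summable (\<lambda>k. b ^ (k + m) / fact (k + m) powr (1 / 2))"
proof -
  have e: "b ^ (k + m) / fact (k + m) powr (1 / 2) = b ^ m * (b ^ k / sqrt (fact (k + m)))" for k
    by (simp add: powr_half_sqrt power_add mult_ac)
  show "summable (\<lambda>k. b ^ (k + m) / fact (k + m) powr (1 / 2))"
    unfolding e by (intro summable_mult sqrt_fact_series_bound(1) b m)
  have "(\<Sum>k. b ^ (k + m) / fact (k + m) powr (1 / 2)) = b ^ m * (\<Sum>k. b ^ k / sqrt (fact (k + m)))"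
    unfolding e by (intro suminf_mult sqrt_fact_series_bound(1) b m)
  also have "\<dots> \<le> b ^ m * (21 / 10 / sqrt (fact m) * exp (b\<^sup>2 / 2))"
    using b by (intro mult_left_mono sqrt_fact_series_bound(2) m) auto
  also have "\<dots> \<le> b ^ m * ((4 * exp 1 / pi) powr (1 / 4) * (exp 1 / real m) powr (real m / 2 - 1 / 4) * exp (1 / 2 * c_const m * b\<^sup>2))"
  proof -
    have "exp (b\<^sup>2 / 2) \<le> exp (1 / 2 * c_const m * b\<^sup>2)"
      using mult_right_mono[OF c_const_ge_1[of m], of "b\<^sup>2"] m by simp
    then show ?thesis using b by (intro mult_left_mono mult_mono stirling_constant m) auto
  qed
  finally show "(\<Sum>k. b ^ (k + m) / fact (k + m) powr (1 / 2)) \<le>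
    (4 * exp 1 / pi) powr (1 / 4) * (exp 1 / real m) powr (real m / 2 - 1 / 4) * b ^ m * exp (1 / 2 * c_const m * b\<^sup>2)"
    by (simp add: mult_ac)
qed

section \<open>Assembly of the bounds\<close>

lemma bound_base_nonneg: "\<gamma>\<^sub>0 \<ge> 0 \<Longrightarrow> bound_base d p \<gamma>\<^sub>0 r evs \<ge> 0"
  by (simp add: bound_base_def gamma1_def mat_trace_def abs_diag_def mat_diag_def sum_nonneg)

lemma bingham_term_le:
  assumes p: "p \<ge> 1" "p \<le> d" and k: "k \<ge> 2"
    and A: "real_symmetric p A" and ev: "eigenvalue_list A evs"
    and S: "real_symmetric d S" and g: "\<gamma>\<^sub>0 \<ge> 0" and fS: "frob_norm S \<le> \<gamma>\<^sub>0 * real d powr (r / 2)"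
  shows "\<bar>bingham_term d p A S k\<bar> \<le> alpha_const p * (bound_base d p \<gamma>\<^sub>0 r evs ^ k / fact k powr (1 / 2))"
proof -
  have d: "0 < d" using p by simp
  define t where "t = mat_trace (abs_diag evs)"
  define c where "c = \<gamma>\<^sub>0 * real p powr (1 / 2) * t * real d powr (- (1 - r) / 2)"
  have t0: "t \<ge> 0" by (simp add: t_def mat_trace_def abs_diag_def mat_diag_def sum_nonneg)
  have c0: "c \<ge> 0" using t0 g by (simp add: c_def)
  have bc: "bound_base d p \<gamma>\<^sub>0 r evs = gamma1 * c" by (simp add: bound_base_def c_def t_def)
  have "sqrt (real p * dotp (sq d) (($$) S) (($$) S) / real d) = sqrt (real p) * frob_norm S / sqrt (real d)"
    by (simp add: dotp_symmetric_trace[OF S] frob_norm_def real_sqrt_mult real_sqrt_divide)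
  also have "\<dots> \<le> sqrt (real p) * (\<gamma>\<^sub>0 * real d powr (r / 2)) / sqrt (real d)"
    using fS by (intro divide_right_mono mult_left_mono) auto
  also have "\<dots> = sqrt (real p) * \<gamma>\<^sub>0 * (real d powr (r / 2) / real d powr (1 / 2))"
    using d by (simp add: powr_half_sqrt)
  also have "real d powr (r / 2) / real d powr (1 / 2) = real d powr (- (1 - r) / 2)"
    by (simp add: powr_diff[symmetric] diff_divide_distrib)
  finally have "sqrt (dotp (sq p) (($$) A) (($$) A)) * sqrt (real p * dotp (sq d) (($$) S) (($$) S) / real d) \<le>
      t * (sqrt (real p) * \<gamma>\<^sub>0 * real d powr (- (1 - r) / 2))"
    unfolding t_def by (intro mult_mono frobenius_le_trace[OF A ev]) (use t0 in \<open>auto simp: t_def dotp_def sum_nonneg\<close>)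
  also have "\<dots> = c" by (simp add: c_def powr_half_sqrt)
  finally have le: "sqrt (dotp (sq p) (($$) A) (($$) A)) * sqrt (real p * dotp (sq d) (($$) S) (($$) S) / real d) \<le> c" .
  have "\<bar>bingham_term d p A S k\<bar> \<le>
      (sqrt (dotp (sq p) (($$) A) (($$) A)) * sqrt (real p * dotp (sq d) (($$) S) (($$) S) / real d)) ^ k / sqrt (fact k)"
    by (rule bingham_term_bound[OF A S p(2) d])
  also have "\<dots> \<le> c ^ k / sqrt (fact k)"
    by (intro divide_right_mono power_mono le) (auto simp: dotp_def sum_nonneg)
  also have "\<dots> \<le> (alpha_const p * gamma1 ^ k) * (c ^ k / sqrt (fact k))"
    using mult_right_mono[OF alpha_gamma_ge_1[OF p(1) k], of "c ^ k / sqrt (fact k)"] c0 by simp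
  also have "\<dots> = alpha_const p * (bound_base d p \<gamma>\<^sub>0 r evs ^ k / fact k powr (1 / 2))"
    by (simp add: bc power_mult_distrib powr_half_sqrt)
  finally show ?thesis .
qed

lemma bingham_remainder_le:
  assumes p: "p \<ge> 1" "p \<le> d" and m: "m \<ge> 2"
    and A: "real_symmetric p A" and ev: "eigenvalue_list A evs"
    and S: "real_symmetric d S" and g: "\<gamma>\<^sub>0 \<ge> 0" and fS: "frob_norm S \<le> \<gamma>\<^sub>0 * real d powr (r / 2)"
  shows "\<bar>bingham_remainder d p m A S\<bar>
      \<le> alpha_const p * (\<Sum>k. bound_base d p \<gamma>\<^sub>0 r evs ^ (k + m) / fact (k + m) powr (1/2))"
proof -
  note s = majorant_series_bound(2)[OF bound_base_nonneg[OF g] m, of d p r evs]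
  have "norm (\<Sum>k. bingham_term d p A S (k + m)) \<le>
      (\<Sum>k. alpha_const p * (bound_base d p \<gamma>\<^sub>0 r evs ^ (k + m) / fact (k + m) powr (1/2)))"
  proof (intro norm_suminf_le summable_mult s)
    fix k
    show "norm (bingham_term d p A S (k + m)) \<le>
        alpha_const p * (bound_base d p \<gamma>\<^sub>0 r evs ^ (k + m) / fact (k + m) powr (1/2))"
      using bingham_term_le[OF p _ A ev S g fS, of "k + m"] m by simp
  qed
  then show ?thesis by (simp only: bingham_remainder_def suminf_mult[OF s] real_norm_def)
qed

lemma majorant_le:
  assumes m: "m \<ge> 2" and g: "\<gamma>\<^sub>0 \<ge> 0"
  shows "alpha_const p * (\<Sum>k. bound_base d p \<gamma>\<^sub>0 r evs ^ (k + m) / fact (k + m) powr (1/2))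
      \<le> alpha_const p * (4 * exp 1 / pi) powr (1/4)
         * (exp 1 / real m) powr (real m / 2 - 1/4) * bound_base d p \<gamma>\<^sub>0 r evs ^ m
         * exp (1/2 * c_const m * (bound_base d p \<gamma>\<^sub>0 r evs)\<^sup>2)"
  using mult_left_mono[OF majorant_series_bound(1)[OF bound_base_nonneg[OF g, of d p r evs] m] alpha_const_nonneg[of p]]
  by (simp only: mult.assoc)

theorem theorem2p1:
  fixes p m :: nat and A :: "real mat" and evs :: "real list" and \<gamma>\<^sub>0 r :: real
  assumes "p \<ge> 1" and "m \<ge> 2"
    and "real_symmetric p A" and "eigenvalue_list A evs"
    and "\<gamma>\<^sub>0 > 0" and "0 \<le> r" and "r < 1"
  shows "(\<forall>d S. d \<ge> p \<longrightarrow> real_symmetric d S \<longrightarrow> frob_norm S \<le> \<gamma>\<^sub>0 * real d powr (r / 2) \<longrightarrow>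
            \<bar>bingham_remainder d p m A S\<bar>
              \<le> alpha_const p * (\<Sum>k. bound_base d p \<gamma>\<^sub>0 r evs ^ (k + m) / fact (k + m) powr (1/2)) \<and>
            alpha_const p * (\<Sum>k. bound_base d p \<gamma>\<^sub>0 r evs ^ (k + m) / fact (k + m) powr (1/2))
              \<le> alpha_const p * (4 * exp 1 / pi) powr (1/4)
                 * (exp 1 / real m) powr (real m / 2 - 1/4) * bound_base d p \<gamma>\<^sub>0 r evs ^ m
                 * exp (1/2 * c_const m * (bound_base d p \<gamma>\<^sub>0 r evs)\<^sup>2))
       \<and> (\<forall>\<Sigma> :: nat \<Rightarrow> real mat.
            (\<forall>d\<ge>p. real_symmetric d (\<Sigma> d) \<and> frob_norm (\<Sigma> d) \<le> \<gamma>\<^sub>0 * real d powr (r / 2)) \<longrightarrow>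
            (\<lambda>d. bingham_remainder d p m A (\<Sigma> d))
              \<in> O[at_top](\<lambda>d. real d powr (- (1 - r) * real m / 2)))"
proof (intro conjI allI impI)
  fix d S assume "d \<ge> p" "real_symmetric d S" "frob_norm S \<le> \<gamma>\<^sub>0 * real d powr (r / 2)"
  then show "\<bar>bingham_remainder d p m A S\<bar>
      \<le> alpha_const p * (\<Sum>k. bound_base d p \<gamma>\<^sub>0 r evs ^ (k + m) / fact (k + m) powr (1/2))"
    using assms by (intro bingham_remainder_le) auto
next
  fix d
  show "alpha_const p * (\<Sum>k. bound_base d p \<gamma>\<^sub>0 r evs ^ (k + m) / fact (k + m) powr (1/2))
      \<le> alpha_const p * (4 * exp 1 / pi) powr (1/4)
         * (exp 1 / real m) powr (real m / 2 - 1/4) * bound_base d p \<gamma>\<^sub>0 r evs ^ m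
         * exp (1/2 * c_const m * (bound_base d p \<gamma>\<^sub>0 r evs)\<^sup>2)"
    using assms by (intro majorant_le) auto
next
  fix \<Sigma> :: "nat \<Rightarrow> real mat"
  assume \<Sigma>: "\<forall>d\<ge>p. real_symmetric d (\<Sigma> d) \<and> frob_norm (\<Sigma> d) \<le> \<gamma>\<^sub>0 * real d powr (r / 2)"
  let ?C = "alpha_const p * (4 * exp 1 / pi) powr (1/4) * (exp 1 / real m) powr (real m / 2 - 1/4)"
  \<comment> \<open>At d = 1 the power of d equals 1, so B collects everything independent of d; for
    d \<ge> 1 the exponential factor is then bounded by its value at B.\<close>
  define B where "B = bound_base 1 p \<gamma>\<^sub>0 r evs"
  have B: "B \<ge> 0" unfolding B_def using assms by (intro bound_base_nonneg) auto
  have C: "?C \<ge> 0" by (simp add: alpha_const_nonneg)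
  have c: "c_const m \<ge> 0" using c_const_ge_1[of m] assms by simp
  have "\<bar>bingham_remainder d p m A (\<Sigma> d)\<bar> \<le>
      (?C * B ^ m * exp (1/2 * c_const m * B\<^sup>2)) * real d powr (- (1 - r) * real m / 2)" if d: "d \<ge> p" for d
  proof -
    let ?b = "bound_base d p \<gamma>\<^sub>0 r evs"
    have d1: "real d \<ge> 1" using d assms(1) by simp
    have b: "?b = B * real d powr (- (1 - r) / 2)" by (simp add: B_def bound_base_def)
    have b0: "?b \<ge> 0" using assms by (intro bound_base_nonneg) auto
    have "real d powr (- (1 - r) / 2) \<le> 1" using powr_mono[of "- (1 - r) / 2" 0 "real d"] d1 assms by simp
    then have "?b \<le> B" unfolding b using B by (simp add: mult_left_le)
    then have "exp (1/2 * c_const m * ?b\<^sup>2) \<le> exp (1/2 * c_const m * B\<^sup>2)"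
      using c b0 by (simp add: mult_left_mono power_mono)
    moreover have "?b ^ m = B ^ m * real d powr (- (1 - r) * real m / 2)"
      unfolding b using d1 by (simp add: power_mult_distrib powr_realpow[symmetric] powr_powr)
    ultimately have "?C * ?b ^ m * exp (1/2 * c_const m * ?b\<^sup>2) \<le>
        ?C * (B ^ m * real d powr (- (1 - r) * real m / 2)) * exp (1/2 * c_const m * B\<^sup>2)"
      using B C by (intro mult_mono mult_nonneg_nonneg) (auto simp: alpha_const_nonneg)
    moreover have "\<bar>bingham_remainder d p m A (\<Sigma> d)\<bar> \<le> ?C * ?b ^ m * exp (1/2 * c_const m * ?b\<^sup>2)"
      using assms d \<Sigma> by (intro order_trans[OF bingham_remainder_le majorant_le]) auto
    ultimately show ?thesis by (simp add: mult_ac)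
  qed
  then show "(\<lambda>d. bingham_remainder d p m A (\<Sigma> d)) \<in> O[at_top](\<lambda>d. real d powr (- (1 - r) * real m / 2))"
    by (intro bigoI eventually_mono[OF eventually_ge_at_top[of p]]) auto
qed

end
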